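(* Let $k\ge3$ and $0<d<d_{\rm cond}$, and let $\mathbf m\sim{\rm Po}(dn/k)$. Then $$\lim_{n\to\infty}\frac1n\,\mathbb E\Big[\big\langle|\boldsymbol\sigma\cdot\boldsymbol\tau|\big\rangle_{\mathbb F_k(n,\mathbf m)}\ \Big|\ Z(\mathbb F_k(n,\mathbf m))>0\Big]=0.$$
   Context: $\mathbb F_k(n,m)$ is the random $k$-CNF formula over $x_1,\dots,x_n$ with $m$ independent uniformly random clauses of length $k$, no variable appearing twice in a clause. An assignment is NAE-satisfying if it and its binary inverse satisfy all clauses; $Z(\mathbb F)$ is the number of NAE-satisfying assignments. Given $\mathbb F$ with $Z(\mathbb F)>0$, $\boldsymbol\sigma,\boldsymbol\tau$ are two independent uniformly random NAE-satisfying assignments, viewed as vectors in $\{\pm1\}^n$ (false/true $=\pm1$), and $\langle\cdot\rangle_{\mathbb F}$ denotes expectation over $\boldsymbol\sigma,\boldsymbol\tau$; $\boldsymbol\sigma\cdot\boldsymbol\tau$ is the inner product. $d_{\rm cond}$ is defined as follows: with $\Lambda(x)=x\ln x$, $\Lambda(0)=0$, $\mathcal P_*[0,1]$ the probability measures on $[0,1]$ with mean $1/2$, $\gamma\sim{\rm Po}(d)$ and $\rho_1,\rho_2,\dots$ i.i.d. from $\pi$ independent of $\gamma$, $$\mathcal B(d,\pi)=\mathbb E\left[\frac{\Lambda\big(\prod_{i=1}^{\gamma}(1-\prod_{j=1}^{k-1}\rho_{ki+j})+\prod_{i=1}^{\gamma}(1-\prod_{j=1}^{k-1}(1-\rho_{ki+j}))\big)}{2(1-2^{1-k})^{\gamma}}-\frac{d(k-1)\Lambda\big(1-\prod_{j=1}^k\rho_j-\prod_{j=1}^k(1-\rho_j)\big)}{k(1-2^{1-k})}\right],$$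 and $d_{\rm cond}=\inf\{d>0:\sup_{\pi\in\mathcal P_*[0,1]}\mathcal B(d,\pi)>\ln2+\frac dk\ln(1-2^{1-k})\}$. *)

theory Defs
  imports "HOL-Probability.Probability"
begin

text \<open>A literal is a pair (variable index, sign); the literal (i, s) is true under an
assignment sigma iff sigma i = s.  A clause is a list of literals; a formula is a list of
clauses.  Variables are x_0, ..., x_(n-1) (indices below n).\<close>

type_synonym literal = "nat \<times> bool"
type_synonym clause = "literal list"
type_synonym formula = "clause list"

definition clauses :: "nat \<Rightarrow> nat \<Rightarrow> clause set" where
  "clauses k n = {c. length c = k \<and> distinct (map fst c) \<and> (\<forall>l\<in>set c. fst l < n)}"

definition random_formula :: "nat \<Rightarrow> nat \<Rightarrow> nat \<Rightarrow> formula pmf" where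
  "random_formula k n m = pmf_of_set {F. length F = m \<and> set F \<subseteq> clauses k n}"

definition assignments :: "nat \<Rightarrow> (nat \<Rightarrow> bool) set" where
  "assignments n = {\<sigma>. \<forall>i. n \<le> i \<longrightarrow> \<sigma> i = False}"

definition sat_clause :: "(nat \<Rightarrow> bool) \<Rightarrow> clause \<Rightarrow> bool" where
  "sat_clause \<sigma> c \<longleftrightarrow> (\<exists>l\<in>set c. \<sigma> (fst l) = snd l)"

definition sat_formula :: "(nat \<Rightarrow> bool) \<Rightarrow> formula \<Rightarrow> bool" where
  "sat_formula \<sigma> F \<longleftrightarrow> (\<forall>c\<in>set F. sat_clause \<sigma> c)"

definition nae_sat :: "(nat \<Rightarrow> bool) \<Rightarrow> formula \<Rightarrow> bool" where
  "nae_sat \<sigma> F \<longleftrightarrow> sat_formula \<sigma> F \<and> sat_formula (\<lambda>i. \<not> \<sigma> i) F"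

definition nae_solutions :: "nat \<Rightarrow> formula \<Rightarrow> (nat \<Rightarrow> bool) set" where
  "nae_solutions n F = {\<sigma> \<in> assignments n. nae_sat \<sigma> F}"

definition Z :: "nat \<Rightarrow> formula \<Rightarrow> nat" where
  "Z n F = card (nae_solutions n F)"

definition spin :: "bool \<Rightarrow> real" where
  "spin b = (if b then -1 else 1)"

definition inner_spin :: "nat \<Rightarrow> (nat \<Rightarrow> bool) \<Rightarrow> (nat \<Rightarrow> bool) \<Rightarrow> real" where
  "inner_spin n \<sigma> \<tau> = (\<Sum>i<n. spin (\<sigma> i) * spin (\<tau> i))"

definition avg_abs_overlap :: "nat \<Rightarrow> formula \<Rightarrow> real" where
  "avg_abs_overlap n F =
     (\<Sum>\<sigma>\<in>nae_solutions n F. \<Sum>\<tau>\<in>nae_solutions n F. \<bar>inner_spin n \<sigma> \<tau>\<bar>)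
       / (real (Z n F))^2"

definition poisson_random_formula :: "nat \<Rightarrow> nat \<Rightarrow> real \<Rightarrow> formula pmf" where
  "poisson_random_formula k n d =
     bind_pmf (poisson_pmf (d * real n / real k)) (\<lambda>m. random_formula k n m)"

definition cond_exp_overlap :: "nat \<Rightarrow> nat \<Rightarrow> real \<Rightarrow> real" where
  "cond_exp_overlap k n d =
     measure_pmf.expectation
       (cond_pmf (poisson_random_formula k n d) {F. Z n F > 0}) (avg_abs_overlap n)"

definition Lam :: "real \<Rightarrow> real" where
  "Lam x = (if x = 0 then 0 else x * ln x)"

definition P_star :: "real measure set" where
  "P_star = {\<pi>. prob_space \<pi> \<and> sets \<pi> = sets borel \<and> measure \<pi> {0..1} = 1
                 \<and> (\<integral>x. x \<partial>\<pi>) = 1/2}"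

definition B_integrand :: "nat \<Rightarrow> real \<Rightarrow> nat \<times> (nat \<Rightarrow> real) \<Rightarrow> real" where
  "B_integrand k d = (\<lambda>(\<gamma>, \<rho>).
      Lam ((\<Prod>i\<in>{1..\<gamma>}. 1 - (\<Prod>j\<in>{1..k-1}. \<rho> (k*i+j)))
         + (\<Prod>i\<in>{1..\<gamma>}. 1 - (\<Prod>j\<in>{1..k-1}. 1 - \<rho> (k*i+j))))
        / (2 * (1 - 2 powr (1 - real k)) ^ \<gamma>)
    - d * (real k - 1) * Lam (1 - (\<Prod>j\<in>{1..k}. \<rho> j) - (\<Prod>j\<in>{1..k}. 1 - \<rho> j))
        / (real k * (1 - 2 powr (1 - real k))))"

definition B :: "nat \<Rightarrow> real \<Rightarrow> real measure \<Rightarrow> real" where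
  "B k d \<pi> = (\<integral>x. B_integrand k d x
                \<partial>(measure_pmf (poisson_pmf d) \<Otimes>\<^sub>M (\<Pi>\<^sub>M i\<in>(UNIV::nat set). \<pi>)))"

definition d_cond :: "nat \<Rightarrow> ereal" where
  "d_cond k = Inf {ereal d | d. d > 0 \<and>
      (SUP \<pi>\<in>P_star. ereal (B k d \<pi>)) > ereal (ln 2 + d / real k * ln (1 - 2 powr (1 - real k)))}"

end

(* Write m ~ D n with D = d/k and let MM be the normalised partition function Z / E Z. Adding one
variable at a time and pinning a bounded random number of variables turns the Gibbs measure into an
approximate product measure, so each increment of E (MM ln MM) is bounded by the Bethe functional
minus its value at the paramagnetic point. Below the condensation threshold this gives
E (MM ln MM) = o(n). As this entropy grows linearly in the number of further clauses whenever the
squared overlap of the planted model is bounded away from 0, the planted overlap concentrates at 0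
with exponentially small error. Evaluating the functional at a two point measure near 1/2 yields the
Kesten-Stigum bound d (k-1) c^2 <= 1, which makes the second moment restricted to small overlaps
subcritical; this first sharpens the planted estimate to overlaps of order n^(-1/2) up to logarithms
and then, by adding clauses and comparing the null with the planted model at polynomially small MM,
carries it over to the null model. *)
theory Submission
  imports Defs "HOL-Real_Asymp.Real_Asymp"
begin

section \<open>Finite averages\<close>

definition avg :: "'a set => ('a => real) => real" where
 "avg S f = (\<Sum>x\<in>S. f x) / real (card S)"

definition lsts :: "nat => 'a set => 'a list set" where
 "lsts m S = {xs. length xs = m & set xs \<subseteq> S}"

lemma avg_cong: "(!!x. x \<in> S ==> f x = g x) ==> avg S f = avg S g"
 unfolding avg_def by (simp cong: sum.cong)

lemma avg_mono: "(!!x. x \<in> S ==> f x <= g x) ==> avg S f <= avg S g"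
 unfolding avg_def by (intro divide_right_mono sum_mono) auto

lemma avg_nonneg: "(!!x. x \<in> S ==> 0 <= f x) ==> 0 <= avg S f"
 unfolding avg_def by (intro divide_nonneg_nonneg sum_nonneg) auto

lemma avg_add: "avg S (%x. f x + g x) = avg S f + avg S g"
 unfolding avg_def by (simp add: sum.distrib add_divide_distrib)

lemma avg_diff: "avg S (%x. f x - g x) = avg S f - avg S g"
 unfolding avg_def by (simp add: sum_subtractf diff_divide_distrib)

lemma avg_cmult: "avg S (%x. c * f x) = c * avg S f"
 unfolding avg_def by (simp add: sum_distrib_left)

lemma avg_cmult_right: "avg S (%x. f x * c) = avg S f * c"
 using avg_cmult[of S c f] by (simp add: mult.commute)

lemma avg_divide: "avg S (%x. f x / c) = avg S f / c"
 using avg_cmult_right[of S f "1/c"] by simp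

lemma avg_zero [simp]: "avg S (%_. 0) = 0"
 unfolding avg_def by simp

lemma avg_const: "finite S ==> S ~= {} ==> avg S (%_. c) = c"
 unfolding avg_def by simp

lemma avg_le: "finite S ==> S ~= {} ==> (!!x. x \<in> S ==> f x <= c) ==> avg S f <= c"
 using avg_mono[of S f "%_. c"] avg_const[of S c] by simp

lemma avg_ge: "finite S ==> S ~= {} ==> (!!x. x \<in> S ==> c <= f x) ==> c <= avg S f"
 using avg_mono[of S "%_. c" f] avg_const[of S c] by simp

lemma avg_abs: "\<bar>avg S f\<bar> <= avg S (%x. \<bar>f x\<bar>)"
 unfolding avg_def by (simp add: divide_right_mono)

lemma avg_sum: "avg S (%x. \<Sum>y\<in>T. f x y) = (\<Sum>y\<in>T. avg S (%x. f x y))"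
 unfolding avg_def by (subst sum.swap) (simp add: sum_divide_distrib)

lemma avg_swap: "avg S (%x. avg T (%y. f x y)) = avg T (%y. avg S (%x. f x y))"
 unfolding avg_def by (simp add: sum_divide_distrib[symmetric] sum.swap[of _ S T] mult.commute)

lemma avg_bij: "bij_betw h A T ==> avg T f = avg A (%x. f (h x))"
 unfolding avg_def by (simp add: sum.reindex_bij_betw bij_betw_same_card)

lemma avg_Times: "avg (A \<times> T) (%(a, b). f a b) = avg A (%a. avg T (%b. f a b))"
 unfolding avg_def
 by (simp add: sum.cartesian_product[symmetric] card_cartesian_product sum_divide_distrib mult.commute)

lemma avg_subset_le:
 assumes "finite T" "A \<subseteq> T" "A ~= {}" "!!x. x \<in> T ==> 0 <= f x"
 shows "avg A f <= real (card T) / real (card A) * avg T f"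
proof -
 have "card A > 0" "card T > 0" using assms by (auto simp: card_gt_0_iff finite_subset)
 moreover have "sum f A <= sum f T" using assms by (intro sum_mono2) auto
 ultimately show ?thesis unfolding avg_def by (simp add: divide_right_mono)
qed

lemma avg_subset_diff:
 assumes "finite T" "A \<subseteq> T" "A ~= {}" "!!x. x \<in> T ==> \<bar>f x\<bar> <= c"
 shows "\<bar>avg A f - avg T f\<bar> <= 2 * c * (1 - real (card A) / real (card T))"
proof -
 have fA: "finite A" using assms finite_subset by auto
 have cA: "real (card A) > 0" using assms fA by (auto simp: card_gt_0_iff)
 have cAB: "card A <= card T" using assms by (simp add: card_mono)
 define a b where "a = real (card A)" and "b = real (card T)"
 have ab: "0 < a" "a <= b" using cA cAB by (auto simp: a_def b_def)
 have "sum f T = sum f A + sum f (T - A)" using assms by (metis add.commute sum.subset_diff)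
 then have e: "avg A f - avg T f = sum f A * (1 / a - 1 / b) - sum f (T - A) / b"
  unfolding avg_def a_def[symmetric] b_def[symmetric] by (simp add: algebra_simps add_divide_distrib)
 have 1: "\<bar>sum f A\<bar> <= c * a"
 proof -
  have "\<bar>sum f A\<bar> <= (\<Sum>x\<in>A. \<bar>f x\<bar>)" by (rule sum_abs)
  also have "... <= (\<Sum>x\<in>A. c)" using assms by (intro sum_mono) auto
  finally show ?thesis by (simp add: a_def mult.commute)
 qed
 have 2: "\<bar>sum f (T - A)\<bar> <= c * (b - a)"
 proof -
  have "\<bar>sum f (T-A)\<bar> <= (\<Sum>x\<in>T-A. \<bar>f x\<bar>)" by (rule sum_abs)
  also have "... <= (\<Sum>x\<in>T-A. c)" using assms by (intro sum_mono) auto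
  also have "... = c * (b - a)" using assms fA cAB
   by (simp add: a_def b_def card_Diff_subset of_nat_diff)
  finally show ?thesis .
 qed
 have "\<bar>avg A f - avg T f\<bar> <= \<bar>sum f A\<bar> * \<bar>1 / a - 1 / b\<bar> + \<bar>sum f (T - A)\<bar> / b"
  unfolding e using ab by (simp add: abs_mult[symmetric] order.trans[OF abs_triangle_ineq4])
 also have "\<bar>1 / a - 1 / b\<bar> = (b - a) / (a * b)" using ab by (simp add: field_simps)
 also have "\<bar>sum f A\<bar> * ((b - a) / (a * b)) + \<bar>sum f (T - A)\<bar> / b <= c * a * ((b - a) / (a * b)) + c * (b - a) / b"
  using ab 1 2 by (intro add_mono mult_right_mono divide_right_mono) auto
 also have "... = 2 * c * (1 - a / b)" using ab by (simp add: field_simps)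
 finally show ?thesis by (simp add: a_def b_def)
qed

lemma finite_lsts [simp]: "finite S ==> finite (lsts m S)"
 unfolding lsts_def using finite_lists_length_eq[of S m] by (simp add: conj_commute)

lemma card_lsts: "finite S ==> card (lsts m S) = card S ^ m"
 unfolding lsts_def using card_lists_length_eq[of S m] by (simp add: conj_commute)

lemma lsts_nonempty [simp]: "S ~= {} ==> lsts m S ~= {}"
proof -
 assume "S ~= {}" then obtain x where "x \<in> S" by auto
 then have "replicate m x \<in> lsts m S" by (auto simp: lsts_def)
 then show ?thesis by auto
qed

lemma lsts_0: "lsts 0 S = {[]}" unfolding lsts_def by auto

lemma avg_lsts_0 [simp]: "avg (lsts 0 S) f = f []" by (simp add: avg_def lsts_0)

lemma in_lsts_Suc: "xs \<in> lsts (Suc m) S \<longleftrightarrow> (\<exists>x ys. xs = x # ys & x \<in> S & ys \<in> lsts m S)"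
 unfolding lsts_def by (cases xs) auto

lemma avg_lsts_append:
 "avg (lsts (a + b) S) f = avg (lsts a S) (%xs. avg (lsts b S) (%ys. f (xs @ ys)))"
proof -
 have "bij_betw (%(xs, ys). xs @ ys) (lsts a S \<times> lsts b S) (lsts (a + b) S)"
 proof (rule bij_betw_byWitness[where f' = "%zs. (take a zs, drop a zs)"])
  show "(%zs. (take a zs, drop a zs)) ` lsts (a + b) S \<subseteq> lsts a S \<times> lsts b S"
   by (auto simp: lsts_def dest: in_set_takeD in_set_dropD)
 qed (auto simp: lsts_def)
 from avg_bij[OF this, of f] show ?thesis
  by (simp add: case_prod_unfold flip: avg_Times)
qed

lemma avg_lsts_Suc:
 "avg (lsts (Suc m) S) f = avg S (%x. avg (lsts m S) (%xs. f (x # xs)))"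
proof -
 have "bij_betw (%(x, xs). x # xs) (S \<times> lsts m S) (lsts (Suc m) S)"
  by (rule bij_betw_byWitness[where f' = "%zs. (hd zs, tl zs)"]) (auto simp: in_lsts_Suc)
 from avg_bij[OF this, of f] show ?thesis
  by (simp add: case_prod_unfold flip: avg_Times)
qed

section \<open>Clauses and pairs of assignments\<close>

definition cl :: "clause => (nat => bool) => real" where
 "cl a sg = of_bool (nae_sat sg [a])"

definition wgt :: "formula => (nat => bool) => real" where
 "wgt F sg = of_bool (nae_sat sg F)"

definition nae :: "bool list => bool" where
 "nae ys \<longleftrightarrow> True \<in> set ys & False \<in> set ys"

definition truth :: "(nat => bool) => clause => bool list" where
 "truth sg a = map (%l. sg (fst l) = snd l) a"

lemma cl_truth: "cl a sg = of_bool (nae (truth sg a))"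
 unfolding cl_def nae_sat_def sat_formula_def sat_clause_def nae_def truth_def by force

lemma cl_01: "0 <= cl a sg" "cl a sg <= 1" unfolding cl_def by auto

lemma wgt_Nil [simp]: "wgt [] sg = 1" unfolding wgt_def nae_sat_def sat_formula_def by simp

lemma wgt_Cons: "wgt (a # F) sg = cl a sg * wgt F sg"
 unfolding cl_def wgt_def nae_sat_def sat_formula_def by auto

lemma wgt_append: "wgt (F @ G) sg = wgt F sg * wgt G sg"
 unfolding wgt_def nae_sat_def sat_formula_def by auto

lemma wgt_01: "0 <= wgt F sg" "wgt F sg <= 1" unfolding wgt_def by auto

definition dl :: "nat => nat => nat list set" where
 "dl k n = {is. length is = k & distinct is & set is \<subseteq> {..<n}}"

lemma finite_dl [simp]: "finite (dl k n)"
proof (rule finite_subset)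
 show "dl k n \<subseteq> lsts k {..<n}" by (auto simp: dl_def lsts_def)
qed simp

lemma card_dl: "k <= n ==> card (dl k n) = \<Prod>{n - k + 1..n}"
 unfolding dl_def using card_lists_distinct_length_eq[of "{..<n}" k] by simp

lemma dl_nonempty: "k <= n ==> dl k n ~= {}"
proof -
 assume "k <= n" then have "[0..<k] \<in> dl k n" by (auto simp: dl_def)
 then show ?thesis by auto
qed

lemma clauses_bij:
 "bij_betw (%(is, ss). zip is ss) (dl k n \<times> lsts k UNIV) (clauses k n)"
proof (rule bij_betw_byWitness[where f' = "%c. (map fst c, map snd c)"])
 show "(%(is, ss). zip is ss) ` (dl k n \<times> lsts k UNIV) \<subseteq> clauses k n"
  by (auto simp: dl_def lsts_def clauses_def dest!: set_zip_leftD)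
 show "(%c. (map fst c, map snd c)) ` clauses k n \<subseteq> dl k n \<times> lsts k UNIV"
  by (auto simp: dl_def lsts_def clauses_def)
qed (auto simp: dl_def lsts_def clauses_def zip_map_fst_snd)

lemma avg_clauses:
 "avg (clauses k n) f = avg (dl k n) (%is. avg (lsts k UNIV) (%ss. f (zip is ss)))"
 using avg_bij[OF clauses_bij, of k n f] by (simp add: case_prod_unfold flip: avg_Times)

lemma finite_clauses [simp]: "finite (clauses k n)"
 using bij_betw_finite[OF clauses_bij, of k n] by simp

lemma clauses_nonempty: "k <= n ==> clauses k n ~= {}"
 using bij_betw_empty1[of "%(is, ss). zip is ss" "clauses k n"] clauses_bij[of k n] dl_nonempty[of k n]
 by (auto simp: bij_betw_def)

lemma card_clauses: "card (clauses k n) = card (dl k n) * 2 ^ k"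
 using bij_betw_same_card[OF clauses_bij, of k n] by (simp add: card_cartesian_product card_lsts)

lemma clauses_subset: "clauses k n \<subseteq> lsts k ({..<n} \<times> UNIV)"
 by (auto simp: clauses_def lsts_def)

lemma card_dl_ge:
 assumes "k <= n" "0 < n"
 shows "real (card (dl k n)) >= (1 - real k ^ 2 / real n) * real n ^ k"
proof -
 have fold: "card (dl k n) = (\<Prod>i<k. n - i)"
 proof -
  have "(\<Prod>i<k. n - i) = \<Prod>{n - k + 1..n}"
   using assms by (intro prod.reindex_bij_witness[of _ "%j. n - j" "%i. n - i"]) auto
  then show ?thesis using assms card_dl by simp
 qed
 have "real (\<Prod>i<k. n - i) >= (1 - real k * real k / real n) * real n ^ k"
 proof -
  have "j <= k ==> real (\<Prod>i<j. n - i) >= (1 - real j * real k / real n) * real n ^ j" for j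
  proof (induction j)
   case (Suc j)
   have IH: "(1 - real j * real k / real n) * real n ^ j <= real (\<Prod>i<j. n - i)" using Suc by simp
   have P: "real (\<Prod>i<j. n - i) <= real n ^ j"
    using prod_mono[of "{..<j}" "%i. real (n - i)" "%_. real n"] by simp
   have "real (\<Prod>i<Suc j. n - i) = real (\<Prod>i<j. n - i) * (real n - real j)"
    using Suc assms by (simp add: of_nat_diff)
   also have "... = real (\<Prod>i<j. n - i) * real n - real j * real (\<Prod>i<j. n - i)" by (simp add: algebra_simps)
   also have "... >= (1 - real j * real k / real n) * real n ^ j * real n - real k * real n ^ j"
    using IH P Suc assms by (intro diff_mono mult_right_mono mult_mono of_nat_0_le_iff) auto
   finally show ?case using assms by (simp add: field_simps)
  qed simp
  then show ?thesis by blast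
 qed
 then show ?thesis by (simp add: fold power2_eq_square)
qed

definition qq :: "nat => real" where "qq k = 1 - 2 powr (1 - real k)"

lemma qq_eq: "k >= 1 ==> qq k = 1 - 2 / 2 ^ k"
 unfolding qq_def by (simp add: powr_diff powr_realpow)

lemma qq_bounds: assumes "k >= 3" shows "3/4 <= qq k" "qq k < 1"
proof -
 have "(2::real) ^ 3 <= 2 ^ k" using assms by (intro power_increasing) auto
 then have "2 / (2::real) ^ k <= 2 / 8" by (intro divide_left_mono) auto
 then show "3/4 <= qq k" "qq k < 1" using assms by (auto simp: qq_eq)
qed

lemma truth_zip:
 assumes "length is = length ss"
 shows "truth sg (zip is ss) = map2 (=) (map sg is) ss"
 unfolding truth_def using assms by (induction "is" ss rule: list_induct2) auto

lemma bij_xnor: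
 assumes "length (bs :: bool list) = k"
 shows "bij_betw (%ss. map2 (=) bs ss) (lsts k UNIV) (lsts k (UNIV::bool set))"
proof -
 have "map2 (=) bs (map2 (=) bs ss) = ss" if "length ss = length bs" for ss :: "bool list"
  using that by (induction ss bs rule: list_induct2) auto
 then show ?thesis using assms
  by (intro bij_betw_byWitness[where f' = "%ss. map2 (=) bs ss"]) (auto simp: lsts_def)
qed

lemma avg_signs:
 assumes "length is = k"
 shows "avg (lsts k UNIV) (%ss. f (truth sg (zip is ss))) = avg (lsts k UNIV) f"
proof -
 have "avg (lsts k UNIV) f = avg (lsts k UNIV) (%ss. f (map2 (=) (map sg is) ss))"
  using assms by (intro avg_bij bij_xnor) auto
 also have "... = avg (lsts k UNIV) (%ss. f (truth sg (zip is ss)))"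
  using assms by (intro avg_cong) (auto simp: lsts_def truth_zip)
 finally show ?thesis by simp
qed

lemma not_nae_iff:
 "length ys = k ==> ~ nae ys \<longleftrightarrow> ys = replicate k True \<or> ys = replicate k False"
proof -
 assume l: "length ys = k"
 have a: "~ nae ys \<longleftrightarrow> (\<forall>y\<in>set ys. y = True) \<or> (\<forall>y\<in>set ys. y = False)"
  unfolding nae_def by auto
 have b: "(\<forall>y\<in>set ys. y = c) \<longleftrightarrow> ys = replicate k c" for c
  using replicate_eqI[OF l, of c] by (metis in_set_replicate)
 show ?thesis by (simp only: a b)
qed

lemma avg_of_bool: "finite S ==> avg S (%x. of_bool (P x)) = real (card {x\<in>S. P x}) / real (card S)"
 unfolding avg_def by (simp add: Collect_conj_eq Int_commute)

lemma avg_compl: "finite S ==> S ~= {} ==> avg S (%x. of_bool (P x)) = 1 - avg S (%x. of_bool (~ P x))"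
 using avg_diff[of S "%_. 1" "%x. of_bool (~ P x)"] avg_const[of S 1]
 by (simp add: of_bool_not_iff)

lemma avg_nae: "k >= 1 ==> avg (lsts k UNIV) (%ys. of_bool (nae ys)) = qq k"
proof -
 assume k: "k >= 1"
 have "{ys \<in> lsts k UNIV. ~ nae ys} = {replicate k True, replicate k False}"
 proof -
  have "ys \<in> lsts k UNIV ==> ~ nae ys \<longleftrightarrow> ys = replicate k True \<or> ys = replicate k False" for ys
   by (rule not_nae_iff) (simp add: lsts_def)
  moreover have "replicate k c \<in> lsts k UNIV" for c :: bool by (simp add: lsts_def)
  ultimately show ?thesis by blast
 qed
 moreover have "replicate k True ~= replicate k False" using k by (cases k) auto
 ultimately have "card {ys \<in> lsts k UNIV. ~ nae ys} = 2" by simp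
 then show ?thesis using k
  by (subst avg_compl) (auto simp: avg_of_bool card_lsts qq_eq)
qed

lemma avg_cl:
 assumes "k >= 1" "k <= n"
 shows "avg (clauses k n) (%a. cl a sg) = qq k"
proof -
 have "avg (clauses k n) (%a. cl a sg) = avg (dl k n) (%is. qq k)"
  unfolding avg_clauses
 proof (rule avg_cong)
  fix "is" assume "is \<in> dl k n"
  then have "length is = k" by (auto simp: dl_def)
  then show "avg (lsts k UNIV) (%ss. cl (zip is ss) sg) = qq k"
   unfolding cl_truth using avg_signs[of "is" k "%ys. of_bool (nae ys)"] avg_nae assms by simp
 qed
 then show ?thesis using assms by (simp add: avg_const dl_nonempty)
qed

definition ov :: "nat => (nat => bool) => (nat => bool) => real" where
 "ov n sg ta = inner_spin n sg ta / real n"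

definition same :: "(nat => bool) => (nat => bool) => nat list => bool" where
 "same sg ta is \<longleftrightarrow> (\<forall>i\<in>set is. sg i = ta i) \<or> (\<forall>i\<in>set is. sg i ~= ta i)"

definition psame :: "nat => nat => (nat => bool) => (nat => bool) => real" where
 "psame k n sg ta = avg (dl k n) (%is. of_bool (same sg ta is))"

lemma xnor_const:
 assumes "length bs = k" "length bs' = k" "length ss = k"
 shows "map2 (=) bs ss = replicate k c \<longleftrightarrow> ss = (if c then bs else map Not bs)"
 using assms
proof (induction bs arbitrary: bs' ss k)
 case (Cons b bs)
 then obtain s ss' where ss: "ss = s # ss'" by (cases ss) auto
 obtain k' where k: "k = Suc k'" using Cons by (cases k) auto
 obtain b' bs'' where "bs' = b' # bs''" using Cons by (cases bs') auto
 then show ?case using Cons.IH[of k' bs'' ss'] Cons.prems ss k by auto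
qed auto

lemma pair_nae:
 assumes k: "k >= 1" and l: "length is = k"
 shows "avg (lsts k UNIV) (%ss. cl (zip is ss) sg * cl (zip is ss) ta)
  = 1 - 4 / 2 ^ k + 2 / 2 ^ k * of_bool (same sg ta is)"
proof -
 have *: "cl (zip is ss) sg * cl (zip is ss) ta =
   of_bool (~ (ss \<in> {map sg is, map Not (map sg is), map ta is, map Not (map ta is)}))"
  if "ss \<in> lsts k UNIV" for ss
 proof -
  have ls: "length ss = k" using that by (simp add: lsts_def)
  have "~ nae (truth \<rho> (zip is ss)) \<longleftrightarrow> ss = map \<rho> is \<or> ss = map Not (map \<rho> is)" for \<rho>
   using not_nae_iff[of "truth \<rho> (zip is ss)" k] ls l
    xnor_const[of "map \<rho> is" k "map \<rho> is" ss True] xnor_const[of "map \<rho> is" k "map \<rho> is" ss False]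
   by (simp add: truth_zip del: map_map)
  then show ?thesis unfolding cl_truth by (auto simp del: map_map)
 qed
 let ?X = "{map sg is, map Not (map sg is), map ta is, map Not (map ta is)}"
 have "avg (lsts k UNIV) (%ss. cl (zip is ss) sg * cl (zip is ss) ta)
   = avg (lsts k UNIV) (%ss. of_bool (~ (ss \<in> ?X)))"
  by (rule avg_cong) (use * in blast)
 also have "... = 1 - avg (lsts k UNIV) (%ss. of_bool (ss \<in> ?X))"
  by (subst avg_compl) auto
 also have "avg (lsts k UNIV) (%ss. of_bool (ss \<in> ?X)) = real (card ?X) / 2 ^ k"
 proof -
  have "{x \<in> lsts k UNIV. x \<in> ?X} = ?X" using l by (auto simp: lsts_def)
  then show ?thesis by (subst avg_of_bool) (simp_all del: insert_iff add: card_lsts)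
 qed
 also have "real (card ?X) = 4 - 2 * of_bool (same sg ta is)"
 proof -
  obtain i where i: "i \<in> set is" using k l by (cases "is") auto
  have n1: "map sg is ~= map Not (map sg is)" "map ta is ~= map Not (map ta is)"
   using i by (auto simp: map_eq_conv)
  have s: "same sg ta is \<longleftrightarrow> map sg is = map ta is \<or> map sg is = map Not (map ta is)"
   unfolding same_def by (auto simp: map_eq_conv)
  have n2: "map Not (map sg is) = map Not (map ta is) \<longleftrightarrow> map sg is = map ta is"
    "map Not (map sg is) = map ta is \<longleftrightarrow> map sg is = map Not (map ta is)"
   by (auto simp: map_eq_conv)
  show ?thesis
  proof (cases "map sg is = map ta is")
   case True
   then have "?X = {map sg is, map Not (map sg is)}" by auto
   then have "card ?X = 2" using n1 by (simp add: card_insert_if del: map_map)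
   moreover have "same sg ta is" using True s by blast
   ultimately show ?thesis by (simp only: of_bool_eq)
  next
   case F: False
   show ?thesis
   proof (cases "map sg is = map Not (map ta is)")
    case True
    then have "?X = {map sg is, map ta is}" using n2 by auto
    then have "card ?X = 2" using F by (simp add: card_insert_if del: map_map)
    moreover have "same sg ta is" using True s by blast
    ultimately show ?thesis by (simp only: of_bool_eq)
   next
    case False
    have "card ?X = 4" using n1 n2 F False by (simp add: card_insert_if del: map_map)
    moreover have "~ same sg ta is" using F False s by blast
    ultimately show ?thesis by (simp only: of_bool_eq)
   qed
  qed
 qed
 finally show ?thesis by (simp add: field_simps)
qed

definition gg :: "nat => nat => (nat => bool) => (nat => bool) => real" where
 "gg k n sg ta = (2 / 2 ^ k) * (psame k n sg ta - 2 / 2 ^ k) / qq k ^ 2"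

lemma avg_cl_pair:
 assumes "k >= 3" "k <= n"
 shows "avg (clauses k n) (%a. cl a sg * cl a ta) = qq k ^ 2 * (1 + gg k n sg ta)"
proof -
 have "avg (clauses k n) (%a. cl a sg * cl a ta)
   = avg (dl k n) (%is. 1 - 4 / 2 ^ k + 2 / 2 ^ k * of_bool (same sg ta is))"
  unfolding avg_clauses using assms by (intro avg_cong pair_nae) (auto simp: dl_def)
 also have "... = 1 - 4 / 2 ^ k + 2 / 2 ^ k * psame k n sg ta"
  unfolding psame_def avg_add avg_cmult using assms by (simp add: avg_const dl_nonempty)
 also have "... = qq k ^ 2 + (2 / 2 ^ k) * (psame k n sg ta - 2 / 2 ^ k)"
  using assms by (simp add: qq_eq power2_eq_square field_simps)
 also have "... = qq k ^ 2 * (1 + gg k n sg ta)"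
  using qq_bounds[of k] assms by (simp add: gg_def field_simps)
 finally show ?thesis .
qed

section \<open>Sums over assignments\<close>

definition tot :: "nat => ((nat => bool) => real) => real" where
 "tot n w = (\<Sum>sg\<in>assignments n. w sg)"

definition tot2 :: "nat => ((nat => bool) => real) => ((nat => bool) => (nat => bool) => real) => real" where
 "tot2 n w h = (\<Sum>sg\<in>assignments n. \<Sum>ta\<in>assignments n. w sg * w ta * h sg ta)"

definition mean :: "nat => ((nat => bool) => real) => ((nat => bool) => real) => real" where
 "mean n w f = tot n (%sg. w sg * f sg) / tot n w"

definition mean2 :: "nat => ((nat => bool) => real) => ((nat => bool) => (nat => bool) => real) => real" where
 "mean2 n w h = tot2 n w h / tot n w ^ 2"

lemma assignments_0: "assignments 0 = {%_. False}"
 unfolding assignments_def by auto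

lemma assignments_Suc: "assignments (Suc n) = assignments n \<union> (%sg. sg(n := True)) ` assignments n"
proof -
 have "sg \<in> assignments n \<union> (%sg. sg(n := True)) ` assignments n" if "sg \<in> assignments (Suc n)" for sg
 proof (cases "sg n")
  case True
  then have "sg = (sg(n := False))(n := True)" using True by (auto simp: fun_eq_iff)
  moreover have "sg(n := False) \<in> assignments n" using that by (auto simp: assignments_def Suc_le_eq)
  ultimately show ?thesis by blast
 next
  case False
  have "~ sg i" if "n <= i" for i
   using \<open>sg \<in> assignments (Suc n)\<close> False that by (cases "i = n") (auto simp: assignments_def)
  then have "sg \<in> assignments n" by (auto simp: assignments_def)
  then show ?thesis by simp
 qed
 then show ?thesis by (auto simp: assignments_def)
qed

lemma finite_assignments [simp]: "finite (assignments n)"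
 by (induction n) (auto simp: assignments_0 assignments_Suc)

lemma assignments_nonempty [simp]: "assignments n ~= {}"
 by (auto simp: assignments_def intro: exI[of _ "%_. False"])

lemma sum_assignments_Suc:
 "(\<Sum>sg\<in>assignments (Suc n). f sg) = (\<Sum>sg\<in>assignments n. f sg + f (sg(n := True)) :: real)"
proof -
 have "inj_on (%sg. sg(n := True)) (assignments n)"
 proof (rule inj_onI)
  fix sg ta assume a: "sg \<in> assignments n" "ta \<in> assignments n" "sg(n := True) = ta(n := True)"
  show "sg = ta"
  proof
   fix i show "sg i = ta i" using a(1,2) fun_cong[OF a(3), of i] by (cases "i = n") (auto simp: assignments_def)
  qed
 qed
 moreover have "assignments n \<inter> (%sg. sg(n := True)) ` assignments n = {}"
  by (auto simp: assignments_def)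
 ultimately show ?thesis
  unfolding assignments_Suc by (simp add: sum.union_disjoint sum.reindex sum.distrib)
qed

lemma card_assignments: "card (assignments n) = 2 ^ n"
proof -
 have "real (card (assignments n)) = 2 ^ n"
 proof (induction n)
  case (Suc n)
  have "real (card (assignments (Suc n))) = (\<Sum>sg\<in>assignments (Suc n). 1)" by simp
  also have "... = 2 * real (card (assignments n))" unfolding sum_assignments_Suc by simp
  finally show ?case using Suc by simp
 qed (simp add: assignments_0)
 then show ?thesis by (metis of_nat_eq_iff of_nat_numeral of_nat_power)
qed

lemma sum_prod_assignments:
 "(\<Sum>sg\<in>assignments n. \<Prod>i<n. u i (sg i)) = (\<Prod>i<n. u i False + u i True :: real)"
proof (induction n)
 case (Suc n)
 have "(\<Sum>sg\<in>assignments (Suc n). \<Prod>i<Suc n. u i (sg i))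
   = (\<Sum>sg\<in>assignments n. (\<Prod>i<n. u i (sg i)) * (u n False + u n True))"
  unfolding sum_assignments_Suc
 proof (rule sum.cong)
  fix sg assume "sg \<in> assignments n"
  then have "~ sg n" by (auto simp: assignments_def)
  moreover have "(\<Prod>i<n. u i ((sg(n := True)) i)) = (\<Prod>i<n. u i (sg i))" by (rule prod.cong) auto
  ultimately show "(\<Prod>i<Suc n. u i (sg i)) + (\<Prod>i<Suc n. u i ((sg(n := True)) i))
   = (\<Prod>i<n. u i (sg i)) * (u n False + u n True)" by (simp add: algebra_simps)
 qed simp
 then show ?case using Suc by (simp add: sum_distrib_right[symmetric])
qed (simp add: assignments_0)

lemma tot_cong: "(!!sg. sg \<in> assignments n ==> w sg = w' sg) ==> tot n w = tot n w'"
 unfolding tot_def by (simp cong: sum.cong)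

lemma tot_mono: "(!!sg. sg \<in> assignments n ==> w sg <= w' sg) ==> tot n w <= tot n w'"
 unfolding tot_def by (intro sum_mono) auto

lemma tot_nonneg: "(!!sg. sg \<in> assignments n ==> 0 <= w sg) ==> 0 <= tot n w"
 unfolding tot_def by (intro sum_nonneg) auto

lemma tot_add: "tot n (%sg. w sg + w' sg) = tot n w + tot n w'"
 unfolding tot_def by (simp add: sum.distrib)

lemma tot_diff: "tot n (%sg. w sg - w' sg) = tot n w - tot n w'"
 unfolding tot_def by (simp add: sum_subtractf)

lemma tot_cmult: "tot n (%sg. c * w sg) = c * tot n w"
 unfolding tot_def by (simp add: sum_distrib_left)

lemma tot_cmult_right: "tot n (%sg. w sg * c) = tot n w * c"
 unfolding tot_def by (simp add: sum_distrib_right)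

lemma tot_sum: "tot n (%sg. \<Sum>x\<in>S. f x sg) = (\<Sum>x\<in>S. tot n (f x))"
 unfolding tot_def by (rule sum.swap)

lemma avg_tot: "avg S (%x. tot n (f x)) = tot n (%sg. avg S (%x. f x sg))"
 unfolding tot_def by (rule avg_sum)

lemma avg_tot2: "avg S (%x. tot2 n (f x) h)
  = (\<Sum>sg\<in>assignments n. \<Sum>ta\<in>assignments n. avg S (%x. f x sg * f x ta) * h sg ta)"
 unfolding tot2_def by (simp add: avg_sum avg_cmult_right)

lemma tot2_one: "tot2 n w (%_ _. 1) = tot n w ^ 2"
 unfolding tot2_def tot_def by (simp add: power2_eq_square sum_product)

lemma tot2_mono:
 "(!!sg. 0 <= w sg) ==> (!!sg ta. h sg ta <= h' sg ta) ==> tot2 n w h <= tot2 n w h'"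
 unfolding tot2_def by (intro sum_mono mult_left_mono) auto

lemma tot2_nonneg: "(!!sg. 0 <= w sg) ==> (!!sg ta. 0 <= h sg ta) ==> 0 <= tot2 n w h"
 unfolding tot2_def by (intro sum_nonneg mult_nonneg_nonneg) auto

lemma tot2_add: "tot2 n w (%sg ta. h sg ta + h' sg ta) = tot2 n w h + tot2 n w h'"
 unfolding tot2_def by (simp add: sum.distrib algebra_simps)

lemma tot2_cmult: "tot2 n w (%sg ta. c * h sg ta) = c * tot2 n w h"
 unfolding tot2_def by (simp add: sum_distrib_left algebra_simps)

lemma mean2_mono:
 "(!!sg. 0 <= w sg) ==> (!!sg ta. h sg ta <= h' sg ta) ==> mean2 n w h <= mean2 n w h'"
 unfolding mean2_def by (intro divide_right_mono tot2_mono) auto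

lemma mean2_nonneg: "(!!sg. 0 <= w sg) ==> (!!sg ta. 0 <= h sg ta) ==> 0 <= mean2 n w h"
 unfolding mean2_def by (intro divide_nonneg_nonneg tot2_nonneg) auto

lemma mean2_add: "mean2 n w (%sg ta. h sg ta + h' sg ta) = mean2 n w h + mean2 n w h'"
 unfolding mean2_def by (simp add: tot2_add add_divide_distrib)

lemma mean2_cmult: "mean2 n w (%sg ta. c * h sg ta) = c * mean2 n w h"
 unfolding mean2_def by (simp add: tot2_cmult)

lemma mean2_const: "tot n w ~= 0 ==> mean2 n w (%_ _. c) = c"
 using tot2_cmult[of n w c "%_ _. 1"] by (simp add: mean2_def tot2_one)

section \<open>The distribution of the overlap\<close>

lemma cosh_le: "cosh (r::real) <= exp (r\<^sup>2 / 2)"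
proof -
 have *: "cosh r <= exp (r\<^sup>2 / 2)" if "r >= 0" for r :: real
 proof -
  have p: "0 < 1 + (1/2) * (exp (2 * r) - 1)" using exp_gt_zero[of "2 * r"] by (simp add: field_simps del: exp_gt_zero)
  have "- (2*r) * (1/2) + ln (1 + (1/2) * (exp (2*r) - 1)) <= (2*r)\<^sup>2 / 8"
   using Hoeffdings_lemma_aux[of "2*r" "1/2"] that by simp
  then have a: "exp (- r + ln (1 + (1/2) * (exp (2*r) - 1))) <= exp (r\<^sup>2 / 2)"
   by (subst exp_le_cancel_iff) (simp add: power2_eq_square)
  have b: "exp (- r + ln (1 + (1/2) * (exp (2*r) - 1))) = cosh r"
   unfolding exp_add exp_ln[OF p] using exp_add[of "-r" "2*r"]
   by (simp add: cosh_def algebra_simps)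
  show ?thesis using a unfolding b .
 qed
 show ?thesis using *[of r] *[of "-r"] by (cases "r >= 0") auto
qed

lemma spin_mult: "spin a * spin b = (if a = b then 1 else -1)"
 unfolding spin_def by auto

lemma sum_exp_inner_spin: "(\<Sum>ta\<in>assignments n. exp (r * inner_spin n sg ta)) <= 2 ^ n * exp (real n * r\<^sup>2 / 2)"
proof -
 have "exp (r * inner_spin n sg ta) = (\<Prod>i<n. exp (r * (spin (sg i) * spin (ta i))))" for ta
  unfolding inner_spin_def by (simp add: sum_distrib_left exp_sum)
 then have "(\<Sum>ta\<in>assignments n. exp (r * inner_spin n sg ta))
  = (\<Sum>ta\<in>assignments n. \<Prod>i<n. exp (r * (spin (sg i) * spin (ta i))))" by simp
 also have "... = (\<Prod>i<n. exp (r * (spin (sg i) * spin False)) + exp (r * (spin (sg i) * spin True)))"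
  by (rule sum_prod_assignments)
 also have "... = (\<Prod>i<n. 2 * cosh r)"
  by (intro prod.cong) (auto simp: spin_def cosh_def)
 also have "... = 2 ^ n * cosh r ^ n" by (simp add: power_mult_distrib)
 also have "... <= 2 ^ n * exp (r\<^sup>2 / 2) ^ n"
  by (intro mult_left_mono power_mono cosh_le) auto
 also have "exp (r\<^sup>2 / 2) ^ n = exp (real n * r\<^sup>2 / 2)" by (simp flip: exp_of_nat_mult)
 finally show ?thesis .
qed

lemma inner_spin_card: "inner_spin n sg ta = 2 * real (card {i\<in>{..<n}. sg i = ta i}) - real n"
proof -
 have "inner_spin n sg ta = (\<Sum>i<n. 2 * of_bool (sg i = ta i) - 1)"
  unfolding inner_spin_def spin_mult by (intro sum.cong) auto
 also have "... = 2 * (\<Sum>i<n. of_bool (sg i = ta i)) - real n"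
  by (simp add: sum_subtractf sum_distrib_left)
 finally show ?thesis by (simp add: Int_def)
qed

lemma abs_inner_spin: "\<bar>inner_spin n sg ta\<bar> <= real n"
proof -
 have "card {i\<in>{..<n}. sg i = ta i} <= card {..<n}" by (intro card_mono) auto
 then show ?thesis unfolding inner_spin_card by simp
qed

lemma abs_ov: "\<bar>ov n sg ta\<bar> <= 1"
 using abs_inner_spin[of n sg ta] unfolding ov_def by (cases "n = 0") auto

lemma ov_sq_le: "(ov n sg ta)\<^sup>2 <= 1" using abs_ov[of n sg ta] by (simp add: abs_square_le_1)

lemma card_ov:
 assumes "n > 0"
 shows "real (card {ta\<in>assignments n. ov n sg ta = r}) <= 2 ^ n * exp (- real n * r\<^sup>2 / 2)"
proof -
 have "real (card {ta\<in>assignments n. ov n sg ta = r}) * exp (real n * r\<^sup>2)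
   = (\<Sum>ta\<in>{ta\<in>assignments n. ov n sg ta = r}. exp (r * inner_spin n sg ta))"
  using assms by (simp add: ov_def power2_eq_square field_simps)
 also have "... <= (\<Sum>ta\<in>assignments n. exp (r * inner_spin n sg ta))"
  by (intro sum_mono2) auto
 also have "... <= 2 ^ n * exp (real n * r\<^sup>2 / 2)" by (rule sum_exp_inner_spin)
 finally have "real (card {ta\<in>assignments n. ov n sg ta = r}) <= 2 ^ n * exp (real n * r\<^sup>2 / 2) / exp (real n * r\<^sup>2)"
  by (simp add: field_simps)
 also have "... = 2 ^ n * exp (real n * r\<^sup>2 / 2 - real n * r\<^sup>2)" by (simp only: exp_diff times_divide_eq_right)
 also have "real n * r\<^sup>2 / 2 - real n * r\<^sup>2 = - real n * r\<^sup>2 / 2" by (simp add: field_simps)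
 finally show ?thesis .
qed

lemma sum_ov_le:
 assumes n: "n > 0" and "A >= 0" and \<phi>: "!!r. \<bar>r\<bar> <= 1 ==> \<phi> r <= A * exp (real n * r\<^sup>2 / 2)"
 shows "(\<Sum>ta\<in>assignments n. \<phi> (ov n sg ta)) <= 2 ^ n * (real n + 1) * A"
proof -
 define V where "V = (%j. (2 * real j - real n) / real n) ` {..n}"
 have fV: "finite V" "card V <= n + 1" unfolding V_def using card_image_le[of "{..n}"] by auto
 have "ov n sg ta \<in> V" for ta
 proof -
  have "card {i\<in>{..<n}. sg i = ta i} <= card {..<n}" by (intro card_mono) auto
  then show ?thesis unfolding V_def ov_def inner_spin_card by auto
 qed
 then have "(\<Sum>ta\<in>assignments n. \<phi> (ov n sg ta))
   = (\<Sum>r\<in>V. \<Sum>ta\<in>{ta\<in>assignments n. ov n sg ta = r}. \<phi> (ov n sg ta))"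
  using fV by (intro sum.group[symmetric]) auto
 also have "... = (\<Sum>r\<in>V. real (card {ta\<in>assignments n. ov n sg ta = r}) * \<phi> r)"
  by (intro sum.cong) auto
 also have "... <= (\<Sum>r\<in>V. 2 ^ n * A)"
 proof (rule sum_mono)
  fix r assume "r \<in> V"
  show "real (card {ta\<in>assignments n. ov n sg ta = r}) * \<phi> r <= 2 ^ n * A"
  proof (cases "{ta\<in>assignments n. ov n sg ta = r} = {}")
   case True
   then show ?thesis using \<open>A >= 0\<close> by (simp only: card.empty) simp
  next
   case False
   then have "\<bar>r\<bar> <= 1" using abs_ov by auto
   then have "real (card {ta\<in>assignments n. ov n sg ta = r}) * \<phi> r
    <= real (card {ta\<in>assignments n. ov n sg ta = r}) * (A * exp (real n * r\<^sup>2 / 2))"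
    using \<phi> by (intro mult_left_mono) auto
   also have "... <= (2 ^ n * exp (- real n * r\<^sup>2 / 2)) * (A * exp (real n * r\<^sup>2 / 2))"
    using card_ov[OF n, of sg r] \<open>A >= 0\<close> by (intro mult_right_mono) auto
   also have "... = 2 ^ n * A * (exp (- real n * r\<^sup>2 / 2) * exp (real n * r\<^sup>2 / 2))" by simp
   also have "... = 2 ^ n * A" by (simp flip: exp_add)
   finally show ?thesis .
  qed
 qed
 also have "... = real (card V) * (2 ^ n * A)" by simp
 also have "... <= (real n + 1) * (2 ^ n * A)" using fV \<open>A >= 0\<close> by (intro mult_right_mono) auto
 finally show ?thesis by (simp add: mult_ac)
qed

section \<open>The pair interaction as a function of the overlap\<close>

definition hh :: "nat => real => real" where "hh k R = (1 + R) ^ k + (1 - R) ^ k - 2"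

definition gf :: "nat => real => real" where "gf k R = 2 / 4 ^ k * hh k R / qq k ^ 2"

lemma avg_lsts_sub:
 assumes "finite S" "T \<subseteq> S"
 shows "avg (lsts k S) (%xs. of_bool (set xs \<subseteq> T)) = (real (card T) / real (card S)) ^ k"
proof -
 have "{xs \<in> lsts k S. set xs \<subseteq> T} = lsts k T" using assms by (auto simp: lsts_def)
 then show ?thesis using assms finite_subset[OF assms(2,1)]
  by (simp add: avg_of_bool card_lsts power_divide)
qed

lemma psame_approx:
 assumes "k >= 1" "k <= n"
 shows "\<bar>psame k n sg ta - (hh k (ov n sg ta) + 2) / 2 ^ k\<bar> <= 2 * real k ^ 2 / real n"
proof -
 have n: "n > 0" using assms by simp
 let ?S = "{..<n}" let ?T = "{i\<in>?S. sg i = ta i}" let ?U = "{i\<in>?S. sg i ~= ta i}"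
 have "avg (lsts k ?S) (%is. of_bool (same sg ta is))
   = avg (lsts k ?S) (%is. of_bool (set is \<subseteq> ?T) + of_bool (set is \<subseteq> ?U))"
 proof (rule avg_cong)
  fix "is" assume i: "is \<in> lsts k ?S"
  then obtain j where "j \<in> set is" using assms by (cases "is") (auto simp: lsts_def)
  then show "of_bool (same sg ta is) = (of_bool (set is \<subseteq> ?T) + of_bool (set is \<subseteq> ?U) :: real)"
   using i unfolding same_def lsts_def by (auto simp: subset_iff)
 qed
 also have "... = (real (card ?T) / real n) ^ k + (real (card ?U) / real n) ^ k"
  unfolding avg_add by (subst avg_lsts_sub, auto)+
 also have "card ?U = n - card ?T"
 proof -
  have "?U = ?S - ?T" by auto
  moreover have "card (?S - ?T) = card ?S - card ?T" by (rule card_Diff_subset) auto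
  ultimately show ?thesis by simp
 qed
 also have "real (card ?T) / real n = (1 + ov n sg ta) / 2"
  using n by (simp add: ov_def inner_spin_card field_simps)
 also have "real (n - card ?T) / real n = (1 - ov n sg ta) / 2"
 proof -
  have "card ?T <= card ?S" by (intro card_mono) auto
  then show ?thesis using n by (simp add: ov_def inner_spin_card field_simps of_nat_diff)
 qed
 finally have 1: "avg (lsts k ?S) (%is. of_bool (same sg ta is)) = (hh k (ov n sg ta) + 2) / 2 ^ k"
  by (simp only: power_divide hh_def) (simp add: add_divide_distrib)
 have "\<bar>avg (dl k n) (%is. of_bool (same sg ta is)) - avg (lsts k ?S) (%is. of_bool (same sg ta is))\<bar>
   <= 2 * 1 * (1 - real (card (dl k n)) / real (card (lsts k ?S)))"
 proof (rule avg_subset_diff)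
  show "dl k n \<subseteq> lsts k ?S" by (auto simp: dl_def lsts_def)
 qed (use dl_nonempty[OF assms(2)] in auto)
 also have "... <= 2 * (real k ^ 2 / real n)"
  using card_dl_ge[of k n] assms n by (simp add: card_lsts field_simps)
 finally show ?thesis using 1 by (simp add: psame_def)
qed

lemma gg_approx:
 assumes "k >= 3" "k <= n"
 shows "\<bar>gg k n sg ta - gf k (ov n sg ta)\<bar> <= 4 * real k ^ 2 / real n"
proof -
 have q: "3/4 <= qq k" using qq_bounds assms by simp
 have "(2::real) ^ 3 <= 2 ^ k" using assms by (intro power_increasing) auto
 then have k2: "2 / (2::real) ^ k <= 1" by (simp add: field_simps)
 have "(4::real) ^ k = 2 ^ k * 2 ^ k" by (simp flip: power_mult_distrib)
 define c where "c = (2 / 2 ^ k) / qq k ^ 2"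
 have "c >= 0" by (simp add: c_def)
 have "gg k n sg ta - gf k (ov n sg ta)
   = c * (psame k n sg ta - (hh k (ov n sg ta) + 2) / 2 ^ k)"
  unfolding gg_def gf_def c_def using \<open>4 ^ k = 2 ^ k * 2 ^ k\<close> by (simp add: add_divide_distrib diff_divide_distrib right_diff_distrib algebra_simps)
 then have "\<bar>gg k n sg ta - gf k (ov n sg ta)\<bar>
   = c * \<bar>psame k n sg ta - (hh k (ov n sg ta) + 2) / 2 ^ k\<bar>"
  using \<open>c >= 0\<close> by (simp add: abs_mult)
 also have "... <= 2 * (2 * real k ^ 2 / real n)"
 proof (intro mult_mono psame_approx)
  have "(3/4)^2 <= qq k ^ 2" using q by (intro power_mono) auto
  then have "1 <= 2 * qq k ^ 2" by (simp add: power2_eq_square)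
  then have "2 / 2 ^ k <= 2 * qq k ^ 2" using k2 by linarith
  then show "c <= 2" using q by (simp add: divide_le_eq c_def mult.commute)
 qed (use assms in auto)
 finally show ?thesis by simp
qed

lemma hh_sum: "hh k R = (\<Sum>j\<in>{2..k}. real (k choose j) * (R ^ j + (- R) ^ j))" if "k >= 1"
proof -
 have "(1 + R) ^ k + (1 - R) ^ k = (\<Sum>j\<le>k. real (k choose j) * (R ^ j + (- R) ^ j))"
  using binomial_ring[of R 1 k] binomial_ring[of "- R" 1 k]
  by (simp add: add.commute sum.distrib[symmetric] algebra_simps)
 also have "{..k} = {0, 1} \<union> {2..k}" using that by auto
 also have "(\<Sum>j\<in>{0, 1} \<union> {2..k}. real (k choose j) * (R ^ j + (- R) ^ j))
   = 2 + (\<Sum>j\<in>{2..k}. real (k choose j) * (R ^ j + (- R) ^ j))"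
  by (subst sum.union_disjoint) auto
 finally show ?thesis by (simp add: hh_def)
qed

lemma even_term: "R ^ j + (- R) ^ j = (if even j then 2 * \<bar>R\<bar> ^ j else 0 :: real)"
 by (auto simp: power_even_abs)

lemma choose_two_r: "real (k choose 2) = real k * (real k - 1) / 2"
proof (induction k)
 case (Suc k)
 have "real (Suc k choose 2) = real k + real (k choose 2)" by (simp add: numeral_2_eq_2)
 then show ?case using Suc by (simp add: field_simps)
qed simp

lemma hh_ge: assumes "k >= 2" shows "real k * (real k - 1) * R\<^sup>2 <= hh k R"
proof -
 have "(\<Sum>j\<in>{2::nat}. real (k choose j) * (R ^ j + (- R) ^ j)) <= hh k R"
  using assms by (subst hh_sum, simp, intro sum_mono2) (auto simp: even_term)
 then show ?thesis by (simp add: power2_eq_square choose_two_r)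
qed

lemma hh_le: assumes "k >= 3" "\<bar>R\<bar> <= 1"
 shows "hh k R <= real k * (real k - 1) * R\<^sup>2 + 2 * 2 ^ k * R ^ 4"
proof -
 have s: "{2..k} = insert 2 {3..k}" using assms by auto
 have "hh k R = real (k choose 2) * (R\<^sup>2 + (-R)\<^sup>2) + (\<Sum>j\<in>{3..k}. real (k choose j) * (R ^ j + (- R) ^ j))"
  using assms by (subst hh_sum) (auto simp: s)
 also have "(\<Sum>j\<in>{3..k}. real (k choose j) * (R ^ j + (- R) ^ j)) <= (\<Sum>j\<in>{3..k}. real (k choose j) * (2 * R ^ 4))"
 proof (intro sum_mono mult_left_mono)
  fix j assume j: "j \<in> {3..k}"
  show "R ^ j + (- R) ^ j <= 2 * R ^ 4"
  proof (cases "even j")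
   case True
   then have "j >= 4" using j by (cases "j = 3") auto
   then have "\<bar>R\<bar> ^ j <= \<bar>R\<bar> ^ 4" using assms by (intro power_decreasing) auto
   then show ?thesis using True by (simp add: even_term power_even_abs)
  qed (simp add: even_term)
 qed auto
 also have "... <= (\<Sum>j\<le>k. real (k choose j) * (2 * R ^ 4))" by (intro sum_mono2) auto
 also have "... = real (\<Sum>j\<le>k. k choose j) * (2 * R ^ 4)" by (simp add: sum_distrib_right)
 also have "... = 2 * 2 ^ k * R ^ 4" by (simp add: choose_row_sum)
 finally show ?thesis by (simp add: choose_two_r power2_eq_square)
qed

lemma hh_gap: assumes "k >= 3" "0 <= a" "a <= \<bar>R\<bar>"
 shows "hh k a + real k * (real k - 1) * (R\<^sup>2 - a\<^sup>2) <= hh k R"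
proof -
 have s: "{2..k} = insert 2 {3..k}" using assms by auto
 have e: "hh k r = real (k choose 2) * (r\<^sup>2 + (-r)\<^sup>2) + (\<Sum>j\<in>{3..k}. real (k choose j) * (r ^ j + (- r) ^ j))" for r
  using assms by (subst hh_sum) (auto simp: s)
 have "(\<Sum>j\<in>{3..k}. real (k choose j) * (a ^ j + (- a) ^ j)) <= (\<Sum>j\<in>{3..k}. real (k choose j) * (R ^ j + (- R) ^ j))"
  using assms by (intro sum_mono mult_left_mono) (auto simp: even_term intro: power_mono)
 moreover have "hh k r = real k * (real k - 1) * r\<^sup>2 + (\<Sum>j\<in>{3..k}. real (k choose j) * (r ^ j + (- r) ^ j))" for r
  unfolding e by (simp add: choose_two_r)
 ultimately show ?thesis by (simp only: right_diff_distrib)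
qed

section \<open>Random formulas: first and second moments\<close>

definition MM :: "nat => nat => formula => real" where
 "MM k n F = tot n (wgt F) / (2 ^ n * qq k ^ length F)"

abbreviation Fm :: "nat => nat => nat => formula set" where
 "Fm k n m \<equiv> lsts m (clauses k n)"

lemma avg_wgt:
 assumes "k >= 1" "k <= n" shows "avg (Fm k n m) (%F. wgt F sg) = qq k ^ m"
proof (induction m)
 case (Suc m)
 then show ?case using assms by (simp add: avg_lsts_Suc wgt_Cons avg_cmult avg_cmult_right avg_cl)
qed simp

lemma avg_wgt2:
 assumes "k >= 3" "k <= n"
 shows "avg (Fm k n m) (%F. wgt F sg * wgt F ta) = (qq k ^ 2 * (1 + gg k n sg ta)) ^ m"
proof (induction m)
 case (Suc m)
 have "avg (Fm k n (Suc m)) (%F. wgt F sg * wgt F ta)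
   = avg (clauses k n) (%a. (cl a sg * cl a ta) * avg (Fm k n m) (%F. wgt F sg * wgt F ta))"
  unfolding avg_lsts_Suc avg_cmult[symmetric] by (intro avg_cong) (simp add: wgt_Cons mult_ac)
 then show ?case using Suc assms by (simp add: avg_cmult_right avg_cl_pair)
qed simp

lemma gg_ge: assumes "k >= 3" "k <= n" shows "0 <= 1 + gg k n sg ta"
proof -
 have "0 <= avg (clauses k n) (%a. cl a sg * cl a ta)" by (intro avg_nonneg mult_nonneg_nonneg cl_01)
 then show ?thesis using avg_cl_pair[OF assms] qq_bounds[OF assms(1)] by (simp add: zero_le_mult_iff)
qed

lemma MM_nonneg: "k >= 3 ==> 0 <= MM k n F"
 unfolding MM_def using qq_bounds[of k] by (intro divide_nonneg_nonneg tot_nonneg) (auto simp: wgt_01)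

lemma avg_MM:
 assumes "k >= 3" "k <= n" shows "avg (Fm k n m) (MM k n) = 1"
proof -
 have "avg (Fm k n m) (MM k n) = avg (Fm k n m) (%F. tot n (wgt F) / (2 ^ n * qq k ^ m))"
  by (intro avg_cong) (auto simp: MM_def lsts_def)
 also have "... = 1" using assms qq_bounds[of k]
  by (simp add: avg_divide avg_tot avg_wgt) (simp add: tot_def card_assignments)
 finally show ?thesis .
qed

lemma tot_wgt_Z: "tot n (wgt F) = real (Z n F)"
 unfolding tot_def wgt_def Z_def nae_solutions_def by (simp add: Collect_conj_eq Int_commute)

section \<open>The planted measure\<close>

definition r2 :: "nat => formula => real" where
 "r2 n F = mean2 n (wgt F) (%sg ta. (ov n sg ta)\<^sup>2)"

definition pl :: "nat => nat => nat => (formula => real) => real" where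
 "pl k n m f = avg (Fm k n m) (%F. MM k n F * f F)"

definition KK :: "nat => nat => nat => real" where
 "KK k n m = avg (Fm k n m) (%F. Lam (MM k n F))"

definition xx :: "nat => nat => formula => clause => real" where
 "xx k n F a = mean n (wgt F) (cl a) / qq k"

lemma wgt_abs_le: "tot n (wgt F) = 0 ==> sg \<in> assignments n ==> wgt F sg = 0"
 unfolding tot_def using wgt_01 by (subst (asm) sum_nonneg_eq_0_iff) auto

lemma MM_Cons:
 assumes "k >= 3"
 shows "MM k n (a # F) = MM k n F * xx k n F a"
proof (cases "tot n (wgt F) = 0")
 case True
 then have "tot n (wgt (a # F)) = 0" unfolding tot_def[of n "wgt (a # F)"]
  by (intro sum.neutral) (auto simp: wgt_Cons wgt_abs_le)
 then show ?thesis using True by (simp add: MM_def)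
next
 case False
 have "wgt (a # F) = (%sg. wgt F sg * cl a sg)" by (simp add: fun_eq_iff wgt_Cons)
 then show ?thesis using False qq_bounds[OF assms] by (simp add: MM_def xx_def mean_def)
qed

lemma avg_mean: "avg S (%a. mean n w (f a)) = mean n w (%sg. avg S (%a. f a sg))"
 unfolding mean_def by (simp add: avg_divide avg_tot avg_cmult)

lemma mean_const: "tot n w ~= 0 ==> mean n w (%_. c) = c"
 unfolding mean_def by (simp add: tot_cmult_right)

lemma mean_mono: "(!!sg. 0 <= w sg) ==> (!!sg. f sg <= g sg) ==> mean n w f <= mean n w g"
 unfolding mean_def by (intro divide_right_mono tot_mono mult_left_mono tot_nonneg) auto

lemma xx_bounds:
 assumes "k >= 3" shows "0 <= xx k n F a" "xx k n F a <= 1 / qq k"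
proof -
 have q: "qq k > 0" using qq_bounds[OF assms] by simp
 have "0 <= mean n (wgt F) (cl a)" unfolding mean_def
  by (intro divide_nonneg_nonneg tot_nonneg mult_nonneg_nonneg wgt_01 cl_01)
 then show "0 <= xx k n F a" using q by (simp add: xx_def)
 have "mean n (wgt F) (cl a) <= 1"
 proof (cases "tot n (wgt F) = 0")
  case False
  then show ?thesis using mean_mono[of "wgt F" "cl a" "%_. 1" n] mean_const[OF False, of 1] wgt_01 cl_01 by auto
 qed (simp add: mean_def)
 then show "xx k n F a <= 1 / qq k" using q by (simp add: xx_def divide_right_mono)
qed

lemma avg_xx:
 assumes "k >= 3" "k <= n" "tot n (wgt F) ~= 0"
 shows "avg (clauses k n) (xx k n F) = 1"
 unfolding xx_def using assms qq_bounds[OF assms(1)]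
 by (simp add: avg_divide avg_mean avg_cl mean_const)

lemma avg_xx_sq:
 assumes "k >= 3" "k <= n" "tot n (wgt F) ~= 0"
 shows "avg (clauses k n) (%a. (xx k n F a - 1)\<^sup>2) = mean2 n (wgt F) (gg k n)"
proof -
 have q: "qq k > 0" using qq_bounds[OF assms(1)] by simp
 have "(tot n (%sg. wgt F sg * cl a sg))\<^sup>2 = tot2 n (wgt F) (%sg ta. cl a sg * cl a ta)" for a
  unfolding tot_def tot2_def by (simp add: power2_eq_square sum_product mult_ac)
 then have "avg (clauses k n) (%a. (xx k n F a)\<^sup>2)
   = avg (clauses k n) (%a. mean2 n (wgt F) (%sg ta. cl a sg * cl a ta) / qq k ^ 2)"
  unfolding xx_def mean_def mean2_def by (simp add: power_divide power_mult_distrib)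
 also have "... = mean2 n (wgt F) (%sg ta. avg (clauses k n) (%a. cl a sg * cl a ta)) / qq k ^ 2"
  unfolding mean2_def tot2_def by (simp add: avg_divide avg_sum avg_cmult)
 also have "... = mean2 n (wgt F) (%sg ta. 1 + gg k n sg ta)"
  using assms q by (simp add: avg_cl_pair mean2_cmult)
 also have "... = 1 + mean2 n (wgt F) (gg k n)"
  using assms by (simp add: mean2_add mean2_const)
 finally have 1: "avg (clauses k n) (%a. (xx k n F a)\<^sup>2) = 1 + mean2 n (wgt F) (gg k n)" .
 have "avg (clauses k n) (%a. (xx k n F a - 1)\<^sup>2)
   = avg (clauses k n) (%a. (xx k n F a)\<^sup>2 - 2 * xx k n F a + 1)"
  by (intro avg_cong) (simp add: power2_eq_square algebra_simps)
 also have "... = mean2 n (wgt F) (gg k n)"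
  using assms by (simp add: avg_add avg_diff avg_cmult 1 avg_xx avg_const clauses_nonempty)
 finally show ?thesis .
qed

lemma ln_ge_half: assumes "1 <= x" "x <= 2" shows "(x - 1) / 2 <= ln (x::real)"
proof -
 have "1 / x - 1 = (1 - x) / x" using assms by (simp add: field_simps)
 have "ln (1 / x) <= 1 / x - 1" using assms by (intro ln_le_minus_one) auto
 then have "ln x >= (x - 1) / x" using assms by (simp add: ln_div field_simps)
 moreover have "(x - 1) / x >= (x - 1) / 2" using assms by (intro divide_left_mono) auto
 ultimately show ?thesis by linarith
qed

lemma Lam_ge:
 assumes "0 <= x" "x <= 2" shows "(x - 1) + (x - 1)\<^sup>2 / 4 <= Lam x"
proof (cases "x = 0")
 case False
 define f where "f = (%x::real. x * ln x - (x - 1) - (x - 1)\<^sup>2 / 4)"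
 have d: "(f has_real_derivative ln y - (y - 1) / 2) (at y)" if "y > 0" for y
  unfolding f_def using that by (auto intro!: derivative_eq_intros simp: field_simps)
 have "f 1 <= f x"
 proof (cases "x >= 1")
  case True
  show ?thesis
  proof (rule DERIV_nonneg_imp_nondecreasing[OF True])
   fix y assume "1 <= y" "y <= x"
   then show "\<exists>z. (f has_real_derivative z) (at y) & 0 <= z"
    using d[of y] ln_ge_half[of y] assms by (intro exI[of _ "ln y - (y - 1) / 2"]) auto
  qed
 next
  case x1: False
  then have x1': "x <= 1" by simp
  show ?thesis
  proof (rule DERIV_nonpos_imp_nonincreasing[OF x1'])
   fix y assume y: "x <= y" "y <= 1"
   then have "y > 0" using assms False by simp
   then show "\<exists>z. (f has_real_derivative z) (at y) & z <= 0"
    using d[of y] ln_le_minus_one[of y] y by (intro exI[of _ "ln y - (y - 1) / 2"]) auto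
  qed
 qed
 then show ?thesis using False by (simp add: f_def Lam_def)
qed (simp add: Lam_def)

lemma Lam_mult: "Lam (x * y) = x * Lam y + y * Lam x" if "0 <= x" "0 <= y"
 using that unfolding Lam_def by (auto simp: ln_mult algebra_simps)

lemma Lam_0 [simp]: "Lam 0 = 0" and Lam_1 [simp]: "Lam 1 = 0"
 unfolding Lam_def by auto

definition ck :: "nat => real" where "ck k = 2 / 4 ^ k * (real k * (real k - 1)) / qq k ^ 2"

lemma ck_pos: "k >= 3 ==> 0 < ck k"
 unfolding ck_def using qq_bounds[of k] by (intro divide_pos_pos mult_pos_pos) auto

lemma gg_lower:
 assumes "k >= 3" "k <= n"
 shows "ck k * (ov n sg ta)\<^sup>2 - 4 * real k ^ 2 / real n <= gg k n sg ta"
proof -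
 have "2 / 4 ^ k * (real k * (real k - 1) * (ov n sg ta)\<^sup>2) / qq k ^ 2 <= gf k (ov n sg ta)"
  unfolding gf_def using assms hh_ge[of k "ov n sg ta"] by (intro divide_right_mono mult_left_mono) auto
 moreover have "ck k * (ov n sg ta)\<^sup>2 = 2 / 4 ^ k * (real k * (real k - 1) * (ov n sg ta)\<^sup>2) / qq k ^ 2"
  by (simp add: ck_def)
 ultimately show ?thesis using gg_approx[OF assms, of sg ta] by linarith
qed

lemma Lam_step:
 assumes k: "k >= 3" "k <= n"
 shows "avg (clauses k n) (%a. Lam (MM k n (a # F))) >= Lam (MM k n F)"
  and "avg (clauses k n) (%a. Lam (MM k n (a # F)))
    >= Lam (MM k n F) + MM k n F * (ck k / 4 * r2 n F - real k ^ 2 / real n)"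
proof -
 let ?C = "clauses k n"
 have "avg ?C (%a. Lam (MM k n (a # F))) >= Lam (MM k n F) &
   avg ?C (%a. Lam (MM k n (a # F)))
    >= Lam (MM k n F) + MM k n F * (ck k / 4 * r2 n F - real k ^ 2 / real n)"
 proof (cases "tot n (wgt F) = 0")
  case True
  then have "MM k n F = 0" by (simp add: MM_def)
  then show ?thesis using k by (simp add: MM_Cons)
 next
  case False
  have M: "0 <= MM k n F" by (rule MM_nonneg[OF k(1)])
  have q: "3/4 <= qq k" using qq_bounds k by auto
  have x2: "xx k n F a <= 2" for a
  proof -
   have "1 / qq k <= 1 / (3/4)" using q by (intro divide_left_mono) auto
   then show ?thesis using xx_bounds(2)[OF k(1), of n F a] by simp
  qed
  have "avg ?C (%a. Lam (MM k n (a # F))) = avg ?C (%a. MM k n F * Lam (xx k n F a) + xx k n F a * Lam (MM k n F))"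
   using k by (intro avg_cong) (simp add: MM_Cons Lam_mult M xx_bounds)
  also have "... = MM k n F * avg ?C (%a. Lam (xx k n F a)) + Lam (MM k n F)"
   using k False by (simp add: avg_add avg_cmult avg_cmult_right avg_xx)
  finally have e: "avg ?C (%a. Lam (MM k n (a # F))) = MM k n F * avg ?C (%a. Lam (xx k n F a)) + Lam (MM k n F)" .
  have "avg ?C (%a. Lam (xx k n F a)) >= avg ?C (%a. (xx k n F a - 1) + (xx k n F a - 1)\<^sup>2 / 4)"
   using k by (intro avg_mono Lam_ge xx_bounds x2)
  also have "avg ?C (%a. (xx k n F a - 1) + (xx k n F a - 1)\<^sup>2 / 4) = avg ?C (%a. (xx k n F a - 1)\<^sup>2) / 4"
   using k False by (simp add: avg_add avg_diff avg_divide avg_xx avg_const clauses_nonempty)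
  finally have L: "avg ?C (%a. Lam (xx k n F a)) >= avg ?C (%a. (xx k n F a - 1)\<^sup>2) / 4" .
  moreover have "avg ?C (%a. (xx k n F a - 1)\<^sup>2) >= 0" by (intro avg_nonneg) auto
  ultimately have 1: "avg ?C (%a. Lam (xx k n F a)) >= 0" by simp
  have "avg ?C (%a. (xx k n F a - 1)\<^sup>2) >= mean2 n (wgt F) (%sg ta. ck k * (ov n sg ta)\<^sup>2 + - (4 * real k ^ 2 / real n))"
   unfolding avg_xx_sq[OF k False] using gg_lower[OF k] by (intro mean2_mono wgt_01) auto
  then have "avg ?C (%a. (xx k n F a - 1)\<^sup>2) >= ck k * r2 n F - 4 * real k ^ 2 / real n"
   unfolding r2_def mean2_add mean2_cmult mean2_const[OF False] by simp
  then have 2: "avg ?C (%a. Lam (xx k n F a)) >= ck k / 4 * r2 n F - real k ^ 2 / real n"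
   using L by simp
  show ?thesis unfolding e using mult_left_mono[OF 1 M] mult_left_mono[OF 2 M] by simp
 qed
 then show "avg ?C (%a. Lam (MM k n (a # F))) >= Lam (MM k n F)"
  and "avg ?C (%a. Lam (MM k n (a # F)))
    >= Lam (MM k n F) + MM k n F * (ck k / 4 * r2 n F - real k ^ 2 / real n)" by auto
qed

lemma KK_mono: assumes "k >= 3" "k <= n" "m <= m'" shows "KK k n m <= KK k n m'"
 using \<open>m <= m'\<close>
proof (induction m' rule: dec_induct)
 case (step m')
 have "KK k n (Suc m') = avg (Fm k n m') (%F. avg (clauses k n) (%a. Lam (MM k n (a # F))))"
  unfolding KK_def avg_lsts_Suc by (rule avg_swap)
 also have "... >= KK k n m'" unfolding KK_def using assms by (intro avg_mono Lam_step)
 finally show ?case using step by simp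
qed simp

lemma KK_0: "KK k n 0 = 0"
proof -
 have "MM k n [] = 1" by (simp add: MM_def tot_def card_assignments)
 then show ?thesis by (simp add: KK_def)
qed

lemma KK_nonneg: "k >= 3 ==> k <= n ==> 0 <= KK k n m"
 using KK_mono[of k n 0 m] by (simp add: KK_0)

text \<open>The squared overlap is a submartingale under the planted measure, being a sum of squared
 posterior means; the linear minorant of \<open>y\<^sup>2 / x\<close> replaces conditional Jensen.\<close>

lemma tot2_ov:
 "n > 0 ==> tot2 n w (%sg ta. (ov n sg ta)\<^sup>2)
  = (\<Sum>i<n. \<Sum>j<n. (tot n (%sg. w sg * (spin (sg i) * spin (sg j))))\<^sup>2) / real n ^ 2"
proof -
 let ?A = "assignments n"
 have "(ov n sg ta)\<^sup>2 = (\<Sum>i<n. \<Sum>j<n. (spin (sg i) * spin (sg j)) * (spin (ta i) * spin (ta j))) / real n ^ 2" for sg ta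
  unfolding ov_def inner_spin_def by (simp add: power_divide) (simp add: power2_eq_square sum_product mult_ac)
 then have "tot2 n w (%sg ta. (ov n sg ta)\<^sup>2)
  = (\<Sum>sg\<in>?A. \<Sum>ta\<in>?A. \<Sum>i<n. \<Sum>j<n. (w sg * (spin (sg i) * spin (sg j))) * (w ta * (spin (ta i) * spin (ta j)))) / real n ^ 2"
  unfolding tot2_def by (simp add: sum_distrib_left sum_divide_distrib mult_ac)
 also have "(\<Sum>sg\<in>?A. \<Sum>ta\<in>?A. \<Sum>i<n. \<Sum>j<n. (w sg * (spin (sg i) * spin (sg j))) * (w ta * (spin (ta i) * spin (ta j))))
   = (\<Sum>i<n. \<Sum>j<n. \<Sum>sg\<in>?A. \<Sum>ta\<in>?A. (w sg * (spin (sg i) * spin (sg j))) * (w ta * (spin (ta i) * spin (ta j))))"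
 proof -
  let ?g = "%sg ta i j. (w sg * (spin (sg i) * spin (sg j))) * (w ta * (spin (ta i) * spin (ta j)))"
  have "(\<Sum>sg\<in>?A. \<Sum>ta\<in>?A. \<Sum>i<n. \<Sum>j<n. ?g sg ta i j) = (\<Sum>sg\<in>?A. \<Sum>i<n. \<Sum>ta\<in>?A. \<Sum>j<n. ?g sg ta i j)"
   by (rule sum.cong[OF refl], rule sum.swap)
  also have "... = (\<Sum>i<n. \<Sum>sg\<in>?A. \<Sum>ta\<in>?A. \<Sum>j<n. ?g sg ta i j)" by (rule sum.swap)
  also have "... = (\<Sum>i<n. \<Sum>sg\<in>?A. \<Sum>j<n. \<Sum>ta\<in>?A. ?g sg ta i j)"
   by (rule sum.cong[OF refl], rule sum.cong[OF refl], rule sum.swap)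
  also have "... = (\<Sum>i<n. \<Sum>j<n. \<Sum>sg\<in>?A. \<Sum>ta\<in>?A. ?g sg ta i j)"
   by (rule sum.cong[OF refl], rule sum.swap)
  finally show ?thesis .
 qed
 also have "... = (\<Sum>i<n. \<Sum>j<n. (tot n (%sg. w sg * (spin (sg i) * spin (sg j))))\<^sup>2)"
  unfolding tot_def by (simp add: power2_eq_square sum_product)
 finally show ?thesis .
qed

lemma spin_abs: "\<bar>spin b\<bar> = 1" by (simp add: spin_def)

lemma square_div_step:
 assumes k: "k >= 3" "k <= n" and u: "!!sg. \<bar>u sg\<bar> <= 1"
 shows "avg (clauses k n) (%a. (tot n (%sg. wgt (a # F) sg * u sg))\<^sup>2 / tot n (wgt (a # F)))
   >= qq k * ((tot n (%sg. wgt F sg * u sg))\<^sup>2 / tot n (wgt F))"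
proof -
 let ?C = "clauses k n"
 define l where "l = tot n (%sg. wgt F sg * u sg) / tot n (wgt F)"
 have ge: "2 * l * tot n (%sg. wgt G sg * u sg) - l\<^sup>2 * tot n (wgt G) <= (tot n (%sg. wgt G sg * u sg))\<^sup>2 / tot n (wgt G)" for G
 proof (cases "tot n (wgt G) = 0")
  case True
  then have "tot n (%sg. wgt G sg * u sg) = 0" unfolding tot_def[of n "%sg. wgt G sg * u sg"]
   by (intro sum.neutral) (auto simp: wgt_abs_le)
  then show ?thesis using True by simp
 next
  case False
  define x y where "x = tot n (wgt G)" and "y = tot n (%sg. wgt G sg * u sg)"
  have "x > 0" using False tot_nonneg[of n "wgt G"] wgt_01 by (auto simp: x_def less_le)
  have "0 <= (y - l * x)\<^sup>2" by simp
  then have "2 * l * x * y - l\<^sup>2 * x\<^sup>2 <= y\<^sup>2" by (simp add: power2_eq_square algebra_simps)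
  then have "(2 * l * y - l\<^sup>2 * x) * x <= y\<^sup>2" by (simp add: power2_eq_square algebra_simps)
  then show ?thesis using \<open>x > 0\<close> unfolding x_def[symmetric] y_def[symmetric] by (simp add: pos_le_divide_eq)
 qed
 have av: "avg ?C (%a. tot n (%sg. wgt (a # F) sg * v sg)) = qq k * tot n (%sg. wgt F sg * v sg)" for v
  using k by (simp add: avg_tot wgt_Cons avg_cmult_right avg_cl mult.assoc tot_cmult)
 have av1: "avg ?C (%a. tot n (wgt (a # F))) = qq k * tot n (wgt F)"
  using av[of "%_. 1"] by simp
 have "avg ?C (%a. (tot n (%sg. wgt (a # F) sg * u sg))\<^sup>2 / tot n (wgt (a # F)))
  >= avg ?C (%a. 2 * l * tot n (%sg. wgt (a # F) sg * u sg) - l\<^sup>2 * tot n (wgt (a # F)))"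
  by (intro avg_mono ge)
 also have "avg ?C (%a. 2 * l * tot n (%sg. wgt (a # F) sg * u sg) - l\<^sup>2 * tot n (wgt (a # F)))
  = qq k * (2 * l * tot n (%sg. wgt F sg * u sg) - l\<^sup>2 * tot n (wgt F))"
  unfolding avg_diff avg_cmult av av1 by (simp add: algebra_simps)
 also have "2 * l * tot n (%sg. wgt F sg * u sg) - l\<^sup>2 * tot n (wgt F) = (tot n (%sg. wgt F sg * u sg))\<^sup>2 / tot n (wgt F)"
  by (cases "tot n (wgt F) = 0") (auto simp: l_def power2_eq_square)
 finally show ?thesis .
qed

lemma MM_r2:
 assumes "n > 0"
 shows "MM k n F * r2 n F = (\<Sum>i<n. \<Sum>j<n. (tot n (%sg. wgt F sg * (spin (sg i) * spin (sg j))))\<^sup>2 / tot n (wgt F))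
   / (real n ^ 2 * (2 ^ n * qq k ^ length F))"
 unfolding MM_def r2_def mean2_def tot2_ov[OF assms]
 by (simp add: sum_divide_distrib[symmetric] power2_eq_square)

lemma r2_step:
 assumes k: "k >= 3" "k <= n"
 shows "avg (clauses k n) (%a. MM k n (a # F) * r2 n (a # F)) >= MM k n F * r2 n F"
proof -
 have n: "n > 0" using k by simp
 have q: "qq k > 0" using qq_bounds(1)[OF k(1)] by linarith
 let ?C = "clauses k n" and ?D = "real n ^ 2 * (2 ^ n * qq k ^ length F)"
 let ?t = "%F i j. (tot n (%sg. wgt F sg * (spin (sg i) * spin (sg j))))\<^sup>2 / tot n (wgt F)"
 have "avg ?C (%a. MM k n (a # F) * r2 n (a # F))
  = (\<Sum>i<n. \<Sum>j<n. avg ?C (%a. ?t (a # F) i j)) / (qq k * ?D)"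
  unfolding MM_r2[OF n] by (simp add: avg_divide avg_sum mult_ac)
 also have "... >= (\<Sum>i<n. \<Sum>j<n. qq k * ?t F i j) / (qq k * ?D)"
  using q by (intro divide_right_mono sum_mono square_div_step k) (auto simp: abs_mult spin_abs)
 also have "(\<Sum>i<n. \<Sum>j<n. qq k * ?t F i j) / (qq k * ?D) = MM k n F * r2 n F"
  unfolding MM_r2[OF n] sum_distrib_left[symmetric] using q by simp
 finally show ?thesis .
qed

lemma avg_MM_append:
 assumes k: "k >= 3" "k <= n"
 shows "avg (Fm k n j) (%G. MM k n (G @ F)) = MM k n F"
proof (induction j)
 case (Suc j)
 have "avg (clauses k n) (%a. MM k n (a # G)) = MM k n G" for G
 proof (cases "tot n (wgt G) = 0")
  case True
  then have "MM k n G = 0" by (simp add: MM_def)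
  then show ?thesis using k by (simp add: MM_Cons)
 qed (use k in \<open>simp add: MM_Cons avg_cmult avg_xx\<close>)
 then show ?case using Suc unfolding avg_lsts_Suc by (subst avg_swap) simp
qed simp

lemma r2_append:
 assumes k: "k >= 3" "k <= n"
 shows "avg (Fm k n j) (%G. MM k n (G @ F) * r2 n (G @ F)) >= MM k n F * r2 n F"
proof (induction j)
 case (Suc j)
 have "avg (Fm k n (Suc j)) (%G. MM k n (G @ F) * r2 n (G @ F))
   = avg (Fm k n j) (%G. avg (clauses k n) (%a. MM k n (a # G @ F) * r2 n (a # G @ F)))"
  unfolding avg_lsts_Suc append_Cons by (rule avg_swap)
 also have "... >= avg (Fm k n j) (%G. MM k n (G @ F) * r2 n (G @ F))"
  by (intro avg_mono r2_step k)
 finally show ?case using Suc by simp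
qed simp

lemma Lam_append:
 assumes k: "k >= 3" "k <= n"
 shows "avg (Fm k n j) (%G. Lam (MM k n (G @ F)))
  >= Lam (MM k n F) + MM k n F * (real j * (ck k / 4 * r2 n F - real k ^ 2 / real n))"
proof (induction j)
 case (Suc j)
 let ?d = "ck k / 4 * r2 n F - real k ^ 2 / real n"
 have "avg (Fm k n (Suc j)) (%G. Lam (MM k n (G @ F)))
   = avg (Fm k n j) (%G. avg (clauses k n) (%a. Lam (MM k n (a # G @ F))))"
  unfolding avg_lsts_Suc append_Cons by (rule avg_swap)
 also have "... >= avg (Fm k n j) (%G. Lam (MM k n (G @ F))
   + (ck k / 4 * (MM k n (G @ F) * r2 n (G @ F)) - real k ^ 2 / real n * MM k n (G @ F)))"
 proof (rule avg_mono)
  fix G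
  have e: "x * (c / 4 * y - z) = c / 4 * (x * y) - z * x" for x c y z :: real by (simp add: algebra_simps)
  show "Lam (MM k n (G @ F)) + (ck k / 4 * (MM k n (G @ F) * r2 n (G @ F)) - real k ^ 2 / real n * MM k n (G @ F))
   <= avg (clauses k n) (%a. Lam (MM k n (a # G @ F)))"
   by (rule Lam_step(2)[OF k, of "G @ F", unfolded e])
 qed
 also have "avg (Fm k n j) (%G. Lam (MM k n (G @ F))
   + (ck k / 4 * (MM k n (G @ F) * r2 n (G @ F)) - real k ^ 2 / real n * MM k n (G @ F)))
   = avg (Fm k n j) (%G. Lam (MM k n (G @ F)))
   + (ck k / 4 * avg (Fm k n j) (%G. MM k n (G @ F) * r2 n (G @ F)) - real k ^ 2 / real n * MM k n F)"
  unfolding avg_add avg_diff avg_cmult avg_MM_append[OF k] ..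
 finally have 1: "avg (Fm k n (Suc j)) (%G. Lam (MM k n (G @ F))) >= avg (Fm k n j) (%G. Lam (MM k n (G @ F)))
   + (ck k / 4 * avg (Fm k n j) (%G. MM k n (G @ F) * r2 n (G @ F)) - real k ^ 2 / real n * MM k n F)" .
 have "ck k / 4 * avg (Fm k n j) (%G. MM k n (G @ F) * r2 n (G @ F)) >= ck k / 4 * (MM k n F * r2 n F)"
  using ck_pos[OF k(1)] by (intro mult_left_mono r2_append k) auto
 then have "avg (Fm k n (Suc j)) (%G. Lam (MM k n (G @ F)))
   >= Lam (MM k n F) + MM k n F * (real j * ?d) + (ck k / 4 * (MM k n F * r2 n F) - real k ^ 2 / real n * MM k n F)"
  using 1 Suc by linarith
 moreover have "MM k n F * (real (Suc j) * ?d) = MM k n F * (real j * ?d)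
   + (ck k / 4 * (MM k n F * r2 n F) - real k ^ 2 / real n * MM k n F)"
  by (simp add: algebra_simps add_divide_distrib)
 ultimately show ?case by linarith
qed simp

section \<open>Concentration of the planted partition function\<close>

text \<open>Violated clauses get weight \<open>b > 0\<close> instead of \<open>0\<close>; this makes the logarithm of the
 partition function Lipschitz in each clause.\<close>

primrec wb :: "real => formula => (nat => bool) => real" where
 "wb b [] ta = 1"
| "wb b (a # F) ta = (b + (1 - b) * cl a ta) * wb b F ta"

lemma wb_append: "wb b (F @ G) ta = wb b F ta * wb b G ta"
 by (induction F) auto

lemma wb_factor: "0 < b ==> b < 1 ==> b <= b + (1 - b) * cl a ta" "0 < b ==> b < 1 ==> b + (1 - b) * cl a ta <= 1"
 unfolding cl_def by auto

lemma wb_pos: "0 < b ==> b < 1 ==> 0 < wb b F ta"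
proof (induction F)
 case (Cons a F)
 then show ?case using wb_factor(1)[of b a ta] by simp
qed simp

lemma wgt_le_wb: "0 < b ==> b < 1 ==> wgt F ta <= wb b F ta"
proof (induction F)
 case (Cons a F)
 have "cl a ta <= b + (1 - b) * cl a ta" using Cons.prems by (auto simp: cl_def)
 then show ?case using Cons wgt_01 cl_01 by (simp add: wgt_Cons mult_mono)
qed simp

lemma tot_wb_pos: "0 < b ==> b < 1 ==> 0 < tot n (wb b F)"
 unfolding tot_def by (intro sum_pos wb_pos) auto

definition Cs :: "nat => nat => (nat => bool) => clause set" where
 "Cs k n sg = {a \<in> clauses k n. cl a sg = 1}"

lemma finite_Cs [simp]: "finite (Cs k n sg)" unfolding Cs_def by simp

lemma card_Cs:
 assumes "k >= 3" "k <= n" shows "real (card (Cs k n sg)) = qq k * real (card (clauses k n))"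
proof -
 have "avg (clauses k n) (%a. cl a sg) = avg (clauses k n) (%a. of_bool (cl a sg = 1))"
  by (intro avg_cong) (auto simp: cl_def)
 also have "... = real (card (Cs k n sg)) / real (card (clauses k n))"
  by (simp add: avg_of_bool Cs_def)
 finally have e: "qq k = real (card (Cs k n sg)) / real (card (clauses k n))"
  using avg_cl[of k n sg] assms by simp
 have "real (card (clauses k n)) ~= 0" using clauses_nonempty[OF assms(2)] by simp
 then show ?thesis unfolding e by simp
qed

lemma Cs_nonempty: assumes "k >= 3" "k <= n" shows "Cs k n sg ~= {}"
proof
 assume "Cs k n sg = {}"
 then have "qq k * real (card (clauses k n)) = 0" using card_Cs[OF assms, of sg] by simp
 then show False using qq_bounds(1)[OF assms(1)] clauses_nonempty[OF assms(2)] by simp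
qed

lemma wgt_set: "wgt F sg = of_bool (\<forall>a\<in>set F. cl a sg = 1)"
proof (induction F)
 case (Cons a F)
 have "cl a sg = 0 \<or> cl a sg = 1" by (auto simp: cl_def)
 then show ?case using Cons by (auto simp: wgt_Cons)
qed simp

lemma avg_wgt_mult:
 assumes "k >= 3" "k <= n"
 shows "avg (Fm k n m) (%F. wgt F sg * f F) = qq k ^ m * avg (lsts m (Cs k n sg)) f"
proof -
 have q: "qq k > 0" using qq_bounds(1)[OF assms(1)] by linarith
 have "(\<Sum>F\<in>Fm k n m. wgt F sg * f F) = (\<Sum>F\<in>lsts m (Cs k n sg). wgt F sg * f F)"
 proof (rule sum.mono_neutral_right)
  show "lsts m (Cs k n sg) \<subseteq> Fm k n m" by (auto simp: lsts_def Cs_def)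
  show "\<forall>F\<in>Fm k n m - lsts m (Cs k n sg). wgt F sg * f F = 0" by (auto simp: lsts_def Cs_def wgt_set)
 qed simp
 also have "... = (\<Sum>F\<in>lsts m (Cs k n sg). f F)"
  by (intro sum.cong) (auto simp: lsts_def Cs_def wgt_set)
 finally show ?thesis using q unfolding avg_def
  by (simp add: card_lsts card_Cs[OF assms] power_mult_distrib)
qed

lemma pl_eq:
 assumes "k >= 3" "k <= n"
 shows "pl k n m f = avg (assignments n) (%sg. avg (lsts m (Cs k n sg)) f)"
proof -
 have q: "qq k > 0" using qq_bounds(1)[OF assms(1)] by linarith
 have "pl k n m f = avg (Fm k n m) (%F. (\<Sum>sg\<in>assignments n. wgt F sg * f F) / (2 ^ n * qq k ^ m))"
  unfolding pl_def by (intro avg_cong) (auto simp: MM_def tot_def lsts_def sum_distrib_right)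
 also have "... = (\<Sum>sg\<in>assignments n. avg (Fm k n m) (%F. wgt F sg * f F)) / (2 ^ n * qq k ^ m)"
  by (simp add: avg_divide avg_sum)
 also have "... = (\<Sum>sg\<in>assignments n. avg (lsts m (Cs k n sg)) f) / 2 ^ n"
  unfolding avg_wgt_mult[OF assms] sum_distrib_left[symmetric] using q by simp
 finally show ?thesis unfolding avg_def[of "assignments n"] by (simp add: card_assignments)
qed

text \<open>Gauge transformation: flipping the signs of the literals according to \<open>sg\<close> moves the planted
 assignment \<open>sg\<close> to the all-false one.\<close>

definition hg :: "(nat => bool) => clause => clause" where
 "hg sg a = map (%(i, s). (i, s ~= sg i)) a"

definition xr :: "(nat => bool) => (nat => bool) => nat => bool" where
 "xr sg ta = (%i. ta i ~= sg i)"

lemma xr_simps [simp]: "xr sg sg = (%_. False)" "xr sg (%_. False) = sg" "xr sg (xr sg ta) = ta"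
 unfolding xr_def by auto

lemma cl_hg: "cl (hg sg a) (xr sg ta) = cl a ta"
proof -
 have "truth (xr sg ta) (hg sg a) = truth ta a"
  unfolding truth_def hg_def xr_def by (auto split: prod.splits)
 then show ?thesis by (simp add: cl_truth)
qed

lemma wb_hg: "wb b (map (hg sg) F) (xr sg ta) = wb b F ta"
 by (induction F) (auto simp: cl_hg)

lemma bij_xr: assumes "sg \<in> assignments n"
 shows "bij_betw (xr sg) (assignments n) (assignments n)"
 using assms by (intro bij_betw_byWitness[where f' = "xr sg"]) (auto simp: assignments_def xr_def)

lemma tot_wb_hg: assumes "sg \<in> assignments n" shows "tot n (wb b (map (hg sg) F)) = tot n (wb b F)"
 unfolding tot_def using sum.reindex_bij_betw[OF bij_xr[OF assms], of "wb b (map (hg sg) F)"]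
 by (simp add: wb_hg)

lemma hg_hg [simp]: "hg sg (hg sg a) = a"
 unfolding hg_def by (induction a) auto

lemma clauses_iff: "a \<in> clauses k n \<longleftrightarrow> length a = k & distinct (map fst a) & set (map fst a) \<subseteq> {..<n}"
 unfolding clauses_def by auto

lemma hg_clauses: "a \<in> clauses k n ==> hg sg a \<in> clauses k n"
proof -
 have "map fst (hg sg a) = map fst a" unfolding hg_def by (induction a) auto
 moreover have "length (hg sg a) = length a" by (simp add: hg_def)
 ultimately show "a \<in> clauses k n ==> hg sg a \<in> clauses k n"
  unfolding clauses_iff by (simp only:) 
qed

lemma avg_gauge:
 assumes "sg \<in> assignments n"
 shows "avg (lsts m (Cs k n sg)) (%F. f (tot n (wb b F))) = avg (lsts m (Cs k n (%_. False))) (%F. f (tot n (wb b F)))"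
proof -
 have 1: "hg sg a \<in> Cs k n (%_. False)" if "a \<in> Cs k n sg" for a
  using that cl_hg[of sg a sg] hg_clauses by (auto simp: Cs_def)
 have 2: "hg sg a \<in> Cs k n sg" if "a \<in> Cs k n (%_. False)" for a
  using that cl_hg[of sg a "%_. False"] hg_clauses by (auto simp: Cs_def)
 have "bij_betw (map (hg sg)) (lsts m (Cs k n sg)) (lsts m (Cs k n (%_. False)))"
  using 1 2 by (intro bij_betw_byWitness[where f' = "map (hg sg)"]) (auto simp: lsts_def o_def subset_iff)
 from avg_bij[OF this, of "%F. f (tot n (wb b F))"] show ?thesis
  by (simp add: tot_wb_hg[OF assms])
qed

lemma Hoeffding_avg:
 assumes S: "finite S" "S ~= {}" and "\<beta> > 0" and g: "!!x x'. x \<in> S ==> x' \<in> S ==> \<bar>g x - g x'\<bar> <= \<beta>"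
 shows "avg S (%x. exp (l * (g x - avg S g))) <= exp ((l * \<beta>)\<^sup>2 / 2)"
proof -
 define y where "y = (%x. g x - avg S g)"
 have y0: "avg S y = 0" using S by (simp add: y_def avg_diff avg_const)
 have yb: "\<bar>y x\<bar> <= \<beta>" if "x \<in> S" for x
 proof -
  have "y x = avg S (%x'. g x - g x')" using S by (simp add: y_def avg_diff avg_const)
  also have "\<bar>...\<bar> <= avg S (%x'. \<bar>g x - g x'\<bar>)" by (rule avg_abs)
  also have "... <= \<beta>" using S g that by (intro avg_le) auto
  finally show ?thesis .
 qed
 have e: "exp (l * y x) <= cosh (l * \<beta>) + y x * (sinh (l * \<beta>) / \<beta>)" if "x \<in> S" for x
 proof -
  define u where "u = (1 + y x / \<beta>) / 2"
  have "- 1 <= y x / \<beta>" "y x / \<beta> <= 1"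
   using yb[OF that] \<open>\<beta> > 0\<close> by (auto simp: pos_le_divide_eq pos_divide_le_eq)
  then have u: "0 <= u" "u <= 1" unfolding u_def by auto
  have ly: "l * y x = (1 - u) * (- (l * \<beta>)) + u * (l * \<beta>)"
   using \<open>\<beta> > 0\<close> by (simp add: u_def field_simps)
  have "exp ((1 - u) *\<^sub>R (- (l * \<beta>)) + u *\<^sub>R (l * \<beta>)) <= (1 - u) * exp (- (l * \<beta>)) + u * exp (l * \<beta>)"
   using convex_onD[OF exp_convex, of u "- (l * \<beta>)" "l * \<beta>"] u by simp
  also have "... = cosh (l * \<beta>) + (2 * u - 1) * sinh (l * \<beta>)"
   by (simp add: cosh_def sinh_def field_simps)
  also have "2 * u - 1 = y x / \<beta>" by (simp add: u_def add_divide_distrib)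
  finally show ?thesis using ly by simp
 qed
 have "avg S (%x. exp (l * y x)) <= avg S (%x. cosh (l * \<beta>) + y x * (sinh (l * \<beta>) / \<beta>))"
  by (intro avg_mono e)
 also have "... = cosh (l * \<beta>)" unfolding avg_add avg_cmult_right y0 using S by (simp add: avg_const)
 also have "... <= exp ((l * \<beta>)\<^sup>2 / 2)" by (rule cosh_le)
 finally show ?thesis by (simp add: y_def)
qed

lemma McDiarmid_avg:
 assumes S: "finite S" "S ~= {}" and "\<beta> > 0"
  and g: "!!F G a a'. set F \<subseteq> S ==> set G \<subseteq> S ==> a \<in> S ==> a' \<in> S ==> \<bar>f (F @ a # G) - f (F @ a' # G)\<bar> <= \<beta>"
 shows "avg (lsts m S) (%F. exp (l * (f F - avg (lsts m S) f))) <= exp (real m * (l * \<beta>)\<^sup>2 / 2)"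
 using g
proof (induction m arbitrary: f)
 case (Suc m)
 let ?L = "lsts m S"
 have L: "finite ?L" "?L ~= {}" using S by auto
 define h where "h = (%x. avg ?L (%xs. f (x # xs)))"
 have Af: "avg (lsts (Suc m) S) f = avg S h" unfolding avg_lsts_Suc h_def ..
 have h: "\<bar>h x - h x'\<bar> <= \<beta>" if "x \<in> S" "x' \<in> S" for x x'
 proof -
  have "h x - h x' = avg ?L (%xs. f (x # xs) - f (x' # xs))" unfolding h_def avg_diff ..
  also have "\<bar>...\<bar> <= avg ?L (%xs. \<bar>f (x # xs) - f (x' # xs)\<bar>)" by (rule avg_abs)
  also have "... <= \<beta>" using L that Suc.prems[of "[]"] by (intro avg_le) (auto simp: lsts_def)
  finally show ?thesis .
 qed
 have "avg (lsts (Suc m) S) (%F. exp (l * (f F - avg S h)))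
   = avg S (%x. exp (l * (h x - avg S h)) * avg ?L (%xs. exp (l * (f (x # xs) - h x))))"
  unfolding avg_lsts_Suc avg_cmult[symmetric]
  by (intro avg_cong) (simp add: exp_add[symmetric] algebra_simps)
 also have "... <= avg S (%x. exp (l * (h x - avg S h)) * exp (real m * (l * \<beta>)\<^sup>2 / 2))"
 proof (intro avg_mono mult_left_mono)
  fix x assume x: "x \<in> S"
  show "avg ?L (%xs. exp (l * (f (x # xs) - h x))) <= exp (real m * (l * \<beta>)\<^sup>2 / 2)"
   unfolding h_def
  proof (rule Suc.IH)
   fix F G a a' assume "set F \<subseteq> S" "set G \<subseteq> S" "a \<in> S" "a' \<in> S"
   then show "\<bar>f (x # F @ a # G) - f (x # F @ a' # G)\<bar> <= \<beta>"
    using Suc.prems[of "x # F" G a a'] x by simp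
  qed
 qed simp
 also have "... <= exp ((l * \<beta>)\<^sup>2 / 2) * exp (real m * (l * \<beta>)\<^sup>2 / 2)"
  unfolding avg_cmult_right using S \<open>\<beta> > 0\<close> h by (intro mult_right_mono Hoeffding_avg) auto
 also have "... = exp (real (Suc m) * (l * \<beta>)\<^sup>2 / 2)"
  by (simp add: exp_add[symmetric] field_simps)
 finally show ?case unfolding Af .
qed simp

lemma wb_Lipschitz:
 assumes b: "0 < b" "b < 1"
 shows "\<bar>ln (tot n (wb b (F @ a # G))) - ln (tot n (wb b (F @ a' # G)))\<bar> <= - ln b"
proof -
 have *: "ln (tot n (wb b (F @ a # G))) + ln b <= ln (tot n (wb b (F @ a' # G)))" for a a'
 proof -
  have "b * wb b (F @ a # G) ta <= wb b (F @ a' # G) ta" for ta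
  proof -
   have p: "0 < wb b F ta" "0 < wb b G ta" using b wb_pos by auto
   have "b * (b + (1 - b) * cl a ta) <= b + (1 - b) * cl a' ta"
    using wb_factor(2)[OF b, of a ta] wb_factor(1)[OF b, of a' ta] mult_left_mono[of "b + (1 - b) * cl a ta" 1 b] b by linarith
   then have "b * (b + (1 - b) * cl a ta) * (wb b F ta * wb b G ta) <= (b + (1 - b) * cl a' ta) * (wb b F ta * wb b G ta)"
    using p by (intro mult_right_mono) auto
   then show ?thesis by (simp add: wb_append mult_ac)
  qed
  then have "tot n (%ta. b * wb b (F @ a # G) ta) <= tot n (wb b (F @ a' # G))" by (intro tot_mono)
  then have "b * tot n (wb b (F @ a # G)) <= tot n (wb b (F @ a' # G))" by (simp add: tot_cmult)
  then have "ln (b * tot n (wb b (F @ a # G))) <= ln (tot n (wb b (F @ a' # G)))"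
   using tot_wb_pos[OF b] b by (subst ln_le_cancel_iff) auto
  then show ?thesis using tot_wb_pos[OF b] b by (simp add: ln_mult add.commute less_imp_neq[symmetric])
 qed
 show ?thesis using *[of a a'] *[of a' a] by simp
qed

lemma pl_mono: "k >= 3 ==> (!!F. F \<in> Fm k n m ==> MM k n F > 0 ==> f F <= g F) ==> pl k n m f <= pl k n m g"
 unfolding pl_def
proof (intro avg_mono)
 fix F assume a: "k >= 3" "!!F. F \<in> Fm k n m ==> MM k n F > 0 ==> f F <= g F" "F \<in> Fm k n m"
 show "MM k n F * f F <= MM k n F * g F"
  using MM_nonneg[OF a(1), of n F] a by (cases "MM k n F = 0") (auto intro: mult_left_mono)
qed

lemma pl_add: "pl k n m (%F. f F + g F) = pl k n m f + pl k n m g"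
 unfolding pl_def by (simp add: distrib_left avg_add)

lemma pl_const: "k >= 3 ==> k <= n ==> pl k n m (%_. c) = c"
 unfolding pl_def by (simp add: avg_cmult_right avg_MM)

lemma pl_nonneg: "k >= 3 ==> (!!F. F \<in> Fm k n m ==> 0 <= f F) ==> 0 <= pl k n m f"
 unfolding pl_def by (intro avg_nonneg mult_nonneg_nonneg MM_nonneg) auto

lemma conc_wb:
 assumes k: "k >= 3" "k <= n" and b: "0 < b" "b < 1" and "l >= 0"
 shows "pl k n m (%F. of_bool (pl k n m (%F. ln (tot n (wb b F))) + t <= ln (tot n (wb b F))))
   <= exp (real m * (l * ln b)\<^sup>2 / 2 - l * t)"
proof -
 define E where "E = avg (lsts m (Cs k n (%_. False))) (%F. ln (tot n (wb b F)))"
 have E: "avg (lsts m (Cs k n sg)) (%F. ln (tot n (wb b F))) = E" if "sg \<in> assignments n" for sg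
  unfolding E_def by (rule avg_gauge[OF that])
 have plE: "pl k n m (%F. ln (tot n (wb b F))) = E"
 proof -
  have "pl k n m (%F. ln (tot n (wb b F))) = avg (assignments n) (%sg. E)"
   unfolding pl_eq[OF k] by (intro avg_cong E)
  then show ?thesis by (simp add: avg_const)
 qed
 have "pl k n m (%F. of_bool (E + t <= ln (tot n (wb b F)))) <= pl k n m (%F. exp (l * (ln (tot n (wb b F)) - E)) * exp (- l * t))"
 proof (intro pl_mono k)
  fix F
  show "of_bool (E + t <= ln (tot n (wb b F))) <= exp (l * (ln (tot n (wb b F)) - E)) * exp (- l * t)"
  proof (cases "E + t <= ln (tot n (wb b F))")
   case True
   then have "0 <= l * (ln (tot n (wb b F)) - E - t)" using \<open>l >= 0\<close> by (intro mult_nonneg_nonneg) auto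
   then have "1 <= exp (l * (ln (tot n (wb b F)) - E) + (- l * t))" by (simp add: algebra_simps)
   then show ?thesis using True by (simp only: exp_add of_bool_eq)
  qed simp
 qed
 also have "... = avg (assignments n) (%sg. avg (lsts m (Cs k n sg)) (%F. exp (l * (ln (tot n (wb b F)) - avg (lsts m (Cs k n sg)) (%F. ln (tot n (wb b F)))))) * exp (- l * t))"
  unfolding pl_eq[OF k] avg_cmult_right by (simp add: E cong: avg_cong)
 also have "... <= avg (assignments n) (%sg. exp (real m * (l * (- ln b))\<^sup>2 / 2) * exp (- l * t))"
  using b by (intro avg_mono mult_right_mono McDiarmid_avg Cs_nonempty k wb_Lipschitz) auto
 also have "... = exp (real m * (l * ln b)\<^sup>2 / 2 - l * t)"
  by (simp add: avg_const exp_add[symmetric])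
 finally show ?thesis unfolding plE .
qed

lemma KK_pl: "KK k n m = pl k n m (%F. ln (MM k n F))"
 unfolding KK_def pl_def by (intro avg_cong) (auto simp: Lam_def)

lemma ln_MM:
 assumes "k >= 3" "MM k n F > 0" "F \<in> Fm k n m"
 shows "ln (tot n (wgt F)) = ln (MM k n F) + (real n * ln 2 + real m * ln (qq k))" "tot n (wgt F) > 0"
proof -
 have q: "qq k > 0" using qq_bounds(1)[OF assms(1)] by linarith
 have l: "length F = m" using assms(3) by (simp add: lsts_def)
 have e: "tot n (wgt F) = MM k n F * (2 ^ n * qq k ^ m)" using q l by (simp add: MM_def)
 show "tot n (wgt F) > 0" unfolding e using assms q by simp
 show "ln (tot n (wgt F)) = ln (MM k n F) + (real n * ln 2 + real m * ln (qq k))"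
  unfolding e using assms q by (simp add: ln_mult ln_realpow less_imp_neq[symmetric])
qed

lemma pl_ln_wb:
 assumes k: "k >= 3" "k <= n" and b: "0 < b" "b < 1"
 shows "pl k n m (%F. ln (tot n (wb b F))) <= KK k n m + (real n * ln 2 + real m * ln (qq k)) + real m * b"
proof -
 have q: "3/4 <= qq k" "qq k < 1" using qq_bounds[OF k(1)] by auto
 let ?c = "real n * ln 2 + real m * ln (qq k)"
 define s where "s = ((qq k + b * (1 - qq k)) / qq k) ^ m"
 have s0: "s > 0" unfolding s_def using q b by (intro zero_less_power divide_pos_pos add_pos_nonneg) auto
 have "avg (clauses k n) (%a. b + (1 - b) * cl a ta) = qq k + b * (1 - qq k)" for ta
  unfolding avg_add avg_cmult using k by (simp add: avg_cl avg_const clauses_nonempty algebra_simps)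
 then have "avg (Fm k n m) (%F. wb b F ta) = (qq k + b * (1 - qq k)) ^ m" for ta
  by (induction m) (simp_all add: avg_lsts_Suc avg_cmult avg_cmult_right)
 then have aw: "avg (Fm k n m) (%F. tot n (wb b F)) = 2 ^ n * (qq k + b * (1 - qq k)) ^ m"
  by (simp add: avg_tot) (simp add: tot_def card_assignments)
 have "pl k n m (%F. tot n (wb b F) / tot n (wgt F)) <= avg (Fm k n m) (%F. tot n (wb b F) / (2 ^ n * qq k ^ m))"
  unfolding pl_def
 proof (intro avg_mono)
  fix F assume "F \<in> Fm k n m"
  then have "MM k n F * (tot n (wb b F) / tot n (wgt F)) = (if tot n (wgt F) = 0 then 0 else tot n (wb b F) / (2 ^ n * qq k ^ m))"
   by (simp add: MM_def lsts_def)
  also have "... <= tot n (wb b F) / (2 ^ n * qq k ^ m)"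
   using q tot_wb_pos[OF b, of n F] by auto
  finally show "MM k n F * (tot n (wb b F) / tot n (wgt F)) <= tot n (wb b F) / (2 ^ n * qq k ^ m)" .
 qed
 also have "... = s" using aw q by (simp add: avg_divide s_def power_divide)
 finally have u: "pl k n m (%F. tot n (wb b F) / tot n (wgt F)) <= s" .
 have "pl k n m (%F. ln (tot n (wb b F)))
  <= pl k n m (%F. ln (MM k n F) + ((1 / s) * (tot n (wb b F) / tot n (wgt F)) + (?c - 1 + ln s)))"
 proof (intro pl_mono k)
  fix F assume F: "F \<in> Fm k n m" "MM k n F > 0"
  note L = ln_MM[OF k(1) F(2,1)]
  define w v where "w = tot n (wb b F)" and "v = tot n (wgt F)"
  have w: "w > 0" using tot_wb_pos[OF b] by (simp add: w_def)
  have v: "v > 0" using L by (simp add: v_def)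
  have "ln (w / v / s) <= w / v / s - 1" using w v s0 by (intro ln_le_minus_one) auto
  then have "ln w - ln v - ln s <= (1 / s) * (w / v) - 1"
   using w v s0 by (simp add: ln_div ln_mult mult.commute)
  then show "ln (tot n (wb b F)) <= ln (MM k n F) + ((1 / s) * (tot n (wb b F) / tot n (wgt F)) + (?c - 1 + ln s))"
   using L(1) unfolding w_def[symmetric] v_def[symmetric] by linarith
 qed
 also have "... = KK k n m + ((1 / s) * pl k n m (%F. tot n (wb b F) / tot n (wgt F)) + (?c - 1 + ln s))"
  unfolding pl_add KK_pl pl_const[OF k] by (simp add: pl_def avg_cmult[symmetric] mult_ac)
 also have "(1 / s) * pl k n m (%F. tot n (wb b F) / tot n (wgt F)) <= (1 / s) * s"
  using u s0 by (intro mult_left_mono) auto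
 also have "(1 / s) * s = 1" using s0 by simp
 also have "ln s <= real m * b"
 proof -
  have "0 < qq k + b * (1 - qq k)" using q b by (simp add: add_pos_nonneg)
  then have p: "0 < (qq k + b * (1 - qq k)) / qq k" using q by simp
  have "ln s = real m * ln ((qq k + b * (1 - qq k)) / qq k)"
   unfolding s_def by (rule ln_realpow)
  also have "ln ((qq k + b * (1 - qq k)) / qq k) <= (qq k + b * (1 - qq k)) / qq k - 1"
   by (rule ln_le_minus_one[OF p])
  also have "... = b * ((1 - qq k) / qq k)" using q by (simp add: field_simps)
  also have "... <= b * 1" using q b by (intro mult_left_mono) (auto simp: divide_le_eq)
  finally show ?thesis by (simp add: mult_left_mono)
 qed
 finally show ?thesis by simp
qed

lemma conc_MM:
 assumes k: "k >= 3" "k <= n" and b: "0 < b" "b < 1" and "l >= 0"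
 shows "pl k n m (%F. of_bool (KK k n m + real m * b + t <= ln (MM k n F)))
   <= exp (real m * (l * ln b)\<^sup>2 / 2 - l * t)"
proof -
 have "pl k n m (%F. of_bool (KK k n m + real m * b + t <= ln (MM k n F)))
   <= pl k n m (%F. of_bool (pl k n m (%F. ln (tot n (wb b F))) + t <= ln (tot n (wb b F))))"
 proof (intro pl_mono k)
  fix F assume F: "F \<in> Fm k n m" "MM k n F > 0"
  note L = ln_MM[OF k(1) F(2,1)]
  have "tot n (wgt F) <= tot n (wb b F)" by (intro tot_mono wgt_le_wb b)
  then have "ln (tot n (wgt F)) <= ln (tot n (wb b F))" using L(2) by (subst ln_le_cancel_iff) auto
  then show "of_bool (KK k n m + real m * b + t <= ln (MM k n F))
   <= (of_bool (pl k n m (%F. ln (tot n (wb b F))) + t <= ln (tot n (wb b F))) :: real)"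
   using L(1) pl_ln_wb[OF k b, of m] by auto
 qed
 also have "... <= exp (real m * (l * ln b)\<^sup>2 / 2 - l * t)" by (rule conc_wb[OF k b \<open>l >= 0\<close>])
 finally show ?thesis .
qed

lemma exp_conc:
 assumes k: "k >= 3" and "D > 0" "y > 0"
 shows "\<exists>c>0. \<forall>n\<ge>k. \<forall>m. real m <= D * real n -->
  pl k n m (%F. of_bool (KK k n m + y * real n <= ln (MM k n F))) <= exp (- c * real n)"
proof -
 define b where "b = min (1/2) (y / (2 * D))"
 have b: "0 < b" "b < 1" using assms by (auto simp: b_def)
 define \<beta> where "\<beta> = ln b"
 have \<beta>: "\<beta> < 0" using b by (simp add: \<beta>_def)
 define l where "l = y / (2 * D * \<beta>\<^sup>2)"
 have l: "l > 0" using assms \<beta> by (simp add: l_def)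
 define c where "c = y\<^sup>2 / (8 * D * \<beta>\<^sup>2)"
 have c: "c > 0" using assms \<beta> by (simp add: c_def)
 have "pl k n m (%F. of_bool (KK k n m + y * real n <= ln (MM k n F))) <= exp (- c * real n)"
  if n: "n >= k" and m: "real m <= D * real n" for n m
 proof -
  have "real m * b <= (D * real n) * (y / (2 * D))" using m b assms by (intro mult_mono) (auto simp: b_def)
  then have mb: "real m * b <= y * real n / 2" using assms by (simp add: mult.commute)
  have "pl k n m (%F. of_bool (KK k n m + y * real n <= ln (MM k n F)))
    <= pl k n m (%F. of_bool (KK k n m + real m * b + y * real n / 2 <= ln (MM k n F)))"
   using mb by (intro pl_mono k) auto
  also have "... <= exp (real m * (l * ln b)\<^sup>2 / 2 - l * (y * real n / 2))"
   by (rule conc_MM) (use k n b l in auto)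
  also have "... <= exp (- c * real n)"
  proof (subst exp_le_cancel_iff)
   have "real m * (l * \<beta>)\<^sup>2 / 2 <= (D * real n) * (l * \<beta>)\<^sup>2 / 2" using m by (intro divide_right_mono mult_right_mono) auto
   also have "... - l * (y * real n / 2) = - c * real n"
    using assms \<beta> unfolding l_def c_def by (simp add: field_simps power2_eq_square)
   finally show "real m * (l * ln b)\<^sup>2 / 2 - l * (y * real n / 2) <= - c * real n" by (simp add: \<beta>_def)
  qed
  finally show ?thesis .
 qed
 then show ?thesis using c by blast
qed

section \<open>Concentration of the overlap\<close>

lemma eventually_real_ge: "\<forall>\<^sub>F n in sequentially. c <= real n"
 by (rule eventually_sequentiallyI[of "nat \<lceil>c\<rceil>"]) linarith

lemma ln_MM_le:
 assumes k: "k >= 3" and F: "F \<in> Fm k n m" "MM k n F > 0"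
 shows "ln (MM k n F) <= real m"
proof -
 have q: "3/4 <= qq k" "qq k < 1" using qq_bounds[OF k] by auto
 note L = ln_MM[OF k F(2,1)]
 have "tot n (wgt F) <= tot n (%_. 1)" by (intro tot_mono wgt_01)
 then have "tot n (wgt F) <= 2 ^ n" by (simp add: tot_def card_assignments)
 then have "ln (tot n (wgt F)) <= ln (2 ^ n)" using L(2) by (subst ln_le_cancel_iff) auto
 then have "ln (tot n (wgt F)) <= real n * ln 2" by (simp add: ln_realpow)
 then have "ln (MM k n F) <= real m * (- ln (qq k))" using L(1) by simp
 also have "- ln (qq k) <= 1"
 proof -
  have "ln (1 / qq k) <= 1 / qq k - 1" using q by (intro ln_le_minus_one) auto
  also have "... <= 1" using q by (simp add: field_simps)
  finally show ?thesis using q by (simp add: ln_div)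
 qed
 finally show ?thesis by (simp add: mult_left_mono)
qed

lemma pl_append:
 assumes "!!F. F \<in> Fm k n m ==> c * (MM k n F * f F) <= avg (Fm k n j) (%G. MM k n (G @ F) * g (G @ F))"
 shows "c * pl k n m f <= pl k n (j + m) g"
proof -
 have "c * pl k n m f = avg (Fm k n m) (%F. c * (MM k n F * f F))" unfolding pl_def avg_cmult ..
 also have "... <= avg (Fm k n m) (%F. avg (Fm k n j) (%G. MM k n (G @ F) * g (G @ F)))"
  by (intro avg_mono assms)
 also have "... = pl k n (j + m) g" unfolding pl_def avg_lsts_append by (rule avg_swap)
 finally show ?thesis .
qed

lemma overlap_conc:
 assumes k: "k >= 3" and D: "0 < D0" "D0 < D1" and "\<epsilon> > 0"
  and KH: "!!\<delta>. \<delta> > 0 ==> \<forall>\<^sub>F n in sequentially. \<forall>m. real m <= D1 * real n --> KK k n m <= \<delta> * real n"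
 shows "\<exists>c>0. \<forall>\<^sub>F n in sequentially. \<forall>m. real m <= D0 * real n -->
   pl k n m (%F. of_bool (\<epsilon> <= r2 n F)) <= exp (- c * real n)"
proof -
 define \<eta> where "\<eta> = (D1 - D0) / 2"
 define y where "y = \<eta> * ck k * \<epsilon> / 32"
 have \<eta>: "\<eta> > 0" using D by (simp add: \<eta>_def)
 have ckp: "ck k > 0" by (rule ck_pos[OF k])
 have y: "y > 0" using \<eta> ckp \<open>\<epsilon> > 0\<close> by (simp add: y_def)
 obtain c1 where c1: "c1 > 0" "!!n m. n >= k ==> real m <= D1 * real n ==>
   pl k n m (%F. of_bool (KK k n m + y * real n <= ln (MM k n F))) <= exp (- c1 * real n)"
  using exp_conc[OF k, of D1 y] D y by auto
 define c where "c = min c1 y / 2"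
 have c: "c > 0" "2 * c <= c1" "2 * c <= y" using c1 y by (auto simp: c_def)
 have ev: "\<forall>\<^sub>F n in sequentially. real k <= real n & 8 * real k ^ 2 / (ck k * \<epsilon>) <= real n & 1 / \<eta> <= real n & (D1 / y + 1) / c <= real n
   & (\<forall>m. real m <= D1 * real n --> KK k n m <= y * real n)"
  by (intro eventually_conj eventually_real_ge KH y)
 have "\<forall>\<^sub>F n in sequentially. \<forall>m. real m <= D0 * real n -->
   pl k n m (%F. of_bool (\<epsilon> <= r2 n F)) <= exp (- c * real n)"
  using ev
 proof eventually_elim
  case (elim n)
  then have nk: "n >= k" and n1: "8 * real k ^ 2 / (ck k * \<epsilon>) <= real n" and n2: "1 / \<eta> <= real n"
   and n3: "(D1 / y + 1) / c <= real n" and KK: "!!m. real m <= D1 * real n ==> KK k n m <= y * real n" by auto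
  have n0: "real n > 0" using nk k by simp
  show ?case
  proof (intro allI impI)
   fix m assume m: "real m <= D0 * real n"
   define j where "j = nat \<lfloor>2 * \<eta> * real n\<rfloor>"
   have jle: "real j <= 2 * \<eta> * real n" using \<eta> unfolding j_def by (simp add: of_nat_floor)
   have "1 <= \<eta> * real n" using n2 \<eta> by (simp add: field_simps)
   then have jge: "\<eta> * real n <= real j" unfolding j_def by linarith
   have jm: "real (j + m) <= D1 * real n" using jle m by (simp add: \<eta>_def algebra_simps)
   let ?bad = "%H. of_bool (2 * y * real n <= ln (MM k n H)) :: real"
   let ?A = "%F. of_bool (\<epsilon> <= r2 n F & - y * real n <= ln (MM k n F)) :: real"
   have "pl k n (j + m) ?bad <= pl k n (j + m) (%F. of_bool (KK k n (j + m) + y * real n <= ln (MM k n F)))"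
    using KK[OF jm] by (intro pl_mono k) auto
   also have "... <= exp (- c1 * real n)" by (rule c1(2)[OF nk jm])
   finally have bad: "pl k n (j + m) ?bad <= exp (- c1 * real n)" .
   have "(y / D1) * (MM k n F * ?A F) <= avg (Fm k n j) (%G. MM k n (G @ F) * ?bad (G @ F))"
    if F: "F \<in> Fm k n m" for F
   proof (cases "?A F = 1 & MM k n F > 0")
    case False
    then have "MM k n F * ?A F = 0" using MM_nonneg[OF k, of n F] by (auto simp: less_le)
    moreover have "0 <= avg (Fm k n j) (%G. MM k n (G @ F) * ?bad (G @ F))"
     by (intro avg_nonneg mult_nonneg_nonneg MM_nonneg k) auto
    ultimately show ?thesis by (simp only: mult_zero_right)
   next
    case True
    then have M: "MM k n F > 0" and r: "\<epsilon> <= r2 n F" and l: "- y * real n <= ln (MM k n F)"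
     by (auto split: if_splits)
    have "real k ^ 2 / real n <= ck k * \<epsilon> / 8"
     using n1 n0 ckp \<open>\<epsilon> > 0\<close> by (simp add: field_simps)
    moreover have "ck k / 4 * \<epsilon> <= ck k / 4 * r2 n F" using r ckp by (intro mult_left_mono) auto
    ultimately have g: "ck k * \<epsilon> / 8 <= ck k / 4 * r2 n F - real k ^ 2 / real n" by linarith
    have "(\<eta> * real n) * (ck k * \<epsilon> / 8) <= real j * (ck k / 4 * r2 n F - real k ^ 2 / real n)"
     using jge g \<eta> ckp \<open>\<epsilon> > 0\<close> by (intro mult_mono) auto
    moreover have "(\<eta> * real n) * (ck k * \<epsilon> / 8) = 4 * y * real n" by (simp add: y_def)
    ultimately have "3 * y * real n <= ln (MM k n F) + real j * (ck k / 4 * r2 n F - real k ^ 2 / real n)"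
     using l by linarith
    then have "MM k n F * (3 * y * real n) <= Lam (MM k n F) + MM k n F * (real j * (ck k / 4 * r2 n F - real k ^ 2 / real n))"
     using M by (simp add: Lam_def distrib_left[symmetric])
    also have "... <= avg (Fm k n j) (%G. Lam (MM k n (G @ F)))" by (rule Lam_append[OF k nk])
    also have "... <= avg (Fm k n j) (%G. (2 * y * real n) * MM k n (G @ F) + (D1 * real n) * (MM k n (G @ F) * ?bad (G @ F)))"
    proof (intro avg_mono)
     fix G assume "G \<in> Fm k n j"
     then have GF: "G @ F \<in> Fm k n (j + m)" using F by (auto simp: lsts_def)
     let ?M = "MM k n (G @ F)"
     have M0: "?M >= 0" by (rule MM_nonneg[OF k])
     show "Lam ?M <= (2 * y * real n) * ?M + (D1 * real n) * (?M * ?bad (G @ F))"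
     proof (cases "?M = 0")
      case False
      then have Mp: "?M > 0" using M0 by simp
      have "ln ?M <= 2 * y * real n + (D1 * real n) * ?bad (G @ F)"
      proof -
       have "0 <= 2 * y * real n" using y n0 by simp
       then show ?thesis using ln_MM_le[OF k GF Mp] jm by (cases "2 * y * real n <= ln ?M") auto
      qed
      then have "?M * ln ?M <= ?M * (2 * y * real n + (D1 * real n) * ?bad (G @ F))" using M0 by (intro mult_left_mono) auto
      also have "... = (2 * y * real n) * ?M + (D1 * real n) * (?M * ?bad (G @ F))" by (simp only: algebra_simps)
      finally show ?thesis using False by (simp add: Lam_def)
     qed simp
    qed
    also have "... = (2 * y * real n) * MM k n F + (D1 * real n) * avg (Fm k n j) (%G. MM k n (G @ F) * ?bad (G @ F))"
     unfolding avg_add avg_cmult avg_MM_append[OF k nk] ..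
    finally have "real n * (y * MM k n F) <= real n * (D1 * avg (Fm k n j) (%G. MM k n (G @ F) * ?bad (G @ F)))"
     by (simp only: algebra_simps)
    then have "y * MM k n F <= D1 * avg (Fm k n j) (%G. MM k n (G @ F) * ?bad (G @ F))"
     using n0 by (rule mult_left_le_imp_le)
    then show ?thesis using True D by (simp add: field_simps)
   qed
   then have "(y / D1) * pl k n m ?A <= pl k n (j + m) ?bad" by (rule pl_append)
   then have "(y / D1) * pl k n m ?A <= exp (- c1 * real n)" using bad by simp
   then have A: "pl k n m ?A <= D1 / y * exp (- c1 * real n)" using y D by (simp add: field_simps)
   have "pl k n m (%F. of_bool (ln (MM k n F) < - y * real n)) <= avg (Fm k n m) (%F. exp (- y * real n))"
    unfolding pl_def
   proof (intro avg_mono)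
    fix F
    show "MM k n F * of_bool (ln (MM k n F) < - y * real n) <= exp (- y * real n)"
    proof (cases "MM k n F > 0 & ln (MM k n F) < - y * real n")
     case True
     then have "exp (ln (MM k n F)) < exp (- y * real n)" by (subst exp_less_cancel_iff) auto
     then show ?thesis using True by simp
    next
     case False
     then have "MM k n F * of_bool (ln (MM k n F) < - y * real n) = 0" using MM_nonneg[OF k, of n F] by auto
     then show ?thesis by (simp only: exp_ge_zero)
    qed
   qed
   then have S: "pl k n m (%F. of_bool (ln (MM k n F) < - y * real n)) <= exp (- y * real n)"
    using nk by (simp add: avg_const clauses_nonempty)
   have "pl k n m (%F. of_bool (\<epsilon> <= r2 n F)) <= pl k n m (%F. ?A F + of_bool (ln (MM k n F) < - y * real n))"
    by (intro pl_mono k) auto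
   also have "... <= D1 / y * exp (- c1 * real n) + exp (- y * real n)"
    unfolding pl_add using A S by simp
   also have "... <= D1 / y * exp (- 2 * c * real n) + exp (- 2 * c * real n)"
    using c y D n0 by (intro add_mono mult_left_mono) auto
   also have "... = (D1 / y + 1) * exp (- 2 * c * real n)" by (simp add: algebra_simps)
   also have "... <= exp (c * real n) * exp (- 2 * c * real n)"
   proof (intro mult_right_mono)
    have "D1 / y + 1 <= c * real n" using n3 c by (simp add: field_simps)
    also have "... <= exp (c * real n)" using exp_ge_add_one_self[of "c * real n"] by linarith
    finally show "D1 / y + 1 <= exp (c * real n)" .
   qed simp
   also have "... = exp (- c * real n)" by (simp flip: exp_add)
   finally show "pl k n m (%F. of_bool (\<epsilon> <= r2 n F)) <= exp (- c * real n)" .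
  qed
 qed
 then show ?thesis using c by blast
qed

section \<open>Large overlaps have exponentially small mass\<close>

definition TT :: "nat => real => formula => real" where
 "TT n \<epsilon> F = mean2 n (wgt F) (%sg ta. of_bool (\<epsilon> < \<bar>ov n sg ta\<bar>))"

lemma avg_tot2_append:
 assumes k: "k >= 3" "k <= n"
 shows "avg (Fm k n j) (%b. tot2 n (wgt (b @ F)) h)
  = tot2 n (wgt F) (%sg ta. (qq k ^ 2 * (1 + gg k n sg ta)) ^ j * h sg ta)"
proof -
 have *: "avg (Fm k n j) (%b. wgt (b @ F) sg * wgt (b @ F) ta)
   = (qq k ^ 2 * (1 + gg k n sg ta)) ^ j * (wgt F sg * wgt F ta)" for sg ta
  unfolding avg_wgt2[OF k, symmetric] avg_cmult_right[symmetric]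
  by (intro avg_cong) (simp add: wgt_append mult_ac)
 show ?thesis unfolding avg_tot2[of "Fm k n j" n "%b. wgt (b @ F)" h] * by (simp add: tot2_def mult_ac)
qed

lemma gf_mono: assumes "k >= 3" "0 <= a" "a <= \<bar>R\<bar>" shows "gf k a <= gf k R"
proof -
 have "a\<^sup>2 <= R\<^sup>2" using assms by (metis abs_ge_zero power2_abs power_mono)
 then have "0 <= real k * (real k - 1) * (R\<^sup>2 - a\<^sup>2)" using assms by (intro mult_nonneg_nonneg) auto
 then have "hh k a <= hh k R" using hh_gap[OF assms] by linarith
 then show ?thesis unfolding gf_def by (intro divide_right_mono mult_left_mono) auto
qed

lemma avg_square_ge: "finite S ==> S ~= {} ==> (avg S f)\<^sup>2 <= avg S (%x. (f x)\<^sup>2)"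
proof -
 assume S: "finite S" "S ~= {}"
 define c where "c = avg S f"
 have "0 <= avg S (%x. (f x - c)\<^sup>2)" by (intro avg_nonneg) auto
 also have "avg S (%x. (f x - c)\<^sup>2) = avg S (%x. (f x)\<^sup>2 - 2 * c * f x + c\<^sup>2)"
  by (intro avg_cong) (simp add: power2_eq_square algebra_simps)
 also have "... = avg S (%x. (f x)\<^sup>2) - 2 * c * c + c\<^sup>2"
  unfolding avg_add avg_diff avg_cmult using S by (simp add: avg_const c_def)
 finally show "(avg S f)\<^sup>2 <= avg S (%x. (f x)\<^sup>2)" by (simp add: c_def power2_eq_square)
qed

text \<open>Adding \<open>j\<close> uniformly random clauses multiplies the mass of the pairs with overlap above
 \<open>\<epsilon>\<close> by at least \<open>u\<^sup>j\<close> and that of the pairs with overlap below \<open>e\<close> by at most \<open>v\<^sup>j\<close>.\<close>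

lemma tilt_step:
 assumes k: "k >= 3" "k <= n" and e: "0 < e" "e <= \<epsilon>" and uv: "0 < u" "0 <= v"
  and u: "!!sg ta. \<epsilon> < \<bar>ov n sg ta\<bar> ==> u <= 1 + gg k n sg ta"
  and v: "!!sg ta. \<bar>ov n sg ta\<bar> <= e ==> 1 + gg k n sg ta <= v"
  and F: "F \<in> Fm k n m" "tot n (wgt F) > 0" and T: "(v / u) ^ j <= TT n \<epsilon> F"
 shows "(qq k ^ j / 4) * MM k n F <= avg (Fm k n j) (%b. MM k n (b @ F) * of_bool (e\<^sup>2 / 4 <= r2 n (b @ F)))"
proof -
 have q: "0 < qq k" using qq_bounds(1)[OF k(1)] by linarith
 define t where "t = tot n (wgt F)"
 define s where "s = (%b. tot n (wgt (b @ F)))"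
 let ?L = "Fm k n j"
 have L: "finite ?L" "?L ~= {}" using k clauses_nonempty by auto
 let ?h1 = "%sg ta. of_bool (e < \<bar>ov n sg ta\<bar>) :: real" and ?h0 = "%sg ta. of_bool (~ e < \<bar>ov n sg ta\<bar>) :: real"
 let ?ind = "%b. of_bool (e\<^sup>2 / 4 <= r2 n (b @ F)) :: real"
 define A where "A = avg ?L (%b. tot2 n (wgt (b @ F)) ?h1)"
 define R where "R = avg ?L (%b. tot2 n (wgt (b @ F)) ?h0)"
 have t: "t > 0" using F by (simp add: t_def)
 have s0: "0 <= s b" for b unfolding s_def by (intro tot_nonneg wgt_01)
 have st: "s b <= t" for b unfolding s_def t_def wgt_append using wgt_01
  by (intro tot_mono) (simp add: mult_left_le_one_le)
 have "A >= tot2 n (wgt F) (%sg ta. (qq k ^ 2) ^ j * u ^ j * of_bool (\<epsilon> < \<bar>ov n sg ta\<bar>))"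
  unfolding A_def avg_tot2_append[OF k]
 proof (intro tot2_mono wgt_01)
  fix sg ta
  have "u ^ j <= (1 + gg k n sg ta) ^ j" if "\<epsilon> < \<bar>ov n sg ta\<bar>" using u[OF that] uv by (intro power_mono) auto
  then show "(qq k ^ 2) ^ j * u ^ j * of_bool (\<epsilon> < \<bar>ov n sg ta\<bar>) <= (qq k ^ 2 * (1 + gg k n sg ta)) ^ j * ?h1 sg ta"
   using e q gg_ge[OF k, of sg ta] by (auto simp: power_mult_distrib intro: mult_left_mono)
 qed
 also have "tot2 n (wgt F) (%sg ta. (qq k ^ 2) ^ j * u ^ j * of_bool (\<epsilon> < \<bar>ov n sg ta\<bar>))
   = (qq k ^ 2) ^ j * u ^ j * (TT n \<epsilon> F * t ^ 2)"
  unfolding tot2_cmult TT_def mean2_def using t by (simp add: t_def)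
 also have "... >= (qq k ^ 2) ^ j * u ^ j * ((v / u) ^ j * t ^ 2)"
  using T uv q by (intro mult_left_mono mult_right_mono) auto
 also have "(qq k ^ 2) ^ j * u ^ j * ((v / u) ^ j * t ^ 2) = (qq k ^ 2) ^ j * v ^ j * t\<^sup>2"
  using uv by (simp add: power_divide)
 finally have A: "A >= (qq k ^ 2) ^ j * v ^ j * t\<^sup>2" .
 have "R <= tot2 n (wgt F) (%sg ta. (qq k ^ 2) ^ j * v ^ j * 1)"
  unfolding R_def avg_tot2_append[OF k]
 proof (intro tot2_mono wgt_01)
  fix sg ta
  have "(1 + gg k n sg ta) ^ j <= v ^ j" if "~ e < \<bar>ov n sg ta\<bar>" using v[of sg ta] that gg_ge[OF k, of sg ta] by (intro power_mono) auto
  then show "(qq k ^ 2 * (1 + gg k n sg ta)) ^ j * ?h0 sg ta <= (qq k ^ 2) ^ j * v ^ j * 1"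
   using q uv by (auto simp: power_mult_distrib intro: mult_left_mono)
 qed
 also have "... = (qq k ^ 2) ^ j * v ^ j * t\<^sup>2" unfolding tot2_cmult tot2_one t_def ..
 finally have RA: "R <= A" using A by simp
 have "avg ?L (%b. (s b)\<^sup>2) = A + R"
 proof -
  have "(s b)\<^sup>2 = tot2 n (wgt (b @ F)) ?h1 + tot2 n (wgt (b @ F)) ?h0" for b
  proof -
   have "tot2 n (wgt (b @ F)) (%sg ta. ?h1 sg ta + ?h0 sg ta) = tot2 n (wgt (b @ F)) (%_ _. 1)"
    by (rule arg_cong[where f = "tot2 n _"]) (auto simp: fun_eq_iff)
   then show ?thesis unfolding tot2_add tot2_one s_def by simp
  qed
  then show ?thesis unfolding A_def R_def by (simp add: avg_add)
 qed
 then have s2: "avg ?L (%b. (s b)\<^sup>2) <= 2 * A" using RA by simp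
 have "avg ?L s = qq k ^ j * t"
  unfolding s_def avg_tot wgt_append avg_cmult_right t_def using k by (simp add: avg_wgt tot_cmult)
 then have s1: "(qq k ^ j * t)\<^sup>2 <= avg ?L (%b. (s b)\<^sup>2)" using avg_square_ge[OF L, of s] by simp
 have "A <= avg ?L (%b. (1/4) * (s b)\<^sup>2 + t * (s b * ?ind b))"
  unfolding A_def
 proof (intro avg_mono)
  fix b
  let ?w = "wgt (b @ F)"
  show "tot2 n ?w ?h1 <= (1/4) * (s b)\<^sup>2 + t * (s b * ?ind b)"
  proof (cases "e\<^sup>2 / 4 <= r2 n (b @ F)")
   case True
   have "tot2 n ?w ?h1 <= tot2 n ?w (%_ _. 1)" by (intro tot2_mono wgt_01) auto
   also have "... = s b * s b" unfolding tot2_one s_def by (simp add: power2_eq_square)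
   also have "... <= t * s b" using st s0 by (intro mult_right_mono) auto
   finally have "tot2 n ?w ?h1 <= t * s b" .
   moreover have "0 <= (1/4) * (s b)\<^sup>2" by simp
   ultimately show ?thesis using True by (simp only: of_bool_eq mult_1_right)
  next
   case False
   have "tot2 n ?w ?h1 <= tot2 n ?w (%sg ta. (1 / e\<^sup>2) * (ov n sg ta)\<^sup>2)"
   proof (intro tot2_mono wgt_01)
    fix sg ta
    have "e\<^sup>2 <= (ov n sg ta)\<^sup>2" if "e < \<bar>ov n sg ta\<bar>" using that e by (metis abs_of_pos less_imp_le abs_le_square_iff)
    then show "?h1 sg ta <= (1 / e\<^sup>2) * (ov n sg ta)\<^sup>2" using e by (auto simp: field_simps)
   qed
   also have "... = (1 / e\<^sup>2) * (r2 n (b @ F) * (s b)\<^sup>2)"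
   proof (cases "s b = 0")
    case True
    have "tot2 n ?w (%sg ta. (ov n sg ta)\<^sup>2) <= tot2 n ?w (%sg ta. 1)" by (intro tot2_mono wgt_01 ov_sq_le)
    moreover have "0 <= tot2 n ?w (%sg ta. (ov n sg ta)\<^sup>2)" by (intro tot2_nonneg wgt_01) auto
    ultimately show ?thesis using True unfolding tot2_one tot2_cmult by (simp add: s_def)
   qed (unfold tot2_cmult, simp add: r2_def mean2_def s_def)
   also have "... <= (1 / e\<^sup>2) * ((e\<^sup>2 / 4) * (s b)\<^sup>2)"
    using False e by (intro mult_left_mono mult_right_mono) auto
   also have "... = (1/4) * (s b)\<^sup>2" using e by simp
   finally show ?thesis using False by simp
  qed
 qed
 also have "... = (1/4) * avg ?L (%b. (s b)\<^sup>2) + t * avg ?L (%b. s b * ?ind b)"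
  unfolding avg_add avg_cmult ..
 finally have "(1/4) * (qq k ^ j * t)\<^sup>2 <= t * avg ?L (%b. s b * ?ind b)" using s1 s2 by linarith
 then have "t * (qq k ^ j * qq k ^ j * t / 4) <= t * avg ?L (%b. s b * ?ind b)" by (simp add: power2_eq_square mult_ac)
 then have fin: "qq k ^ j * qq k ^ j * t / 4 <= avg ?L (%b. s b * ?ind b)" using t by (rule mult_left_le_imp_le)
 have lF: "length F = m" using F by (simp add: lsts_def)
 have "avg ?L (%b. MM k n (b @ F) * ?ind b) = avg ?L (%b. s b * ?ind b / (2 ^ n * (qq k ^ j * qq k ^ m)))"
  by (intro avg_cong) (auto simp: MM_def s_def lF lsts_def power_add)
 also have "... = avg ?L (%b. s b * ?ind b) / (2 ^ n * (qq k ^ j * qq k ^ m))" by (rule avg_divide)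
 also have "... >= (qq k ^ j * qq k ^ j * t / 4) / (2 ^ n * (qq k ^ j * qq k ^ m))"
  using fin q by (intro divide_right_mono) auto
 also have "(qq k ^ j * qq k ^ j * t / 4) / (2 ^ n * (qq k ^ j * qq k ^ m)) = (qq k ^ j / 4) * MM k n F"
  using q by (simp add: MM_def t_def lF)
 finally show ?thesis .
qed

lemma TT_conc:
 assumes k: "k >= 3" and D: "0 < D0" "D0 < D1" and "\<epsilon> > 0"
  and OC: "!!\<epsilon>. \<epsilon> > 0 ==> \<exists>c>0. \<forall>\<^sub>F n in sequentially. \<forall>m. real m <= D1 * real n -->
   pl k n m (%F. of_bool (\<epsilon> <= r2 n F)) <= exp (- c * real n)"
 shows "\<exists>c>0. \<forall>\<^sub>F n in sequentially. \<forall>m. real m <= D0 * real n -->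
   pl k n m (%F. of_bool (exp (- c * real n) <= TT n \<epsilon> F)) <= exp (- c * real n)"
proof -
 have q: "3/4 <= qq k" using qq_bounds(1)[OF k] by simp
 define e where "e = \<epsilon> / 2"
 have e: "0 < e" "e <= \<epsilon>" using \<open>\<epsilon> > 0\<close> by (auto simp: e_def)
 define \<gamma> where "\<gamma> = gf k \<epsilon> - gf k e"
 have "\<gamma> > 0"
 proof -
  have "0 < \<epsilon>\<^sup>2 - e\<^sup>2" using \<open>\<epsilon> > 0\<close> by (simp add: e_def power2_eq_square)
  then have "0 < real k * (real k - 1) * (\<epsilon>\<^sup>2 - e\<^sup>2)" using k by (intro mult_pos_pos) auto
  then have "hh k e < hh k \<epsilon>" using hh_gap[OF k, of e \<epsilon>] e by simp
  then show ?thesis unfolding \<gamma>_def gf_def using q by (simp add: divide_strict_right_mono)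
 qed
 have gf0: "gf k 0 = 0" by (simp add: gf_def hh_def)
 have ge0: "0 <= gf k e" using gf_mono[OF k, of 0 e] gf0 by simp
 define u v where "u = 1 + gf k \<epsilon> - \<gamma> / 4" and "v = 1 + gf k e + \<gamma> / 4"
 have "gf k \<epsilon> = gf k e + \<gamma>" by (simp add: \<gamma>_def)
 then have uv: "v < u" "1 <= v" unfolding u_def v_def using \<open>\<gamma> > 0\<close> ge0 by linarith+
 define \<rho> where "\<rho> = v / u"
 have \<rho>: "0 < \<rho>" "\<rho> < 1" using uv by (auto simp: \<rho>_def)
 obtain c1 where c1: "c1 > 0" "\<forall>\<^sub>F n in sequentially. \<forall>m. real m <= D1 * real n -->
   pl k n m (%F. of_bool (e\<^sup>2 / 4 <= r2 n F)) <= exp (- c1 * real n)"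
  using OC[of "e\<^sup>2 / 4"] e by auto
 define \<delta> where "\<delta> = min (D1 - D0) (c1 / 2)"
 have \<delta>: "\<delta> > 0" "\<delta> <= D1 - D0" "\<delta> <= c1 / 2" unfolding \<delta>_def using D c1(1) by linarith+
 define c where "c = min (c1 / 4) ((1 - \<rho>) * \<delta> / 2)"
 have c: "c > 0" "c <= c1 / 4" "c <= (1 - \<rho>) * \<delta> / 2" using c1 \<rho> \<delta> by (auto simp: c_def)
 have ev: "\<forall>\<^sub>F n in sequentially. real k <= real n & 16 * real k ^ 2 / \<gamma> <= real n & 2 / \<delta> <= real n & 16 / c1 <= real n
   & (\<forall>m. real m <= D1 * real n --> pl k n m (%F. of_bool (e\<^sup>2 / 4 <= r2 n F)) <= exp (- c1 * real n))"
  by (intro eventually_conj eventually_real_ge c1)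
 have "\<forall>\<^sub>F n in sequentially. \<forall>m. real m <= D0 * real n -->
   pl k n m (%F. of_bool (exp (- c * real n) <= TT n \<epsilon> F)) <= exp (- c * real n)"
  using ev
 proof eventually_elim
  case (elim n)
  then have nk: "n >= k" and n1: "16 * real k ^ 2 / \<gamma> <= real n" and n2: "2 / \<delta> <= real n" and n3: "16 / c1 <= real n"
   and P: "!!m. real m <= D1 * real n ==> pl k n m (%F. of_bool (e\<^sup>2 / 4 <= r2 n F)) <= exp (- c1 * real n)" by auto
  have n0: "real n > 0" using nk k by simp
  have err: "4 * real k ^ 2 / real n <= \<gamma> / 4" using n1 n0 \<open>\<gamma> > 0\<close> by (simp add: field_simps)
  show ?case
  proof (intro allI impI)
   fix m assume m: "real m <= D0 * real n"
   define j where "j = nat \<lfloor>\<delta> * real n\<rfloor>"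
   have jle: "real j <= \<delta> * real n" using \<delta> unfolding j_def by (simp add: of_nat_floor)
   have "2 <= \<delta> * real n" using n2 \<delta> by (simp add: field_simps)
   then have jge: "\<delta> * real n / 2 <= real j" unfolding j_def by linarith
   have "real j <= (D1 - D0) * real n" using jle \<delta> n0 by (smt (verit) mult_right_mono)
   then have jm: "real (j + m) <= D1 * real n" using m by (simp add: algebra_simps)
   have "\<rho> ^ j <= exp (- c * real n)"
   proof -
    have "\<rho> <= exp (\<rho> - 1)" using exp_ge_add_one_self[of "\<rho> - 1"] by simp
    then have "\<rho> ^ j <= exp (\<rho> - 1) ^ j" using \<rho> by (intro power_mono) auto
    also have "... = exp (- (1 - \<rho>) * real j)" by (simp flip: exp_of_nat_mult add: algebra_simps)
    also have "... <= exp (- c * real n)"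
    proof (subst exp_le_cancel_iff)
     have "c * real n <= (1 - \<rho>) * \<delta> / 2 * real n" using c n0 by (intro mult_right_mono) auto
     also have "... = (1 - \<rho>) * (\<delta> * real n / 2)" by simp
     also have "... <= (1 - \<rho>) * real j" using jge \<rho> by (intro mult_left_mono) auto
     finally show "- (1 - \<rho>) * real j <= - c * real n" by (simp add: algebra_simps)
    qed
    finally show ?thesis .
   qed
   then have T: "(v / u) ^ j <= TT n \<epsilon> F" if "exp (- c * real n) <= TT n \<epsilon> F" for F
    using that by (simp add: \<rho>_def)
   have "(qq k ^ j / 4) * (MM k n F * of_bool (exp (- c * real n) <= TT n \<epsilon> F))
     <= avg (Fm k n j) (%b. MM k n (b @ F) * of_bool (e\<^sup>2 / 4 <= r2 n (b @ F)))"
    if F: "F \<in> Fm k n m" for F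
   proof (cases "exp (- c * real n) <= TT n \<epsilon> F & MM k n F > 0")
    case False
    then have "MM k n F * of_bool (exp (- c * real n) <= TT n \<epsilon> F) = 0" using MM_nonneg[OF k, of n F] by (auto simp: less_le)
    moreover have "0 <= avg (Fm k n j) (%b. MM k n (b @ F) * of_bool (e\<^sup>2 / 4 <= r2 n (b @ F)))"
     by (intro avg_nonneg mult_nonneg_nonneg MM_nonneg k) auto
    ultimately show ?thesis by (simp only: mult_zero_right)
   next
    case True
    have "(qq k ^ j / 4) * MM k n F <= avg (Fm k n j) (%b. MM k n (b @ F) * of_bool (e\<^sup>2 / 4 <= r2 n (b @ F)))"
    proof (rule tilt_step[OF k nk e])
     show "0 < u" "0 <= v" using uv by auto
     show "u <= 1 + gg k n sg ta" if "\<epsilon> < \<bar>ov n sg ta\<bar>" for sg ta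
      using gg_approx[OF k nk, of sg ta] err gf_mono[OF k, of \<epsilon> "ov n sg ta"] that \<open>\<epsilon> > 0\<close> unfolding u_def by linarith
     show "1 + gg k n sg ta <= v" if "\<bar>ov n sg ta\<bar> <= e" for sg ta
     proof -
      have "gf k \<bar>ov n sg ta\<bar> = gf k (ov n sg ta)" by (auto simp: gf_def hh_def abs_if)
      then show ?thesis
       using gg_approx[OF k nk, of sg ta] err gf_mono[OF k, of "\<bar>ov n sg ta\<bar>" e] that e unfolding v_def by linarith
     qed
     show "F \<in> Fm k n m" by fact
     show "tot n (wgt F) > 0" using ln_MM(2)[OF k _ F] True by simp
     show "(v / u) ^ j <= TT n \<epsilon> F" using T True by simp
    qed
    then show ?thesis using True by simp
   qed
   then have "(qq k ^ j / 4) * pl k n m (%F. of_bool (exp (- c * real n) <= TT n \<epsilon> F)) <= pl k n (j + m) (%F. of_bool (e\<^sup>2 / 4 <= r2 n F))"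
    by (rule pl_append)
   also have "... <= exp (- c1 * real n)" by (rule P[OF jm])
   finally have 1: "(qq k ^ j / 4) * pl k n m (%F. of_bool (exp (- c * real n) <= TT n \<epsilon> F)) <= exp (- c1 * real n)" .
   have qj: "exp (- (c1 / 2) * real n) <= qq k ^ j"
   proof -
    have "exp (-1) <= (1/2 :: real)" using exp_ge_add_one_self[of "1::real"] by (simp add: exp_minus field_simps)
    then have "exp (-1) <= qq k" using q by linarith
    then have "exp (-1) ^ j <= qq k ^ j" by (intro power_mono) auto
    moreover have "exp (-1) ^ j = exp (- real j)" by (simp flip: exp_of_nat_mult)
    moreover have "exp (- (c1 / 2) * real n) <= exp (- real j)"
    proof (subst exp_le_cancel_iff)
     have "\<delta> * real n <= (c1 / 2) * real n" using \<delta> n0 by (intro mult_right_mono) auto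
     then show "- (c1 / 2) * real n <= - real j" using jle by simp
    qed
    ultimately show ?thesis by linarith
   qed
   let ?p = "pl k n m (%F. of_bool (exp (- c * real n) <= TT n \<epsilon> F))"
   have "?p >= 0" by (intro pl_nonneg k) auto
   then have "(exp (- (c1 / 2) * real n) / 4) * ?p <= (qq k ^ j / 4) * ?p" using qj by (intro mult_right_mono) auto
   then have "exp (- (c1 / 2) * real n) * ?p <= 4 * exp (- c1 * real n)" using 1 by linarith
   then have "exp ((c1 / 2) * real n) * (exp (- (c1 / 2) * real n) * ?p) <= exp ((c1 / 2) * real n) * (4 * exp (- c1 * real n))"
    by (intro mult_left_mono) auto
   moreover have "exp ((c1 / 2) * real n) * (exp (- (c1 / 2) * real n) * ?p) = ?p"
    by (simp only: mult.assoc[symmetric] exp_add[symmetric]) simp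
   moreover have "exp ((c1 / 2) * real n) * (4 * exp (- c1 * real n)) = 4 * exp (- (c1 / 2) * real n)"
    by (simp only: mult.left_commute[of _ 4] exp_add[symmetric]) (simp add: field_simps)
   ultimately have "?p <= 4 * exp (- (c1 / 2) * real n)" by linarith
   also have "... <= exp ((c1 / 4) * real n) * exp (- (c1 / 2) * real n)"
   proof (intro mult_right_mono)
    have "4 <= (c1 / 4) * real n" using n3 c1 by (simp add: field_simps)
    then show "4 <= exp ((c1 / 4) * real n)" using exp_ge_add_one_self[of "(c1 / 4) * real n"] by linarith
   qed simp
   also have "... = exp (- (c1 / 4) * real n)" by (simp only: exp_add[symmetric]) (simp add: field_simps)
   also have "... <= exp (- c * real n)" using c n0 by (subst exp_le_cancel_iff) (simp add: mult_right_mono)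
   finally show "?p <= exp (- c * real n)" .
  qed
 qed
 then show ?thesis using c by blast
qed

section \<open>Overlaps in the null model\<close>

lemma gf_le:
 assumes "k >= 3" "\<bar>r\<bar> <= 1" shows "gf k r <= ck k * r\<^sup>2 + r ^ 4"
proof -
 have q: "3/4 <= qq k" using qq_bounds(1)[OF assms(1)] .
 have "(2::real) ^ 3 <= 2 ^ k" using assms by (intro power_increasing) auto
 then have k2: "8 <= (2::real) ^ k" by simp
 have "(3/4)^2 <= qq k ^ 2" using q by (intro power_mono) auto
 then have q2: "1/2 <= qq k ^ 2" by (simp add: power2_eq_square)
 have k4: "(4::real) ^ k = 2 ^ k * 2 ^ k" by (simp flip: power_mult_distrib)
 have "gf k r <= 2 / 4 ^ k * (real k * (real k - 1) * r\<^sup>2 + 2 * 2 ^ k * r ^ 4) / qq k ^ 2"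
  unfolding gf_def by (intro divide_right_mono mult_left_mono hh_le assms) auto
 also have "... = ck k * r\<^sup>2 + (4 / 2 ^ k / qq k ^ 2) * r ^ 4"
  unfolding ck_def k4 using q by (simp add: field_simps)
 also have "... <= ck k * r\<^sup>2 + 1 * r ^ 4"
 proof (intro add_left_mono mult_right_mono)
  have "4 / 2 ^ k <= 4 / (8::real)" using k2 by (intro divide_left_mono) auto
  then have "4 / 2 ^ k <= qq k ^ 2" using q2 by linarith
  then show "4 / 2 ^ k / qq k ^ 2 <= 1" using q by (simp add: divide_le_eq mult.commute)
 qed simp
 finally show ?thesis by simp
qed

lemma gf_nonneg: "k >= 3 ==> 0 <= gf k r"
 using gf_mono[of k 0 r] by (simp add: gf_def hh_def)

definition UU :: "nat => real => real => formula => real" where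
 "UU n \<xi> \<epsilon> F = mean2 n (wgt F) (%sg ta. of_bool (\<xi> < (ov n sg ta)\<^sup>2 & \<bar>ov n sg ta\<bar> <= \<epsilon>))"

lemma local_second_moment:
 assumes k: "k >= 3" "k <= n" and m: "real m <= D * real n" and "0 <= \<xi>" "\<epsilon> <= 1" "0 <= D"
  and a: "0 <= a" "D * ck k + D * \<epsilon>\<^sup>2 <= 1 / 2 - a"
 shows "avg (Fm k n m) (%F. MM k n F ^ 2 * UU n \<xi> \<epsilon> F) <= (real n + 1) * exp (4 * real k ^ 2 * D) * exp (- a * real n * \<xi>)"
proof -
 have q: "0 < qq k" using qq_bounds(1)[OF k(1)] by linarith
 have n0: "n > 0" using k by simp
 let ?h = "%r. of_bool (\<xi> < r\<^sup>2 & \<bar>r\<bar> <= \<epsilon>) :: real"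
 define A where "A = exp (4 * real k ^ 2 * D) * exp (- a * real n * \<xi>)"
 define \<phi> where "\<phi> = (%r. ?h r * exp (real m * (gf k r + 4 * real k ^ 2 / real n)))"
 have "MM k n F ^ 2 * UU n \<xi> \<epsilon> F = tot2 n (wgt F) (%sg ta. ?h (ov n sg ta)) / (2 ^ n * qq k ^ m)\<^sup>2" if "F \<in> Fm k n m" for F
 proof (cases "tot n (wgt F) = 0")
  case True
  have "tot2 n (wgt F) (%sg ta. ?h (ov n sg ta)) <= tot2 n (wgt F) (%sg ta. 1)" by (intro tot2_mono wgt_01) auto
  moreover have "0 <= tot2 n (wgt F) (%sg ta. ?h (ov n sg ta))" by (intro tot2_nonneg wgt_01) auto
  ultimately show ?thesis using True unfolding tot2_one by (simp add: MM_def)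
 next
  case False
  then show ?thesis using that by (simp add: MM_def UU_def mean2_def lsts_def power_divide)
 qed
 then have "avg (Fm k n m) (%F. MM k n F ^ 2 * UU n \<xi> \<epsilon> F)
  = avg (Fm k n m) (%F. tot2 n (wgt F) (%sg ta. ?h (ov n sg ta)) / (2 ^ n * qq k ^ m)\<^sup>2)"
  by (intro avg_cong)
 also have "... = (\<Sum>sg\<in>assignments n. \<Sum>ta\<in>assignments n. (qq k ^ 2 * (1 + gg k n sg ta)) ^ m * ?h (ov n sg ta)) / (2 ^ n * qq k ^ m)\<^sup>2"
  unfolding avg_divide avg_tot2 avg_wgt2[OF k] ..
 also have "... = (\<Sum>sg\<in>assignments n. \<Sum>ta\<in>assignments n. (1 + gg k n sg ta) ^ m * ?h (ov n sg ta)) / (2 ^ n)\<^sup>2"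
  unfolding power_mult_distrib[of "qq k ^ 2"] mult.assoc sum_distrib_left[symmetric] using q
  by (simp add: power_mult_distrib power_mult[symmetric] mult.commute)
 also have "... <= (\<Sum>sg\<in>assignments n. 2 ^ n * (real n + 1) * A) / (2 ^ n)\<^sup>2"
 proof (intro divide_right_mono sum_mono)
  fix sg
  have "(\<Sum>ta\<in>assignments n. (1 + gg k n sg ta) ^ m * ?h (ov n sg ta)) <= (\<Sum>ta\<in>assignments n. \<phi> (ov n sg ta))"
  proof (intro sum_mono)
   fix ta
   have "1 + gg k n sg ta <= 1 + (gf k (ov n sg ta) + 4 * real k ^ 2 / real n)"
    using gg_approx[OF k, of sg ta] by linarith
   also have "... <= exp (gf k (ov n sg ta) + 4 * real k ^ 2 / real n)" by (rule exp_ge_add_one_self)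
   finally have "(1 + gg k n sg ta) ^ m <= exp (gf k (ov n sg ta) + 4 * real k ^ 2 / real n) ^ m"
    using gg_ge[OF k] by (intro power_mono) auto
   then have "(1 + gg k n sg ta) ^ m <= exp (real m * (gf k (ov n sg ta) + 4 * real k ^ 2 / real n))"
    by (simp only: exp_of_nat_mult)
   then show "(1 + gg k n sg ta) ^ m * ?h (ov n sg ta) <= \<phi> (ov n sg ta)"
    unfolding \<phi>_def by (subst mult.commute) (intro mult_left_mono, auto)
  qed
  also have "... <= 2 ^ n * (real n + 1) * A"
  proof (rule sum_ov_le[OF n0])
   show "0 <= A" by (simp add: A_def)
   fix r :: real assume r: "\<bar>r\<bar> <= 1"
   show "\<phi> r <= A * exp (real n * r\<^sup>2 / 2)"
   proof (cases "\<xi> < r\<^sup>2 & \<bar>r\<bar> <= \<epsilon>")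
    case False
    have "\<phi> r = 0" unfolding \<phi>_def by (simp only: False of_bool_eq mult_zero_left)
    then show ?thesis by (simp add: A_def)
   next
    case True
    have r2e: "r\<^sup>2 <= \<epsilon>\<^sup>2" using True by (metis abs_ge_zero power2_abs power_mono)
    have g0: "0 <= gf k r" by (rule gf_nonneg[OF k(1)])
    have "r ^ 4 = r\<^sup>2 * r\<^sup>2" by (simp add: power2_eq_square power4_eq_xxxx)
    also have "... <= \<epsilon>\<^sup>2 * r\<^sup>2" using r2e by (intro mult_right_mono) auto
    finally have "gf k r <= (ck k + \<epsilon>\<^sup>2) * r\<^sup>2" using gf_le[OF k(1) r] by (simp add: algebra_simps)
    then have "real m * gf k r <= (D * real n) * ((ck k + \<epsilon>\<^sup>2) * r\<^sup>2)" using m g0 by (intro mult_mono) auto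
    also have "... = real n * r\<^sup>2 * (D * ck k + D * \<epsilon>\<^sup>2)" by (simp add: algebra_simps)
    also have "... <= real n * r\<^sup>2 * (1/2 - a)" using a by (intro mult_left_mono) auto
    also have "... = real n * r\<^sup>2 / 2 - a * real n * r\<^sup>2" by (simp add: algebra_simps)
    finally have "real m * gf k r <= real n * r\<^sup>2 / 2 - a * real n * r\<^sup>2" .
    moreover have "a * real n * \<xi> <= a * real n * r\<^sup>2" using True a by (intro mult_left_mono) auto
    ultimately have 1: "real m * gf k r <= real n * r\<^sup>2 / 2 - a * real n * \<xi>" by linarith
    have "real m * (4 * real k ^ 2 / real n) <= (D * real n) * (4 * real k ^ 2 / real n)"
     using m by (intro mult_right_mono) auto
    also have "... = 4 * real k ^ 2 * D" using n0 by simp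
    finally have "real m * (gf k r + 4 * real k ^ 2 / real n) <= 4 * real k ^ 2 * D + - a * real n * \<xi> + real n * r\<^sup>2 / 2"
     using 1 by (simp add: algebra_simps)
    then have "\<phi> r <= exp (4 * real k ^ 2 * D + - a * real n * \<xi> + real n * r\<^sup>2 / 2)"
     unfolding \<phi>_def using True by simp
    then show ?thesis unfolding A_def exp_add by simp
   qed
  qed
  finally show "(\<Sum>ta\<in>assignments n. (1 + gg k n sg ta) ^ m * ?h (ov n sg ta)) <= 2 ^ n * (real n + 1) * A" .
 qed simp
 also have "... = (real n + 1) * A" by (simp add: card_assignments power2_eq_square)
 finally show ?thesis by (simp add: A_def mult.assoc)
qed

lemma r2_le_UU_TT:
 assumes "0 < \<xi>" "3 * \<xi> < r2 n F" "\<epsilon> <= 1"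
 shows "\<xi> <= UU n \<xi> \<epsilon> F \<or> \<xi> <= TT n \<epsilon> F"
proof (rule ccontr)
 assume "~ ?thesis"
 then have 1: "UU n \<xi> \<epsilon> F < \<xi>" "TT n \<epsilon> F < \<xi>" by auto
 have t: "tot n (wgt F) ~= 0" using assms by (auto simp: r2_def mean2_def)
 have "r2 n F <= mean2 n (wgt F) (%sg ta. \<xi> + (of_bool (\<xi> < (ov n sg ta)\<^sup>2 & \<bar>ov n sg ta\<bar> <= \<epsilon>) + of_bool (\<epsilon> < \<bar>ov n sg ta\<bar>)))"
  unfolding r2_def
 proof (intro mean2_mono wgt_01)
  fix sg ta
  show "(ov n sg ta)\<^sup>2 <= \<xi> + (of_bool (\<xi> < (ov n sg ta)\<^sup>2 & \<bar>ov n sg ta\<bar> <= \<epsilon>) + of_bool (\<epsilon> < \<bar>ov n sg ta\<bar>))"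
   using ov_sq_le[of n sg ta] assms by auto
 qed
 also have "... = \<xi> + (UU n \<xi> \<epsilon> F + TT n \<epsilon> F)"
  unfolding mean2_add mean2_const[OF t] UU_def TT_def ..
 finally show False using 1 assms by linarith
qed

lemma null_overlap:
 assumes k: "k >= 3" and D: "0 < D" "D * ck k < 1 / 2"
  and TC: "!!\<epsilon>. \<epsilon> > 0 ==> \<exists>c>0. \<forall>\<^sub>F n in sequentially. \<forall>m. real m <= D * real n -->
   pl k n m (%F. of_bool (exp (- c * real n) <= TT n \<epsilon> F)) <= exp (- c * real n)"
 shows "\<exists>a>0. \<exists>c>0. \<exists>A. \<forall>\<^sub>F n in sequentially. \<forall>m L \<xi>. real m <= D * real n --> 0 <= L --> 0 < \<xi> --> exp (- c * real n) <= \<xi> -->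
   avg (Fm k n m) (%F. of_bool (exp (- L) <= MM k n F & 3 * \<xi> < r2 n F))
    <= A * (real n + 1) / \<xi> * exp (2 * L - a * real n * \<xi>) + exp (L - c * real n)"
proof -
 define a where "a = (1/2 - D * ck k) / 2"
 define \<epsilon> where "\<epsilon> = min 1 (a / D)"
 have a: "a > 0" using D by (simp add: a_def)
 have \<epsilon>: "0 < \<epsilon>" "\<epsilon> <= 1" using a D by (auto simp: \<epsilon>_def)
 have "\<epsilon>\<^sup>2 <= \<epsilon>" using \<epsilon> by (simp add: power2_eq_square mult_left_le_one_le)
 then have "D * \<epsilon>\<^sup>2 <= D * (a / D)" using D by (intro mult_left_mono) (auto simp: \<epsilon>_def)
 also have "D * (a / D) = a" using D by simp
 moreover have "D * ck k = 1 / 2 - 2 * a" by (simp add: a_def field_simps)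
 ultimately have ae: "D * ck k + D * \<epsilon>\<^sup>2 <= 1 / 2 - a" by linarith
 obtain c where c: "c > 0" "\<forall>\<^sub>F n in sequentially. \<forall>m. real m <= D * real n -->
   pl k n m (%F. of_bool (exp (- c * real n) <= TT n \<epsilon> F)) <= exp (- c * real n)"
  using TC[OF \<epsilon>(1)] by auto
 define A where "A = exp (4 * real k ^ 2 * D)"
 have ev: "\<forall>\<^sub>F n in sequentially. real k <= real n & (\<forall>m. real m <= D * real n -->
   pl k n m (%F. of_bool (exp (- c * real n) <= TT n \<epsilon> F)) <= exp (- c * real n))"
  by (intro eventually_conj eventually_real_ge c)
 have "\<forall>\<^sub>F n in sequentially. \<forall>m L \<xi>. real m <= D * real n --> 0 <= L --> 0 < \<xi> --> exp (- c * real n) <= \<xi> -->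
   avg (Fm k n m) (%F. of_bool (exp (- L) <= MM k n F & 3 * \<xi> < r2 n F))
    <= A * (real n + 1) / \<xi> * exp (2 * L - a * real n * \<xi>) + exp (L - c * real n)"
  using ev
 proof eventually_elim
  case (elim n)
  then have nk: "n >= k" and P: "!!m. real m <= D * real n ==> pl k n m (%F. of_bool (exp (- c * real n) <= TT n \<epsilon> F)) <= exp (- c * real n)" by auto
  show ?case
  proof (intro allI impI)
   fix m and L \<xi> :: real assume m: "real m <= D * real n" and L: "0 <= L" and \<xi>: "0 < \<xi>" "exp (- c * real n) <= \<xi>"
   let ?S = "Fm k n m"
   have "avg ?S (%F. of_bool (exp (- L) <= MM k n F & 3 * \<xi> < r2 n F))
    <= avg ?S (%F. exp (2 * L) / \<xi> * (MM k n F ^ 2 * UU n \<xi> \<epsilon> F) + exp L * (MM k n F * of_bool (exp (- c * real n) <= TT n \<epsilon> F)))"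
   proof (intro avg_mono)
    fix F
    have U0: "0 <= UU n \<xi> \<epsilon> F" unfolding UU_def by (intro mean2_nonneg wgt_01) auto
    have M0: "0 <= MM k n F" by (rule MM_nonneg[OF k])
    show "of_bool (exp (- L) <= MM k n F & 3 * \<xi> < r2 n F)
     <= exp (2 * L) / \<xi> * (MM k n F ^ 2 * UU n \<xi> \<epsilon> F) + exp L * (MM k n F * of_bool (exp (- c * real n) <= TT n \<epsilon> F))"
    proof (cases "exp (- L) <= MM k n F & 3 * \<xi> < r2 n F")
     case False
     then show ?thesis using U0 M0 \<xi> by (auto intro!: add_nonneg_nonneg)
    next
     case True
     have t1: "0 <= exp (2 * L) / \<xi> * (MM k n F ^ 2 * UU n \<xi> \<epsilon> F)" using U0 \<xi> by auto
     have t2: "0 <= exp L * (MM k n F * of_bool (exp (- c * real n) <= TT n \<epsilon> F))" using M0 by auto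
     from r2_le_UU_TT[OF \<xi>(1) conjunct2[OF True] \<epsilon>(2)] have "1 <= exp (2 * L) / \<xi> * (MM k n F ^ 2 * UU n \<xi> \<epsilon> F) \<or> 1 <= exp L * (MM k n F * of_bool (exp (- c * real n) <= TT n \<epsilon> F))"
     proof
      assume u: "\<xi> <= UU n \<xi> \<epsilon> F"
      have "exp (- L) ^ 2 <= MM k n F ^ 2" using True by (intro power_mono) auto
      then have "exp (- L) ^ 2 * \<xi> <= MM k n F ^ 2 * UU n \<xi> \<epsilon> F" using u \<xi> by (intro mult_mono) auto
      then have "exp (2 * L) / \<xi> * (exp (- L) ^ 2 * \<xi>) <= exp (2 * L) / \<xi> * (MM k n F ^ 2 * UU n \<xi> \<epsilon> F)"
       using \<xi> by (intro mult_left_mono) auto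
      moreover have "exp (2 * L) / \<xi> * (exp (- L) ^ 2 * \<xi>) = 1"
       using \<xi> by (simp add: power2_eq_square exp_add[symmetric])
      ultimately show ?thesis by simp
     next
      assume "\<xi> <= TT n \<epsilon> F"
      then have "exp (- c * real n) <= TT n \<epsilon> F" using \<xi> by simp
      moreover have "exp L * exp (- L) <= exp L * MM k n F" using True by (intro mult_left_mono) auto
      moreover have "exp L * exp (- L) = 1" by (simp add: exp_add[symmetric])
      ultimately show ?thesis by simp
     qed
     moreover have "of_bool (exp (- L) <= MM k n F & 3 * \<xi> < r2 n F) = (1 :: real)" by (simp only: True of_bool_eq simp_thms)
     ultimately show ?thesis using t1 t2 by linarith
    qed
   qed
   also have "... = exp (2 * L) / \<xi> * avg ?S (%F. MM k n F ^ 2 * UU n \<xi> \<epsilon> F) + exp L * pl k n m (%F. of_bool (exp (- c * real n) <= TT n \<epsilon> F))"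
    unfolding avg_add avg_cmult pl_def ..
   also have "... <= exp (2 * L) / \<xi> * ((real n + 1) * exp (4 * real k ^ 2 * D) * exp (- a * real n * \<xi>)) + exp L * exp (- c * real n)"
    using \<xi> D a \<epsilon> by (intro add_mono mult_left_mono P m local_second_moment k nk ae) auto
   also have "... = A * (real n + 1) / \<xi> * exp (2 * L - a * real n * \<xi>) + exp (L - c * real n)"
    by (simp add: A_def exp_diff exp_minus field_simps)
   finally show "avg ?S (%F. of_bool (exp (- L) <= MM k n F & 3 * \<xi> < r2 n F))
    <= A * (real n + 1) / \<xi> * exp (2 * L - a * real n * \<xi>) + exp (L - c * real n)" .
  qed
 qed
 then show ?thesis using a c by blast
qed

section \<open>The null model stays close to the planted model\<close>

definition cc :: "nat => formula => nat => nat => real" where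
 "cc n F i j = (mean n (wgt F) (%sg. spin (sg i) * spin (sg j)))\<^sup>2"

lemma cc_sym: "cc n F i j = cc n F j i" unfolding cc_def by (simp add: mult.commute)

lemma mean_abs_le: assumes "!!sg. \<bar>f sg\<bar> <= 1" shows "\<bar>mean n (wgt F) f\<bar> <= 1"
proof (cases "tot n (wgt F) = 0")
 case False
 have "mean n (wgt F) f <= mean n (wgt F) (%_. 1)" "mean n (wgt F) (%_. -1) <= mean n (wgt F) f"
  using assms by (intro mean_mono wgt_01; simp add: abs_le_iff minus_le_iff)+
 then show ?thesis using mean_const[OF False] by (simp add: abs_le_iff)
qed (simp add: mean_def)

lemma cc_bounds: "0 <= cc n F i j" "cc n F i j <= 1"
proof -
 have "\<bar>mean n (wgt F) (%sg. spin (sg i) * spin (sg j))\<bar> <= 1"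
  by (intro mean_abs_le) (auto simp: spin_def)
 then show "0 <= cc n F i j" "cc n F i j <= 1" unfolding cc_def by (auto simp: abs_square_le_1)
qed

lemma cc_mean2: "cc n F i j = mean2 n (wgt F) (%sg ta. (spin (sg i) * spin (sg j)) * (spin (ta i) * spin (ta j)))"
 unfolding cc_def mean_def mean2_def tot2_def tot_def
 by (simp add: power_divide power2_eq_square[of "sum _ _"] sum_product mult_ac)

lemma mean2_sum: "mean2 n w (%sg ta. \<Sum>x\<in>S. f x sg ta) = (\<Sum>x\<in>S. mean2 n w (f x))"
proof -
 have "tot2 n w (%sg ta. \<Sum>x\<in>S. f x sg ta) = (\<Sum>sg\<in>assignments n. \<Sum>x\<in>S. \<Sum>ta\<in>assignments n. w sg * w ta * f x sg ta)"
  unfolding tot2_def sum_distrib_left by (rule sum.cong[OF refl], rule sum.swap)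
 also have "... = (\<Sum>x\<in>S. tot2 n w (f x))" unfolding tot2_def by (rule sum.swap)
 finally show ?thesis unfolding mean2_def by (simp add: sum_divide_distrib)
qed

lemma r2_cc: "n > 0 ==> r2 n F = (\<Sum>i<n. \<Sum>j<n. cc n F i j) / real n ^ 2"
 unfolding r2_def mean2_def tot2_ov cc_def mean_def
 by (simp add: power_divide sum_divide_distrib mult.commute)

lemma mean2_CS:
 assumes "!!sg. 0 <= w sg"
 shows "(mean2 n w (%sg ta. f sg ta * g sg ta))\<^sup>2 <= mean2 n w (%sg ta. (f sg ta)\<^sup>2) * mean2 n w (%sg ta. (g sg ta)\<^sup>2)"
proof -
 let ?P = "assignments n \<times> assignments n"
 let ?s = "%p. sqrt (w (fst p) * w (snd p))"
 have s: "?s p * ?s p = w (fst p) * w (snd p)" for p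
  using assms by simp
 have t: "tot2 n w h = (\<Sum>p\<in>?P. w (fst p) * w (snd p) * h (fst p) (snd p))" for h
  unfolding tot2_def by (simp add: sum.cartesian_product case_prod_unfold)
 have "(\<Sum>p\<in>?P. (?s p * f (fst p) (snd p)) * (?s p * g (fst p) (snd p)))\<^sup>2
   <= (\<Sum>p\<in>?P. (?s p * f (fst p) (snd p))\<^sup>2) * (\<Sum>p\<in>?P. (?s p * g (fst p) (snd p))\<^sup>2)"
  by (rule Cauchy_Schwarz_ineq_sum)
 moreover have "(?s p * f (fst p) (snd p)) * (?s p * g (fst p) (snd p)) = w (fst p) * w (snd p) * (f (fst p) (snd p) * g (fst p) (snd p))" for p
 proof -
  have "(?s p * f (fst p) (snd p)) * (?s p * g (fst p) (snd p)) = (?s p * ?s p) * (f (fst p) (snd p) * g (fst p) (snd p))"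
   by (simp only: mult_ac)
  then show ?thesis by (simp only: s)
 qed
 moreover have "(?s p * h)\<^sup>2 = w (fst p) * w (snd p) * h\<^sup>2" for p h
 proof -
  have "(?s p * h)\<^sup>2 = (?s p * ?s p) * h\<^sup>2" by (simp only: power2_eq_square mult_ac)
  then show ?thesis by (simp only: s)
 qed
 ultimately have "(tot2 n w (%sg ta. f sg ta * g sg ta))\<^sup>2 <= tot2 n w (%sg ta. (f sg ta)\<^sup>2) * tot2 n w (%sg ta. (g sg ta)\<^sup>2)"
  unfolding t by simp
 then have "(tot2 n w (%sg ta. f sg ta * g sg ta))\<^sup>2 / (tot n w ^ 2)\<^sup>2 <= tot2 n w (%sg ta. (f sg ta)\<^sup>2) * tot2 n w (%sg ta. (g sg ta)\<^sup>2) / (tot n w ^ 2)\<^sup>2"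
  by (intro divide_right_mono) auto
 then show ?thesis unfolding mean2_def power_divide by (simp add: power2_eq_square[of "tot n w ^ 2"])
qed

text \<open>Two applications of Cauchy--Schwarz, the first one to the pair of overlaps \<open>R\<close> and
 \<open>n\<^sup>-\<^sup>1 \<Sum>\<^sub>j r\<^sub>j sg\<^sub>j ta\<^sub>j\<close> where \<open>r\<^sub>j\<close> is the row average of the squared correlations.\<close>

lemma row_bound:
 fixes F :: formula
 assumes n: "n > 0"
 defines "r \<equiv> %j. (\<Sum>i<n. cc n F i j) / real n"
 shows "(\<Sum>j<n. (r j)\<^sup>2) / real n <= r2 n F * sqrt (r2 n F)"
proof -
 let ?N = "real n"
 define \<rho> where "\<rho> = (\<Sum>j<n. (r j)\<^sup>2) / ?N"
 define x where "x = r2 n F"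
 have x0: "0 <= x" unfolding x_def r2_def by (intro mean2_nonneg wgt_01) auto
 have \<rho>0: "0 <= \<rho>" unfolding \<rho>_def by (intro divide_nonneg_nonneg sum_nonneg) auto
 define Q where "Q = (%sg ta. (\<Sum>j<n. r j * (spin (sg j) * spin (ta j))) / ?N)"
 have RQ: "mean2 n (wgt F) (%sg ta. ov n sg ta * Q sg ta) = \<rho>"
 proof -
  have "ov n sg ta * Q sg ta = (\<Sum>i<n. \<Sum>j<n. (r j / ?N ^ 2) * ((spin (sg i) * spin (sg j)) * (spin (ta i) * spin (ta j))))" for sg ta
  proof -
   have "ov n sg ta * Q sg ta = (\<Sum>i<n. \<Sum>j<n. (spin (sg i) * spin (ta i)) * (r j * (spin (sg j) * spin (ta j)))) / ?N ^ 2"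
    unfolding ov_def inner_spin_def Q_def times_divide_times_eq sum_product power2_eq_square ..
   then show ?thesis by (simp add: sum_divide_distrib mult_ac)
  qed
  then have "mean2 n (wgt F) (%sg ta. ov n sg ta * Q sg ta) = (\<Sum>i<n. \<Sum>j<n. (r j / ?N ^ 2) * cc n F i j)"
   by (simp only: mean2_sum mean2_cmult cc_mean2)
  also have "... = (\<Sum>j<n. \<Sum>i<n. (r j / ?N ^ 2) * cc n F i j)" by (rule sum.swap)
  also have "... = (\<Sum>j<n. (r j)\<^sup>2 / ?N)"
   unfolding sum_distrib_left[symmetric] r_def by (simp add: power2_eq_square mult.assoc)
  finally show ?thesis by (simp add: \<rho>_def sum_divide_distrib)
 qed
 have QQ: "mean2 n (wgt F) (%sg ta. (Q sg ta)\<^sup>2) = (\<Sum>i<n. \<Sum>j<n. (r i * r j) * cc n F i j) / ?N ^ 2"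
 proof -
  have "(Q sg ta)\<^sup>2 = (\<Sum>i<n. \<Sum>j<n. (r i * r j / ?N ^ 2) * ((spin (sg i) * spin (sg j)) * (spin (ta i) * spin (ta j))))" for sg ta
  proof -
   have "(Q sg ta)\<^sup>2 = (\<Sum>i<n. \<Sum>j<n. (r i * (spin (sg i) * spin (ta i))) * (r j * (spin (sg j) * spin (ta j)))) / ?N ^ 2"
    unfolding Q_def power2_eq_square times_divide_times_eq sum_product ..
   then show ?thesis by (simp add: sum_divide_distrib mult_ac)
  qed
  then have "mean2 n (wgt F) (%sg ta. (Q sg ta)\<^sup>2) = (\<Sum>i<n. \<Sum>j<n. (r i * r j / ?N ^ 2) * cc n F i j)"
   by (simp only: mean2_sum mean2_cmult cc_mean2)
  then show ?thesis by (simp add: sum_divide_distrib)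
 qed
 have c2: "(\<Sum>i<n. \<Sum>j<n. (r i * r j) * cc n F i j)\<^sup>2 <= (\<rho> * ?N)\<^sup>2 * (x * ?N ^ 2)"
 proof -
  let ?P = "{..<n} \<times> {..<n}"
  have "(\<Sum>p\<in>?P. (r (fst p) * r (snd p)) * cc n F (fst p) (snd p))\<^sup>2
    <= (\<Sum>p\<in>?P. (r (fst p) * r (snd p))\<^sup>2) * (\<Sum>p\<in>?P. (cc n F (fst p) (snd p))\<^sup>2)"
   by (rule Cauchy_Schwarz_ineq_sum)
  also have "(\<Sum>p\<in>?P. (r (fst p) * r (snd p))\<^sup>2) = (\<rho> * ?N)\<^sup>2"
   using n by (simp add: \<rho>_def power2_eq_square[of "sum _ _"] sum_product sum.cartesian_product case_prod_unfold power_mult_distrib)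
  also have "(\<Sum>p\<in>?P. (cc n F (fst p) (snd p))\<^sup>2) <= (\<Sum>p\<in>?P. cc n F (fst p) (snd p))"
   using cc_bounds by (intro sum_mono) (simp add: power2_eq_square mult_left_le_one_le)
  also have "(\<Sum>p\<in>?P. cc n F (fst p) (snd p)) = x * ?N ^ 2"
   using n by (simp add: x_def r2_cc sum.cartesian_product case_prod_unfold)
  finally show ?thesis by (simp add: sum.cartesian_product case_prod_unfold mult_left_mono)
 qed
 have "\<rho>\<^sup>2 <= x * ((\<Sum>i<n. \<Sum>j<n. (r i * r j) * cc n F i j) / ?N ^ 2)"
  using mean2_CS[of "wgt F" n "ov n" Q, OF wgt_01(1)] unfolding RQ QQ x_def r2_def .
 also have "(\<Sum>i<n. \<Sum>j<n. (r i * r j) * cc n F i j) <= \<rho> * ?N ^ 2 * sqrt x"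
 proof (rule power2_le_imp_le)
  have "(\<rho> * ?N ^ 2 * sqrt x)\<^sup>2 = (\<rho> * ?N)\<^sup>2 * (x * ?N ^ 2)"
   using x0 by (simp add: power_mult_distrib power2_eq_square mult_ac)
  then show "(\<Sum>i<n. \<Sum>j<n. (r i * r j) * cc n F i j)\<^sup>2 <= (\<rho> * ?N ^ 2 * sqrt x)\<^sup>2" using c2 by simp
  show "0 <= \<rho> * ?N ^ 2 * sqrt x" using \<rho>0 x0 by simp
 qed
 finally have "\<rho>\<^sup>2 <= x * (\<rho> * ?N ^ 2 * sqrt x / ?N ^ 2)"
  using x0 by (simp add: divide_right_mono mult_left_mono)
 then have "\<rho> * \<rho> <= \<rho> * (x * sqrt x)" using n by (simp add: power2_eq_square mult_ac)
 then have "\<rho> <= x * sqrt x" using \<rho>0 x0 by (cases "\<rho> = 0") auto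
 then show ?thesis by (simp add: \<rho>_def x_def)
qed

lemma avg_first_three:
 assumes "k >= 3" "finite S" "S ~= {}"
 shows "avg (lsts k S) (%xs. f (xs ! 0) (xs ! 1) (xs ! 2)) = avg S (%x. avg S (%y. avg S (%z. f x y z)))"
proof -
 obtain k' where k': "k = Suc (Suc (Suc k'))" using assms by (auto dest!: le_Suc_ex simp: numeral_3_eq_3)
 show ?thesis unfolding k' avg_lsts_Suc using assms by (simp add: avg_const numeral_2_eq_2)
qed

lemma avg_fst: "avg ({..<n} \<times> (UNIV :: bool set)) (%x. f (fst x)) = avg {..<n} f"
proof -
 have "avg ({..<n} \<times> (UNIV :: bool set)) (%(a, b). f a) = avg {..<n} (%a. avg (UNIV :: bool set) (%b. f a))"
  by (rule avg_Times)
 then show ?thesis by (simp add: avg_const case_prod_unfold)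
qed

lemma avg_fst3:
 fixes n :: nat defines "S \<equiv> {..<n} \<times> (UNIV :: bool set)" and "N \<equiv> {..<n}"
 shows "avg S (%x. avg S (%y. avg S (%z. f (fst x) (fst y) (fst z)))) = avg N (%i. avg N (%j. avg N (f i j)))"
proof -
 have 1: "avg S (%z. f (fst x) (fst y) (fst z)) = avg N (f (fst x) (fst y))" for x y :: "nat \<times> bool"
  unfolding S_def N_def by (rule avg_fst)
 have 2: "avg S (%y. avg N (f (fst x) (fst y))) = avg N (%j. avg N (f (fst x) j))" for x :: "nat \<times> bool"
  unfolding S_def N_def by (rule avg_fst[where f = "%j. avg {..<n} (f (fst x) j)"])
 show ?thesis unfolding 1 2 unfolding S_def N_def by (rule avg_fst[where f = "%i. avg {..<n} (%j. avg {..<n} (f i j))"])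
qed

lemma small_xx_prob:
 assumes k: "k >= 3" "k <= n" and n: "2 * real k ^ 2 <= real n" and t: "tot n (wgt F) ~= 0"
 shows "avg (clauses k n) (%a. of_bool (xx k n F a < 1 / 4)) <= 32 * (r2 n F * sqrt (r2 n F))"
proof -
 have n0: "n > 0" using k by simp
 let ?S = "{..<n} \<times> (UNIV :: bool set)"
 let ?g = "%a. cc n F (fst (a ! 0)) (fst (a ! 1)) * cc n F (fst (a ! 1)) (fst (a ! 2))"
 have corr: "1/4 <= cc n F (fst (a ! p)) (fst (a ! p'))" if a: "xx k n F a < 1/4" and p: "p < length a" "p' < length a" for a p p'
 proof -
  have q: "3/4 <= qq k" "qq k < 1" using qq_bounds[OF k(1)] by auto
  have "mean n (wgt F) (cl a) = xx k n F a * qq k" using q by (simp add: xx_def)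
  also have "... <= (1/4) * 1" using a q xx_bounds(1)[OF k(1), of n F a] by (intro mult_mono) auto
  finally have m: "mean n (wgt F) (cl a) <= 1/4" by simp
  define s where "s = spin (snd (a ! p)) * spin (snd (a ! p'))"
  have s2: "s\<^sup>2 = 1" unfolding s_def by (auto simp: spin_def)
  let ?c = "%sg. spin (sg (fst (a ! p))) * spin (sg (fst (a ! p')))"
  have "1 + - 2 * cl a sg <= s * ?c sg" for sg
  proof (cases "nae (truth sg a)")
   case True
   then show ?thesis by (auto simp: cl_truth s_def spin_def)
  next
   case False
   have "truth sg a ! p \<in> set (truth sg a)" "truth sg a ! p' \<in> set (truth sg a)" using p by (auto simp: truth_def)
   then have "truth sg a ! p = truth sg a ! p'" using False unfolding nae_def by (metis (full_types))
   then have "(sg (fst (a ! p)) = snd (a ! p)) = (sg (fst (a ! p')) = snd (a ! p'))" using p by (simp add: truth_def)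
   then show ?thesis by (auto simp: cl_truth s_def spin_def)
  qed
  then have "mean n (wgt F) (%sg. 1 + - 2 * cl a sg) <= mean n (wgt F) (%sg. s * ?c sg)" by (intro mean_mono wgt_01)
  moreover have "mean n (wgt F) (%sg. 1 + - 2 * cl a sg) = 1 - 2 * mean n (wgt F) (cl a)"
  proof -
   have "tot n (%sg. wgt F sg * (1 + - 2 * cl a sg)) = tot n (wgt F) - 2 * tot n (%sg. wgt F sg * cl a sg)"
    unfolding tot_cmult[symmetric] tot_diff[symmetric] by (intro tot_cong) (simp add: algebra_simps)
   then show ?thesis using t unfolding mean_def by (simp add: diff_divide_distrib)
  qed
  moreover have "mean n (wgt F) (%sg. s * ?c sg) = s * mean n (wgt F) ?c"
   unfolding mean_def mult.left_commute[of _ s] tot_cmult by simp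
  ultimately have "1/2 <= s * mean n (wgt F) ?c" using m by linarith
  then have "(1/2)\<^sup>2 <= (s * mean n (wgt F) ?c)\<^sup>2" by (intro power_mono) auto
  then show ?thesis using s2 by (simp add: cc_def power_mult_distrib power2_eq_square[of "1/2 :: real"] power_divide)
 qed
 have "avg (clauses k n) (%a. of_bool (xx k n F a < 1 / 4)) <= avg (clauses k n) (%a. 16 * ?g a)"
 proof (intro avg_mono)
  fix a assume "a \<in> clauses k n"
  then have l: "length a = k" by (simp add: clauses_def)
  show "of_bool (xx k n F a < 1 / 4) <= 16 * ?g a"
  proof (cases "xx k n F a < 1 / 4")
   case True
   have "(1/4) * (1/4) <= ?g a" using corr[OF True, of 0 1] corr[OF True, of 1 2] l k cc_bounds by (intro mult_mono) auto
   then show ?thesis using True by simp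
  qed (simp add: cc_bounds)
 qed
 also have "... = 16 * avg (clauses k n) ?g" by (rule avg_cmult)
 finally have 1: "avg (clauses k n) (%a. of_bool (xx k n F a < 1 / 4)) <= 16 * avg (clauses k n) ?g" .
 have 2: "avg (clauses k n) ?g <= real (card (lsts k ?S)) / real (card (clauses k n)) * avg (lsts k ?S) ?g"
  using clauses_subset clauses_nonempty[OF k(2)] cc_bounds by (intro avg_subset_le) auto
 have 3: "real (card (lsts k ?S)) / real (card (clauses k n)) <= 2"
 proof -
  have "real k ^ 2 / real n <= 1/2" using n n0 by (simp add: field_simps)
  then have "(1/2) * real n ^ k <= (1 - real k ^ 2 / real n) * real n ^ k" by (intro mult_right_mono) auto
  then have "real n ^ k <= 2 * real (card (dl k n))" using card_dl_ge[of k n] k n0 by linarith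
  moreover have "card (dl k n) > 0" using dl_nonempty[OF k(2)] by (simp add: card_gt_0_iff)
  ultimately show ?thesis by (simp add: card_lsts card_clauses card_cartesian_product power_mult_distrib divide_le_eq)
 qed
 have "avg (lsts k ?S) ?g = avg {..<n} (%i. avg {..<n} (%j. avg {..<n} (%l. cc n F i j * cc n F j l)))"
  using avg_first_three[OF k(1), of ?S "%x y z. cc n F (fst x) (fst y) * cc n F (fst y) (fst z)"] n0
   avg_fst3[of n "%i j l. cc n F i j * cc n F j l"] by (simp add: lessThan_empty_iff)
 also have "... = avg {..<n} (%j. avg {..<n} (%i. cc n F i j) * avg {..<n} (%l. cc n F j l))"
  unfolding avg_cmult by (subst avg_swap) (simp add: avg_cmult_right)
 also have "... = (\<Sum>j<n. ((\<Sum>i<n. cc n F i j) / real n)\<^sup>2) / real n"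
  unfolding avg_def by (simp add: power2_eq_square cc_sym[of n F _ _])
 also have "... <= r2 n F * sqrt (r2 n F)" by (rule row_bound[OF n0])
 finally have 4: "avg (lsts k ?S) ?g <= r2 n F * sqrt (r2 n F)" .
 have "0 <= avg (lsts k ?S) ?g" by (intro avg_nonneg mult_nonneg_nonneg cc_bounds)
 then have "real (card (lsts k ?S)) / real (card (clauses k n)) * avg (lsts k ?S) ?g <= 2 * avg (lsts k ?S) ?g"
  using 3 by (intro mult_right_mono)
 then show ?thesis using 1 2 4 by linarith
qed

definition kap :: "nat => real" where "kap k = 3 * (ck k + 1) + 4 * real k ^ 2"

lemma kap_pos: "k >= 3 ==> 0 < kap k"
 unfolding kap_def using ck_pos[of k] by (intro add_pos_nonneg) auto

lemma avg_xx_sq_le: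
 assumes k: "k >= 3" "k <= n" and t: "tot n (wgt F) ~= 0" and \<xi>: "1 / real n <= \<xi>" "r2 n F <= 3 * \<xi>"
 shows "avg (clauses k n) (%a. (xx k n F a - 1)\<^sup>2) <= kap k * \<xi>"
proof -
 have "avg (clauses k n) (%a. (xx k n F a - 1)\<^sup>2) = mean2 n (wgt F) (gg k n)" by (rule avg_xx_sq[OF k t])
 also have "... <= mean2 n (wgt F) (%sg ta. (ck k + 1) * (ov n sg ta)\<^sup>2 + 4 * real k ^ 2 / real n)"
 proof (intro mean2_mono wgt_01)
  fix sg ta
  let ?r = "ov n sg ta"
  have "?r ^ 4 = ?r\<^sup>2 * ?r\<^sup>2" by (simp add: power2_eq_square power4_eq_xxxx)
  also have "... <= 1 * ?r\<^sup>2" by (intro mult_right_mono ov_sq_le) auto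
  finally show "gg k n sg ta <= (ck k + 1) * ?r\<^sup>2 + 4 * real k ^ 2 / real n"
   using gg_approx[OF k, of sg ta] gf_le[OF k(1) abs_ov, of n sg ta] by (simp only: distrib_right)
 qed
 also have "... = (ck k + 1) * r2 n F + 4 * real k ^ 2 / real n"
  unfolding mean2_add mean2_cmult mean2_const[OF t] r2_def ..
 also have "... <= (ck k + 1) * (3 * \<xi>) + 4 * real k ^ 2 * \<xi>"
 proof (intro add_mono mult_left_mono \<xi>)
  show "4 * real k ^ 2 / real n <= 4 * real k ^ 2 * \<xi>"
   using mult_left_mono[OF \<xi>(1), of "4 * real k ^ 2"] by simp
 qed (use ck_pos[OF k(1)] in auto)
 finally show ?thesis by (simp add: kap_def algebra_simps)
qed

text \<open>The growth condition \<open>4 \<kappa> \<xi>\<^sub>j <= L\<^sub>j\<^sub>+\<^sub>1 - L\<^sub>j\<close> below makes the thresholds \<open>L\<^sub>j\<close> absorb the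
 decay of \<open>MM\<close> that overlaps of order \<open>\<xi>\<^sub>j\<close> can cause; since \<open>\<xi>\<^sub>j\<close> is proportional to \<open>L\<^sub>j / n\<close>, the
 thresholds grow only by a bounded factor over a linear number of steps.\<close>

primrec gd :: "nat => nat => (nat => real) => (nat => real) => formula => bool" where
 "gd k n L \<xi> [] = True"
| "gd k n L \<xi> (a # F) = (gd k n L \<xi> F & exp (- L (length F)) <= MM k n F
   & r2 n F <= 3 * \<xi> (length F) & 1 / 4 <= xx k n F a)"

lemma MM_Nil: "MM k n [] = 1" by (simp add: MM_def tot_def card_assignments)

lemma gd_pos: "k >= 3 ==> gd k n L \<xi> F ==> 0 < MM k n F"
 by (induction F) (auto simp: MM_Nil MM_Cons)

lemma tot_pos_MM: "0 < MM k n F ==> tot n (wgt F) ~= 0" by (auto simp: MM_def)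

lemma inverse_le_quadratic: "0 <= x ==> of_bool (1/4 <= x) / x <= 1 - (x - 1) + 4 * (x - 1)\<^sup>2" for x :: real
proof (cases "1/4 <= x")
 case True
 then have "1 / x = 1 - (x - 1) + (x - 1)\<^sup>2 / x" by (simp add: field_simps power2_eq_square)
 also have "(x - 1)\<^sup>2 / x <= (x - 1)\<^sup>2 / (1/4)" using True by (intro divide_left_mono) auto
 finally show ?thesis using True by simp
next
 case False
 then have "0 <= 1 - (x - 1)" by simp
 then have "0 <= 1 - (x - 1) + 4 * (x - 1)\<^sup>2" by (intro add_nonneg_nonneg) auto
 then show ?thesis using False by simp
qed

lemma inverse_MM_bound:
 assumes k: "k >= 3" "k <= n" and \<xi>: "!!j. 1 / real n <= \<xi> j" and L: "!!j. 4 * kap k * \<xi> j <= L (Suc j) - L j"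
 shows "avg (Fm k n j) (%F. of_bool (gd k n L \<xi> F) / MM k n F) <= exp (L j - L 0)"
proof (induction j)
 case (Suc j)
 let ?C = "clauses k n"
 have "avg (Fm k n (Suc j)) (%F. of_bool (gd k n L \<xi> F) / MM k n F)
   = avg (Fm k n j) (%F. avg ?C (%a. of_bool (gd k n L \<xi> (a # F)) / MM k n (a # F)))"
  unfolding avg_lsts_Suc by (rule avg_swap)
 also have "... <= avg (Fm k n j) (%F. of_bool (gd k n L \<xi> F) / MM k n F * exp (L (Suc j) - L j))"
 proof (intro avg_mono)
  fix F assume F: "F \<in> Fm k n j"
  then have l: "length F = j" by (simp add: lsts_def)
  show "avg ?C (%a. of_bool (gd k n L \<xi> (a # F)) / MM k n (a # F)) <= of_bool (gd k n L \<xi> F) / MM k n F * exp (L (Suc j) - L j)"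
  proof (cases "gd k n L \<xi> F & exp (- L j) <= MM k n F & r2 n F <= 3 * \<xi> j")
   case False
   then have "~ gd k n L \<xi> (a # F)" for a using l by auto
   then have "avg ?C (%a. of_bool (gd k n L \<xi> (a # F)) / MM k n (a # F)) = 0"
    by (simp only: of_bool_eq) simp
   then show ?thesis using MM_nonneg[OF k(1), of n F] by simp
  next
   case True
   then have M: "0 < MM k n F" using gd_pos[OF k(1)] by auto
   note t = tot_pos_MM[OF M]
   have "avg ?C (%a. of_bool (gd k n L \<xi> (a # F)) / MM k n (a # F))
     = avg ?C (%a. (1 / MM k n F) * (of_bool (1/4 <= xx k n F a) / xx k n F a))"
    using True l by (intro avg_cong) (simp add: MM_Cons[OF k(1)])
   also have "... = (1 / MM k n F) * avg ?C (%a. of_bool (1/4 <= xx k n F a) / xx k n F a)" by (rule avg_cmult)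
   also have "avg ?C (%a. of_bool (1/4 <= xx k n F a) / xx k n F a) <= avg ?C (%a. 1 - (xx k n F a - 1) + 4 * (xx k n F a - 1)\<^sup>2)"
    by (intro avg_mono inverse_le_quadratic xx_bounds k)
   also have "... = 1 + 4 * avg ?C (%a. (xx k n F a - 1)\<^sup>2)"
    unfolding avg_add avg_diff avg_cmult avg_xx[OF k t] using clauses_nonempty[OF k(2)] by (simp add: avg_const)
   also have "... <= 1 + 4 * (kap k * \<xi> j)"
    using avg_xx_sq_le[OF k t \<xi>] True by simp
   also have "... <= 1 + (L (Suc j) - L j)" using L[of j] by simp
   also have "... <= exp (L (Suc j) - L j)" by (rule exp_ge_add_one_self)
   finally show ?thesis using True M by (simp add: divide_right_mono)
  qed
 qed
 also have "... <= exp (L j - L 0) * exp (L (Suc j) - L j)"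
  unfolding avg_cmult_right using Suc by (intro mult_right_mono) auto
 finally show ?case by (simp add: exp_add[symmetric])
qed (simp add: MM_Nil)

lemma not_gd_step:
 assumes k: "k >= 3" "k <= n" and n: "2 * real k ^ 2 <= real n" and \<xi>: "!!j. 1 / real n <= \<xi> j" and L: "!!j. 4 * kap k * \<xi> j <= L (Suc j) - L j"
 shows "avg (Fm k n (Suc j)) (%F. of_bool (~ gd k n L \<xi> F))
  <= avg (Fm k n j) (%F. of_bool (~ gd k n L \<xi> F)) + exp (- L 0)
   + avg (Fm k n j) (%F. of_bool (exp (- L j) <= MM k n F & 3 * \<xi> j < r2 n F)) + 32 * (3 * \<xi> j * sqrt (3 * \<xi> j))"
proof -
 let ?C = "clauses k n"
 have \<xi>0: "0 <= \<xi> j" using \<xi>[of j] by (meson divide_nonneg_nonneg of_nat_0_le_iff order_trans zero_le_one)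
 have "avg (Fm k n (Suc j)) (%F. of_bool (~ gd k n L \<xi> F))
   = avg (Fm k n j) (%F. avg ?C (%a. of_bool (~ gd k n L \<xi> (a # F))))"
  unfolding avg_lsts_Suc by (rule avg_swap)
 also have "... <= avg (Fm k n j) (%F. of_bool (~ gd k n L \<xi> F) + exp (- L j) * (of_bool (gd k n L \<xi> F) / MM k n F)
   + of_bool (exp (- L j) <= MM k n F & 3 * \<xi> j < r2 n F) + 32 * (3 * \<xi> j * sqrt (3 * \<xi> j)))"
 proof (intro avg_mono)
  fix F assume F: "F \<in> Fm k n j"
  then have l: "length F = j" by (simp add: lsts_def)
  let ?s = "32 * (3 * \<xi> j * sqrt (3 * \<xi> j))"
  let ?q = "exp (- L j) * (of_bool (gd k n L \<xi> F) / MM k n F)"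
  have s0: "0 <= ?s" using \<xi>0 by simp
  have q0: "0 <= ?q" using MM_nonneg[OF k(1)] by simp
  have a1: "avg ?C (%a. of_bool (~ gd k n L \<xi> (a # F))) <= 1"
   using clauses_nonempty[OF k(2)] by (intro avg_le) auto
  show "avg ?C (%a. of_bool (~ gd k n L \<xi> (a # F))) <= of_bool (~ gd k n L \<xi> F) + ?q
   + of_bool (exp (- L j) <= MM k n F & 3 * \<xi> j < r2 n F) + ?s"
  proof (cases "gd k n L \<xi> F")
   case False
   then show ?thesis using a1 s0 q0 by simp
  next
   case g: True
   note M = gd_pos[OF k(1) g]
   note t = tot_pos_MM[OF M]
   show ?thesis
   proof (cases "exp (- L j) <= MM k n F")
    case False
    then have "1 <= ?q" using g M by (simp add: field_simps)
    then show ?thesis using a1 s0 g False by simp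
   next
    case m: True
    show ?thesis
    proof (cases "3 * \<xi> j < r2 n F")
     case True
     then show ?thesis using a1 s0 q0 g m by simp
    next
     case False
     have "avg ?C (%a. of_bool (~ gd k n L \<xi> (a # F))) = avg ?C (%a. of_bool (xx k n F a < 1/4))"
      using g m False l by (intro avg_cong) auto
     also have "... <= 32 * (r2 n F * sqrt (r2 n F))" by (rule small_xx_prob[OF k n t])
     also have "... <= ?s"
     proof -
      have "0 <= r2 n F" unfolding r2_def by (intro mean2_nonneg wgt_01) auto
      then have "r2 n F * sqrt (r2 n F) <= 3 * \<xi> j * sqrt (3 * \<xi> j)" using False \<xi>0 by (intro mult_mono) auto
      then show ?thesis by simp
     qed
     finally show ?thesis using g q0 False by simp
    qed
   qed
  qed
 qed
 also have "... = avg (Fm k n j) (%F. of_bool (~ gd k n L \<xi> F)) + exp (- L j) * avg (Fm k n j) (%F. of_bool (gd k n L \<xi> F) / MM k n F)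
   + avg (Fm k n j) (%F. of_bool (exp (- L j) <= MM k n F & 3 * \<xi> j < r2 n F)) + 32 * (3 * \<xi> j * sqrt (3 * \<xi> j))"
  unfolding avg_add avg_cmult using clauses_nonempty[OF k(2)] by (simp add: avg_const)
 also have "exp (- L j) * avg (Fm k n j) (%F. of_bool (gd k n L \<xi> F) / MM k n F) <= exp (- L j) * exp (L j - L 0)"
  by (intro mult_left_mono inverse_MM_bound k \<xi> L) auto
 also have "... = exp (- L 0)" by (simp add: exp_add[symmetric])
 finally show ?thesis by simp
qed

lemma null_bad:
 assumes k: "k >= 3" "k <= n" and n: "2 * real k ^ 2 <= real n" and \<xi>: "!!j. 1 / real n <= \<xi> j" and L: "!!j. 4 * kap k * \<xi> j <= L (Suc j) - L j"
  and N: "!!j. j <= m ==> avg (Fm k n j) (%F. of_bool (exp (- L j) <= MM k n F & 3 * \<xi> j < r2 n F)) <= N"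
  and \<eta>: "!!j. j <= m ==> \<xi> j <= \<eta>" and \<delta>: "3 * \<eta> <= \<delta>"
 shows "avg (Fm k n m) (%F. of_bool (MM k n F = 0 \<or> \<delta> < r2 n F))
   <= (real m + 1) * (exp (- L 0) + N + 32 * (3 * \<eta> * sqrt (3 * \<eta>)))"
proof -
 let ?e = "exp (- L 0) + N + 32 * (3 * \<eta> * sqrt (3 * \<eta>))"
 have \<xi>0: "0 <= \<xi> j" for j using \<xi>[of j] by (meson divide_nonneg_nonneg of_nat_0_le_iff order_trans zero_le_one)
 have \<eta>0: "0 <= \<eta>" using \<xi>0[of 0] \<eta>[of 0] by simp
 have p: "avg (Fm k n j) (%F. of_bool (~ gd k n L \<xi> F)) <= real j * ?e" if "j <= m" for j
  using that
 proof (induction j)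
  case (Suc j)
  have "3 * \<xi> j * sqrt (3 * \<xi> j) <= 3 * \<eta> * sqrt (3 * \<eta>)" using \<eta>[of j] Suc \<xi>0[of j] \<eta>0 by (intro mult_mono) auto
  then show ?case using not_gd_step[of k n \<xi> L j, OF k n \<xi> L] Suc N[of j] by (simp add: algebra_simps)
 qed simp
 have "avg (Fm k n m) (%F. of_bool (MM k n F = 0 \<or> \<delta> < r2 n F))
  <= avg (Fm k n m) (%F. of_bool (~ gd k n L \<xi> F) + exp (- L m) * (of_bool (gd k n L \<xi> F) / MM k n F)
   + of_bool (exp (- L m) <= MM k n F & 3 * \<xi> m < r2 n F))"
 proof (intro avg_mono)
  fix F
  let ?q = "exp (- L m) * (of_bool (gd k n L \<xi> F) / MM k n F)"
  have q0: "0 <= ?q" using MM_nonneg[OF k(1)] by simp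
  show "of_bool (MM k n F = 0 \<or> \<delta> < r2 n F) <= of_bool (~ gd k n L \<xi> F) + ?q + of_bool (exp (- L m) <= MM k n F & 3 * \<xi> m < r2 n F)"
  proof (cases "gd k n L \<xi> F")
   case False
   then show ?thesis using q0 by simp
  next
   case g: True
   note M = gd_pos[OF k(1) g]
   show ?thesis
   proof (cases "exp (- L m) <= MM k n F")
    case False
    then have "1 <= ?q" using g M by (simp add: field_simps)
    then show ?thesis using g False M by simp
   next
    case m: True
    then show ?thesis using g M q0 \<eta>[of m] \<delta> by auto
   qed
  qed
 qed
 also have "... = avg (Fm k n m) (%F. of_bool (~ gd k n L \<xi> F)) + exp (- L m) * avg (Fm k n m) (%F. of_bool (gd k n L \<xi> F) / MM k n F)
   + avg (Fm k n m) (%F. of_bool (exp (- L m) <= MM k n F & 3 * \<xi> m < r2 n F))"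
  unfolding avg_add avg_cmult ..
 also have "... <= real m * ?e + exp (- L m) * exp (L m - L 0) + N"
  by (intro add_mono p N mult_left_mono inverse_MM_bound k \<xi> L) auto
 also have "exp (- L m) * exp (L m - L 0) = exp (- L 0)" by (simp add: exp_add[symmetric])
 also have "real m * ?e + exp (- L 0) + N <= (real m + 1) * ?e"
  using \<eta>0 by (simp add: algebra_simps)
 finally show ?thesis .
qed

lemma null_main:
 assumes k: "k >= 3" and D: "0 < D" and a: "a > 0" and c: "c > 0" and "\<delta> > 0"
  and NO: "\<forall>\<^sub>F n in sequentially. \<forall>m L \<xi>. real m <= D * real n --> 0 <= L --> 0 < \<xi> --> exp (- c * real n) <= \<xi> -->
   avg (Fm k n m) (%F. of_bool (exp (- L) <= MM k n F & 3 * \<xi> < r2 n F))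
    <= A * (real n + 1) / \<xi> * exp (2 * L - a * real n * \<xi>) + exp (L - c * real n)"
 shows "\<forall>\<^sub>F n in sequentially. \<forall>m. real m <= D * real n -->
   avg (Fm k n m) (%F. of_bool (MM k n F = 0 \<or> \<delta> < r2 n F)) <= \<delta>"
proof -
 define \<alpha> where "\<alpha> = 6 / a"
 define \<beta> where "\<beta> = 4 * kap k * \<alpha>"
 define \<Gamma> where "\<Gamma> = exp (\<beta> * D)"
 have \<alpha>: "\<alpha> > 0" and \<beta>: "\<beta> > 0" using a kap_pos[OF k] by (auto simp: \<alpha>_def \<beta>_def)
 have \<Gamma>: "\<Gamma> > 0" by (simp add: \<Gamma>_def)
 define A' where "A' = \<bar>A\<bar>"
 define N where "N = (%n::nat. A' * (real n + 1) * real n * exp (- 8 * ln (real n)) + exp (2 * \<Gamma> * ln (real n) - c * real n))"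
 define \<eta> where "\<eta> = (%n::nat. \<alpha> * (2 * \<Gamma> * ln (real n)) / real n)"
 define e where "e = (%n::nat. exp (- (2 * ln (real n))) + N n + 32 * (3 * \<eta> n * sqrt (3 * \<eta> n)))"
 have lim1: "(%n. (D * real n + 1) * e n) \<longlonglongrightarrow> 0"
  unfolding e_def N_def \<eta>_def using D c \<alpha> \<Gamma> by real_asymp
 have lim2: "\<eta> \<longlonglongrightarrow> 0" unfolding \<eta>_def using \<alpha> \<Gamma> by real_asymp
 have ev1: "\<forall>\<^sub>F n in sequentially. (D * real n + 1) * e n < \<delta>"
  using lim1 \<open>\<delta> > 0\<close> by (rule order_tendstoD)
 have ev2: "\<forall>\<^sub>F n in sequentially. \<eta> n < \<delta> / 3"
  using lim2 \<open>\<delta> > 0\<close> by (intro order_tendstoD(2)[OF lim2]) auto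
 have ev3: "\<forall>\<^sub>F n in sequentially. exp (- c * real n) <= 1 / real n" using c by real_asymp
 have ev4: "\<forall>\<^sub>F n in sequentially. 1 <= \<alpha> * (2 * ln (real n))" using \<alpha> by real_asymp
 have ev: "\<forall>\<^sub>F n in sequentially. real k <= real n & 2 * real k ^ 2 <= real n"
  by (intro eventually_conj eventually_real_ge)
 show ?thesis
  using NO ev1 ev2 ev3 ev4 ev
 proof eventually_elim
  case (elim n)
  then have nk: "k <= n" and n2: "2 * real k ^ 2 <= real n" by auto
  have n0: "real n > 0" "1 <= real n" using nk k by auto
  define l where "l = 2 * ln (real n)"
  have l0: "0 <= l" using n0 by (simp add: l_def)
  define L where "L = (%j. l * (1 + \<beta> / real n) ^ j)"
  define \<xi> where "\<xi> = (%j. \<alpha> * L j / real n)"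
  have b1: "1 <= 1 + \<beta> / real n" using \<beta> n0 by simp
  have Ll: "l <= L j" for j unfolding L_def using l0 one_le_power[OF b1, of j] by (simp add: mult_left_mono[of 1 _ l, simplified])
  show ?case
  proof (intro allI impI)
   fix m assume m: "real m <= D * real n"
   have Lu: "L j <= 2 * \<Gamma> * ln (real n)" if "j <= m" for j
   proof -
    have "(1 + \<beta> / real n) ^ j <= exp (\<beta> / real n) ^ j"
     using b1 exp_ge_add_one_self[of "\<beta> / real n"] by (intro power_mono) auto
    also have "... = exp (real j * (\<beta> / real n))" by (simp flip: exp_of_nat_mult)
    also have "... <= \<Gamma>" unfolding \<Gamma>_def
    proof (subst exp_le_cancel_iff)
     have "real j * (\<beta> / real n) <= (D * real n) * (\<beta> / real n)" using that m \<beta> by (intro mult_right_mono) auto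
     then show "real j * (\<beta> / real n) <= \<beta> * D" using n0 by (simp add: mult.commute)
    qed
    finally have "l * (1 + \<beta> / real n) ^ j <= l * \<Gamma>" using l0 by (intro mult_left_mono) auto
    then show ?thesis by (simp add: L_def l_def mult_ac)
   qed
   have \<xi>n: "1 / real n <= \<xi> j" for j
   proof -
    have "1 <= \<alpha> * L j" using elim(5) \<alpha> mult_left_mono[OF Ll[of j], of \<alpha>] unfolding l_def by linarith
    then show ?thesis unfolding \<xi>_def using n0 by (intro divide_right_mono) auto
   qed
   have \<xi>p: "0 < \<xi> j" for j using \<xi>n[of j] n0 by (smt (verit) divide_pos_pos)
   have "avg (Fm k n m) (%F. of_bool (MM k n F = 0 \<or> \<delta> < r2 n F))
     <= (real m + 1) * (exp (- L 0) + N n + 32 * (3 * \<eta> n * sqrt (3 * \<eta> n)))"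
   proof (rule null_bad[where \<xi> = \<xi> and L = L, OF k nk n2 \<xi>n])
    show "4 * kap k * \<xi> j <= L (Suc j) - L j" for j
     using n0 by (simp add: \<xi>_def L_def \<beta>_def algebra_simps)
    show "\<xi> j <= \<eta> n" if "j <= m" for j
     unfolding \<xi>_def \<eta>_def using Lu[OF that] \<alpha> n0 by (intro divide_right_mono mult_left_mono) auto
    show "3 * \<eta> n <= \<delta>" using elim(3) by simp
    fix j assume j: "j <= m"
    have "avg (Fm k n j) (%F. of_bool (exp (- L j) <= MM k n F & 3 * \<xi> j < r2 n F))
      <= A * (real n + 1) / \<xi> j * exp (2 * L j - a * real n * \<xi> j) + exp (L j - c * real n)"
     using elim(1)[rule_format, of j "L j" "\<xi> j"] j m Ll[of j] l0 \<xi>p[of j] \<xi>n[of j] elim(4) by simp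
    also have "... <= N n" unfolding N_def
    proof (intro add_mono)
     have "a * real n * \<xi> j = 6 * L j" using a n0 by (simp add: \<xi>_def \<alpha>_def)
     then have e8: "exp (2 * L j - a * real n * \<xi> j) <= exp (- 8 * ln (real n))"
      using Ll[of j] by (simp add: l_def)
     have i\<xi>: "1 / \<xi> j <= real n" using \<xi>n[of j] \<xi>p[of j] n0 by (simp add: field_simps)
     have "A * (real n + 1) / \<xi> j * exp (2 * L j - a * real n * \<xi> j) = A * ((real n + 1) * (1 / \<xi> j) * exp (2 * L j - a * real n * \<xi> j))"
      by simp
     also have "... <= A' * ((real n + 1) * (1 / \<xi> j) * exp (2 * L j - a * real n * \<xi> j))"
      using \<xi>p[of j] by (intro mult_right_mono) (auto simp: A'_def)
     also have "... <= A' * ((real n + 1) * real n * exp (- 8 * ln (real n)))"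
      using e8 i\<xi> \<xi>p[of j] by (intro mult_left_mono mult_mono) (auto simp: A'_def)
     finally show "A * (real n + 1) / \<xi> j * exp (2 * L j - a * real n * \<xi> j) <= A' * (real n + 1) * real n * exp (- 8 * ln (real n))"
      by (simp only: mult.assoc)
     show "exp (L j - c * real n) <= exp (2 * \<Gamma> * ln (real n) - c * real n)" using Lu[OF j] by simp
    qed
    finally show "avg (Fm k n j) (%F. of_bool (exp (- L j) <= MM k n F & 3 * \<xi> j < r2 n F)) <= N n" .
   qed
   also have "L 0 = 2 * ln (real n)" by (simp add: L_def l_def)
   also have "(real m + 1) * (exp (- (2 * ln (real n))) + N n + 32 * (3 * \<eta> n * sqrt (3 * \<eta> n))) = (real m + 1) * e n"
    by (simp add: e_def)
   also have "... <= (D * real n + 1) * e n"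
   proof (intro mult_right_mono)
    have "0 <= N n" unfolding N_def A'_def by (intro add_nonneg_nonneg mult_nonneg_nonneg) auto
    moreover have "0 <= \<eta> n" unfolding \<eta>_def using \<alpha> \<Gamma> n0 by (intro divide_nonneg_nonneg mult_nonneg_nonneg) auto
    ultimately show "0 <= e n" unfolding e_def by (intro add_nonneg_nonneg mult_nonneg_nonneg) auto
   qed (use m in simp)
   also have "... <= \<delta>" using elim(2) by simp
   finally show "avg (Fm k n m) (%F. of_bool (MM k n F = 0 \<or> \<delta> < r2 n F)) <= \<delta>" .
  qed
 qed
qed

section \<open>The Bethe functional at finitely supported measures\<close>

definition Wl :: "real list list => real" where
 "Wl yss = prod_list (map (%ys. 1 - prod_list ys) yss) + prod_list (map (%ys. 1 - prod_list (map (%y. 1 - y) ys)) yss)"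

definition El :: "real list => real" where
 "El ys = 1 - prod_list ys - prod_list (map (%y. 1 - y) ys)"

definition jss :: "nat => nat => nat list list" where
 "jss k \<gamma> = map (%i. [k * i + 1..<k * i + k]) [1..<\<gamma> + 1]"

lemma prod_block:
 assumes "k >= 1"
 shows "(\<Prod>j\<in>{1..k-1}. f (k * i + j) :: real) = prod_list (map f [k * i + 1..<k * i + k])"
proof -
 have "(\<Prod>j\<in>{1..k-1}. f (k * i + j)) = (\<Prod>t\<in>set [k * i + 1..<k * i + k]. f t)"
  using assms by (intro prod.reindex_bij_witness[of _ "%t. t - k * i" "%j. k * i + j"]) auto
 then show ?thesis by (simp only: prod.distinct_set_conv_list[OF distinct_upt])
qed

lemma prod_atLeast1: "(\<Prod>i\<in>{1..\<gamma>}. f i) = prod_list (map f [1..<\<gamma> + 1])" for f :: "nat => real"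
proof -
 have "{1..\<gamma>} = set [1..<\<gamma> + 1]" by auto
 then show ?thesis by (simp only: prod.distinct_set_conv_list[OF distinct_upt])
qed

lemma Wl_jss:
 assumes "k >= 1"
 shows "Wl (map (map \<rho>) (jss k \<gamma>)) = (\<Prod>i\<in>{1..\<gamma>}. 1 - (\<Prod>j\<in>{1..k-1}. \<rho> (k*i+j)))
     + (\<Prod>i\<in>{1..\<gamma>}. 1 - (\<Prod>j\<in>{1..k-1}. 1 - \<rho> (k*i+j)))"
proof -
 have "(\<Prod>i\<in>{1..\<gamma>}. 1 - (\<Prod>j\<in>{1..k-1}. \<rho> (k*i+j))) = (\<Prod>i\<in>{1..\<gamma>}. 1 - prod_list (map \<rho> [k * i + 1..<k * i + k]))"
  by (simp only: prod_block[OF assms, of \<rho>])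
 also have "... = prod_list (map (%i. 1 - prod_list (map \<rho> [k * i + 1..<k * i + k])) [1..<\<gamma> + 1])" by (rule prod_atLeast1)
 also have "... = prod_list (map (%ys. 1 - prod_list ys) (map (map \<rho>) (jss k \<gamma>)))"
  unfolding jss_def map_map o_def ..
 finally have 1: "(\<Prod>i\<in>{1..\<gamma>}. 1 - (\<Prod>j\<in>{1..k-1}. \<rho> (k*i+j))) = prod_list (map (%ys. 1 - prod_list ys) (map (map \<rho>) (jss k \<gamma>)))" .
 have "(\<Prod>i\<in>{1..\<gamma>}. 1 - (\<Prod>j\<in>{1..k-1}. 1 - \<rho> (k*i+j))) = (\<Prod>i\<in>{1..\<gamma>}. 1 - prod_list (map (%t. 1 - \<rho> t) [k * i + 1..<k * i + k]))"
  by (simp only: prod_block[OF assms, of "%t. 1 - \<rho> t"])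
 also have "... = prod_list (map (%i. 1 - prod_list (map (%t. 1 - \<rho> t) [k * i + 1..<k * i + k])) [1..<\<gamma> + 1])" by (rule prod_atLeast1)
 also have "... = prod_list (map (%ys. 1 - prod_list (map (%y. 1 - y) ys)) (map (map \<rho>) (jss k \<gamma>)))"
  unfolding jss_def map_map o_def ..
 finally show ?thesis unfolding 1 Wl_def by simp
qed

lemma El_upt: "El (map \<rho> [1..<k + 1]) = 1 - (\<Prod>j\<in>{1..k}. \<rho> j) - (\<Prod>j\<in>{1..k}. 1 - \<rho> j)"
 unfolding El_def prod_atLeast1 map_map o_def ..

lemma B_integrand_eq:
 assumes "k >= 1"
 shows "B_integrand k d (\<gamma>, \<rho>) = Lam (Wl (map (map \<rho>) (jss k \<gamma>))) / (2 * qq k ^ \<gamma>)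
  - d * (real k - 1) * Lam (El (map \<rho> [1..<k + 1])) / (real k * qq k)"
 unfolding Wl_jss[OF assms] El_upt B_integrand_def qq_def by simp

lemma prod_list_unit: "(\<forall>y\<in>set ys. 0 <= y & y <= 1) ==> 0 <= prod_list ys & prod_list ys <= (1::real)"
 by (induction ys) (auto intro: mult_le_one)

lemma prod_list_compl: "(\<forall>y\<in>set ys. 0 <= y & y <= 1) ==> 0 <= prod_list (map (%y. 1 - y) ys) & prod_list (map (%y. 1 - y) ys) <= (1::real)"
 by (rule prod_list_unit) auto

lemma Wl_bounds:
 assumes "\<forall>ys\<in>set yss. \<forall>y\<in>set ys. 0 <= y & y <= 1"
 shows "0 <= Wl yss" "Wl yss <= 2"
proof -
 have "0 <= prod_list (map (%ys. 1 - prod_list ys) yss) & prod_list (map (%ys. 1 - prod_list ys) yss) <= 1"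
  using assms prod_list_unit by (intro prod_list_unit) auto
 moreover have "0 <= prod_list (map (%ys. 1 - prod_list (map (%y. 1 - y) ys)) yss) & prod_list (map (%ys. 1 - prod_list (map (%y. 1 - y) ys)) yss) <= 1"
  using assms prod_list_compl by (intro prod_list_unit) auto
 ultimately show "0 <= Wl yss" "Wl yss <= 2" unfolding Wl_def by auto
qed

lemma El_bounds:
 assumes "\<forall>y\<in>set ys. 0 <= y & y <= 1" "ys ~= []"
 shows "0 <= El ys" "El ys <= 1"
proof -
 obtain z zs where ys: "ys = z # zs" using assms(2) by (cases ys) auto
 have z: "0 <= z" "z <= 1" using assms ys by auto
 have p: "0 <= prod_list zs & prod_list zs <= 1" "0 <= prod_list (map (%y. 1 - y) zs) & prod_list (map (%y. 1 - y) zs) <= 1"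
  using prod_list_unit[of zs] prod_list_compl[of zs] assms ys by auto
 have "z * prod_list zs <= z * 1" "(1 - z) * prod_list (map (%y. 1 - y) zs) <= (1 - z) * 1"
  using z p by (intro mult_left_mono; simp)+
 then show "0 <= El ys" unfolding El_def ys by simp
 have "0 <= z * prod_list zs" "0 <= (1 - z) * prod_list (map (%y. 1 - y) zs)" using z p by auto
 then show "El ys <= 1" unfolding El_def ys by simp
qed

lemma Lam_abs_le: assumes "0 <= x" "x <= 2" shows "\<bar>Lam x\<bar> <= 2"
proof -
 have "-1 <= Lam x"
 proof -
  have "0 <= (x - 1)\<^sup>2 / 4" by simp
  then show ?thesis using Lam_ge[OF assms] assms by linarith
 qed
 moreover have "Lam x <= 2"
 proof (cases "x = 0")
  case False
  then have "x * ln x <= x * (x - 1)" using assms ln_le_minus_one[of x] by (intro mult_left_mono) auto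
  also have "... <= 2"
  proof -
   have "0 <= (2 - x) * (x + 1)" using assms by (intro mult_nonneg_nonneg) auto
   then show ?thesis by (simp add: algebra_simps)
  qed
  finally show ?thesis using False by (simp add: Lam_def)
 qed simp
 ultimately show ?thesis by (simp add: abs_le_iff)
qed

lemma Lam_measurable [measurable]: "Lam \<in> borel_measurable borel"
proof -
 have "(%x::real. if x = 0 then 0 else x * ln x) \<in> borel_measurable borel" by measurable
 moreover have "Lam = (%x. if x = 0 then 0 else x * ln x)" by (simp add: Lam_def fun_eq_iff)
 ultimately show ?thesis by simp
qed

lemma sum_lsts_Suc: "finite S ==> (\<Sum>xs\<in>lsts (Suc m) S. f xs :: real) = (\<Sum>x\<in>S. \<Sum>xs\<in>lsts m S. f (x # xs))"
proof -
 have "bij_betw (%(x, xs). x # xs) (S \<times> lsts m S) (lsts (Suc m) S)"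
  by (rule bij_betw_byWitness[where f' = "%zs. (hd zs, tl zs)"]) (auto simp: in_lsts_Suc)
 from sum.reindex_bij_betw[OF this, of f] show ?thesis
  by (simp add: case_prod_unfold sum.cartesian_product)
qed

context
 fixes S :: "'a set" and p :: "'a => real"
 assumes S: "finite S" "S ~= {}" and p01: "!!x. x \<in> S ==> 0 <= p x & p x <= 1"
begin

definition fpi :: "real measure" where
 "fpi = distr (measure_pmf (pmf_of_set S)) borel p"

lemma prob_fpi: "prob_space fpi"
 unfolding fpi_def by (intro measure_pmf.prob_space_distr) simp

lemma sets_fpi [simp, measurable_cong]: "sets fpi = sets borel" unfolding fpi_def by simp

lemma space_fpi [simp]: "space fpi = UNIV" unfolding fpi_def by simp

lemma measure_fpi: "A \<in> sets borel ==> measure fpi A = real (card {x\<in>S. p x \<in> A}) / real (card S)"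
proof -
 assume "A \<in> sets borel"
 then have "measure fpi A = measure (measure_pmf (pmf_of_set S)) (p -` A)"
  unfolding fpi_def by (simp add: measure_distr)
 also have "... = real (card (S \<inter> p -` A)) / real (card S)" using S by (simp add: measure_pmf_of_set)
 also have "S \<inter> p -` A = {x\<in>S. p x \<in> A}" by auto
 finally show ?thesis .
qed

lemma fpi_P_star: "avg S p = 1 / 2 ==> fpi \<in> P_star"
proof -
 assume a: "avg S p = 1 / 2"
 have "{x\<in>S. p x \<in> {0..1}} = S" using p01 by auto
 then have "measure fpi {0..1} = 1" using S by (simp add: measure_fpi)
 moreover have "(\<integral>x. x \<partial>fpi) = avg S p"
  unfolding fpi_def using S by (simp add: integral_distr integral_pmf_of_set avg_def)
 ultimately show ?thesis using a prob_fpi by (simp add: P_star_def)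
qed

lemma AE_fpi: "AE y in fpi. y \<in> p ` S"
proof -
 interpret prob_space fpi by (rule prob_fpi)
 have b: "p ` S \<in> sets borel" using S by (intro borel_closed finite_imp_closed) auto
 have "{x\<in>S. p x \<in> p ` S} = S" by auto
 then have "measure fpi (p ` S) = 1" using S b by (simp add: measure_fpi)
 then show ?thesis using b by (intro AE_prob_1) auto
qed

abbreviation PP :: "(nat => real) measure" where "PP \<equiv> (\<Pi>\<^sub>M i\<in>(UNIV::nat set). fpi)"

lemma PP_prob: "prob_space PP" by (intro prob_space_PiM prob_fpi)

lemma AE_PP: "AE \<rho> in PP. \<forall>j\<in>J. \<rho> j \<in> p ` S"
proof -
 interpret product_prob_space "%_ :: nat. fpi" UNIV
  by (simp add: product_prob_space_def product_prob_space_axioms_def product_sigma_finite_def prob_fpi prob_space_imp_sigma_finite)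
 have "AE \<rho> in PP. \<rho> j \<in> p ` S" for j using AE_component[of j "%y. y \<in> p ` S"] AE_fpi by simp
 then have "AE \<rho> in PP. \<forall>j. \<rho> j \<in> p ` S" by (simp add: AE_all_countable)
 then show ?thesis by (rule AE_mp) auto
qed

lemma sum_weighted_lsts:
 "(\<Sum>ys\<in>lsts r (p ` S). g ys * prod_list (map (%y. measure fpi {y}) ys)) = avg (lsts r S) (%xs. g (map p xs))"
proof (induction r arbitrary: g)
 case 0
 then show ?case by (simp add: lsts_0 avg_def)
next
 case (Suc r)
 have "(\<Sum>ys\<in>lsts (Suc r) (p ` S). g ys * prod_list (map (%y. measure fpi {y}) ys))
   = (\<Sum>y\<in>p ` S. measure fpi {y} * (\<Sum>ys\<in>lsts r (p ` S). g (y # ys) * prod_list (map (%y. measure fpi {y}) ys)))"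
  using S by (simp add: sum_lsts_Suc sum_distrib_left mult_ac)
 also have "... = (\<Sum>y\<in>p ` S. measure fpi {y} * avg (lsts r S) (%xs. g (y # map p xs)))"
  by (simp only: Suc[of "%ys. g (_ # ys)"])
 also have "... = (\<Sum>y\<in>p ` S. \<Sum>x\<in>{x\<in>S. p x = y}. avg (lsts r S) (%xs. g (p x # map p xs)) / real (card S))"
  by (intro sum.cong) (auto simp: measure_fpi)
 also have "... = (\<Sum>x\<in>S. avg (lsts r S) (%xs. g (p x # map p xs)) / real (card S))"
  using S by (intro sum.group) auto
 also have "... = avg (lsts (Suc r) S) (%xs. g (map p xs))"
  unfolding avg_lsts_Suc by (simp add: avg_def[of S] sum_divide_distrib)
 finally show ?case .
qed

lemma measure_PP_list:
 assumes js: "distinct js" "length ys = length js"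
 shows "measure PP {\<rho> \<in> space PP. map \<rho> js = ys} = prod_list (map (%y. measure fpi {y}) ys)"
  and "{\<rho> \<in> space PP. map \<rho> js = ys} \<in> sets PP"
proof -
 interpret product_prob_space "%_ :: nat. fpi" UNIV
  by (simp add: product_prob_space_def product_prob_space_axioms_def product_sigma_finite_def prob_fpi prob_space_imp_sigma_finite)
 define X where "X = (%j. {the (map_of (zip js ys) j)})"
 have Xn: "X (js ! i) = {ys ! i}" if "i < length js" for i
  using that js by (simp add: X_def map_of_zip_nth)
 have eq: "{\<rho> \<in> space PP. map \<rho> js = ys} = {\<rho> \<in> space PP. \<forall>j\<in>set js. \<rho> j \<in> X j}"
 proof -
  have "map \<rho> js = ys \<longleftrightarrow> (\<forall>j\<in>set js. \<rho> j \<in> X j)" for \<rho>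
   using js Xn by (simp add: list_eq_iff_nth_eq all_set_conv_all_nth)
  then show ?thesis by simp
 qed
 have "emeasure PP {\<rho> \<in> space PP. \<forall>j\<in>set js. \<rho> j \<in> X j} = (\<Prod>j\<in>set js. emeasure fpi (X j))"
  by (rule emeasure_PiM_Collect) (auto simp: X_def)
 then have "measure PP {\<rho> \<in> space PP. map \<rho> js = ys} = (\<Prod>j\<in>set js. measure fpi (X j))"
  unfolding eq measure_def by (simp add: M.emeasure_eq_measure prod_ennreal prod_nonneg measure_def[symmetric])
 also have "... = prod_list (map (%j. measure fpi (X j)) js)" using js by (simp add: prod.distinct_set_conv_list)
 also have "map (%j. measure fpi (X j)) js = map (%y. measure fpi {y}) ys"
  using js Xn by (auto simp: list_eq_iff_nth_eq)
 finally show "measure PP {\<rho> \<in> space PP. map \<rho> js = ys} = prod_list (map (%y. measure fpi {y}) ys)" .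
 show "{\<rho> \<in> space PP. map \<rho> js = ys} \<in> sets PP"
  unfolding eq X_def by measurable
qed

lemma PP_integral:
 assumes js: "distinct js" and m: "(%\<rho>. g (map \<rho> js)) \<in> borel_measurable PP"
 shows "(\<integral>\<rho>. g (map \<rho> js) \<partial>PP) = avg (lsts (length js) S) (%xs. g (map p xs))"
proof -
 interpret P: prob_space PP by (rule PP_prob)
 let ?Y = "lsts (length js) (p ` S)" and ?A = "%ys. {\<rho> \<in> space PP. map \<rho> js = ys}"
 have fY: "finite ?Y" using S by simp
 have A: "?A ys \<in> sets PP" if "ys \<in> ?Y" for ys using measure_PP_list(2)[OF js] that by (simp add: lsts_def)
 have "(\<integral>\<rho>. g (map \<rho> js) \<partial>PP) = (\<integral>\<rho>. (\<Sum>ys\<in>?Y. g ys * indicator (?A ys) \<rho>) \<partial>PP)"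
 proof (rule integral_cong_AE[OF m])
  show "(%\<rho>. \<Sum>ys\<in>?Y. g ys * indicator (?A ys) \<rho>) \<in> borel_measurable PP"
   using A by (intro borel_measurable_sum borel_measurable_times borel_measurable_indicator) auto
  show "AE \<rho> in PP. g (map \<rho> js) = (\<Sum>ys\<in>?Y. g ys * indicator (?A ys) \<rho>)"
  proof (rule AE_mp[OF AE_PP[of "set js"]], rule AE_I2, rule impI)
   fix \<rho> assume \<rho>: "\<rho> \<in> space PP" "\<forall>j\<in>set js. \<rho> j \<in> p ` S"
   then have mem: "map \<rho> js \<in> ?Y" by (auto simp: lsts_def)
   have "(\<Sum>ys\<in>?Y. g ys * indicator (?A ys) \<rho>) = (\<Sum>ys\<in>?Y. if ys = map \<rho> js then g ys else 0)"
    using \<rho>(1) by (intro sum.cong) (auto simp: indicator_def)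
   also have "... = g (map \<rho> js)" using fY mem by simp
   finally show "g (map \<rho> js) = (\<Sum>ys\<in>?Y. g ys * indicator (?A ys) \<rho>)" by simp
  qed
 qed
 also have "... = (\<Sum>ys\<in>?Y. g ys * measure PP (?A ys))"
  using A by (subst Bochner_Integration.integral_sum) (auto simp: P.emeasure_eq_measure)
 also have "... = (\<Sum>ys\<in>?Y. g ys * prod_list (map (%y. measure fpi {y}) ys))"
  using measure_PP_list(1)[OF js] by (intro sum.cong) (auto simp: lsts_def)
 also have "... = avg (lsts (length js) S) (%xs. g (map p xs))" by (rule sum_weighted_lsts)
 finally show ?thesis .
qed

end

primrec chunks :: "nat => nat => 'a list => 'a list list" where
 "chunks r 0 xs = []"
| "chunks r (Suc g) xs = take r xs # chunks r g (drop r xs)"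

lemma chunks_map: "chunks r g (map f xs) = map (map f) (chunks r g xs)"
 by (induction g arbitrary: xs) (auto simp: take_map drop_map)

lemma chunks_concat: "(\<forall>xs\<in>set xss. length xs = r) ==> chunks r (length xss) (concat xss) = xss"
 by (induction xss) auto

lemma avg_chunks:
 "avg (lsts g (lsts r S)) f = avg (lsts (g * r) S) (%xs. f (chunks r g xs))"
proof (induction g arbitrary: f)
 case (Suc g)
 have "avg (lsts (Suc g) (lsts r S)) f = avg (lsts r S) (%xs. avg (lsts (g * r) S) (%ys. f (xs # chunks r g ys)))"
  unfolding avg_lsts_Suc Suc ..
 also have "... = avg (lsts r S) (%xs. avg (lsts (g * r) S) (%ys. f (chunks r (Suc g) (xs @ ys))))"
  by (intro avg_cong) (simp add: lsts_def)
 also have "... = avg (lsts (r + g * r) S) (%xs. f (chunks r (Suc g) xs))"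
  by (rule avg_lsts_append[symmetric])
 finally show ?case by simp
qed simp

lemma concat_jss_distinct: "k >= 1 ==> distinct (concat (jss k \<gamma>))"
proof (induction \<gamma>)
 case (Suc \<gamma>)
 have "t < k * (\<gamma> + 1) + 1" if "t \<in> set (concat (jss k \<gamma>))" for t
 proof -
  have "\<exists>i\<in>set [1..<\<gamma> + 1]. t \<in> set [k * i + 1..<k * i + k]"
   using that unfolding jss_def set_concat set_map by blast
  then obtain i where "i \<in> set [1..<\<gamma> + 1]" "t \<in> set [k * i + 1..<k * i + k]" by blast
  then have i: "i <= \<gamma>" "t < k * i + k" by auto
  have "k * i <= k * \<gamma>" using i(1) by (rule mult_le_mono2)
  then show ?thesis using i(2) unfolding distrib_left by linarith
 qed
 moreover have "jss k (Suc \<gamma>) = jss k \<gamma> @ [[k * (\<gamma> + 1) + 1..<k * (\<gamma> + 1) + k]]" by (simp add: jss_def)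
 ultimately show ?case using Suc by fastforce
qed (simp add: jss_def)

lemma jss_lengths: "\<forall>js\<in>set (jss k \<gamma>). length js = k - 1" "length (jss k \<gamma>) = \<gamma>"
 by (auto simp: jss_def)

lemma length_concat_jss: "length (concat (jss k \<gamma>)) = \<gamma> * (k - 1)"
 by (induction \<gamma>) (auto simp: jss_def)

definition Vt :: "nat => 'a set => ('a => real) => nat => real" where
 "Vt k S p \<gamma> = avg (lsts \<gamma> (lsts (k - 1) S)) (%xss. Lam (Wl (map (map p) xss))) / (2 * qq k ^ \<gamma>)"

definition Ed :: "nat => 'a set => ('a => real) => real" where
 "Ed k S p = avg (lsts k S) (%xs. Lam (El (map p xs))) / qq k"


section \<open>Poisson averages\<close>

definition po :: "real => nat => real" where "po l m = l ^ m / fact m * exp (- l)"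

definition EP :: "real => (nat => real) => real" where "EP l f = (\<Sum>\<^sub>\<infinity>m. po l m * f m)"

lemma po_nonneg: "0 <= l ==> 0 <= po l m" unfolding po_def by simp

lemma po_power_has_sum: "0 <= l ==> 0 <= r ==> ((%m. po l m * r ^ m) has_sum exp (l * r - l)) UNIV"
proof -
 assume a: "0 <= l" "0 <= r"
 have "(%m. (l * r) ^ m /\<^sub>R fact m) sums exp (l * r)" by (rule exp_converges)
 then have "(%m. exp (- l) * ((l * r) ^ m /\<^sub>R fact m)) sums (exp (- l) * exp (l * r))" by (rule sums_mult)
 moreover have "(%m. exp (- l) * ((l * r) ^ m /\<^sub>R fact m)) = (%m. po l m * r ^ m)"
  by (simp add: po_def power_mult_distrib field_simps)
 moreover have "exp (- l) * exp (l * r) = exp (l * r - l)" by (simp add: exp_add[symmetric])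
 ultimately have "(%m. po l m * r ^ m) sums exp (l * r - l)" by (simp only:)
 then show ?thesis using a by (intro sums_nonneg_imp_has_sum_strong) (auto simp: po_nonneg)
qed

lemma po_summable:
 assumes "0 <= l" "0 <= r" "!!m. \<bar>f m\<bar> <= C * r ^ m"
 shows "(%m. po l m * f m) summable_on UNIV"
proof (rule norm_summable_imp_summable_on)
 have "(%m. po l m * r ^ m) summable_on UNIV" using po_power_has_sum[OF assms(1,2)] by (rule has_sum_imp_summable)
 then have "summable (%m. C * (po l m * r ^ m))" by (intro summable_mult summable_on_imp_summable)
 then show "summable (%m. norm (po l m * f m))"
 proof (rule summable_comparison_test')
  fix m
  have "po l m * \<bar>f m\<bar> <= po l m * (C * r ^ m)" using assms po_nonneg by (intro mult_left_mono) auto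
  then show "norm (norm (po l m * f m)) <= C * (po l m * r ^ m)" using po_nonneg[OF assms(1)] by (simp add: abs_mult mult_ac)
 qed
qed

lemma EP_power: "0 <= l ==> 0 <= r ==> EP l (%m. r ^ m) = exp (l * r - l)"
 unfolding EP_def by (rule infsumI) (rule po_power_has_sum)

lemma EP_const: "0 <= l ==> EP l (%_. c) = c"
 using EP_power[of l 1] unfolding EP_def by (simp add: infsum_cmult_left')

lemma EP_cmult: "EP l (%m. c * f m) = c * EP l f"
proof -
 have "(%m. po l m * (c * f m)) = (%m. c * (po l m * f m))" by (simp add: mult_ac)
 then show ?thesis unfolding EP_def by (simp only: infsum_cmult_right')
qed

lemma EP_add:
 "(%m. po l m * f m) summable_on UNIV ==> (%m. po l m * g m) summable_on UNIV ==> EP l (%m. f m + g m) = EP l f + EP l g"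
 unfolding EP_def distrib_left by (rule infsum_add)

lemma EP_mono:
 "0 <= l ==> (%m. po l m * f m) summable_on UNIV ==> (%m. po l m * g m) summable_on UNIV ==> (!!m. f m <= g m) ==> EP l f <= EP l g"
 unfolding EP_def by (intro infsum_mono mult_left_mono po_nonneg) auto

lemma integral_poisson:
 assumes l: "0 < l" and r: "0 <= r" "!!m. \<bar>f m\<bar> <= C * r ^ m"
 shows "integrable (measure_pmf (poisson_pmf l)) f" "(\<integral>m. f m \<partial>measure_pmf (poisson_pmf l)) = EP l f"
proof -
 have pm: "pmf (poisson_pmf l) m = po l m" for m using l by (simp add: po_def)
 have n: "summable (%m. norm (po l m * f m))"
 proof -
  have "(%m. po l m * \<bar>f m\<bar>) summable_on UNIV" using l r by (intro po_summable[of l r _ C]) auto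
  then have "summable (%m. po l m * \<bar>f m\<bar>)" by (rule summable_on_imp_summable)
  then show ?thesis using l by (simp add: abs_mult po_nonneg less_imp_le)
 qed
 have d: "measure_pmf (poisson_pmf l) = density (count_space UNIV) (%m. ennreal (po l m))"
  unfolding measure_pmf_eq_density pm ..
 have i: "integrable (count_space UNIV) (%m. po l m * f m)"
  using n by (simp add: integrable_count_space_nat_iff)
 show "integrable (measure_pmf (poisson_pmf l)) f"
  unfolding d using i l by (subst integrable_density) (auto simp: po_nonneg)
 have "(\<integral>m. f m \<partial>measure_pmf (poisson_pmf l)) = (\<integral>m. po l m * f m \<partial>count_space UNIV)"
  unfolding d using l by (subst integral_density) (auto simp: po_nonneg)
 also have "... = (\<Sum>m. po l m * f m)" by (rule integral_count_space_nat[OF i])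
 also have "... = EP l f" unfolding EP_def
  by (rule infsumI[symmetric], rule norm_summable_imp_has_sum[OF n]) (use n in \<open>simp add: summable_sums summable_norm_cancel\<close>)
 finally show "(\<integral>m. f m \<partial>measure_pmf (poisson_pmf l)) = EP l f" .
qed

lemma lsts_lsts_mem: "xss \<in> lsts \<gamma> (lsts r S) ==> ys \<in> set xss ==> y \<in> set ys ==> y \<in> S"
proof -
 assume a: "xss \<in> lsts \<gamma> (lsts r S)" "ys \<in> set xss" "y \<in> set ys"
 then have "ys \<in> lsts r S" unfolding lsts_def[of \<gamma>] by blast
 then show "y \<in> S" using a unfolding lsts_def by blast
qed

lemma Vt_bound:
 assumes k: "k >= 3" and S: "finite S" "S ~= {}" and p01: "!!x. x \<in> S ==> 0 <= p x & p x <= 1"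
 shows "\<bar>Vt k S p \<gamma>\<bar> <= (1 / qq k) ^ \<gamma>"
proof -
 let ?L = "lsts \<gamma> (lsts (k - 1) S)"
 have q: "3/4 <= qq k" using qq_bounds(1)[OF k] .
 have "\<bar>avg ?L (%xss. Lam (Wl (map (map p) xss)))\<bar> <= avg ?L (%xss. \<bar>Lam (Wl (map (map p) xss))\<bar>)"
  by (rule avg_abs)
 also have "... <= 2"
 proof (rule avg_le)
  fix xss assume x: "xss \<in> ?L"
  have b: "\<forall>ys\<in>set (map (map p) xss). \<forall>y\<in>set ys. 0 <= y & y <= 1"
   using p01 lsts_lsts_mem[OF x] by auto
  show "\<bar>Lam (Wl (map (map p) xss))\<bar> <= 2" by (intro Lam_abs_le Wl_bounds b)
 qed (use S in auto)
 finally have A: "\<bar>avg ?L (%xss. Lam (Wl (map (map p) xss)))\<bar> <= 2" .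
 show ?thesis using divide_right_mono[OF A, of "2 * qq k ^ \<gamma>"] q unfolding Vt_def by (simp add: abs_divide power_divide)
qed

lemma integral_lin:
 fixes a b :: "'b => real"
 shows "integrable M a ==> integrable M b ==> (\<integral>x. a x / u - c * b x \<partial>M) = (\<integral>x. a x \<partial>M) / u - c * (\<integral>x. b x \<partial>M)"
 by simp

lemma B_fpi:
 fixes S :: "'a set"
 assumes k: "k >= 3" and d: "0 < d" and S: "finite S" "S ~= {}" and p01: "!!x. x \<in> S ==> 0 <= p x & p x <= 1"
 shows "B k d (fpi S p) = EP d (Vt k S p) - d * (real k - 1) / real k * Ed k S p"
proof -
 have q: "3/4 <= qq k" using qq_bounds(1)[OF k] .
 have k1: "1 <= k" using k by simp
 let ?PP = "\<Pi>\<^sub>M i\<in>(UNIV::nat set). fpi S p"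
 interpret P: prob_space ?PP by (rule PP_prob) (use S p01 in auto)
 have AP: "AE \<rho> in ?PP. \<forall>j\<in>UNIV. \<rho> j \<in> p ` S" by (rule AE_PP) (use S p01 in auto)
 have sf: "sets (fpi S p) = sets borel" by (rule sets_fpi) (use S p01 in auto)
 let ?po = "measure_pmf (poisson_pmf d)"
 interpret pair_sigma_finite ?po ?PP
  by (intro pair_sigma_finite.intro measure_pmf.sigma_finite_measure_axioms P.sigma_finite_measure_axioms)
 let ?c = "d * (real k - 1) / (real k * qq k)"
 have comp [measurable]: "(%\<rho>. \<rho> i) \<in> borel_measurable ?PP" for i
  by (subst measurable_cong_sets[OF refl sf[symmetric]]) auto
 have mW: "(%\<rho>. Lam (Wl (map (map \<rho>) (jss k \<gamma>)))) \<in> borel_measurable ?PP" for \<gamma>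
  unfolding Wl_jss[OF k1] by measurable
 have mE: "(%\<rho>. Lam (El (map \<rho> [1..<k + 1]))) \<in> borel_measurable ?PP"
  unfolding El_upt by measurable
 have AEW: "AE \<rho> in ?PP. norm (Lam (Wl (map (map \<rho>) (jss k \<gamma>)))) <= 2" for \<gamma>
  using AP
 proof eventually_elim
  case (elim \<rho>)
  then have "!!j. 0 <= \<rho> j & \<rho> j <= 1" using p01 by (metis UNIV_I imageE)
  then show ?case
   unfolding real_norm_def by (intro Lam_abs_le Wl_bounds) auto
 qed
 have AEE: "AE \<rho> in ?PP. norm (Lam (El (map \<rho> [1..<k + 1]))) <= 2"
  using AP
 proof eventually_elim
  case (elim \<rho>)
  then have "!!j. 0 <= \<rho> j & \<rho> j <= 1" using p01 by (metis UNIV_I imageE)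
  then have "0 <= El (map \<rho> [1..<k + 1])" "El (map \<rho> [1..<k + 1]) <= 1" using k by (intro El_bounds; auto)+
  then show ?case
   unfolding real_norm_def by (intro Lam_abs_le) auto
 qed
 have iW: "integrable ?PP (%\<rho>. Lam (Wl (map (map \<rho>) (jss k \<gamma>))))" for \<gamma>
  by (rule P.integrable_const_bound[OF AEW mW])
 have iE: "integrable ?PP (%\<rho>. Lam (El (map \<rho> [1..<k + 1])))"
  by (rule P.integrable_const_bound[OF AEE mE])
 have H: "B_integrand k d (\<gamma>, \<rho>) = Lam (Wl (map (map \<rho>) (jss k \<gamma>))) / (2 * qq k ^ \<gamma>) - ?c * Lam (El (map \<rho> [1..<k + 1]))" for \<gamma> \<rho>
  using k by (simp add: B_integrand_eq)
 have iH: "integrable ?PP (%\<rho>. B_integrand k d (\<gamma>, \<rho>))" for \<gamma>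
  unfolding H using iW iE by (intro Bochner_Integration.integrable_diff integrable_divide_zero integrable_mult_right) auto
 have Wint: "(\<integral>\<rho>. Lam (Wl (map (map \<rho>) (jss k \<gamma>))) \<partial>?PP) = avg (lsts \<gamma> (lsts (k - 1) S)) (%xss. Lam (Wl (map (map p) xss)))" for \<gamma>
 proof -
  have e: "map (map \<rho>) (jss k \<gamma>) = chunks (k - 1) \<gamma> (map \<rho> (concat (jss k \<gamma>)))" for \<rho> :: "nat => real"
   unfolding chunks_map using chunks_concat[OF jss_lengths(1), of k \<gamma>] by (simp add: jss_lengths(2))
  have "(\<integral>\<rho>. (%ys. Lam (Wl (chunks (k - 1) \<gamma> ys))) (map \<rho> (concat (jss k \<gamma>))) \<partial>?PP)
    = avg (lsts (length (concat (jss k \<gamma>))) S) (%xs. (%ys. Lam (Wl (chunks (k - 1) \<gamma> ys))) (map p xs))"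
  proof (rule PP_integral)
   show "finite S" "S ~= {}" by (rule S)+
   show "0 <= p x & p x <= 1" if "x \<in> S" for x by (rule p01[OF that])
   show "distinct (concat (jss k \<gamma>))" using k by (intro concat_jss_distinct) auto
   show "(%\<rho>. Lam (Wl (chunks (k - 1) \<gamma> (map \<rho> (concat (jss k \<gamma>)))))) \<in> borel_measurable ?PP"
    using mW[of \<gamma>] unfolding e .
  qed
  moreover have "Lam (Wl (map (map p) (chunks (k - 1) \<gamma> xs))) = (%ys. Lam (Wl (chunks (k - 1) \<gamma> ys))) (map p xs)" for xs
   by (simp only: chunks_map)
  ultimately show ?thesis unfolding e avg_chunks length_concat_jss by (simp only:)
 qed
 have Eint: "(\<integral>\<rho>. Lam (El (map \<rho> [1..<k + 1])) \<partial>?PP) = qq k * Ed k S p"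
 proof -
  have "(\<integral>\<rho>. (%ys. Lam (El ys)) (map \<rho> [1..<k + 1]) \<partial>?PP)
    = avg (lsts (length [1..<k + 1]) S) (%xs. (%ys. Lam (El ys)) (map p xs))"
  proof (rule PP_integral)
   show "finite S" "S ~= {}" by (rule S)+
   show "0 <= p x & p x <= 1" if "x \<in> S" for x by (rule p01[OF that])
   show "(%\<rho>. Lam (El (map \<rho> [1..<k + 1]))) \<in> borel_measurable ?PP" by (rule mE)
  qed simp
  then show ?thesis using q by (simp add: Ed_def del: upt_Suc)
 qed
 have Hint: "(\<integral>\<rho>. B_integrand k d (\<gamma>, \<rho>) \<partial>?PP) = Vt k S p \<gamma> - ?c * (qq k * Ed k S p)" for \<gamma>
  unfolding H integral_lin[OF iW iE] Wint Eint Vt_def ..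
 have ib: "(\<integral>\<rho>. norm (B_integrand k d (\<gamma>, \<rho>)) \<partial>?PP) <= (1 + 2 * \<bar>?c\<bar>) * (1 / qq k) ^ \<gamma>" for \<gamma>
 proof -
  have g1: "1 <= (1 / qq k) ^ \<gamma>" using q qq_bounds(2)[OF k] by (intro one_le_power) (auto simp: le_divide_eq)
  have "AE \<rho> in ?PP. norm (B_integrand k d (\<gamma>, \<rho>)) <= (1 + 2 * \<bar>?c\<bar>) * (1 / qq k) ^ \<gamma>"
   using AEW[of \<gamma>] AEE
  proof eventually_elim
   case (elim \<rho>)
   have "norm (B_integrand k d (\<gamma>, \<rho>)) <= \<bar>Lam (Wl (map (map \<rho>) (jss k \<gamma>))) / (2 * qq k ^ \<gamma>)\<bar> + \<bar>?c * Lam (El (map \<rho> [1..<k + 1]))\<bar>"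
    unfolding H real_norm_def by (rule abs_triangle_ineq4)
   also have "\<bar>Lam (Wl (map (map \<rho>) (jss k \<gamma>))) / (2 * qq k ^ \<gamma>)\<bar> <= 2 / (2 * qq k ^ \<gamma>)"
    using divide_right_mono[OF elim(1)[unfolded real_norm_def], of "2 * qq k ^ \<gamma>"] q by (simp add: abs_divide)
   also have "2 / (2 * qq k ^ \<gamma>) = (1 / qq k) ^ \<gamma>" by (simp add: power_divide)
   also have "\<bar>?c * Lam (El (map \<rho> [1..<k + 1]))\<bar> <= \<bar>?c\<bar> * 2" using elim unfolding abs_mult by (intro mult_left_mono) auto
   also have "\<bar>?c\<bar> * 2 <= \<bar>?c\<bar> * 2 * (1 / qq k) ^ \<gamma>" using g1 mult_left_mono[of 1 "(1 / qq k) ^ \<gamma>" "\<bar>?c\<bar> * 2"] by simp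
   finally show ?case by (simp add: algebra_simps)
  qed
  then have "(\<integral>\<rho>. norm (B_integrand k d (\<gamma>, \<rho>)) \<partial>?PP) <= (\<integral>\<rho>. (1 + 2 * \<bar>?c\<bar>) * (1 / qq k) ^ \<gamma> \<partial>?PP)"
   using iH by (intro integral_mono_AE) auto
  then show ?thesis by (simp add: P.prob_space)
 qed
 have iP: "integrable (?po \<Otimes>\<^sub>M ?PP) (B_integrand k d)"
 proof (rule Fubini_integrable)
  have "B_integrand k d \<in> borel_measurable (count_space UNIV \<Otimes>\<^sub>M ?PP)"
   using iH by (intro measurable_pair_measure_countable1) auto
  then show "B_integrand k d \<in> borel_measurable (?po \<Otimes>\<^sub>M ?PP)"
   by (subst measurable_cong_sets[OF sets_pair_measure_cong[OF sets_measure_pmf_count_space refl] refl])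
  show "integrable ?po (%\<gamma>. \<integral>\<rho>. norm (B_integrand k d (\<gamma>, \<rho>)) \<partial>?PP)"
   using ib q by (intro integral_poisson(1)[OF d, of "1 / qq k" _ "1 + 2 * \<bar>?c\<bar>"]) auto
  show "AE \<gamma> in ?po. integrable ?PP (%\<rho>. B_integrand k d (\<gamma>, \<rho>))" using iH by simp
 qed
 have Vb: "\<bar>Vt k S p \<gamma>\<bar> <= 1 * (1 / qq k) ^ \<gamma>" for \<gamma>
  using Vt_bound[of k S p \<gamma>] k S p01 by simp
 have "B k d (fpi S p) = (\<integral>\<gamma>. \<integral>\<rho>. B_integrand k d (\<gamma>, \<rho>) \<partial>?PP \<partial>?po)"
  unfolding B_def using integral_fst'[OF iP] by simp
 also have "... = (\<integral>\<gamma>. Vt k S p \<gamma> - ?c * (qq k * Ed k S p) \<partial>?po)" unfolding Hint ..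
 also have "... = (\<integral>\<gamma>. Vt k S p \<gamma> \<partial>?po) - ?c * (qq k * Ed k S p)"
  using Vb q by (subst Bochner_Integration.integral_diff) (auto intro!: integral_poisson(1)[OF d, of "1 / qq k" _ 1])
 also have "(\<integral>\<gamma>. Vt k S p \<gamma> \<partial>?po) = EP d (Vt k S p)"
  using Vb q by (intro integral_poisson(2)[OF d, of "1 / qq k" _ 1]) auto
 finally show ?thesis using q by simp
qed

lemma EP_thin:
 assumes l: "0 <= l" and p: "0 <= p" "p <= 1" and r: "0 <= r" and g: "!!i j. \<bar>g i j\<bar> <= C * r ^ (i + j)"
 shows "EP l (%m. \<Sum>i\<le>m. real (m choose i) * p ^ i * (1 - p) ^ (m - i) * g i (m - i)) = EP (l * p) (%i. EP (l * (1 - p)) (g i))"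
proof -
 define a b where "a = l * p" and "b = l * (1 - p)"
 have ab: "0 <= a" "0 <= b" using l p by (auto simp: a_def b_def)
 define h where "h = (%x. po a (fst x) * (po b (snd x) * g (fst x) (snd x)))"
 define u where "u = (%x::nat \<times> nat. (po a (fst x) * r ^ fst x) * (po b (snd x) * r ^ snd x))"
 have su: "u summable_on (UNIV \<times> UNIV)"
 proof (rule summable_on_SigmaI)
  fix i :: nat
  show "((%j. u (i, j)) has_sum (po a i * r ^ i) * exp (b * r - b)) UNIV"
   unfolding u_def fst_conv snd_conv by (intro has_sum_cmult_right po_power_has_sum ab r)
 next
  show "(%i. (po a i * r ^ i) * exp (b * r - b)) summable_on UNIV"
   by (intro summable_on_cmult_left has_sum_imp_summable[OF po_power_has_sum[OF ab(1) r]])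
 qed (auto simp: u_def ab r po_nonneg)
 have sh: "h summable_on (UNIV \<times> UNIV)"
 proof (rule summable_on_iff_abs_summable_on_real[THEN iffD2], rule summable_on_comparison_test)
  show "(%x. C * u x) summable_on UNIV \<times> UNIV" by (intro summable_on_cmult_right su)
  fix x :: "nat \<times> nat"
  have "\<bar>h x\<bar> = (po a (fst x) * po b (snd x)) * \<bar>g (fst x) (snd x)\<bar>"
   unfolding h_def using ab by (simp add: abs_mult po_nonneg)
  also have "... <= (po a (fst x) * po b (snd x)) * (C * r ^ (fst x + snd x))"
   using ab by (intro mult_left_mono g mult_nonneg_nonneg po_nonneg)
  also have "... = C * u x" by (simp add: u_def power_add mult_ac)
  finally show "norm (h x) <= C * u x" by simp
 qed auto
 have "infsum h (UNIV \<times> UNIV) = infsum (%i. infsum (%j. h (i, j)) UNIV) UNIV"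
  using infsum_Sigma_banach[OF sh] by simp
 also have "... = EP a (%i. EP b (g i))"
  unfolding EP_def h_def fst_conv snd_conv by (simp add: infsum_cmult_right')
 finally have R: "infsum h (UNIV \<times> UNIV) = EP a (%i. EP b (g i))" .
 define h' where "h' = (%(m, i). h (i, m - i))"
 define be where "be = (%(i, j). (i + j, i :: nat))"
 have bij: "bij_betw be (UNIV \<times> UNIV) (Sigma UNIV (%m. {..m}))"
  by (rule bij_betw_byWitness[where f' = "%(m, i). (i, m - i)"]) (auto simp: be_def)
 have hb: "h' (be x) = h x" for x by (cases x) (simp add: h'_def be_def)
 have sh': "h' summable_on Sigma UNIV (%m. {..m})"
  using summable_on_reindex_bij_betw[OF bij, of h'] sh unfolding hb by simp
 have "infsum h (UNIV \<times> UNIV) = infsum h' (Sigma UNIV (%m. {..m}))"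
  using infsum_reindex_bij_betw[OF bij, of h'] unfolding hb .
 also have "... = infsum (%m. infsum (%i. h' (m, i)) {..m}) UNIV"
  using infsum_Sigma_banach[OF sh'] by simp
 also have "... = EP l (%m. \<Sum>i\<le>m. real (m choose i) * p ^ i * (1 - p) ^ (m - i) * g i (m - i))"
  unfolding EP_def
 proof (rule infsum_cong)
  fix m :: nat
  have "infsum (%i. h' (m, i)) {..m} = (\<Sum>i\<le>m. h (i, m - i))" by (simp add: h'_def)
  also have "... = po l m * (\<Sum>i\<le>m. real (m choose i) * p ^ i * (1 - p) ^ (m - i) * g i (m - i))"
   unfolding sum_distrib_left
  proof (rule sum.cong[OF refl])
   fix i assume "i \<in> {..m}"
   then have i: "i <= m" by simp
   have "po a i * po b (m - i) = po l m * (real (m choose i) * p ^ i * (1 - p) ^ (m - i))"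
   proof -
    have e: "exp (- a) * exp (- b) = exp (- l)" unfolding a_def b_def by (simp add: exp_add[symmetric] algebra_simps)
    have lm: "l ^ m = l ^ i * l ^ (m - i)" using i by (simp flip: power_add)
    have "po a i * po b (m - i) = (a ^ i * b ^ (m - i)) / (fact i * fact (m - i)) * (exp (- a) * exp (- b))"
     by (simp add: po_def)
    also have "a ^ i * b ^ (m - i) = l ^ m * (p ^ i * (1 - p) ^ (m - i))"
     unfolding a_def b_def lm by (simp add: power_mult_distrib)
    finally show ?thesis unfolding e binomial_fact[OF i] by (simp add: po_def)
   qed
   then show "h (i, m - i) = po l m * (real (m choose i) * p ^ i * (1 - p) ^ (m - i) * g i (m - i))"
    unfolding h_def fst_conv snd_conv by (simp only: mult.assoc[symmetric])
  qed
  finally show "infsum (%i. h' (m, i)) {..m} = po l m * (\<Sum>i\<le>m. real (m choose i) * p ^ i * (1 - p) ^ (m - i) * g i (m - i))" .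
 qed
 finally show ?thesis using R by (simp add: a_def b_def)
qed

lemma binom_sum_Suc:
 fixes h :: "nat => nat => real"
 shows "(\<Sum>i\<le>Suc m. real (Suc m choose i) * p ^ i * s ^ (Suc m - i) * h i (Suc m - i))
  = p * (\<Sum>i\<le>m. real (m choose i) * p ^ i * s ^ (m - i) * h (Suc i) (m - i))
  + s * (\<Sum>i\<le>m. real (m choose i) * p ^ i * s ^ (m - i) * h i (Suc (m - i)))"
proof -
 let ?t = "%c i. c * p ^ i * s ^ (Suc m - i) * h i (Suc m - i)"
 have A: "(\<Sum>i\<le>Suc m. ?t (real (Suc m choose i)) i) = ?t 1 0 + (\<Sum>i\<le>m. ?t (real (Suc m choose Suc i)) (Suc i))"
  by (subst sum.atMost_Suc_shift) simp
 have B: "(\<Sum>i\<le>m. ?t (real (Suc m choose Suc i)) (Suc i)) = (\<Sum>i\<le>m. ?t (real (m choose i)) (Suc i)) + (\<Sum>i\<le>m. ?t (real (m choose Suc i)) (Suc i))"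
  by (simp add: sum.distrib[symmetric] algebra_simps)
 have C: "(\<Sum>i\<le>Suc m. ?t (real (m choose i)) i) = ?t 1 0 + (\<Sum>i\<le>m. ?t (real (m choose Suc i)) (Suc i))"
  by (subst sum.atMost_Suc_shift) simp
 have D: "(\<Sum>i\<le>Suc m. ?t (real (m choose i)) i) = (\<Sum>i\<le>m. ?t (real (m choose i)) i)" by simp
 have E: "(\<Sum>i\<le>m. ?t (real (m choose i)) i) = s * (\<Sum>i\<le>m. real (m choose i) * p ^ i * s ^ (m - i) * h i (Suc (m - i)))"
  unfolding sum_distrib_left by (intro sum.cong) (auto simp: Suc_diff_le)
 have G: "(\<Sum>i\<le>m. ?t (real (m choose i)) (Suc i)) = p * (\<Sum>i\<le>m. real (m choose i) * p ^ i * s ^ (m - i) * h (Suc i) (m - i))"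
  unfolding sum_distrib_left by (intro sum.cong) auto
 show ?thesis using A B C D E G by linarith
qed

lemma avg_union:
 assumes "finite A" "finite T" "A \<inter> T = {}" "A ~= {}" "T ~= {}"
 shows "avg (A \<union> T) f = real (card A) / real (card (A \<union> T)) * avg A f + (1 - real (card A) / real (card (A \<union> T))) * avg T f"
proof -
 have c: "card (A \<union> T) = card A + card T" using assms by (simp add: card_Un_disjoint)
 have p: "real (card A) > 0" "real (card T) > 0" using assms by (auto simp: card_gt_0_iff)
 have "1 - real (card A) / (real (card A) + real (card T)) = real (card T) / (real (card A) + real (card T))"
  using p by (simp add: field_simps)
 then show ?thesis using p assms unfolding avg_def c by (simp add: sum.union_disjoint add_divide_distrib)
qed

lemma avg_lsts_union:
 assumes AT: "finite A" "finite T" "A \<inter> T = {}" "A ~= {}" "T ~= {}"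
  and sym: "!!F G. mset F = mset G ==> f F = f G"
 defines "p \<equiv> real (card A) / real (card (A \<union> T))"
 shows "avg (lsts m (A \<union> T)) f = (\<Sum>i\<le>m. real (m choose i) * p ^ i * (1 - p) ^ (m - i)
   * avg (lsts i A) (%F. avg (lsts (m - i) T) (%G. f (F @ G))))"
 using sym
proof (induction m arbitrary: f)
 case 0
 show ?case by simp
next
 case (Suc m)
 define h where "h = (%i j. avg (lsts i A) (%F. avg (lsts j T) (%G. f (F @ G))))"
 have IH: "avg (lsts m (A \<union> T)) (%xs. f (x # xs)) = (\<Sum>i\<le>m. real (m choose i) * p ^ i * (1 - p) ^ (m - i)
   * avg (lsts i A) (%F. avg (lsts (m - i) T) (%G. f (x # F @ G))))" for x
  by (rule Suc.IH) (auto intro: Suc.prems)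
 have hA: "avg A (%x. avg (lsts i A) (%F. avg (lsts j T) (%G. f (x # F @ G)))) = h (Suc i) j" for i j
  unfolding h_def avg_lsts_Suc by simp
 have hT: "avg T (%x. avg (lsts i A) (%F. avg (lsts j T) (%G. f (x # F @ G)))) = h i (Suc j)" for i j
 proof -
  have "avg T (%x. avg (lsts i A) (%F. avg (lsts j T) (%G. f (x # F @ G))))
    = avg T (%x. avg (lsts i A) (%F. avg (lsts j T) (%G. f (F @ x # G))))"
   by (intro avg_cong Suc.prems) simp
  also have "... = h i (Suc j)" unfolding h_def avg_lsts_Suc by (rule avg_swap)
  finally show ?thesis .
 qed
 have "avg (lsts (Suc m) (A \<union> T)) f
   = p * avg A (%x. avg (lsts m (A \<union> T)) (%xs. f (x # xs))) + (1 - p) * avg T (%x. avg (lsts m (A \<union> T)) (%xs. f (x # xs)))"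
  unfolding avg_lsts_Suc p_def by (rule avg_union[OF AT])
 also have "... = p * (\<Sum>i\<le>m. real (m choose i) * p ^ i * (1 - p) ^ (m - i) * h (Suc i) (m - i))
   + (1 - p) * (\<Sum>i\<le>m. real (m choose i) * p ^ i * (1 - p) ^ (m - i) * h i (Suc (m - i)))"
  unfolding IH avg_sum avg_cmult hA hT ..
 also have "... = (\<Sum>i\<le>Suc m. real (Suc m choose i) * p ^ i * (1 - p) ^ (Suc m - i) * h i (Suc m - i))"
  by (rule binom_sum_Suc[symmetric])
 finally show ?case unfolding h_def .
qed

lemma EP_exp_bound:
 assumes l: "0 <= l" and f: "!!m. 0 <= f m" "!!m. f m <= C * r ^ m" "!!m. f m <= 1" and r: "0 <= r"
 shows "EP l f <= C * exp (l * r - l)"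
proof -
 have s: "(%m. po l m * (C * r ^ m)) summable_on UNIV"
 proof (rule po_summable[OF l r])
  show "\<bar>C * r ^ m\<bar> <= \<bar>C\<bar> * r ^ m" for m using r by (simp add: abs_mult)
 qed
 have "EP l f <= EP l (%m. C * r ^ m)"
  using f by (intro EP_mono l s po_summable[OF l, of 1 _ 1]) (auto simp: abs_le_iff intro: order_trans[of _ 0])
 also have "... = C * exp (l * r - l)" unfolding EP_cmult using EP_power[OF l r] by simp
 finally show ?thesis .
qed

lemma po_lower_tail:
 assumes "0 < c" "D < c" "0 < \<epsilon>"
 shows "\<forall>\<^sub>F n in sequentially. EP (c * real n) (%m. of_bool (real m <= D * real n)) <= \<epsilon>"
proof -
 define x where "x = min 1 ((c - D) / (2 * c))"
 have x: "0 < x" "x <= 1" "x * c <= (c - D) / 2" using assms by (auto simp: x_def min_def field_simps)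
 define y where "y = x * ((c - D) / 2)"
 have y: "0 < y" using x assms by (simp add: y_def)
 have ex: "exp (- x) <= 1 - x + x\<^sup>2"
 proof -
  have "1 + x <= exp x" by (rule exp_ge_add_one_self)
  then have "exp (- x) <= 1 / (1 + x)" using x by (simp add: exp_minus inverse_eq_divide frac_le)
  also have "... <= 1 - x + x\<^sup>2"
  proof -
   have "(1 - x + x\<^sup>2) * (1 + x) = 1 + x * x\<^sup>2" by (simp add: power2_eq_square algebra_simps)
   moreover have "0 <= x * x\<^sup>2" using x by simp
   ultimately show ?thesis using x by (subst pos_divide_le_eq) auto
  qed
  finally show ?thesis .
 qed
 have b: "EP (c * real n) (%m. of_bool (real m <= D * real n)) <= exp (- y * real n)" for n
 proof -
  have "EP (c * real n) (%m. of_bool (real m <= D * real n)) <= exp (x * D * real n) * exp (c * real n * exp (- x) - c * real n)"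
  proof (rule EP_exp_bound)
   show "of_bool (real m <= D * real n) <= exp (x * D * real n) * exp (- x) ^ m" for m
   proof (cases "real m <= D * real n")
    case True
    have "exp (- x) ^ m = exp (- x * real m)" by (simp flip: exp_of_nat_mult add: mult.commute)
    then have "exp (x * D * real n) * exp (- x) ^ m = exp (x * (D * real n - real m))" by (simp add: exp_add[symmetric] algebra_simps)
    also have "... >= 1" using True x by simp
    finally show ?thesis using True by simp
   qed simp
  qed (use assms in auto)
  also have "... = exp (real n * (x * D + c * (exp (- x) - 1)))" by (simp add: exp_add[symmetric] algebra_simps)
  also have "... <= exp (- y * real n)"
  proof (subst exp_le_cancel_iff)
   have "c * (exp (- x) - 1) <= c * (x\<^sup>2 - x)" using ex assms by (intro mult_left_mono) auto
   then have "x * D + c * (exp (- x) - 1) <= x * (D - c + x * c)" by (simp add: power2_eq_square algebra_simps)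
   also have "... <= x * (- ((c - D) / 2))"
   proof (rule mult_left_mono)
    have "D - c + x * c <= D - c + (c - D) / 2" using x(3) by (rule add_left_mono)
    also have "... = - ((c - D) / 2)" by (simp add: field_simps)
    finally show "D - c + x * c <= - ((c - D) / 2)" .
   qed (use x in auto)
   also have "... = - y" unfolding y_def by (rule mult_minus_right)
   finally have "real n * (x * D + c * (exp (- x) - 1)) <= real n * (- y)" by (intro mult_left_mono) auto
   then show "real n * (x * D + c * (exp (- x) - 1)) <= - y * real n" by (simp add: mult.commute)
  qed
  finally show ?thesis .
 qed
 have "(%n. exp (- y * real n)) \<longlonglongrightarrow> 0" using y by real_asymp
 then have "\<forall>\<^sub>F n in sequentially. exp (- y * real n) < \<epsilon>" using assms by (intro order_tendstoD(2)) auto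
 then show ?thesis
 proof eventually_elim
  case (elim n)
  then show ?case using b[of n] by linarith
 qed
qed

lemma po_upper_tail:
 assumes "0 < c" "c < D" "0 < \<epsilon>"
 shows "\<forall>\<^sub>F n in sequentially. EP (c * real n) (%m. of_bool (~ real m <= D * real n)) <= \<epsilon>"
proof -
 define x where "x = min 1 ((D - c) / (2 * c))"
 have x: "0 < x" "x <= 1" "x * c <= (D - c) / 2" using assms by (auto simp: x_def min_def field_simps)
 define y where "y = x * ((D - c) / 2)"
 have y: "0 < y" using x assms by (simp add: y_def)
 have ex: "exp x <= 1 + x + x\<^sup>2" using x by (intro exp_bound) auto
 have b: "EP (c * real n) (%m. of_bool (~ real m <= D * real n)) <= exp (- y * real n)" for n
 proof -
  have "EP (c * real n) (%m. of_bool (~ real m <= D * real n)) <= exp (- x * D * real n) * exp (c * real n * exp x - c * real n)"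
  proof (rule EP_exp_bound)
   show "of_bool (~ real m <= D * real n) <= exp (- x * D * real n) * exp x ^ m" for m
   proof (cases "real m <= D * real n")
    case False
    have "exp x ^ m = exp (x * real m)" by (simp flip: exp_of_nat_mult add: mult.commute)
    then have "exp (- x * D * real n) * exp x ^ m = exp (x * (real m - D * real n))" by (simp add: exp_add[symmetric] algebra_simps)
    also have "... >= 1" using False x by simp
    finally show ?thesis using False by simp
   qed simp
  qed (use assms in auto)
  also have "... = exp (real n * (c * (exp x - 1) - x * D))" by (simp add: exp_add[symmetric] algebra_simps)
  also have "... <= exp (- y * real n)"
  proof (subst exp_le_cancel_iff)
   have "c * (exp x - 1) <= c * (x + x\<^sup>2)" using ex assms by (intro mult_left_mono) auto
   then have "c * (exp x - 1) - x * D <= x * (c - D + x * c)" by (simp add: power2_eq_square algebra_simps)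
   also have "... <= x * (- ((D - c) / 2))"
   proof (rule mult_left_mono)
    have "c - D + x * c <= c - D + (D - c) / 2" using x(3) by (rule add_left_mono)
    also have "... = - ((D - c) / 2)" by (simp add: field_simps)
    finally show "c - D + x * c <= - ((D - c) / 2)" .
   qed (use x in auto)
   also have "... = - y" unfolding y_def by (rule mult_minus_right)
   finally have "real n * (c * (exp x - 1) - x * D) <= real n * (- y)" by (intro mult_left_mono) auto
   then show "real n * (c * (exp x - 1) - x * D) <= - y * real n" by (simp add: mult.commute)
  qed
  finally show ?thesis .
 qed
 have "(%n. exp (- y * real n)) \<longlonglongrightarrow> 0" using y by real_asymp
 then have "\<forall>\<^sub>F n in sequentially. exp (- y * real n) < \<epsilon>" using assms by (intro order_tendstoD(2)) auto
 then show ?thesis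
 proof eventually_elim
  case (elim n)
  then show ?case using b[of n] by linarith
 qed
qed

section \<open>Pinning\<close>

definition cnd :: "((nat => bool) => real) => nat list => bool list => (nat => bool) => real" where
 "cnd u I v = (%sg. u sg * of_bool (map sg I = v))"

abbreviation bl :: "nat => bool list set" where "bl m \<equiv> lsts m UNIV"

definition tt :: "nat => ((nat => bool) => real) => nat => real" where
 "tt n u i = tot n (%sg. u sg * of_bool (sg i))"

definition del :: "nat => ((nat => bool) => real) => nat => nat list => real" where
 "del n u i J = (\<Sum>y\<in>bl (length J). \<bar>tt n (cnd u J y) i - tot n (cnd u J y) * tt n u i / tot n u\<bar>)"

definition SS :: "nat => ((nat => bool) => real) => nat list => nat => real" where
 "SS n u I i = (\<Sum>v\<in>bl (length I). (tt n (cnd u I v) i)\<^sup>2 / tot n (cnd u I v))"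

lemma cnd_nonneg: "0 <= u sg ==> 0 <= cnd u I v sg" unfolding cnd_def by simp

lemma cnd_Nil [simp]: "cnd u [] [] = u" unfolding cnd_def by simp

lemma cnd_append: "length v = length I ==> cnd (cnd u I v) J y = cnd u (I @ J) (v @ y)"
 unfolding cnd_def by (auto simp: fun_eq_iff)

lemma sum_bl: "length I = m ==> (\<Sum>v\<in>bl m. of_bool (map sg I = v) :: real) = 1"
proof -
 assume "length I = m"
 then have "map sg I \<in> bl m" by (simp add: lsts_def)
 moreover have "(\<Sum>v\<in>bl m. of_bool (map sg I = v) :: real) = (\<Sum>v\<in>bl m. if v = map sg I then 1 else 0)"
  by (intro sum.cong) auto
 ultimately show ?thesis by simp
qed

lemma sum_tot_cnd: "length I = m ==> (\<Sum>v\<in>bl m. tot n (cnd u I v)) = tot n u"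
 unfolding cnd_def tot_sum[symmetric] sum_distrib_left[symmetric] by (rule tot_cong) (simp only: sum_bl mult_1_right)

lemma sum_tt_cnd: "length I = m ==> (\<Sum>v\<in>bl m. tt n (cnd u I v) i) = tt n u i"
proof -
 assume l: "length I = m"
 have "(%sg. cnd u I v sg * of_bool (sg i)) = cnd (%sg. u sg * of_bool (sg i)) I v" for v
  unfolding cnd_def by (simp add: mult_ac)
 then show ?thesis unfolding tt_def by (simp only: sum_tot_cnd[OF l])
qed

lemma tt_bounds: "(!!sg. 0 <= u sg) ==> 0 <= tt n u i & tt n u i <= tot n u"
 unfolding tt_def by (auto intro!: tot_nonneg tot_mono)

lemma sum_lsts_append:
 "finite S ==> (\<Sum>zs\<in>lsts (a + b) S. f zs :: real) = (\<Sum>xs\<in>lsts a S. \<Sum>ys\<in>lsts b S. f (xs @ ys))"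
proof (induction a arbitrary: f)
 case (Suc a)
 then show ?case by (simp add: sum_lsts_Suc)
qed (simp add: lsts_0)

lemma SS_cnd: "(\<Sum>v\<in>bl (length I). SS n (cnd u I v) J i) = SS n u (I @ J) i"
 unfolding SS_def length_append by (subst sum_lsts_append) (auto simp: cnd_append lsts_def intro!: sum.cong)

lemma SS_bounds: assumes "!!sg. 0 <= u sg" shows "0 <= SS n u I i" "SS n u I i <= tot n u"
proof -
 have c: "0 <= cnd u I v sg" for v sg using assms cnd_nonneg by blast
 show "0 <= SS n u I i" unfolding SS_def using c by (intro sum_nonneg divide_nonneg_nonneg tot_nonneg) auto
 have "SS n u I i <= (\<Sum>v\<in>bl (length I). tot n (cnd u I v))"
  unfolding SS_def
 proof (rule sum_mono)
  fix v
  note b = tt_bounds[of "cnd u I v" n i, OF c]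
  have "(tt n (cnd u I v) i)\<^sup>2 <= tot n (cnd u I v) * tot n (cnd u I v)"
   unfolding power2_eq_square using b by (intro mult_mono) auto
  then show "(tt n (cnd u I v) i)\<^sup>2 / tot n (cnd u I v) <= tot n (cnd u I v)"
   using b by (cases "tot n (cnd u I v) = 0") (auto simp: divide_le_eq)
 qed
 then show "SS n u I i <= tot n u" by (simp add: sum_tot_cnd)
qed

lemma del_le:
 assumes u: "!!sg. 0 <= u sg" and "\<eta> > 0"
 shows "del n u i J <= \<eta> * tot n u + (SS n u J i - SS n u [] i) / \<eta>"
proof (cases "tot n u = 0")
 case True
 have c: "0 <= cnd u J v sg" for v sg using u cnd_nonneg by blast
 have t: "tot n (cnd u J v) <= tot n u" for v
  unfolding cnd_def using u by (intro tot_mono) auto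
 have "tt n (cnd u J v) i = 0" for v
  using tt_bounds[of "cnd u J v" n i, OF c] t[of v] True by simp
 moreover have "tt n u i = 0" using tt_bounds[of u n i, OF u] True by simp
 ultimately show ?thesis using True by (simp add: del_def SS_def lsts_0)
next
 case False
 define d where "d = tot n u"
 define t where "t = tt n u i"
 have d: "d > 0" using False tot_nonneg[of n u] u unfolding d_def by (simp add: less_le)
 have c: "0 <= cnd u J v sg" for v sg using u cnd_nonneg by blast
 have "del n u i J <= (\<Sum>y\<in>bl (length J). \<eta> * tot n (cnd u J y)
   + ((tt n (cnd u J y) i)\<^sup>2 / tot n (cnd u J y) - 2 * (t / d) * tt n (cnd u J y) i + (t / d)\<^sup>2 * tot n (cnd u J y)) / \<eta>)"
  unfolding del_def d_def[symmetric] t_def[symmetric]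
 proof (rule sum_mono)
  fix y
  define b a where "b = tot n (cnd u J y)" and "a = tt n (cnd u J y) i"
  note ab = tt_bounds[of "cnd u J y" n i, OF c, folded a_def b_def]
  show "\<bar>tt n (cnd u J y) i - tot n (cnd u J y) * t / d\<bar> <= \<eta> * tot n (cnd u J y)
   + ((tt n (cnd u J y) i)\<^sup>2 / tot n (cnd u J y) - 2 * (t / d) * tt n (cnd u J y) i + (t / d)\<^sup>2 * tot n (cnd u J y)) / \<eta>"
   unfolding a_def[symmetric] b_def[symmetric]
  proof (cases "b = 0")
   case True
   then have "a = 0" using ab by simp
   then show "\<bar>a - b * t / d\<bar> <= \<eta> * b + (a\<^sup>2 / b - 2 * (t / d) * a + (t / d)\<^sup>2 * b) / \<eta>" using True by simp
  next
   case False
   then have b0: "b > 0" using ab by simp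
   define z where "z = a / b - t / d"
   have "\<bar>z\<bar> * \<eta> <= \<eta> * \<eta> + z\<^sup>2"
   proof -
    have "0 <= (\<bar>z\<bar> - \<eta>)\<^sup>2" by simp
    then have "2 * (\<bar>z\<bar> * \<eta>) <= \<eta> * \<eta> + z\<^sup>2" by (simp add: power2_eq_square algebra_simps)
    moreover have "0 <= \<bar>z\<bar> * \<eta>" using \<open>\<eta> > 0\<close> by simp
    ultimately show ?thesis by linarith
   qed
   then have "\<bar>z\<bar> <= \<eta> + z\<^sup>2 / \<eta>" using \<open>\<eta> > 0\<close> by (simp add: field_simps)
   then have "b * \<bar>z\<bar> <= b * (\<eta> + z\<^sup>2 / \<eta>)" using b0 by (intro mult_left_mono) auto
   moreover have "b * \<bar>z\<bar> = \<bar>a - b * t / d\<bar>"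
   proof -
    have "b * \<bar>z\<bar> = \<bar>b * z\<bar>" using b0 by (simp add: abs_mult)
    also have "b * z = a - b * t / d" using b0 by (simp add: z_def right_diff_distrib)
    finally show ?thesis .
   qed
   moreover have "b * (\<eta> + z\<^sup>2 / \<eta>) = \<eta> * b + (b * z\<^sup>2) / \<eta>" by (simp add: algebra_simps)
   moreover have "b * z\<^sup>2 = a\<^sup>2 / b - 2 * (t / d) * a + (t / d)\<^sup>2 * b"
   proof -
    have "b * (a / b - s)\<^sup>2 = a\<^sup>2 / b - 2 * s * a + s\<^sup>2 * b" for s
     using b0 by (simp add: power2_eq_square field_simps)
    then show ?thesis by (simp only: z_def)
   qed
   ultimately show "\<bar>a - b * t / d\<bar> <= \<eta> * b + (a\<^sup>2 / b - 2 * (t / d) * a + (t / d)\<^sup>2 * b) / \<eta>" by simp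
  qed
 qed
 also have "... = \<eta> * d + (SS n u J i - 2 * (t / d) * t + (t / d)\<^sup>2 * d) / \<eta>"
  unfolding sum.distrib sum_divide_distrib[symmetric] sum_subtractf sum_distrib_left[symmetric] sum_tot_cnd[OF refl] sum_tt_cnd[OF refl]
  by (simp add: SS_def d_def t_def)
 also have "SS n u J i - 2 * (t / d) * t + (t / d)\<^sup>2 * d = SS n u J i - SS n u [] i"
  using d by (simp add: SS_def lsts_0 d_def[symmetric] t_def[symmetric] power2_eq_square)
 finally show ?thesis by (simp add: d_def)
qed

definition Dl :: "nat => nat => ((nat => bool) => real) => real" where
 "Dl R n w = avg {..<n} (%i. avg (lsts R {..<n}) (%J. del n w i J))"

lemma pinning:
 assumes u: "!!sg. 0 <= u sg" and "\<eta> > 0" and n: "n > 0"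
 shows "(\<Sum>\<theta><\<Theta>. avg (lsts (R * \<theta>) {..<n}) (%I. \<Sum>v\<in>bl (R * \<theta>). Dl R n (cnd u I v)))
   <= (real \<Theta> * \<eta> + 1 / \<eta>) * tot n u"
proof -
 let ?N = "{..<n}"
 have N: "finite ?N" "?N ~= {}" using n by auto
 define A where "A = (%\<theta>. avg (lsts (R * \<theta>) ?N) (%I. avg ?N (%i. SS n u I i)))"
 have step: "avg (lsts (R * \<theta>) ?N) (%I. \<Sum>v\<in>bl (R * \<theta>). Dl R n (cnd u I v)) <= \<eta> * tot n u + (A (Suc \<theta>) - A \<theta>) / \<eta>" for \<theta>
 proof -
  have "avg (lsts (R * \<theta>) ?N) (%I. \<Sum>v\<in>bl (R * \<theta>). Dl R n (cnd u I v))
    <= avg (lsts (R * \<theta>) ?N) (%I. avg ?N (%i. avg (lsts R ?N) (%J. \<eta> * tot n u + (SS n u (I @ J) i - SS n u I i) / \<eta>)))"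
  proof (rule avg_mono)
   fix I assume I: "I \<in> lsts (R * \<theta>) ?N"
   then have l: "length I = R * \<theta>" by (simp add: lsts_def)
   have "(\<Sum>v\<in>bl (R * \<theta>). Dl R n (cnd u I v)) = avg ?N (%i. avg (lsts R ?N) (%J. \<Sum>v\<in>bl (R * \<theta>). del n (cnd u I v) i J))"
    unfolding Dl_def avg_sum ..
   also have "... <= avg ?N (%i. avg (lsts R ?N) (%J. \<eta> * tot n u + (SS n u (I @ J) i - SS n u I i) / \<eta>))"
   proof (intro avg_mono)
    fix i J
    have "(\<Sum>v\<in>bl (R * \<theta>). del n (cnd u I v) i J) <= (\<Sum>v\<in>bl (R * \<theta>). \<eta> * tot n (cnd u I v) + (SS n (cnd u I v) J i - SS n (cnd u I v) [] i) / \<eta>)"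
     using u by (intro sum_mono del_le \<open>\<eta> > 0\<close> cnd_nonneg)
    also have "... = \<eta> * tot n u + (SS n u (I @ J) i - SS n u I i) / \<eta>"
     unfolding sum.distrib sum_divide_distrib[symmetric] sum_subtractf sum_distrib_left[symmetric] l[symmetric] SS_cnd sum_tot_cnd[OF refl] by simp
    finally show "(\<Sum>v\<in>bl (R * \<theta>). del n (cnd u I v) i J) <= \<eta> * tot n u + (SS n u (I @ J) i - SS n u I i) / \<eta>" .
   qed
   finally show "(\<Sum>v\<in>bl (R * \<theta>). Dl R n (cnd u I v)) <= avg ?N (%i. avg (lsts R ?N) (%J. \<eta> * tot n u + (SS n u (I @ J) i - SS n u I i) / \<eta>))" .
  qed
  also have "... = \<eta> * tot n u + (A (Suc \<theta>) - A \<theta>) / \<eta>"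
  proof -
   have "A (Suc \<theta>) = avg (lsts (R * \<theta>) ?N) (%I. avg ?N (%i. avg (lsts R ?N) (%J. SS n u (I @ J) i)))"
    unfolding A_def mult_Suc_right add.commute[of R] avg_lsts_append by (intro avg_cong) (rule avg_swap)
   then show ?thesis unfolding avg_add avg_divide avg_diff A_def using N by (simp add: avg_const)
  qed
  finally show ?thesis .
 qed
 have "(\<Sum>\<theta><\<Theta>. avg (lsts (R * \<theta>) ?N) (%I. \<Sum>v\<in>bl (R * \<theta>). Dl R n (cnd u I v)))
   <= (\<Sum>\<theta><\<Theta>. \<eta> * tot n u + (A (Suc \<theta>) - A \<theta>) / \<eta>)" by (intro sum_mono step)
 also have "... = real \<Theta> * (\<eta> * tot n u) + (A \<Theta> - A 0) / \<eta>"
  unfolding sum.distrib sum_divide_distrib[symmetric] sum_lessThan_telescope by simp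
 also have "... <= real \<Theta> * (\<eta> * tot n u) + tot n u / \<eta>"
 proof -
  have "A \<Theta> <= tot n u" unfolding A_def using N u by (intro avg_le SS_bounds) auto
  moreover have "0 <= A 0" unfolding A_def using u by (intro avg_nonneg SS_bounds)
  ultimately show ?thesis using \<open>\<eta> > 0\<close> by (intro add_left_mono divide_right_mono) auto
 qed
 also have "... = (real \<Theta> * \<eta> + 1 / \<eta>) * tot n u" by (simp add: algebra_simps)
 finally show ?thesis .
qed

section \<open>Replacing the Gibbs measure by a product measure\<close>

primrec ind :: "('a => real) => 'a list => (bool list => real) => real" where
 "ind p [] h = h []"
| "ind p (x # xs) h = p x * ind p xs (%y. h (True # y)) + (1 - p x) * ind p xs (%y. h (False # y))"

lemma ind_cmult: "ind p xs (%y. c * h y) = c * ind p xs h"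
 by (induction xs arbitrary: h) (simp_all add: algebra_simps)

lemma ind_add: "ind p xs (%y. h y + h' y) = ind p xs h + ind p xs h'"
 by (induction xs arbitrary: h h') (simp_all add: algebra_simps)

lemma ind_const: "ind p xs (%_. c) = c"
 by (induction xs) (simp_all add: algebra_simps)

lemma ind_append: "ind p (xs @ ys) (%z. f (take (length xs) z) * g (drop (length xs) z)) = ind p xs f * ind p ys g"
proof (induction xs arbitrary: f)
 case Nil
 then show ?case by (simp add: ind_cmult)
next
 case (Cons x xs)
 show ?case using Cons[of "%y. f (True # y)"] Cons[of "%y. f (False # y)"] by (simp add: algebra_simps)
qed

lemma ind_all_True: "ind p xs (%y. of_bool (\<forall>b\<in>set y. b = True)) = prod_list (map p xs)"
proof (induction xs)
 case (Cons x xs)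
 have "(%y. of_bool (\<forall>b\<in>set (False # y). b = True) :: real) = (%_. 0)" by (simp add: fun_eq_iff)
 then have "ind p xs (%y. of_bool (\<forall>b\<in>set (False # y). b = True)) = 0" by (simp only: ind_const)
 then show ?case using Cons by simp
qed simp

lemma ind_all_False: "ind p xs (%y. of_bool (\<forall>b\<in>set y. b = False)) = prod_list (map (%x. 1 - p x) xs)"
proof (induction xs)
 case (Cons x xs)
 have "(%y. of_bool (\<forall>b\<in>set (True # y). b = False) :: real) = (%_. 0)" by (simp add: fun_eq_iff)
 then have "ind p xs (%y. of_bool (\<forall>b\<in>set (True # y). b = False)) = 0" by (simp only: ind_const)
 then show ?case using Cons by simp
qed simp

text \<open>The truth values of the \<open>\<gamma> (k - 1)\<close> literals surrounding a new variable determine the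
 number (as a weight in \<open>[0, 2]\<close>) of values of the new variable compatible with its clauses.\<close>

definition Ag :: "bool => bool list list => real" where
 "Ag b yss = prod_list (map (%ys. 1 - of_bool (\<forall>y\<in>set ys. y = b)) yss)"

definition Yt :: "bool list list => real" where "Yt yss = Ag True yss + Ag False yss"

lemma Ag_bounds: "0 <= Ag b yss & Ag b yss <= 1"
 unfolding Ag_def by (rule prod_list_unit) auto

lemma ind_Ag:
 assumes q: "!!xs. ind p xs (%y. of_bool (\<forall>z\<in>set y. z = b)) = prod_list (map q xs)"
 assumes "\<forall>xs\<in>set xss. length xs = r"
 shows "ind p (concat xss) (%z. Ag b (chunks r (length xss) z)) = prod_list (map (%xs. 1 - prod_list (map q xs)) xss)"
 using assms(2)
proof (induction xss)
 case (Cons xs xss)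
 let ?f = "%y. 1 + (- 1) * of_bool (\<forall>z\<in>set y. z = b) :: real"
 have "ind p (concat (xs # xss)) (%z. Ag b (chunks r (length (xs # xss)) z))
   = ind p (xs @ concat xss) (%z. ?f (take (length xs) z) * Ag b (chunks r (length xss) (drop (length xs) z)))"
  using Cons.prems by (simp add: Ag_def)
 also have "... = ind p xs ?f * ind p (concat xss) (%z. Ag b (chunks r (length xss) z))" by (rule ind_append)
 also have "ind p xs ?f = 1 + (- 1) * prod_list (map q xs)" unfolding ind_add ind_const ind_cmult q ..
 finally show ?case using Cons by simp
qed (simp add: Ag_def)

lemma ind_Yt:
 assumes "\<forall>xs\<in>set xss. length xs = r"
 shows "ind p (concat xss) (%z. Yt (chunks r (length xss) z)) = Wl (map (map p) xss)"
 unfolding Yt_def ind_add ind_Ag[where q = p, OF ind_all_True assms] ind_Ag[where q = "%x. 1 - p x", OF ind_all_False assms]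
 by (simp add: Wl_def o_def)

lemma ind_nae:
 assumes "xs ~= []" shows "ind p xs (%y. of_bool (nae y)) = El (map p xs)"
proof -
 have "of_bool (nae y) = 1 + (- 1) * (of_bool (\<forall>b\<in>set y. b = True) + of_bool (\<forall>b\<in>set y. b = False) :: real)" if "y ~= []" for y
 proof -
  from that obtain z zs where "y = z # zs" by (cases y) auto
  then show ?thesis unfolding nae_def by (cases z) (auto, (metis (full_types))+)
 qed
 then have e: "h (of_bool (nae (b # y))) = h (1 + (- 1) * (of_bool (\<forall>c\<in>set (b # y). c = True) + of_bool (\<forall>c\<in>set (b # y). c = False) :: real))" for h :: "real => real" and b y
  by simp
 obtain x xs' where xs: "xs = x # xs'" using assms by (cases xs) auto
 have "ind p xs (%y. of_bool (nae y)) = ind p xs (%y. 1 + (- 1) * (of_bool (\<forall>b\<in>set y. b = True) + of_bool (\<forall>b\<in>set y. b = False)))"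
  unfolding xs ind.simps by (simp only: e[of "%t. t"])
 also have "... = 1 + (- 1) * (prod_list (map p xs) + prod_list (map (%x. 1 - p x) xs))"
  unfolding ind_add ind_const ind_cmult ind_all_True ind_all_False ..
 finally show ?thesis by (simp add: El_def o_def)
qed

definition pw :: "nat => ((nat => bool) => real) => nat \<times> bool => real" where
 "pw n w x = mean n w (%sg. of_bool (sg (fst x) = snd x))"

definition dl1 :: "nat => ((nat => bool) => real) => nat => nat list => real" where
 "dl1 n w i J = del n w i J / tot n w"

primrec bnd :: "nat => ((nat => bool) => real) => (nat \<times> bool) list => real" where
 "bnd n w [] = 0"
| "bnd n w (x # xs) = 2 * dl1 n w (fst x) (map fst xs) + bnd n w xs"

context
 fixes n :: nat and w :: "(nat => bool) => real"
 assumes w: "!!sg. 0 <= w sg" and t: "tot n w > 0"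
begin

lemma mean_add: "mean n w (%sg. f sg + g sg) = mean n w f + mean n w g"
 unfolding mean_def by (simp add: distrib_left tot_add add_divide_distrib)

lemma mean_diff: "mean n w (%sg. f sg - g sg) = mean n w f - mean n w g"
 unfolding mean_def by (simp add: right_diff_distrib tot_diff diff_divide_distrib)

lemma mean_cmult: "mean n w (%sg. c * f sg) = c * mean n w f"
 unfolding mean_def mult.left_commute[of _ c] tot_cmult by simp

lemma mean_sum: "mean n w (%sg. \<Sum>x\<in>S. f x sg) = (\<Sum>x\<in>S. mean n w (f x))"
 unfolding mean_def sum_distrib_left tot_sum by (simp add: sum_divide_distrib)

lemma mean_bounds: assumes "!!sg. 0 <= f sg" "!!sg. f sg <= c" shows "0 <= mean n w f" "mean n w f <= c"
 using mean_mono[of w "%_. 0" f n] mean_mono[of w f "%_. c" n] mean_const[of n w] w t assms by auto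

lemma pw_bounds: "0 <= pw n w x & pw n w x <= 1"
 unfolding pw_def using mean_bounds[of "%sg. of_bool (sg (fst x) = snd x)" 1] by simp

lemma pw_compl: "pw n w (i, False) = 1 - pw n w (i, True)"
proof -
 have "mean n w (%sg. 1 - of_bool (sg i)) = 1 - mean n w (%sg. of_bool (sg i))"
  unfolding mean_diff using mean_const[of n w] t by simp
 moreover have "(%sg. of_bool (sg i = False) :: real) = (%sg. 1 - of_bool (sg i))" by (simp add: fun_eq_iff)
 ultimately show ?thesis unfolding pw_def by simp
qed

lemma avg_pw: "n > 0 ==> avg ({..<n} \<times> UNIV) (pw n w) = 1 / 2"
proof -
 assume n: "n > 0"
 have "avg ({..<n} \<times> UNIV) (%(i, s). pw n w (i, s)) = avg {..<n} (%i. avg UNIV (%s. pw n w (i, s)))" by (rule avg_Times)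
 also have "... = avg {..<n} (%i. 1 / 2)"
  by (intro avg_cong) (simp add: avg_def UNIV_bool pw_compl)
 finally show ?thesis using n by (simp add: avg_const lessThan_empty_iff)
qed

lemma del_expand:
 "dl1 n w i J = (\<Sum>y\<in>bl (length J). \<bar>mean n w (%sg. of_bool (map sg J = y) * of_bool (sg i)) - mean n w (%sg. of_bool (map sg J = y)) * pw n w (i, True)\<bar>)"
proof -
 have "\<bar>tt n (cnd w J y) i - tot n (cnd w J y) * tt n w i / tot n w\<bar> / tot n w
   = \<bar>mean n w (%sg. of_bool (map sg J = y) * of_bool (sg i)) - mean n w (%sg. of_bool (map sg J = y)) * pw n w (i, True)\<bar>" for y
 proof -
  have "\<bar>tt n (cnd w J y) i - tot n (cnd w J y) * tt n w i / tot n w\<bar> / tot n w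
    = \<bar>(tt n (cnd w J y) i - tot n (cnd w J y) * tt n w i / tot n w) / tot n w\<bar>" using t by (simp add: abs_divide)
  then show ?thesis unfolding mean_def pw_def tt_def cnd_def by (simp add: diff_divide_distrib mult.assoc)
 qed
 then show ?thesis unfolding dl1_def del_def sum_divide_distrib by simp
qed

lemma dl1_append: "dl1 n w i J <= dl1 n w i (J @ K)"
proof -
 let ?a = "%L y. mean n w (%sg. of_bool (map sg L = y) * of_bool (sg i)) - mean n w (%sg. of_bool (map sg L = y)) * pw n w (i, True)"
 have e: "?a J y = (\<Sum>z\<in>bl (length K). ?a (J @ K) (y @ z))" if "length y = length J" for y
 proof -
  have s: "of_bool (map sg J = y) = (\<Sum>z\<in>bl (length K). of_bool (map sg (J @ K) = y @ z) :: real)" for sg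
  proof -
   have "(\<Sum>z\<in>bl (length K). of_bool (map sg (J @ K) = y @ z) :: real) = (\<Sum>z\<in>bl (length K). of_bool (map sg J = y) * of_bool (map sg K = z))"
    using that by (intro sum.cong) auto
   then show ?thesis unfolding sum_distrib_left[symmetric] sum_bl[OF refl] by simp
  qed
  show ?thesis unfolding s sum_distrib_right mean_sum sum_subtractf ..
 qed
 have "dl1 n w i J = (\<Sum>y\<in>bl (length J). \<bar>\<Sum>z\<in>bl (length K). ?a (J @ K) (y @ z)\<bar>)"
  unfolding del_expand by (intro sum.cong refl arg_cong[where f = abs] e) (simp add: lsts_def)
 also have "... <= (\<Sum>y\<in>bl (length J). \<Sum>z\<in>bl (length K). \<bar>?a (J @ K) (y @ z)\<bar>)"
  by (intro sum_mono sum_abs)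
 also have "... = dl1 n w i (J @ K)"
  unfolding del_expand length_append by (rule sum_lsts_append[symmetric]) simp
 finally show ?thesis .
qed

lemma hybrid_one:
 assumes h: "!!y. 0 <= h y & h y <= 1"
 shows "\<bar>mean n w (%sg. of_bool (sg i) * h (truth sg xs)) - pw n w (i, True) * mean n w (%sg. h (truth sg xs))\<bar> <= dl1 n w i (map fst xs)"
proof -
 let ?J = "map fst xs" and ?S = "map snd xs"
 have tr: "truth sg xs = map2 (=) (map sg ?J) ?S" for sg
  unfolding truth_def by (induction xs) auto
 have hs: "h (truth sg xs) = (\<Sum>y\<in>bl (length ?J). of_bool (map sg ?J = y) * h (map2 (=) y ?S))" for sg
 proof -
  have "map sg ?J \<in> bl (length ?J)" by (simp add: lsts_def)
  moreover have "(\<Sum>y\<in>bl (length ?J). of_bool (map sg ?J = y) * h (map2 (=) y ?S)) = (\<Sum>y\<in>bl (length ?J). if y = map sg ?J then h (map2 (=) y ?S) else 0)"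
   by (intro sum.cong) auto
  ultimately show ?thesis unfolding tr by simp
 qed
 let ?a = "%y. mean n w (%sg. of_bool (map sg ?J = y) * of_bool (sg i)) - mean n w (%sg. of_bool (map sg ?J = y)) * pw n w (i, True)"
 have e: "mean n w (%sg. of_bool (sg i) * h (truth sg xs)) - pw n w (i, True) * mean n w (%sg. h (truth sg xs))
   = (\<Sum>y\<in>bl (length ?J). h (map2 (=) y ?S) * ?a y)"
 proof -
  have 1: "mean n w (%sg. of_bool (sg i) * h (truth sg xs)) = (\<Sum>y\<in>bl (length ?J). h (map2 (=) y ?S) * mean n w (%sg. of_bool (map sg ?J = y) * of_bool (sg i)))"
   unfolding hs sum_distrib_left mean_sum mean_cmult[symmetric] by (simp only: mult_ac)
  have 2: "mean n w (%sg. h (truth sg xs)) = (\<Sum>y\<in>bl (length ?J). h (map2 (=) y ?S) * mean n w (%sg. of_bool (map sg ?J = y)))"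
   unfolding hs mean_sum mean_cmult[symmetric] by (simp only: mult_ac)
  show ?thesis unfolding 1 2 sum_distrib_left sum_subtractf[symmetric] by (simp only: right_diff_distrib mult_ac)
 qed
 have "\<bar>\<Sum>y\<in>bl (length ?J). h (map2 (=) y ?S) * ?a y\<bar> <= (\<Sum>y\<in>bl (length ?J). \<bar>h (map2 (=) y ?S) * ?a y\<bar>)" by (rule sum_abs)
 also have "... <= (\<Sum>y\<in>bl (length ?J). \<bar>?a y\<bar>)"
 proof (rule sum_mono)
  fix y
  have hy: "\<bar>h (map2 (=) y ?S)\<bar> <= 1" using h[of "map2 (=) y ?S"] by simp
  show "\<bar>h (map2 (=) y ?S) * ?a y\<bar> <= \<bar>?a y\<bar>"
   unfolding abs_mult by (rule mult_left_le_one_le[OF abs_ge_zero abs_ge_zero hy])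
 qed
 also have "... = dl1 n w i ?J" unfolding del_expand ..
 finally show ?thesis unfolding e .
qed

lemma hybrid:
 assumes h: "!!y. 0 <= h y & h y <= 1"
 shows "\<bar>mean n w (%sg. h (truth sg xs)) - ind (pw n w) xs h\<bar> <= bnd n w xs"
 using h
proof (induction xs arbitrary: h)
 case Nil
 have "mean n w (%sg. h []) = h []" using mean_const[of n w] t by simp
 then show ?case by (simp add: truth_def)
next
 case (Cons x xs)
 obtain i s where x: "x = (i, s)" by (cases x)
 define hT hF where "hT = (%y. h (True # y))" and "hF = (%y. h (False # y))"
 have hb: "!!y. 0 <= hT y & hT y <= 1" "!!y. 0 <= hF y & hF y <= 1" using Cons.prems by (auto simp: hT_def hF_def)
 define p where "p = pw n w x"
 define mT mF where "mT = mean n w (%sg. hT (truth sg xs))" and "mF = mean n w (%sg. hF (truth sg xs))"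
 have p: "0 <= p" "p <= 1" using pw_bounds[of x] by (auto simp: p_def)
 let ?d = "dl1 n w i (map fst xs)"
 have lit: "\<bar>mean n w (%sg. of_bool (sg i = s) * g (truth sg xs)) - p * mean n w (%sg. g (truth sg xs))\<bar> <= ?d
   & \<bar>mean n w (%sg. (1 - of_bool (sg i = s)) * g (truth sg xs)) - (1 - p) * mean n w (%sg. g (truth sg xs))\<bar> <= ?d"
  if g: "!!y. 0 <= g y & g y <= 1" for g
 proof -
  define G where "G = mean n w (%sg. g (truth sg xs))"
  define H where "H = mean n w (%sg. of_bool (sg i) * g (truth sg xs))"
  have b: "\<bar>H - pw n w (i, True) * G\<bar> <= ?d" unfolding H_def G_def by (rule hybrid_one[OF g])
  have c: "mean n w (%sg. (1 - of_bool (P sg)) * g (truth sg xs)) = G - mean n w (%sg. of_bool (P sg) * g (truth sg xs))" for P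
   unfolding left_diff_distrib mean_diff G_def by simp
  show ?thesis
  proof (cases s)
   case True
   have "p = pw n w (i, True)" using True by (simp add: p_def x)
   moreover have "mean n w (%sg. of_bool (sg i = s) * g (truth sg xs)) = H" using True by (simp add: H_def)
   ultimately show ?thesis unfolding c G_def[symmetric] using b by (simp add: abs_le_iff algebra_simps)
  next
   case False
   have "p = 1 - pw n w (i, True)" using False by (simp add: p_def x pw_compl)
   moreover have "mean n w (%sg. of_bool (sg i = s) * g (truth sg xs)) = G - H"
   proof -
    have "(%sg. of_bool (sg i = s) * g (truth sg xs)) = (%sg. (1 - of_bool (sg i)) * g (truth sg xs))"
     using False by (simp add: fun_eq_iff)
    then show ?thesis using c[of "%sg. sg i"] by (simp add: H_def)
   qed
   moreover have "G - H - (1 - pw n w (i, True)) * G = - (H - pw n w (i, True) * G)"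
    "G - (G - H) - (1 - (1 - pw n w (i, True))) * G = H - pw n w (i, True) * G" by (simp_all add: algebra_simps)
   ultimately show ?thesis unfolding c G_def[symmetric] using b by (simp only: abs_minus_cancel)
  qed
 qed
 have split: "mean n w (%sg. h (truth sg (x # xs))) = mean n w (%sg. of_bool (sg i = s) * hT (truth sg xs)) + mean n w (%sg. (1 - of_bool (sg i = s)) * hF (truth sg xs))"
  unfolding mean_add[symmetric]
 proof (rule arg_cong[where f = "mean n w"], rule ext)
  fix sg show "h (truth sg (x # xs)) = of_bool (sg i = s) * hT (truth sg xs) + (1 - of_bool (sg i = s)) * hF (truth sg xs)"
   by (cases "sg i = s") (auto simp: truth_def x hT_def hF_def)
 qed
 have IHT: "\<bar>mT - ind (pw n w) xs hT\<bar> <= bnd n w xs" unfolding mT_def by (rule Cons.IH) (use hb in auto)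
 have IHF: "\<bar>mF - ind (pw n w) xs hF\<bar> <= bnd n w xs" unfolding mF_def by (rule Cons.IH) (use hb in auto)
 have I: "ind (pw n w) (x # xs) h = p * ind (pw n w) xs hT + (1 - p) * ind (pw n w) xs hF"
  by (simp add: p_def hT_def hF_def)
 have lT: "\<bar>mean n w (%sg. of_bool (sg i = s) * hT (truth sg xs)) - p * mT\<bar> <= ?d"
  unfolding mT_def by (rule conjunct1, rule lit, rule hb)
 have lF: "\<bar>mean n w (%sg. (1 - of_bool (sg i = s)) * hF (truth sg xs)) - (1 - p) * mF\<bar> <= ?d"
  unfolding mF_def by (rule conjunct2, rule lit, rule hb)
 have "\<bar>p * (mT - ind (pw n w) xs hT)\<bar> <= p * bnd n w xs" using IHT p by (simp add: abs_mult mult_left_mono)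
 moreover have "\<bar>(1 - p) * (mF - ind (pw n w) xs hF)\<bar> <= (1 - p) * bnd n w xs" using IHF p by (simp add: abs_mult mult_left_mono)
 moreover have "mean n w (%sg. h (truth sg (x # xs))) - ind (pw n w) (x # xs) h
   = (mean n w (%sg. of_bool (sg i = s) * hT (truth sg xs)) - p * mT) + (mean n w (%sg. (1 - of_bool (sg i = s)) * hF (truth sg xs)) - (1 - p) * mF)
    + (p * (mT - ind (pw n w) xs hT) + (1 - p) * (mF - ind (pw n w) xs hF))"
  unfolding split I by (simp add: algebra_simps)
 moreover have "p * bnd n w xs + (1 - p) * bnd n w xs = bnd n w xs" by (simp add: algebra_simps)
 ultimately have "\<bar>mean n w (%sg. h (truth sg (x # xs))) - ind (pw n w) (x # xs) h\<bar> <= ?d + ?d + bnd n w xs"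
  using lT lF by linarith
 then show ?case by (simp add: x)
qed

lemma bnd_avg:
 assumes n: "n > 0" and r: "r <= R"
 shows "avg (lsts r ({..<n} \<times> UNIV)) (bnd n w) <= 2 * real r * (Dl R n w / tot n w)"
 using r
proof (induction r)
 case (Suc r)
 let ?S = "{..<n} \<times> (UNIV :: bool set)" and ?N = "{..<n}"
 have S: "finite ?S" "?S ~= {}" using n by auto
 have N: "finite ?N" "?N ~= {}" using n by auto
 have mapfst: "avg (lsts m ?S) (%xs. f (map fst xs)) = avg (lsts m ?N) f" for m f
 proof (induction m arbitrary: f)
  case (Suc m)
  have "avg (lsts (Suc m) ?S) (%xs. f (map fst xs)) = avg ?S (%x. avg (lsts m ?S) (%xs. f (fst x # map fst xs)))"
   by (simp add: avg_lsts_Suc)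
  also have "... = avg ?S (%x. avg (lsts m ?N) (%is. f (fst x # is)))" by (simp only: Suc[of "%is. f (_ # is)"])
  also have "... = avg ?N (%i. avg (lsts m ?N) (%is. f (i # is)))" by (rule avg_fst)
  finally show ?case by (simp add: avg_lsts_Suc)
 qed simp
 have "avg (lsts (Suc r) ?S) (bnd n w) = avg ?S (%x. avg (lsts r ?S) (%xs. 2 * dl1 n w (fst x) (map fst xs))) + avg (lsts r ?S) (bnd n w)"
  unfolding avg_lsts_Suc bnd.simps avg_add using S by (simp add: avg_const)
 also have "avg ?S (%x. avg (lsts r ?S) (%xs. 2 * dl1 n w (fst x) (map fst xs))) = 2 * avg ?N (%i. avg (lsts r ?N) (%J. dl1 n w i J))"
  unfolding avg_cmult mapfst[of r "dl1 n w _"] by (simp only: avg_fst[where f = "%i. avg (lsts r ?N) (dl1 n w i)"])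
 also have "avg ?N (%i. avg (lsts r ?N) (%J. dl1 n w i J)) <= avg ?N (%i. avg (lsts r ?N) (%J. avg (lsts (R - r) ?N) (%K. dl1 n w i (J @ K))))"
  using N by (intro avg_mono avg_ge dl1_append) auto
 also have "... = avg ?N (%i. avg (lsts (r + (R - r)) ?N) (%J. dl1 n w i J))" by (simp only: avg_lsts_append)
 also have "r + (R - r) = R" using Suc by simp
 also have "avg ?N (%i. avg (lsts R ?N) (%J. dl1 n w i J)) = Dl R n w / tot n w"
  unfolding Dl_def dl1_def avg_divide ..
 finally show ?case using Suc by (simp add: algebra_simps)
qed simp

end

lemma Lam_continuous: "continuous_on {0..2} Lam"
 unfolding continuous_on_def
proof
 fix x :: real assume x: "x \<in> {0..2}"
 show "(Lam \<longlongrightarrow> Lam x) (at x within {0..2})"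
 proof (cases "x = 0")
  case True
  have "((%x::real. x * ln x) \<longlongrightarrow> 0) (at_right 0)" by real_asymp
  then have "((%x::real. x * ln x) \<longlongrightarrow> 0) (at 0 within {0..2})"
   by (rule filterlim_mono) (auto simp: at_within_Icc_at_right)
  moreover have "Lam = (%x. x * ln x)" by (auto simp: Lam_def fun_eq_iff)
  ultimately show ?thesis using True by simp
 next
  case False
  have e: "Lam = (%x. x * ln x)" by (auto simp: Lam_def fun_eq_iff)
  show ?thesis unfolding e using False by (intro tendsto_intros) auto
 qed
qed

lemma Lam_modulus:
 assumes "0 < \<epsilon>"
 shows "\<exists>C>0. \<forall>x y. 0 <= x & x <= 2 & 0 <= y & y <= 2 --> \<bar>Lam x - Lam y\<bar> <= \<epsilon> + C * \<bar>x - y\<bar>"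
proof -
 have "uniformly_continuous_on {0..2} Lam" by (rule compact_uniformly_continuous[OF Lam_continuous]) auto
 then obtain \<delta> where \<delta>: "\<delta> > 0" "!!x y. x \<in> {0..2} ==> y \<in> {0..2} ==> dist y x < \<delta> ==> dist (Lam y) (Lam x) < \<epsilon>"
  unfolding uniformly_continuous_on_def using assms by meson
 have "\<bar>Lam x - Lam y\<bar> <= \<epsilon> + 4 / \<delta> * \<bar>x - y\<bar>" if "0 <= x & x <= 2 & 0 <= y & y <= 2" for x y
 proof (cases "\<bar>x - y\<bar> < \<delta>")
  case True
  have "dist (Lam x) (Lam y) < \<epsilon>" by (rule \<delta>(2)) (use that True in \<open>auto simp: dist_real_def\<close>)
  moreover have "0 <= 4 / \<delta> * \<bar>x - y\<bar>" using \<delta> by simp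
  ultimately show ?thesis unfolding dist_real_def by linarith
 next
  case False
  have "4 <= 4 / \<delta> * \<bar>x - y\<bar>" using False \<delta> by (simp add: field_simps)
  then show ?thesis using Lam_abs_le[of x] Lam_abs_le[of y] that assms by linarith
 qed
 then show ?thesis using \<delta>(1) by (intro exI[of _ "4 / \<delta>"]) auto
qed

lemma avg_lsts_subset:
 assumes T: "finite T" "A \<subseteq> T" "A ~= {}" and f: "!!xs. xs \<in> lsts j T ==> \<bar>f xs\<bar> <= c"
  and r: "1 - \<rho> <= real (card A) / real (card T)" and c: "0 <= c"
 shows "\<bar>avg (lsts j A) f - avg (lsts j T) f\<bar> <= 2 * c * (real j * \<rho>)"
proof -
 define s where "s = real (card A) / real (card T)"
 have fA: "finite A" using T finite_subset by auto
 have s: "0 <= s" "s <= 1" using T card_mono[OF T(1,2)] by (auto simp: s_def divide_le_eq_1)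
 have "lsts j A \<subseteq> lsts j T" using T(2) by (auto simp: lsts_def)
 then have "\<bar>avg (lsts j A) f - avg (lsts j T) f\<bar> <= 2 * c * (1 - real (card (lsts j A)) / real (card (lsts j T)))"
  using T f by (intro avg_subset_diff) auto
 also have "real (card (lsts j A)) / real (card (lsts j T)) = s ^ j"
  unfolding s_def card_lsts[OF T(1)] card_lsts[OF fA] by (simp add: power_divide)
 also have "1 - s ^ j <= real j * \<rho>"
 proof -
  have "1 + real j * (s - 1) <= (1 + (s - 1)) ^ j" using s by (intro Bernoulli_inequality) auto
  moreover have "real j * (1 - \<rho>) <= real j * s" using r by (intro mult_left_mono) (auto simp: s_def)
  ultimately show ?thesis by (simp add: algebra_simps)
 qed
 finally show ?thesis using c by (simp add: mult_left_mono)
qed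

lemma clauses_density:
 assumes "r <= n" "0 < n"
 shows "1 - real r ^ 2 / real n <= real (card (clauses r n)) / real (card (lsts r ({..<n} \<times> (UNIV :: bool set))))"
proof -
 have "card (lsts r ({..<n} \<times> (UNIV :: bool set))) = n ^ r * 2 ^ r"
  by (simp add: card_lsts card_cartesian_product power_mult_distrib)
 then show ?thesis using card_dl_ge[OF assms] assms by (simp add: card_clauses field_simps)
qed

definition Vx :: "nat => nat => ((nat => bool) => real) => nat => real" where
 "Vx k n w j = avg (lsts j (clauses (k - 1) n)) (%cs. Lam (mean n w (%sg. Yt (map (truth sg) cs)))) / (2 * qq k ^ j)"

definition Ec :: "nat => nat => ((nat => bool) => real) => real" where
 "Ec k n w = avg (clauses k n) (%a. Lam (mean n w (cl a))) / qq k"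

lemma Yt_bounds: "0 <= Yt yss & Yt yss <= 2"
 unfolding Yt_def using Ag_bounds[of True yss] Ag_bounds[of False yss] by linarith

lemma truth_concat: "truth sg (concat xss) = concat (map (truth sg) xss)"
 unfolding truth_def by (induction xss) auto

context
 fixes k n :: nat and w :: "(nat => bool) => real"
 assumes k: "k >= 3" "k <= n" and w: "!!sg. 0 <= w sg" and t: "tot n w > 0"
begin

lemma mean_Yt_bounds: "0 <= mean n w (%sg. Yt (F sg))" "mean n w (%sg. Yt (F sg)) <= 2"
 using mean_bounds[of w n "%sg. Yt (F sg)" 2] w t Yt_bounds by auto

lemma Vx_bound: "\<bar>Vx k n w j\<bar> <= (1 / qq k) ^ j"
proof -
 have q: "0 < qq k" using qq_bounds[OF k(1)] by simp
 have "\<bar>avg (lsts j (clauses (k - 1) n)) (%cs. Lam (mean n w (%sg. Yt (map (truth sg) cs))))\<bar>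
   <= avg (lsts j (clauses (k - 1) n)) (%cs. \<bar>Lam (mean n w (%sg. Yt (map (truth sg) cs)))\<bar>)" by (rule avg_abs)
 also have "... <= 2" using k clauses_nonempty[of "k - 1" n]
  by (intro avg_le Lam_abs_le mean_Yt_bounds) auto
 finally show ?thesis using q unfolding Vx_def by (simp add: abs_divide abs_mult power_divide field_simps)
qed

lemma vertex_cmp:
 assumes mod: "!!x y. 0 <= x & x <= 2 & 0 <= y & y <= 2 ==> \<bar>Lam x - Lam y\<bar> <= \<epsilon> + C * \<bar>x - y\<bar>"
  and C: "0 <= C" and R: "j * (k - 1) <= R"
 shows "\<bar>Vx k n w j - Vt k ({..<n} \<times> UNIV) (pw n w) j\<bar>
  <= (1 / qq k) ^ j * (\<epsilon> + 4 * real j * real k ^ 2 / real n + 4 * C * real j * real k * (Dl R n w / tot n w))"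
proof -
 let ?S = "{..<n} \<times> (UNIV :: bool set)" and ?r = "k - 1"
 let ?T = "lsts ?r ?S"
 have n: "n > 0" using k by simp
 have S: "finite ?S" "?S ~= {}" using n by auto
 have p01: "0 <= pw n w x & pw n w x <= 1" for x by (rule pw_bounds[OF w t])
 have q: "0 < qq k" using qq_bounds[OF k(1)] by simp
 have D0: "0 <= Dl R n w / tot n w" unfolding Dl_def
  using t by (intro divide_nonneg_pos avg_nonneg) (auto simp: del_def intro: sum_nonneg)
 let ?f = "%cs. Lam (mean n w (%sg. Yt (map (truth sg) cs)))"
 have 1: "\<bar>avg (lsts j (clauses ?r n)) ?f - avg (lsts j ?T) ?f\<bar> <= 2 * 2 * (real j * (real k ^ 2 / real n))"
 proof (rule avg_lsts_subset)
  show "1 - real k ^ 2 / real n <= real (card (clauses ?r n)) / real (card ?T)"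
  proof -
   have "real ?r ^ 2 / real n <= real k ^ 2 / real n" by (intro divide_right_mono power_mono) auto
   then show ?thesis using clauses_density[of ?r n] k n by linarith
  qed
  show "clauses ?r n ~= {}" by (rule clauses_nonempty) (use k in simp)
  show "\<bar>?f xs\<bar> <= 2" for xs by (intro Lam_abs_le mean_Yt_bounds)
 qed (use S clauses_subset in auto)
 let ?g = "%xss. Lam (Wl (map (map (pw n w)) xss))"
 have pt: "\<bar>?f xss - ?g xss\<bar> <= \<epsilon> + C * (2 * bnd n w (concat xss))" if "xss \<in> lsts j ?T" for xss
 proof -
  have l: "\<forall>xs\<in>set xss. length xs = ?r" "length xss = j" using that by (auto simp: lsts_def)
  let ?h = "%z. Yt (chunks ?r j z) / 2"
  have "\<bar>mean n w (%sg. ?h (truth sg (concat xss))) - ind (pw n w) (concat xss) ?h\<bar> <= bnd n w (concat xss)"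
   by (rule hybrid[OF w t]) (use Yt_bounds in \<open>auto simp: field_simps\<close>)
  moreover have "chunks ?r j (truth sg (concat xss)) = map (truth sg) xss" for sg
  proof -
   have "\<forall>ys\<in>set (map (truth sg) xss). length ys = ?r" using l(1) by (auto simp: truth_def)
   then show ?thesis unfolding truth_concat using chunks_concat[of "map (truth sg) xss" ?r] l(2) by simp
  qed
  moreover have "mean n w (%sg. Yt (map (truth sg) xss) / 2) = mean n w (%sg. Yt (map (truth sg) xss)) / 2"
   using mean_cmult[of w n "1/2" "%sg. Yt (map (truth sg) xss)"] w t by simp
  moreover have "ind (pw n w) (concat xss) ?h = Wl (map (map (pw n w)) xss) / 2"
   using ind_Yt[OF l(1), of "pw n w"] ind_cmult[of "pw n w" "concat xss" "1/2" "%z. Yt (chunks ?r j z)"] l(2) by simp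
  ultimately have "\<bar>mean n w (%sg. Yt (map (truth sg) xss)) / 2 - Wl (map (map (pw n w)) xss) / 2\<bar> <= bnd n w (concat xss)"
   by (simp only:)
  then have a: "\<bar>mean n w (%sg. Yt (map (truth sg) xss)) - Wl (map (map (pw n w)) xss)\<bar> <= 2 * bnd n w (concat xss)"
   by linarith
  have W: "0 <= Wl (map (map (pw n w)) xss)" "Wl (map (map (pw n w)) xss) <= 2"
   by (rule Wl_bounds, use p01 in auto)+
  have "\<bar>?f xss - ?g xss\<bar> <= \<epsilon> + C * \<bar>mean n w (%sg. Yt (map (truth sg) xss)) - Wl (map (map (pw n w)) xss)\<bar>"
   by (rule mod) (use W mean_Yt_bounds in auto)
  moreover have "C * \<bar>mean n w (%sg. Yt (map (truth sg) xss)) - Wl (map (map (pw n w)) xss)\<bar> <= C * (2 * bnd n w (concat xss))"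
   using a C by (rule mult_left_mono)
  ultimately show ?thesis by linarith
 qed
 have ne: "lsts j ?T ~= {}" "finite (lsts j ?T)" using S by auto
 have "\<bar>avg (lsts j ?T) ?f - avg (lsts j ?T) ?g\<bar> <= avg (lsts j ?T) (%xss. \<bar>?f xss - ?g xss\<bar>)"
  unfolding avg_diff[symmetric] by (rule avg_abs)
 also have "... <= avg (lsts j ?T) (%xss. \<epsilon> + C * (2 * bnd n w (concat xss)))" by (rule avg_mono) (rule pt)
 also have "... = \<epsilon> + C * (2 * avg (lsts j ?T) (%xss. bnd n w (concat xss)))"
  unfolding avg_add avg_cmult using ne by (simp add: avg_const)
 also have "avg (lsts j ?T) (%xss. bnd n w (concat xss)) = avg (lsts (j * ?r) ?S) (bnd n w)"
 proof -
  have "avg (lsts j ?T) (%xss. bnd n w (concat xss)) = avg (lsts (j * ?r) ?S) (%xs. bnd n w (concat (chunks ?r j xs)))"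
   by (rule avg_chunks)
  also have "... = avg (lsts (j * ?r) ?S) (bnd n w)"
  proof (rule avg_cong)
   have cc: "length xs = j * r ==> concat (chunks r j xs) = xs" for r j and xs :: "(nat \<times> bool) list"
    by (induction j arbitrary: xs) simp_all
   fix xs assume "xs \<in> lsts (j * ?r) ?S"
   then show "bnd n w (concat (chunks ?r j xs)) = bnd n w xs" using cc[of xs j ?r] by (simp add: lsts_def)
  qed
  finally show ?thesis .
 qed
 also have "\<epsilon> + C * (2 * avg (lsts (j * ?r) ?S) (bnd n w)) <= \<epsilon> + C * (2 * (2 * real (j * k) * (Dl R n w / tot n w)))"
 proof -
  have "avg (lsts (j * ?r) ?S) (bnd n w) <= 2 * real (j * ?r) * (Dl R n w / tot n w)"
   by (rule bnd_avg[OF w t n R])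
  also have "... <= 2 * real (j * k) * (Dl R n w / tot n w)"
   using D0 by (intro mult_right_mono) (auto intro!: mult_left_mono)
  finally show ?thesis using C by (intro add_left_mono mult_left_mono) auto
 qed
 finally have 2: "\<bar>avg (lsts j ?T) ?f - avg (lsts j ?T) ?g\<bar> <= \<epsilon> + 4 * C * real j * real k * (Dl R n w / tot n w)"
  by (simp add: algebra_simps)
 let ?E = "\<epsilon> + 4 * real j * real k ^ 2 / real n + 4 * C * real j * real k * (Dl R n w / tot n w)"
 have E: "\<bar>avg (lsts j (clauses ?r n)) ?f - avg (lsts j ?T) ?g\<bar> <= ?E"
 proof -
  have "2 * 2 * (real j * (real k ^ 2 / real n)) = 4 * real j * real k ^ 2 / real n" by simp
  then show ?thesis using 1 2 by linarith
 qed
 have "Vx k n w j - Vt k ?S (pw n w) j = (avg (lsts j (clauses ?r n)) ?f - avg (lsts j ?T) ?g) / (2 * qq k ^ j)"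
  unfolding Vx_def Vt_def by (simp add: diff_divide_distrib)
 then have "\<bar>Vx k n w j - Vt k ?S (pw n w) j\<bar> = \<bar>avg (lsts j (clauses ?r n)) ?f - avg (lsts j ?T) ?g\<bar> / (2 * qq k ^ j)"
  using q by (simp add: abs_divide)
 also have "... <= ?E / (2 * qq k ^ j)" using E q by (intro divide_right_mono) auto
 also have "... <= ?E / (1 * qq k ^ j)"
  using q E by (intro divide_left_mono mult_right_mono) (auto intro: order_trans[OF abs_ge_zero])
 also have "... = (1 / qq k) ^ j * ?E" by (simp add: power_divide)
 finally show ?thesis .
qed

lemma edge_cmp:
 assumes mod: "!!x y. 0 <= x & x <= 2 & 0 <= y & y <= 2 ==> \<bar>Lam x - Lam y\<bar> <= \<epsilon> + C * \<bar>x - y\<bar>"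
  and C: "0 <= C" and R: "k <= R"
 shows "\<bar>Ec k n w - Ed k ({..<n} \<times> UNIV) (pw n w)\<bar>
  <= (\<epsilon> + 4 * real k ^ 2 / real n + 2 * C * real k * (Dl R n w / tot n w)) / qq k"
proof -
 let ?S = "{..<n} \<times> (UNIV :: bool set)"
 let ?T = "lsts k ?S"
 have n: "n > 0" using k by simp
 have S: "finite ?S" "?S ~= {}" using n by auto
 have p01: "0 <= pw n w x & pw n w x <= 1" for x by (rule pw_bounds[OF w t])
 have q: "0 < qq k" using qq_bounds[OF k(1)] by simp
 let ?f = "%a. Lam (mean n w (cl a))" and ?g = "%xs. Lam (El (map (pw n w) xs))"
 have mb: "0 <= mean n w (cl a)" "mean n w (cl a) <= 1" for a
  using mean_bounds[of w n "cl a" 1] w t cl_01 by auto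
 have "\<bar>avg (clauses k n) ?f - avg ?T ?f\<bar> <= 2 * 2 * (1 - real (card (clauses k n)) / real (card ?T))"
 proof (rule avg_subset_diff)
  show "\<bar>?f a\<bar> <= 2" for a using mb[of a] by (intro Lam_abs_le) auto
 qed (use S clauses_subset clauses_nonempty k in auto)
 also have "... <= 2 * 2 * (real k ^ 2 / real n)"
 proof (rule mult_left_mono)
  show "1 - real (card (clauses k n)) / real (card ?T) <= real k ^ 2 / real n"
   using clauses_density[OF k(2) n] by (simp only: diff_le_eq add.commute)
 qed simp
 finally have 1: "\<bar>avg (clauses k n) ?f - avg ?T ?f\<bar> <= 4 * (real k ^ 2 / real n)" by simp
 have pt: "\<bar>?f xs - ?g xs\<bar> <= \<epsilon> + C * bnd n w xs" if "xs \<in> ?T" for xs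
 proof -
  have x: "xs ~= []" using that k by (auto simp: lsts_def)
  have "\<bar>mean n w (%sg. of_bool (nae (truth sg xs))) - ind (pw n w) xs (%y. of_bool (nae y))\<bar> <= bnd n w xs"
   by (rule hybrid[OF w t]) auto
  then have a: "\<bar>mean n w (cl xs) - El (map (pw n w) xs)\<bar> <= bnd n w xs"
   unfolding ind_nae[OF x] cl_truth[abs_def] .
  have W: "0 <= El (map (pw n w) xs)" "El (map (pw n w) xs) <= 1"
   by (rule El_bounds, use p01 x in auto)+
  have "\<bar>?f xs - ?g xs\<bar> <= \<epsilon> + C * \<bar>mean n w (cl xs) - El (map (pw n w) xs)\<bar>"
   by (rule mod) (use W mb[of xs] in auto)
  moreover have "C * \<bar>mean n w (cl xs) - El (map (pw n w) xs)\<bar> <= C * bnd n w xs"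
   using a C by (rule mult_left_mono)
  ultimately show ?thesis by linarith
 qed
 have ne: "?T ~= {}" "finite ?T" using S by auto
 have "\<bar>avg ?T ?f - avg ?T ?g\<bar> <= avg ?T (%xss. \<bar>?f xss - ?g xss\<bar>)"
  unfolding avg_diff[symmetric] by (rule avg_abs)
 also have "... <= avg ?T (%xs. \<epsilon> + C * bnd n w xs)" by (rule avg_mono) (rule pt)
 also have "... = \<epsilon> + C * avg ?T (bnd n w)"
  unfolding avg_add avg_cmult using ne by (simp add: avg_const)
 also have "... <= \<epsilon> + C * (2 * real k * (Dl R n w / tot n w))"
  using C by (intro add_left_mono mult_left_mono bnd_avg[OF w t n R]) auto
 finally have "\<bar>avg (clauses k n) ?f - avg ?T ?g\<bar> <= \<epsilon> + 4 * real k ^ 2 / real n + 2 * C * real k * (Dl R n w / tot n w)"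
  using 1 by (simp add: algebra_simps)
 moreover have "\<bar>Ec k n w - Ed k ?S (pw n w)\<bar> = \<bar>avg (clauses k n) ?f - avg ?T ?g\<bar> / qq k"
  unfolding Ec_def Ed_def diff_divide_distrib[symmetric] using q by (simp add: abs_divide)
 ultimately show ?thesis using q by (simp add: divide_right_mono)
qed

end

lemma EP_tail:
 assumes l: "0 <= l" and r: "0 <= r" and \<epsilon>: "0 < \<epsilon>"
 shows "\<exists>\<Gamma>::nat. EP l (%j. of_bool (\<Gamma> < j) * r ^ j) <= \<epsilon>"
proof -
 have "(%\<Gamma>::nat. exp (l * (2 * r) - l) * (1 / 2) ^ \<Gamma>) \<longlonglongrightarrow> exp (l * (2 * r) - l) * 0"
  by (intro tendsto_intros LIMSEQ_realpow_zero) auto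
 then have "\<forall>\<^sub>F \<Gamma> in sequentially. exp (l * (2 * r) - l) * (1 / 2) ^ \<Gamma> < \<epsilon>"
  using \<epsilon> by (intro order_tendstoD(2)) auto
 then obtain \<Gamma> :: nat where \<Gamma>: "exp (l * (2 * r) - l) * (1 / 2) ^ \<Gamma> < \<epsilon>"
  by (auto simp: eventually_sequentially)
 have le: "of_bool (\<Gamma> < j) * r ^ j <= (1 / 2) ^ \<Gamma> * (2 * r) ^ j" for j :: nat
 proof (cases "\<Gamma> < j")
  case True
  have "(1::real) <= 2 ^ (j - \<Gamma>)" by simp
  also have "(2::real) ^ (j - \<Gamma>) = (1 / 2) ^ \<Gamma> * 2 ^ j" using True by (simp add: power_diff power_divide)
  finally have "1 * r ^ j <= (1 / 2) ^ \<Gamma> * 2 ^ j * r ^ j" using r by (intro mult_right_mono) auto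
  then show ?thesis using True by (simp add: power_mult_distrib)
 qed (use r in simp)
 have "EP l (%j. of_bool (\<Gamma> < j) * r ^ j) <= EP l (%j. (1 / 2) ^ \<Gamma> * (2 * r) ^ j)"
 proof (rule EP_mono[OF l _ _ le])
  show "(%j. po l j * (of_bool (\<Gamma> < j) * r ^ j)) summable_on UNIV"
   by (rule po_summable[OF l r, of _ 1]) (use r in auto)
  show "(%j. po l j * ((1 / 2) ^ \<Gamma> * (2 * r) ^ j)) summable_on UNIV"
   by (rule po_summable[OF l, of "2 * r" _ "(1 / 2) ^ \<Gamma>"]) (use r in \<open>auto simp: abs_mult\<close>)
 qed
 also have "... = (1 / 2) ^ \<Gamma> * exp (l * (2 * r) - l)" using r by (simp only: EP_cmult) (subst EP_power[OF l], auto)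
 finally show ?thesis using \<Gamma> by (intro exI[of _ \<Gamma>]) (simp add: mult.commute)
qed

lemma cavity_step:
 fixes d \<phi> \<epsilon> :: real
 assumes k: "k >= 3" and d: "0 < d" and \<epsilon>: "0 < \<epsilon>" and cond: "!!\<pi>. \<pi> \<in> P_star ==> B k d \<pi> <= \<phi>"
 shows "\<exists>R C. 0 < C & (\<forall>n w. k <= n --> (\<forall>sg. 0 <= w sg) --> 0 < tot n w -->
   EP d (Vx k n w) - d * (real k - 1) / real k * Ec k n w <= \<phi> + \<epsilon> + C * (Dl R n w / tot n w + 1 / real n))"
proof -
 define r where "r = 1 / qq k"
 have q: "0 < qq k" "qq k < 1" using qq_bounds[OF k] by auto
 then have r: "1 <= r" by (simp add: r_def)
 obtain \<Gamma> where \<Gamma>: "EP d (%j. of_bool (\<Gamma> < j) * r ^ j) <= \<epsilon> / 8"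
  using EP_tail[of d r "\<epsilon> / 8"] d r \<epsilon> by auto
 define \<epsilon>' where "\<epsilon>' = \<epsilon> / (4 * (r ^ \<Gamma> + d * r))"
 have den: "0 < r ^ \<Gamma> + d * r" using r d by (intro add_pos_pos mult_pos_pos zero_less_power) auto
 then have \<epsilon>': "0 < \<epsilon>'" using \<epsilon> by (simp add: \<epsilon>'_def)
 obtain C where C: "0 < C" and mod: "!!x y. 0 <= x & x <= 2 & 0 <= y & y <= 2 ==> \<bar>Lam x - Lam y\<bar> <= \<epsilon>' + C * \<bar>x - y\<bar>"
  using Lam_modulus[OF \<epsilon>'] by blast
 define R where "R = \<Gamma> * (k - 1) + k"
 define C1 where "C1 = 4 * real (\<Gamma> + 1) * real k ^ 2 * (1 + C)"
 have C1: "0 < C1" using C k by (simp add: C1_def)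
 have main: "EP d (Vx k n w) - d * (real k - 1) / real k * Ec k n w <= \<phi> + \<epsilon> + C1 * (r ^ \<Gamma> + d * r) * (Dl R n w / tot n w + 1 / real n)"
  if kn: "k <= n" and w: "!!sg. 0 <= w sg" and t: "0 < tot n w" for n w
 proof -
  let ?S = "{..<n} \<times> (UNIV :: bool set)"
  have n: "0 < n" using k kn by simp
  have S: "finite ?S" "?S ~= {}" using n by auto
  have p01: "0 <= pw n w x & pw n w x <= 1" for x by (rule pw_bounds[OF w t])
  define E where "E = Dl R n w / tot n w"
  have E0: "0 <= E" unfolding E_def Dl_def
   using t by (intro divide_nonneg_pos avg_nonneg) (auto simp: del_def intro: sum_nonneg)
  define X where "X = \<epsilon>' + C1 * (E + 1 / real n)"
  have X: "0 <= X" using \<epsilon>' C1 E0 by (simp add: X_def)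
  have C1a: "4 * real j * real k ^ 2 <= C1" "4 * C * real j * real k <= C1" if "j <= \<Gamma> + 1" for j
  proof -
   have "4 * real j * real k ^ 2 * 1 <= 4 * real (\<Gamma> + 1) * real k ^ 2 * (1 + C)"
    using that C by (intro mult_mono) auto
   then show "4 * real j * real k ^ 2 <= C1" by (simp add: C1_def)
   have "real k <= real k ^ 2" using k by (simp add: power2_eq_square)
   then have "4 * real j * real k * C <= 4 * real (\<Gamma> + 1) * real k ^ 2 * (1 + C)"
    using that C by (intro mult_mono) auto
   then show "4 * C * real j * real k <= C1" by (simp add: C1_def mult_ac)
  qed
  have v: "Vx k n w j <= Vt k ?S (pw n w) j + (r ^ \<Gamma> * X + 2 * (of_bool (\<Gamma> < j) * r ^ j))" for j
  proof (cases "j <= \<Gamma>")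
   case True
   have R: "j * (k - 1) <= R" using True by (simp add: R_def trans_le_add1)
   have a: "\<bar>Vx k n w j - Vt k ?S (pw n w) j\<bar> <= r ^ j * (\<epsilon>' + 4 * real j * real k ^ 2 / real n + 4 * C * real j * real k * E)"
    using vertex_cmp[OF k kn w t mod less_imp_le[OF C] R] by (simp add: r_def E_def)
   have "4 * real j * real k ^ 2 / real n <= C1 * (1 / real n)" using C1a(1)[of j] True n by (simp add: divide_right_mono)
   moreover have "4 * C * real j * real k * E <= C1 * E" using C1a(2)[of j] True E0 by (intro mult_right_mono) auto
   ultimately have b: "\<epsilon>' + 4 * real j * real k ^ 2 / real n + 4 * C * real j * real k * E <= X"
    by (simp add: X_def distrib_left)
   have "r ^ j * (\<epsilon>' + 4 * real j * real k ^ 2 / real n + 4 * C * real j * real k * E) <= r ^ j * X"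
    using b r by (intro mult_left_mono) auto
   also have "... <= r ^ \<Gamma> * X" using True r X by (intro mult_right_mono power_increasing) auto
   finally show ?thesis using a True by simp
  next
   case False
   have "0 <= r ^ \<Gamma> * X" using r X by simp
   moreover have "\<bar>Vt k ?S (pw n w) j\<bar> <= r ^ j" unfolding r_def by (rule Vt_bound[OF k S p01])
   moreover have "\<bar>Vx k n w j\<bar> <= r ^ j" unfolding r_def by (rule Vx_bound[OF k kn w t])
   ultimately show ?thesis using False by simp
  qed
  have sV: "(%j. po d j * Vx k n w j) summable_on UNIV"
   using d r Vx_bound[OF k kn w t, folded r_def] by (intro po_summable[of d r _ 1]) auto
  have sT: "(%j. po d j * Vt k ?S (pw n w) j) summable_on UNIV"
   using d r Vt_bound[OF k S p01, folded r_def] by (intro po_summable[of d r _ 1]) auto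
  have sc: "(%j. po d j * c) summable_on UNIV" for c
   using d by (intro po_summable[of d 1 _ "\<bar>c\<bar>"]) auto
  have sb: "(%j. po d j * (2 * (of_bool (\<Gamma> < j) * r ^ j))) summable_on UNIV"
   using d r by (intro po_summable[of d r _ 2]) auto
  have sb2: "(%j. po d j * (r ^ \<Gamma> * X + 2 * (of_bool (\<Gamma> < j) * r ^ j))) summable_on UNIV"
   using summable_on_add[OF sc sb] by (simp add: distrib_left)
  have sb3: "(%j. po d j * (Vt k ?S (pw n w) j + (r ^ \<Gamma> * X + 2 * (of_bool (\<Gamma> < j) * r ^ j)))) summable_on UNIV"
   using summable_on_add[OF sT sb2] by (simp add: distrib_left)
  have "EP d (Vx k n w) <= EP d (%j. Vt k ?S (pw n w) j + (r ^ \<Gamma> * X + 2 * (of_bool (\<Gamma> < j) * r ^ j)))"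
   by (rule EP_mono[OF less_imp_le[OF d] sV sb3 v])
  also have "... = EP d (Vt k ?S (pw n w)) + (r ^ \<Gamma> * X + 2 * EP d (%j. of_bool (\<Gamma> < j) * r ^ j))"
   unfolding EP_add[OF sT sb2] EP_add[OF sc sb] EP_cmult using EP_const[of d] d by simp
  finally have V: "EP d (Vx k n w) <= EP d (Vt k ?S (pw n w)) + (r ^ \<Gamma> * X + \<epsilon> / 4)" using \<Gamma> by simp
  have e: "\<bar>Ec k n w - Ed k ?S (pw n w)\<bar> <= r * X"
  proof -
   have a: "\<bar>Ec k n w - Ed k ?S (pw n w)\<bar> <= r * (\<epsilon>' + 4 * real k ^ 2 / real n + 2 * C * real k * E)"
    using edge_cmp[OF k kn w t mod less_imp_le[OF C], of R] by (simp add: r_def E_def R_def)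
   have "4 * real k ^ 2 / real n <= C1 * (1 / real n)" using C1a(1)[of 1] n by (simp add: divide_right_mono)
   moreover have "2 * C * real k * E <= C1 * E"
   proof (intro mult_right_mono)
    have "0 <= C * real k" using C by simp
    then show "2 * C * real k <= C1" using C1a(2)[of 1] by simp
   qed (use E0 in auto)
   ultimately have b: "\<epsilon>' + 4 * real k ^ 2 / real n + 2 * C * real k * E <= X"
    by (simp add: X_def distrib_left)
   show ?thesis using a mult_left_mono[OF b, of r] r by linarith
  qed
  define c where "c = d * (real k - 1) / real k"
  have c: "0 <= c" "c <= d" using k d by (auto simp: c_def field_simps)
  have "- c * Ec k n w <= - c * Ed k ?S (pw n w) + d * (r * X)"
  proof -
   have "c * (Ed k ?S (pw n w) - Ec k n w) <= c * (r * X)" using e c by (intro mult_left_mono) auto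
   also have "... <= d * (r * X)" using c r X by (intro mult_right_mono) auto
   finally show ?thesis by (simp add: algebra_simps)
  qed
  moreover have "EP d (Vt k ?S (pw n w)) - c * Ed k ?S (pw n w) <= \<phi>"
  proof -
   have "fpi ?S (pw n w) \<in> P_star"
    by (rule fpi_P_star[OF S]) (use p01 avg_pw[OF w t n] in auto)
   from cond[OF this] show ?thesis
    using B_fpi[OF k d S p01] by (simp add: c_def)
  qed
  ultimately have "EP d (Vx k n w) - c * Ec k n w <= \<phi> + (r ^ \<Gamma> + d * r) * X + \<epsilon> / 4"
   using V by (simp add: algebra_simps)
  also have "(r ^ \<Gamma> + d * r) * X = \<epsilon> / 4 + C1 * (r ^ \<Gamma> + d * r) * (E + 1 / real n)"
   using den by (simp add: X_def \<epsilon>'_def distrib_left) (simp add: field_simps)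
  finally show ?thesis using \<epsilon> by (simp add: c_def E_def)
 qed
 show ?thesis
  by (rule exI[of _ R], rule exI[of _ "C1 * (r ^ \<Gamma> + d * r)"]) (use C1 den main in auto)
qed

section \<open>Adding a variable\<close>

definition rest :: "nat => clause => clause" where
 "rest n a = map (%l. (fst l, snd l = snd (hd (filter (%l. fst l = n) a)))) (filter (%l. fst l ~= n) a)"

definition ins :: "nat => nat \<times> bool \<times> clause => clause" where
 "ins n = (%(p, s, c). let c' = map (%l. (fst l, snd l = s)) c in take p c' @ (n, s) # drop p c')"

lemma rest_split:
 assumes "n \<notin> fst ` set xs" "n \<notin> fst ` set ys"
 shows "rest n (xs @ (n, s) # ys) = map (%l. (fst l, snd l = s)) (xs @ ys)"
proof -
 have f: "filter (%l. fst l ~= n) zs = zs" "filter (%l. fst l = n) zs = []" if "n \<notin> fst ` set zs" for zs :: clause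
  using that by (auto simp: filter_empty_conv filter_id_conv)
 show ?thesis unfolding rest_def using f[OF assms(1)] f[OF assms(2)] by simp
qed

lemma new_clause_split:
 assumes "a \<in> clauses k (Suc n) - clauses k n"
 obtains xs s ys where "a = xs @ (n, s) # ys" "n \<notin> fst ` set xs" "n \<notin> fst ` set ys"
proof -
 have a: "length a = k" "distinct (map fst a)" "\<forall>l\<in>set a. fst l < Suc n" "~ (\<forall>l\<in>set a. fst l < n)"
  using assms by (auto simp: clauses_def)
 then obtain l where "l \<in> set a" "fst l = n" by (auto simp: less_Suc_eq)
 then obtain xs ys where s: "a = xs @ l # ys" by (meson split_list)
 show ?thesis
  by (rule that[of xs "snd l" ys]) (use a(2) s \<open>fst l = n\<close> in auto)
qed

lemma ins_bij:
 assumes k: "k >= 1"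
 shows "bij_betw (ins n) ({..<k} \<times> UNIV \<times> clauses (k - 1) n) (clauses k (Suc n) - clauses k n)"
proof -
 define g where "g a = (length (takeWhile (%l. fst l ~= n) a), snd (hd (filter (%l. fst l = n) a)), rest n a)" for a :: clause
 have flip: "map (%l. (fst l, snd l = s)) (map (%l. (fst l, snd l = s)) c) = c" for s and c :: clause
  by (induction c) auto
 have gs: "g (xs @ (n, s) # ys) = (length xs, s, map (%l. (fst l, snd l = s)) (xs @ ys))"
  if "n \<notin> fst ` set xs" "n \<notin> fst ` set ys" for xs s ys
 proof -
  have "filter (%l. fst l = n) xs = []" using that by (auto simp: filter_empty_conv)
  moreover have "takeWhile (%l. fst l ~= n) (xs @ (n, s) # ys) = xs" using that by (subst takeWhile_append2) auto
  ultimately show ?thesis unfolding g_def rest_split[OF that] by simp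
 qed
 show ?thesis
 proof (rule bij_betw_byWitness[where f' = g])
  show "\<forall>x\<in>{..<k} \<times> UNIV \<times> clauses (k - 1) n. g (ins n x) = x"
  proof
   fix x assume "x \<in> {..<k} \<times> (UNIV :: bool set) \<times> clauses (k - 1) n"
   then obtain p s c where x: "x = (p, s, c)" "p < k" "c \<in> clauses (k - 1) n" by auto
   let ?c = "map (%l. (fst l, snd l = s)) c"
   have c: "length c = k - 1" "\<forall>l\<in>set c. fst l < n" using x(3) by (auto simp: clauses_def)
   have "n \<notin> fst ` set ?c" using c(2) by auto
   then have "n \<notin> fst ` set (take p ?c)" "n \<notin> fst ` set (drop p ?c)" by (meson image_mono set_take_subset set_drop_subset subsetD)+
   from gs[OF this, of s] show "g (ins n x) = x"
    unfolding append_take_drop_id flip x(1) ins_def Let_def prod.case using c(1) x(2) by simp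
  qed
  show "\<forall>a\<in>clauses k (Suc n) - clauses k n. ins n (g a) = a"
  proof
   fix a assume "a \<in> clauses k (Suc n) - clauses k n"
   then obtain xs s ys where a: "a = xs @ (n, s) # ys" "n \<notin> fst ` set xs" "n \<notin> fst ` set ys" by (rule new_clause_split)
   show "ins n (g a) = a" unfolding a(1) gs[OF a(2,3)] ins_def Let_def prod.case flip by simp
  qed
  show "ins n ` ({..<k} \<times> UNIV \<times> clauses (k - 1) n) \<subseteq> clauses k (Suc n) - clauses k n"
  proof
   fix a assume "a \<in> ins n ` ({..<k} \<times> UNIV \<times> clauses (k - 1) n)"
   then obtain p s c where x: "a = ins n (p, s, c)" "p < k" "c \<in> clauses (k - 1) n" by auto
   let ?c = "map (%l. (fst l, snd l = s)) c"
   have c: "length c = k - 1" "distinct (map fst c)" "\<forall>l\<in>set c. fst l < n" using x(3) by (auto simp: clauses_def)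
   have a: "a = take p ?c @ (n, s) # drop p ?c" using x(1) by (simp add: ins_def Let_def)
   have m: "mset a = mset ((n, s) # ?c)"
   proof -
    have "mset (take p ?c) + mset (drop p ?c) = mset ?c" unfolding mset_append[symmetric] append_take_drop_id ..
    then show ?thesis unfolding a mset_append mset.simps(2) by (simp only: union_mset_add_mset_right)
   qed
   have "length a = k" using mset_eq_length[OF m] c(1) k by simp
   moreover have "set a = set ((n, s) # ?c)" by (rule mset_eq_setD[OF m])
   moreover have "distinct (map fst a)"
   proof -
    have "distinct (map fst ((n, s) # ?c))" using c(2,3) by (auto simp: comp_def)
    moreover have "mset (map fst a) = mset (map fst ((n, s) # ?c))" unfolding mset_map m ..
    ultimately show ?thesis using mset_eq_imp_distinct_iff by blast
   qed
   ultimately show "a \<in> clauses k (Suc n) - clauses k n" using c(3) by (auto simp: clauses_def less_SucI)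
  qed
  show "g ` (clauses k (Suc n) - clauses k n) \<subseteq> {..<k} \<times> UNIV \<times> clauses (k - 1) n"
  proof
   fix x assume "x \<in> g ` (clauses k (Suc n) - clauses k n)"
   then obtain a where xa: "x = g a" and aD: "a \<in> clauses k (Suc n) - clauses k n" by auto
   from aD obtain xs s ys where a: "a = xs @ (n, s) # ys" "n \<notin> fst ` set xs" "n \<notin> fst ` set ys" by (rule new_clause_split)
   have b: "length a = k" "distinct (map fst a)" "\<forall>l\<in>set a. fst l < Suc n" using aD by (auto simp: clauses_def)
   have "\<forall>l\<in>set xs \<union> set ys. fst l < n"
   proof
    fix l assume l: "l \<in> set xs \<union> set ys"
    then have "fst l ~= n" "fst l < Suc n" using a b(3) by auto
    then show "fst l < n" by simp
   qed
   then have "fst ` set (xs @ ys) \<subseteq> {..<n}" by auto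
   moreover have "distinct (map fst (xs @ ys))" "length (xs @ ys) = k - 1" "length xs < k" using b a(1) by auto
   moreover have "(\<forall>l\<in>set c. fst l < n) \<longleftrightarrow> fst ` set c \<subseteq> {..<n}" for c :: clause by auto
   ultimately show "x \<in> {..<k} \<times> UNIV \<times> clauses (k - 1) n"
    unfolding xa a(1) gs[OF a(2,3)] clauses_def
    by (simp only: mem_Sigma_iff mem_Collect_eq length_map map_map comp_def fst_conv set_map image_image UNIV_I lessThan_iff simp_thms)
  qed
 qed
qed

lemma avg_rest:
 assumes k: "k >= 1" "k <= Suc n"
 shows "avg (clauses k (Suc n) - clauses k n) (%a. f (rest n a)) = avg (clauses (k - 1) n) f"
proof -
 let ?P = "{..<k} \<times> (UNIV :: bool set) \<times> clauses (k - 1) n"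
 have "avg (clauses k (Suc n) - clauses k n) (%a. f (rest n a)) = avg ?P (%x. f (rest n (ins n x)))"
  by (rule avg_bij[OF ins_bij[OF k(1)]])
 also have "... = avg ?P (%(p, sc). (%(s, c). f c) sc)"
 proof (rule avg_cong)
  fix x assume "x \<in> ?P"
  then obtain p s c where x: "x = (p, s, c)" "p < k" "c \<in> clauses (k - 1) n" by auto
  let ?c = "map (%l. (fst l, snd l = s)) c"
  have "\<forall>l\<in>set c. fst l < n" using x(3) by (auto simp: clauses_def)
  then have "n \<notin> fst ` set ?c" by auto
  then have "n \<notin> fst ` set (take p ?c)" "n \<notin> fst ` set (drop p ?c)" by (meson image_mono set_take_subset set_drop_subset subsetD)+
  from rest_split[OF this, of s] have "rest n (ins n x) = map (%l. (fst l, snd l = s)) ?c"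
   unfolding append_take_drop_id x(1) ins_def Let_def prod.case .
  also have "... = c" by (induction c) auto
  finally show "f (rest n (ins n x)) = (%(p, sc). (%(s, c). f c) sc) x" by (simp add: x(1))
 qed
 also have "... = avg (clauses (k - 1) n) f"
  unfolding avg_Times using k by (simp add: avg_const lessThan_empty_iff)
 finally show ?thesis .
qed

lemma avg_map:
 assumes "!!f. avg A (%a. f (h a)) = avg T f"
 shows "avg (lsts j A) (%xs. f (map h xs)) = avg (lsts j T) f"
proof (induction j arbitrary: f)
 case (Suc j)
 have "avg (lsts (Suc j) A) (%xs. f (map h xs)) = avg A (%x. avg (lsts j A) (%xs. f (h x # map h xs)))"
  by (simp add: avg_lsts_Suc)
 also have "... = avg A (%x. avg (lsts j T) (%xs. f (h x # xs)))" by (simp only: Suc[of "%xs. f (_ # xs)"])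
 also have "... = avg T (%x. avg (lsts j T) (%xs. f (x # xs)))" by (rule assms)
 finally show ?case by (simp add: avg_lsts_Suc)
qed simp

lemma cl_new:
 assumes "a \<in> clauses k (Suc n) - clauses k n"
 shows "cl a (sg(n := b)) = 1 - of_bool (\<forall>y\<in>set (truth sg (rest n a)). y = b)"
proof -
 obtain xs s ys where a: "a = xs @ (n, s) # ys" "n \<notin> fst ` set xs" "n \<notin> fst ` set ys" using assms by (rule new_clause_split)
 have z: "!!l. l \<in> set xs \<union> set ys ==> fst l ~= n" using a by auto
 have t: "set (truth (sg(n := b)) a) = insert (b = s) ((%l. sg (fst l) = snd l) ` (set xs \<union> set ys))"
  unfolding truth_def a(1) using z by (auto simp: image_iff)
 have r: "set (truth sg (rest n a)) = (%l. sg (fst l) = (snd l = s)) ` (set xs \<union> set ys)"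
  unfolding a(1) rest_split[OF a(2,3)] truth_def by (simp add: image_image image_Un)
 have "nae (truth (sg(n := b)) a) \<longleftrightarrow> ~ (\<forall>y\<in>set (truth sg (rest n a)). y = b)"
  unfolding nae_def t r by (cases s; cases b) (auto simp: image_iff)
 then show ?thesis unfolding cl_truth by (simp only: of_bool_not_iff)
qed

lemma wgt_new:
 assumes "set G \<subseteq> clauses k (Suc n) - clauses k n"
 shows "wgt G (sg(n := b)) = Ag b (map (truth sg) (map (rest n) G))"
 using assms
proof (induction G)
 case (Cons a G)
 have a: "a \<in> clauses k (Suc n) - clauses k n" "set G \<subseteq> clauses k (Suc n) - clauses k n" using Cons.prems by auto
 show ?case unfolding wgt_Cons cl_new[OF a(1)] Cons.IH[OF a(2)] by (simp only: Ag_def list.map prod_list.Cons)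
qed (simp add: Ag_def)

lemma wgt_old:
 assumes "set F \<subseteq> clauses k n" shows "wgt F (sg(n := b)) = wgt F sg"
 using assms
proof (induction F)
 case (Cons a F)
 have "truth (sg(n := b)) a = truth sg a" using Cons.prems by (auto simp: truth_def clauses_def)
 moreover have "wgt F (sg(n := b)) = wgt F sg" by (rule Cons.IH) (use Cons.prems in simp)
 ultimately show ?case by (simp only: wgt_Cons cl_truth)
qed simp

lemma tot_new:
 assumes F: "set F \<subseteq> clauses k n" and G: "set G \<subseteq> clauses k (Suc n) - clauses k n" and I: "set I \<subseteq> {..<n}"
 shows "tot (Suc n) (cnd (wgt (F @ G)) I v) = tot n (%sg. cnd (wgt F) I v sg * Yt (map (truth sg) (map (rest n) G)))"
proof -
 have "cnd (wgt (F @ G)) I v sg + cnd (wgt (F @ G)) I v (sg(n := True)) = cnd (wgt F) I v sg * Yt (map (truth sg) (map (rest n) G))"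
  if "sg \<in> assignments n" for sg
 proof -
  have "sg n = False" using that by (simp add: assignments_def)
  then have "sg(n := False) = sg" by (rule fun_upd_idem)
  then have 1: "wgt G sg = Ag False (map (truth sg) (map (rest n) G))" using wgt_new[OF G, of sg False] by simp
  have 2: "map (sg(n := True)) I = map sg I" using I by auto
  show ?thesis unfolding cnd_def wgt_append wgt_old[OF F] wgt_new[OF G] 1 2 Yt_def by (simp add: algebra_simps)
 qed
 then show ?thesis unfolding tot_def sum_assignments_Suc by (intro sum.cong) auto
qed

lemma avg_Yt:
 assumes k: "k >= 3" "k <= n"
 shows "avg (lsts j (clauses (k - 1) n)) (%cs. Yt (map (truth sg) cs)) = 2 * qq k ^ j"
proof -
 have one: "avg (clauses (k - 1) n) (%c. 1 - of_bool (\<forall>y\<in>set (truth sg c). y = b)) = qq k" for b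
 proof -
  have ne: "clauses (k - 1) n ~= {}" "dl (k - 1) n ~= {}" using clauses_nonempty dl_nonempty k by auto
  have "avg (clauses (k - 1) n) (%c. of_bool (\<forall>y\<in>set (truth sg c). y = b))
   = avg (dl (k - 1) n) (%is. avg (lsts (k - 1) UNIV) (%ys. of_bool (\<forall>y\<in>set ys. y = b)))"
   unfolding avg_clauses
  proof (rule avg_cong)
   fix "is" assume "is \<in> dl (k - 1) n"
   then show "avg (lsts (k - 1) UNIV) (%ss. of_bool (\<forall>y\<in>set (truth sg (zip is ss)). y = b)) = avg (lsts (k - 1) UNIV) (%ys. of_bool (\<forall>y\<in>set ys. y = b))"
    using avg_signs[of "is" "k - 1" "%ys. of_bool (\<forall>y\<in>set ys. y = b)" sg] by (simp add: dl_def)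
  qed
  also have "... = avg (lsts (k - 1) UNIV) (%ys. of_bool (\<forall>y\<in>set ys. y = b))" using ne by (simp add: avg_const)
  also have "... = (1 / 2) ^ (k - 1)"
  proof -
   have "set ys \<subseteq> {b} \<longleftrightarrow> (\<forall>y\<in>set ys. y = b)" for ys by auto
   then show ?thesis using avg_lsts_sub[of UNIV "{b}" "k - 1"] by (simp only:) simp
  qed
  also have "... = 2 / 2 ^ k" using k by (simp add: power_diff power_divide)
  finally show ?thesis unfolding avg_diff using ne qq_eq[of k] k by (simp add: avg_const)
 qed
 have Ag: "avg (lsts j (clauses (k - 1) n)) (%cs. Ag b (map (truth sg) cs)) = qq k ^ j" for b
 proof (induction j)
  case (Suc j)
  have "avg (lsts (Suc j) (clauses (k - 1) n)) (%cs. Ag b (map (truth sg) cs))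
   = avg (clauses (k - 1) n) (%c. (1 - of_bool (\<forall>y\<in>set (truth sg c). y = b)) * avg (lsts j (clauses (k - 1) n)) (%cs. Ag b (map (truth sg) cs)))"
   unfolding avg_lsts_Suc avg_cmult[symmetric] by (simp add: Ag_def)
  then show ?case unfolding Suc avg_cmult_right one by simp
 qed (simp add: Ag_def)
 show ?thesis unfolding Yt_def avg_add Ag by simp
qed

lemma Lam_tot:
 assumes w: "!!sg. 0 <= w sg" and f: "!!sg. 0 <= f sg" "!!sg. f sg <= c"
 shows "Lam (tot n (%sg. w sg * f sg)) = tot n w * Lam (mean n w f) + mean n w f * Lam (tot n w)"
proof (cases "tot n w = 0")
 case True
 have "tot n (%sg. w sg * f sg) <= tot n (%sg. w sg * c)" using w f by (intro tot_mono mult_left_mono) auto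
 also have "... = 0" using True by (simp add: tot_cmult_right)
 moreover have "0 <= tot n (%sg. w sg * f sg)" using w f by (intro tot_nonneg) auto
 ultimately have "tot n (%sg. w sg * f sg) = 0" by linarith
 then show ?thesis using True by simp
next
 case False
 then have e: "tot n (%sg. w sg * f sg) = tot n w * mean n w f" by (simp add: mean_def)
 have "0 <= tot n w" "0 <= mean n w f" unfolding mean_def using w f by (auto intro!: tot_nonneg divide_nonneg_nonneg)
 then show ?thesis unfolding e by (rule Lam_mult)
qed

lemma avg_Lam_Yt:
 assumes k: "k >= 3" "k <= n" and w: "!!sg. 0 <= w sg"
 shows "avg (lsts j (clauses k (Suc n) - clauses k n)) (%G. Lam (tot n (%sg. w sg * Yt (map (truth sg) (map (rest n) G))))) / (2 * qq k ^ j)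
  = tot n w * Vx k n w j + Lam (tot n w)"
proof -
 let ?T = "clauses (k - 1) n"
 have q: "0 < qq k" using qq_bounds[OF k(1)] by simp
 have "avg (lsts j (clauses k (Suc n) - clauses k n)) (%G. Lam (tot n (%sg. w sg * Yt (map (truth sg) (map (rest n) G)))))
   = avg (lsts j ?T) (%cs. Lam (tot n (%sg. w sg * Yt (map (truth sg) cs))))"
  by (rule avg_map) (use avg_rest k in auto)
 also have "... = avg (lsts j ?T) (%cs. tot n w * Lam (mean n w (%sg. Yt (map (truth sg) cs))) + mean n w (%sg. Yt (map (truth sg) cs)) * Lam (tot n w))"
  by (intro avg_cong Lam_tot[OF w, where c = 2]) (use Yt_bounds in auto)
 also have "... = tot n w * (2 * qq k ^ j * Vx k n w j) + mean n w (%sg. 2 * qq k ^ j) * Lam (tot n w)"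
  unfolding avg_add avg_cmult avg_cmult_right avg_mean avg_Yt[OF k] Vx_def using q by simp
 also have "... = 2 * qq k ^ j * (tot n w * Vx k n w j + Lam (tot n w))"
 proof (cases "tot n w = 0")
  case False
  then show ?thesis by (simp add: mean_const algebra_simps)
 qed simp
 finally show ?thesis using q by simp
qed

lemma log_sum:
 assumes S: "finite S" "S ~= {}" and x: "!!b. b \<in> S ==> 0 <= x b" and y: "!!b. b \<in> S ==> 0 <= y b"
  and xy: "!!b. b \<in> S ==> y b = 0 ==> x b = 0"
 shows "avg S y * Lam (avg S x / avg S y) <= avg S (%b. y b * Lam (x b / y b))"
proof (cases "avg S x = 0")
 case True
 then have "sum x S = 0" using S by (simp add: avg_def)
 then have "x b = 0" if "b \<in> S" for b using sum_nonneg_eq_0_iff[OF S(1), of x] x that by blast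
 then have "avg S (%b. y b * Lam (x b / y b)) = avg S (%_. 0)" by (intro avg_cong) simp
 then show ?thesis using True by simp
next
 case False
 define X Y where "X = avg S x" and "Y = avg S y"
 have X: "0 < X" using False avg_nonneg[of S x] x by (auto simp: X_def order.order_iff_strict)
 have "Y ~= 0"
 proof
  assume "Y = 0"
  then have "sum y S = 0" using S by (simp add: avg_def Y_def)
  then have "x b = 0" if "b \<in> S" for b using sum_nonneg_eq_0_iff[OF S(1), of y] y xy that by blast
  then have "avg S x = avg S (%_. 0)" by (intro avg_cong) simp
  then show False using False by simp
 qed
 then have Y: "0 < Y" using avg_nonneg[of S y] y by (auto simp: Y_def order.order_iff_strict)
 have pt: "x b * (ln (X / Y) + 1) - y b * (X / Y) <= y b * Lam (x b / y b)" if b: "b \<in> S" for b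
 proof (cases "x b = 0")
  case True
  have "0 <= y b * (X / Y)" using y[OF b] X Y by simp
  then show ?thesis using True by simp
 next
  case False
  then have xb: "0 < x b" "0 < y b" using x[OF b] y[OF b] xy[OF b] by (auto simp: order.order_iff_strict)
  define u where "u = (X / Y) / (x b / y b)"
  have u: "0 < u" using X Y xb by (simp add: u_def)
  have "ln u = ln (X / Y) - ln (x b / y b)" unfolding u_def using X Y xb by (intro ln_divide_pos) auto
  moreover have "ln u <= u - 1" using u by (rule ln_le_minus_one)
  ultimately have "x b * (ln (X / Y) - ln (x b / y b)) <= x b * (u - 1)" using xb by (intro mult_left_mono) auto
  moreover have "x b * u = y b * (X / Y)" using xb by (simp add: u_def)
  moreover have "y b * Lam (x b / y b) = x b * ln (x b / y b)" using xb by (simp add: Lam_def)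
  ultimately show ?thesis by (simp add: algebra_simps)
 qed
 have "avg S (%b. x b * (ln (X / Y) + 1) - y b * (X / Y)) <= avg S (%b. y b * Lam (x b / y b))" by (rule avg_mono) (rule pt)
 also have "avg S (%b. x b * (ln (X / Y) + 1) - y b * (X / Y)) = X * (ln (X / Y) + 1) - Y * (X / Y)"
  unfolding avg_diff avg_cmult_right X_def Y_def ..
 also have "... = Y * Lam (X / Y)" using X Y by (simp add: Lam_def algebra_simps)
 finally show ?thesis unfolding X_def Y_def .
qed

section \<open>The free energy recursion\<close>

lemma EP_abs_le:
 assumes l: "0 <= l" and r: "0 <= r" and f: "!!m. \<bar>f m\<bar> <= C * r ^ m"
 shows "\<bar>EP l f\<bar> <= C * exp (l * r - l)"
proof -
 have s: "(%m. po l m * f m) summable_on UNIV" by (rule po_summable[OF l r f])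
 have c: "(%m. po l m * (c * r ^ m)) summable_on UNIV" for c by (rule po_summable[OF l r, of _ "\<bar>c\<bar>"]) (use r in \<open>auto simp: abs_mult\<close>)
 have e: "EP l (%m. c * r ^ m) = c * exp (l * r - l)" for c unfolding EP_cmult EP_power[OF l r] ..
 have "f m <= C * r ^ m" "(- C) * r ^ m <= f m" for m using f[of m] by auto
 then have "EP l f <= EP l (%m. C * r ^ m)" "EP l (%m. (- C) * r ^ m) <= EP l f"
  by (intro EP_mono[OF l] s c; simp)+
 then show ?thesis unfolding e by simp
qed

lemma EP_linear:
 assumes l: "0 <= l" shows "EP l (%j. a + real j * b) = a + l * b"
proof -
 have 1: "((%j. po l j * real j) has_sum l) UNIV"
 proof -
  have "((%j. l * po l j) has_sum l * 1) UNIV"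
   using po_power_has_sum[OF l, of 1] by (intro has_sum_cmult_right) simp
  moreover have "(%j. l * po l j) = (%j. po l j * real j) \<circ> Suc"
  proof
   fix j
   have "real (Suc j) ~= 0" by simp
   then show "l * po l j = ((%j. po l j * real j) \<circ> Suc) j"
    unfolding po_def o_def fact_Suc power_Suc by (simp del: of_nat_Suc)
  qed
  ultimately have "((%j. po l j * real j) has_sum l) (range Suc)"
   by (subst has_sum_reindex) auto
  moreover have "j \<notin> range Suc ==> po l j * real j = 0" for j by (cases j) auto
  ultimately show ?thesis
   by (subst has_sum_cong_neutral[where T = "range Suc" and g = "%j. po l j * real j"]) auto
 qed
 have s: "(%j. po l j * real j) summable_on UNIV" using 1 by (rule has_sum_imp_summable)
 have "(%j. po l j * a) summable_on UNIV" by (rule po_summable[OF l, of 1 _ "\<bar>a\<bar>"]) auto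
 moreover have "(%j. po l j * (b * real j)) summable_on UNIV"
  using summable_on_cmult_right[OF s, of b] by (simp add: mult_ac)
 ultimately have "EP l (%j. a + b * real j) = EP l (%_. a) + EP l (%j. b * real j)" by (rule EP_add)
 also have "... = a + b * l" unfolding EP_cmult EP_const[OF l] using infsumI[OF 1] by (simp add: EP_def)
 finally show ?thesis by (simp add: mult.commute)
qed

lemma EP_sum:
 assumes "finite S" "!!x. x \<in> S ==> (%m. po l m * f x m) summable_on UNIV"
 shows "(%m. po l m * (\<Sum>x\<in>S. f x m)) summable_on UNIV" "EP l (%m. \<Sum>x\<in>S. f x m) = (\<Sum>x\<in>S. EP l (f x))"
proof -
 have "(%m. po l m * (\<Sum>x\<in>S. f x m)) summable_on UNIV & EP l (%m. \<Sum>x\<in>S. f x m) = (\<Sum>x\<in>S. EP l (f x))"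
  using assms
 proof (induction S rule: finite_induct)
  case (insert x S)
  then have s: "(%m. po l m * (\<Sum>x\<in>S. f x m)) summable_on UNIV" "(%m. po l m * f x m) summable_on UNIV" by auto
  have "EP l (%m. f x m + (\<Sum>x\<in>S. f x m)) = EP l (f x) + EP l (%m. \<Sum>x\<in>S. f x m)"
   by (rule EP_add[OF s(2,1)])
  moreover have "(%m. po l m * (f x m + (\<Sum>x\<in>S. f x m))) summable_on UNIV"
   unfolding distrib_left by (rule summable_on_add[OF s(2,1)])
  ultimately show ?case using insert by simp
 qed (simp add: EP_def)
 then show "(%m. po l m * (\<Sum>x\<in>S. f x m)) summable_on UNIV" "EP l (%m. \<Sum>x\<in>S. f x m) = (\<Sum>x\<in>S. EP l (f x))" by auto
qed

definition Av :: "nat => nat => nat list => nat => (((nat => bool) => real) => real) => real" where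
 "Av k n I m h = avg (Fm k n m) (%F. \<Sum>v\<in>bl (length I). h (cnd (wgt F) I v)) / (2 ^ n * qq k ^ m)"

lemma Av_add: "Av k n I m (%w. h w + h' w) = Av k n I m h + Av k n I m h'"
 unfolding Av_def sum.distrib avg_add by (rule add_divide_distrib)

lemma Av_cmult: "Av k n I m (%w. c * h w) = c * Av k n I m h"
 unfolding Av_def sum_distrib_left[symmetric] avg_cmult by simp

lemma Av_mono:
 assumes k: "k >= 3" and h: "!!w. (!!sg. 0 <= w sg) ==> (!!sg. w sg <= 1) ==> h w <= h' w"
 shows "Av k n I m h <= Av k n I m h'"
 unfolding Av_def
proof (intro divide_right_mono avg_mono sum_mono h)
 show "0 <= 2 ^ n * qq k ^ m" using qq_bounds[OF k] by simp
qed (use wgt_01 in \<open>auto simp: cnd_def mult_le_one\<close>)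

lemma Av_abs:
 assumes k: "k >= 3" and h: "!!w. (!!sg. 0 <= w sg) ==> (!!sg. w sg <= 1) ==> \<bar>h w\<bar> <= h' w"
 shows "\<bar>Av k n I m h\<bar> <= Av k n I m h'"
proof -
 have "Av k n I m h <= Av k n I m h'" by (rule Av_mono[OF k]) (use h in \<open>force simp: abs_le_iff\<close>)
 moreover have "Av k n I m (%w. (- 1) * h w) <= Av k n I m h'" by (rule Av_mono[OF k]) (use h in \<open>force simp: abs_le_iff\<close>)
 ultimately show ?thesis unfolding Av_cmult by simp
qed

lemma Av_tot:
 assumes k: "k >= 3" "k <= n" shows "Av k n I m (tot n) = 1"
proof -
 have "Av k n I m (tot n) = avg (Fm k n m) (MM k n)"
  unfolding Av_def sum_tot_cnd[OF refl] avg_divide[symmetric] by (intro avg_cong) (simp add: MM_def lsts_def)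
 then show ?thesis using avg_MM[OF k] by simp
qed

definition Phi :: "nat => nat => nat list => nat => real" where
 "Phi k n I m = Av k n I m (%w. Lam (tot n w))"

definition Qe :: "nat => nat => nat list => nat => real" where
 "Qe k n I m = Av k n I m (%w. tot n w * Ec k n w)"

lemma cnd_Cons: "cnd (wgt (a # F)) I v = (%sg. cnd (wgt F) I v sg * cl a sg)"
 by (auto simp: cnd_def wgt_Cons)

lemma avg_Fm_Suc: "avg (Fm k n (Suc m)) f = avg (Fm k n m) (%F. avg (clauses k n) (%a. f (a # F)))"
 unfolding avg_lsts_Suc by (rule avg_swap)

lemma Phi_Suc:
 assumes k: "k >= 3" "k <= n"
 shows "Phi k n I (Suc m) = Phi k n I m + Qe k n I m"
proof -
 have q: "0 < qq k" using qq_bounds[OF k(1)] by simp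
 have one: "avg (clauses k n) (%a. Lam (tot n (%sg. w sg * cl a sg))) = qq k * (Lam (tot n w) + tot n w * Ec k n w)"
  if w: "!!sg. 0 <= w sg" for w
 proof -
  have "avg (clauses k n) (%a. Lam (tot n (%sg. w sg * cl a sg)))
   = avg (clauses k n) (%a. tot n w * Lam (mean n w (cl a)) + mean n w (cl a) * Lam (tot n w))"
   by (intro avg_cong Lam_tot[where c = 1] w cl_01)
  also have "... = tot n w * (qq k * Ec k n w) + mean n w (%_. qq k) * Lam (tot n w)"
   unfolding avg_add avg_cmult avg_cmult_right avg_mean Ec_def using q avg_cl[of k n] k by simp
  also have "... = qq k * (Lam (tot n w) + tot n w * Ec k n w)"
   by (cases "tot n w = 0") (simp_all add: mean_const algebra_simps)
  finally show ?thesis .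
 qed
 have "avg (Fm k n (Suc m)) (%F. \<Sum>v\<in>bl (length I). Lam (tot n (cnd (wgt F) I v)))
  = avg (Fm k n m) (%F. \<Sum>v\<in>bl (length I). qq k * (Lam (tot n (cnd (wgt F) I v)) + tot n (cnd (wgt F) I v) * Ec k n (cnd (wgt F) I v)))"
  unfolding avg_Fm_Suc avg_sum[of "clauses k n"] cnd_Cons by (intro avg_cong sum.cong refl one cnd_nonneg wgt_01)
 also have "... = qq k * avg (Fm k n m) (%F. \<Sum>v\<in>bl (length I). Lam (tot n (cnd (wgt F) I v)) + tot n (cnd (wgt F) I v) * Ec k n (cnd (wgt F) I v))"
  unfolding sum_distrib_left[symmetric] avg_cmult ..
 finally have "Phi k n I (Suc m) = Av k n I m (%w. Lam (tot n w) + tot n w * Ec k n w)"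
  unfolding Phi_def Av_def using q by simp
 then show ?thesis unfolding Av_add Phi_def Qe_def .
qed

lemma Qe_Suc:
 assumes k: "k >= 3" "k <= n"
 shows "Qe k n I m <= Qe k n I (Suc m)"
proof -
 have q: "0 < qq k" using qq_bounds[OF k(1)] by simp
 let ?C = "clauses k n"
 have C: "finite ?C" "?C ~= {}" using clauses_nonempty k by auto
 have one: "qq k * (tot n w * Ec k n w) <= avg ?C (%b. tot n (%sg. w sg * cl b sg) * Ec k n (%sg. w sg * cl b sg))"
  if w: "!!sg. 0 <= w sg" for w
 proof -
  define y where "y b = tot n (%sg. w sg * cl b sg)" for b
  define x where "x a b = tot n (%sg. w sg * cl b sg * cl a sg)" for a b
  have wc: "0 <= w sg * cl b sg" for b sg using w cl_01 by simp
  have y0: "0 <= y b" for b unfolding y_def by (rule tot_nonneg, rule wc)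
  have x0: "0 <= x a b" for a b unfolding x_def by (rule tot_nonneg, rule mult_nonneg_nonneg[OF wc cl_01(1)])
  have xy: "x a b <= y b" for a b unfolding x_def y_def by (rule tot_mono, rule mult_right_le_one_le[OF wc cl_01])
  have Y: "avg ?C y = qq k * tot n w"
   unfolding y_def avg_tot avg_cmult using avg_cl[of k n] k by (simp add: tot_cmult_right tot_cmult mult.commute)
  have X: "avg ?C (x a) = qq k * tot n (%sg. w sg * cl a sg)" for a
  proof -
   have "avg ?C (x a) = tot n (%sg. (w sg * cl a sg) * avg ?C (%b. cl b sg))"
    unfolding x_def avg_tot avg_cmult[symmetric] by (simp only: mult_ac)
   then show ?thesis using avg_cl[of k n] k by (simp add: tot_cmult_right tot_cmult mult.commute)
  qed
  have "qq k * (tot n w * Ec k n w) = avg ?C (%a. avg ?C y * Lam (avg ?C (x a) / avg ?C y)) / qq k"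
   unfolding X Y Ec_def mean_def avg_cmult using q by simp
  also have "... <= avg ?C (%a. avg ?C (%b. y b * Lam (x a b / y b))) / qq k"
  proof (intro divide_right_mono avg_mono log_sum C x0 y0)
   show "x a b = 0" if "y b = 0" for a b using that x0[of a b] xy[of a b] by simp
  qed (use q in simp)
  also have "... = avg ?C (%b. avg ?C (%a. y b * Lam (x a b / y b))) / qq k" by (subst avg_swap) (rule refl)
  also have "... = avg ?C (%b. y b * Ec k n (%sg. w sg * cl b sg))"
   unfolding avg_cmult Ec_def mean_def y_def x_def by (simp add: avg_divide)
  finally show ?thesis unfolding y_def .
 qed
 have "qq k * avg (Fm k n m) (%F. \<Sum>v\<in>bl (length I). tot n (cnd (wgt F) I v) * Ec k n (cnd (wgt F) I v))
  <= avg (Fm k n (Suc m)) (%F. \<Sum>v\<in>bl (length I). tot n (cnd (wgt F) I v) * Ec k n (cnd (wgt F) I v))"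
  unfolding avg_Fm_Suc avg_sum[of "clauses k n"] cnd_Cons avg_cmult[symmetric] sum_distrib_left
  by (intro avg_mono sum_mono one cnd_nonneg wgt_01)
 then show ?thesis unfolding Qe_def Av_def using q by (simp add: field_simps)
qed

lemma Phi_lower:
 assumes k: "k >= 3" "k <= n"
 shows "Phi k n I i + real j * Qe k n I i <= Phi k n I (i + j)"
proof (induction j)
 case (Suc j)
 have "Qe k n I i <= Qe k n I (i + j)" by (rule lift_Suc_mono_le[of "Qe k n I"]) (use Qe_Suc[OF k] in auto)
 then show ?case using Suc Phi_Suc[OF k, of I "i + j"] by (simp add: algebra_simps)
qed simp

lemma Lam_crude: "0 <= x ==> \<bar>Lam x\<bar> <= 2 + x\<^sup>2"
proof (cases "x <= 2")
 case False
 then have "0 <= ln x" "ln x <= x" using ln_le_minus_one[of x] by auto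
 then have "\<bar>Lam x\<bar> <= x * x" using False unfolding Lam_def by (simp add: abs_mult mult_left_mono)
 then show ?thesis by (simp add: power2_eq_square)
qed (use Lam_abs_le[of x] in \<open>auto intro: order_trans\<close>)

lemma Phi_bound:
 assumes k: "k >= 3" "k <= n"
 shows "\<exists>C\<ge>0. \<forall>m. \<bar>Phi k n I m\<bar> <= C * (1 / qq k) ^ m"
proof -
 have q: "0 < qq k" using qq_bounds[OF k(1)] by simp
 define c where "c = (2::real) + (2 ^ n)\<^sup>2"
 have b: "\<bar>Lam (tot n w)\<bar> <= c" if w: "!!sg. 0 <= w sg" "!!sg. w sg <= 1" for w
 proof -
  have 0: "0 <= tot n w" using w by (intro tot_nonneg) auto
  have "tot n w <= tot n (%_. 1)" using w by (intro tot_mono) auto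
  also have "... = 2 ^ n" by (simp add: tot_def card_assignments)
  finally have "(tot n w)\<^sup>2 <= (2 ^ n)\<^sup>2" using 0 by (rule power_mono)
  then show ?thesis using Lam_crude[OF 0] by (simp add: c_def)
 qed
 have "\<bar>Phi k n I m\<bar> <= (c * real (card (bl (length I))) / 2 ^ n) * (1 / qq k) ^ m" for m
 proof -
  have "\<bar>Phi k n I m\<bar> <= Av k n I m (%_. c)" unfolding Phi_def by (rule Av_abs[OF k(1) b])
  also have "... = (c * real (card (bl (length I))) / 2 ^ n) * (1 / qq k) ^ m"
   unfolding Av_def using clauses_nonempty[OF k(2)] by (simp add: avg_const power_divide mult.commute)
  finally show ?thesis .
 qed
 moreover have "0 <= c * real (card (bl (length I))) / 2 ^ n" by (simp add: c_def)
 ultimately show ?thesis by blast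
qed

lemma Ec_bound:
 assumes k: "k >= 3" "k <= n" and w: "!!sg. 0 <= w sg"
 shows "\<bar>Ec k n w\<bar> <= 2 / qq k"
proof -
 have q: "0 < qq k" using qq_bounds[OF k(1)] by simp
 have m: "0 <= mean n w (cl a)" "mean n w (cl a) <= 1" for a
 proof -
  have "0 <= tot n w" "0 <= tot n (%sg. w sg * cl a sg)" "tot n (%sg. w sg * cl a sg) <= tot n w"
   using w cl_01 by (auto intro!: tot_nonneg tot_mono mult_right_le_one_le)
  then show "0 <= mean n w (cl a)" "mean n w (cl a) <= 1" unfolding mean_def by (auto simp: divide_le_eq_1)
 qed
 have "\<bar>avg (clauses k n) (%a. Lam (mean n w (cl a)))\<bar> <= avg (clauses k n) (%a. \<bar>Lam (mean n w (cl a))\<bar>)" by (rule avg_abs)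
 also have "... <= 2"
 proof (rule avg_le)
  show "\<bar>Lam (mean n w (cl a))\<bar> <= 2" for a using m[of a] by (intro Lam_abs_le) auto
 qed (use clauses_nonempty k in auto)
 finally show ?thesis unfolding Ec_def using q by (simp add: abs_divide divide_right_mono)
qed

lemma Qe_bound:
 assumes k: "k >= 3" "k <= n"
 shows "\<bar>Qe k n I m\<bar> <= 2 / qq k"
proof -
 have "\<bar>Qe k n I m\<bar> <= Av k n I m (%w. 2 / qq k * tot n w)"
  unfolding Qe_def
 proof (rule Av_abs[OF k(1)])
  fix w :: "(nat => bool) => real" assume w: "!!sg. 0 <= w sg" "!!sg. w sg <= 1"
  have "0 <= tot n w" using w by (intro tot_nonneg) auto
  then show "\<bar>tot n w * Ec k n w\<bar> <= 2 / qq k * tot n w"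
   using mult_right_mono[OF Ec_bound[OF k, of w] \<open>0 <= tot n w\<close>] w(1) by (simp add: abs_mult mult.commute)
 qed
 then show ?thesis unfolding Av_cmult Av_tot[OF k] by simp
qed

lemma Phi_old_lower:
 assumes k: "k >= 3" "k <= n" and l: "0 <= l" and \<mu>: "0 < \<mu>"
 shows "EP l (%i. Phi k n I i + \<mu> * Qe k n I i) <= EP (l + \<mu>) (Phi k n I)"
proof -
 define r where "r = 1 / qq k"
 have r: "1 <= r" using qq_bounds[OF k(1)] by (simp add: r_def)
 obtain C where C: "C >= 0" "!!m. \<bar>Phi k n I m\<bar> <= C * r ^ m" using Phi_bound[OF k, of I] by (auto simp: r_def)
 define p where "p = l / (l + \<mu>)"
 have p: "0 <= p" "p <= 1" using l \<mu> by (auto simp: p_def divide_le_eq_1)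
 have e: "(l + \<mu>) * p = l" "(l + \<mu>) * (1 - p) = \<mu>" using l \<mu> by (auto simp: p_def field_simps)
 have "EP (l + \<mu>) (Phi k n I) = EP (l + \<mu>) (%m. \<Sum>i\<le>m. real (m choose i) * p ^ i * (1 - p) ^ (m - i) * Phi k n I (i + (m - i)))"
 proof (rule arg_cong[where f = "EP (l + \<mu>)"], rule ext)
  fix m
  have "(\<Sum>i\<le>m. real (m choose i) * p ^ i * (1 - p) ^ (m - i) * Phi k n I (i + (m - i))) = (p + (1 - p)) ^ m * Phi k n I m"
   unfolding binomial_ring sum_distrib_right by (intro sum.cong) auto
  then show "Phi k n I m = (\<Sum>i\<le>m. real (m choose i) * p ^ i * (1 - p) ^ (m - i) * Phi k n I (i + (m - i)))" by simp
 qed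
 also have "... = EP l (%i. EP \<mu> (%j. Phi k n I (i + j)))"
  using EP_thin[of "l + \<mu>" p r "%i j. Phi k n I (i + j)" C] l \<mu> p r C(2) by (simp add: e)
 also have "... >= EP l (%i. Phi k n I i + \<mu> * Qe k n I i)"
 proof (rule EP_mono[OF l])
  have CP: "\<bar>Phi k n I (i + j)\<bar> <= (C * r ^ i) * r ^ j" for i j using C(2)[of "i + j"] by (simp add: power_add mult.assoc)
  show "(%m. po l m * EP \<mu> (%j. Phi k n I (m + j))) summable_on UNIV"
  proof (rule po_summable[OF l, of r])
   show "\<bar>EP \<mu> (%j. Phi k n I (m + j))\<bar> <= (C * exp (\<mu> * r - \<mu>)) * r ^ m" for m
   proof -
    have "\<bar>EP \<mu> (%j. Phi k n I (m + j))\<bar> <= (C * r ^ m) * exp (\<mu> * r - \<mu>)"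
     by (rule EP_abs_le) (use \<mu> r CP in auto)
    then show ?thesis by (simp only: mult_ac)
   qed
  qed (use r in auto)
  show "(%m. po l m * (Phi k n I m + \<mu> * Qe k n I m)) summable_on UNIV"
  proof (rule po_summable[OF l, of r])
   show "\<bar>Phi k n I m + \<mu> * Qe k n I m\<bar> <= (C + \<mu> * (2 / qq k)) * r ^ m" for m
   proof -
    have "\<bar>\<mu> * Qe k n I m\<bar> <= \<mu> * (2 / qq k) * 1" using mult_left_mono[OF Qe_bound[OF k, of I m], of \<mu>] \<mu> by (simp add: abs_mult)
    also have "... <= \<mu> * (2 / qq k) * r ^ m" using \<mu> r qq_bounds[OF k(1)] by (intro mult_left_mono) auto
    finally show ?thesis using C(2)[of m] by (simp add: distrib_right)
   qed
  qed (use r in auto)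
  show "Phi k n I i + \<mu> * Qe k n I i <= EP \<mu> (%j. Phi k n I (i + j))" for i
  proof -
   have "Phi k n I i + \<mu> * Qe k n I i = EP \<mu> (%j. Phi k n I i + real j * Qe k n I i)" by (rule EP_linear[symmetric]) (use \<mu> in simp)
   also have "... <= EP \<mu> (%j. Phi k n I (i + j))"
   proof (rule EP_mono[OF less_imp_le[OF \<mu>]])
    show "(%m. po \<mu> m * Phi k n I (i + m)) summable_on UNIV"
     by (rule po_summable[of \<mu> r _ "C * r ^ i"]) (use \<mu> r CP in auto)
    show "(%m. po \<mu> m * (Phi k n I i + real m * Qe k n I i)) summable_on UNIV"
    proof (rule po_summable[of \<mu> 2 _ "\<bar>Phi k n I i\<bar> + \<bar>Qe k n I i\<bar>"])
     show "\<bar>Phi k n I i + real m * Qe k n I i\<bar> <= (\<bar>Phi k n I i\<bar> + \<bar>Qe k n I i\<bar>) * 2 ^ m" for m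
     proof -
      have "real m <= 2 ^ m" using of_nat_less_two_power[of m] by (rule less_imp_le)
      then have "real m * \<bar>Qe k n I i\<bar> <= 2 ^ m * \<bar>Qe k n I i\<bar>" by (rule mult_right_mono) simp
      moreover have "1 * \<bar>Phi k n I i\<bar> <= 2 ^ m * \<bar>Phi k n I i\<bar>" by (rule mult_right_mono) simp_all
      moreover have "\<bar>Phi k n I i + real m * Qe k n I i\<bar> <= \<bar>Phi k n I i\<bar> + real m * \<bar>Qe k n I i\<bar>"
       by (rule order_trans[OF abs_triangle_ineq]) (simp add: abs_mult)
      ultimately show ?thesis by (simp add: algebra_simps)
     qed
    qed (use \<mu> in auto)
   qed (rule Phi_lower[OF k])
   finally show ?thesis .
  qed
 qed
 finally show ?thesis .
qed

lemma clauses_ratio: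
 assumes k: "1 <= k" "k <= n"
 shows "real (card (clauses k n)) / real (card (clauses k (Suc n))) = (real (Suc n) - real k) / real (Suc n)"
proof -
 let ?P = "\<Prod>{n - k + 1..Suc n}"
 have 1: "?P = \<Prod>{n - k + 1..n} * Suc n" using k by (simp add: prod.nat_ivl_Suc')
 have 2: "?P = (n - k + 1) * \<Prod>{n - k + 2..Suc n}" using k by (subst prod.atLeast_Suc_atMost) (auto simp: numeral_2_eq_2)
 have c: "card (dl k n) = \<Prod>{n - k + 1..n}" "card (dl k (Suc n)) = \<Prod>{n - k + 2..Suc n}"
  using card_dl[of k n] card_dl[of k "Suc n"] k by (auto simp: Suc_diff_le numeral_2_eq_2)
 have e: "real (card (dl k n)) * real (Suc n) = (real (Suc n) - real k) * real (card (dl k (Suc n)))"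
 proof -
  have "real (card (dl k n) * Suc n) = real ((n - k + 1) * card (dl k (Suc n)))" using 1 2 c by simp
  then show ?thesis using k by (simp only: of_nat_mult) (simp add: of_nat_diff)
 qed
 have "dl k (Suc n) ~= {}" using k by (intro dl_nonempty) simp
 then have "0 < real (card (dl k (Suc n)))" by (simp add: card_gt_0_iff)
 then have "real (card (dl k n)) / real (card (dl k (Suc n))) = (real (Suc n) - real k) / real (Suc n)"
  using e by (subst frac_eq_eq) auto
 then show ?thesis by (simp add: card_clauses)
qed

lemma clauses_Suc: "clauses k n \<union> (clauses k (Suc n) - clauses k n) = clauses k (Suc n)"
 by (auto simp: clauses_def less_SucI)

lemma wgt_mset: "mset F = mset G ==> wgt F = wgt G"
 using mset_eq_setD[of F G] by (auto simp: wgt_def nae_sat_def sat_formula_def fun_eq_iff)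

lemma new_clauses_nonempty:
 assumes k: "1 <= k" "k <= Suc n" shows "clauses k (Suc n) - clauses k n ~= {}"
proof -
 have "clauses (k - 1) n ~= {}" using k by (intro clauses_nonempty) simp
 then have "{..<k} \<times> (UNIV :: bool set) \<times> clauses (k - 1) n ~= {}" using k by (auto simp: lessThan_empty_iff)
 then show ?thesis using bij_betw_imp_surj_on[OF ins_bij[OF k(1), of n]] by blast
qed

lemma Phi_new:
 assumes k: "k >= 3" "k <= n" and I: "set I \<subseteq> {..<n}"
 defines "p \<equiv> (real (Suc n) - real k) / real (Suc n)"
 shows "Phi k (Suc n) I m = (\<Sum>i\<le>m. real (m choose i) * p ^ i * (1 - p) ^ (m - i)
   * Av k n I i (%w. tot n w * Vx k n w (m - i) + Lam (tot n w)))"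
proof -
 have q: "0 < qq k" using qq_bounds[OF k(1)] by simp
 let ?A = "clauses k n" and ?D = "clauses k (Suc n) - clauses k n"
 let ?f = "%F. \<Sum>v\<in>bl (length I). Lam (tot (Suc n) (cnd (wgt F) I v))"
 have inner: "avg (lsts i ?A) (%F. avg (lsts j ?D) (%G. ?f (F @ G))) / (2 ^ Suc n * qq k ^ (i + j))
   = Av k n I i (%w. tot n w * Vx k n w j + Lam (tot n w))" for i j
 proof -
  have "avg (lsts i ?A) (%F. avg (lsts j ?D) (%G. ?f (F @ G)))
   = avg (lsts i ?A) (%F. \<Sum>v\<in>bl (length I). 2 * qq k ^ j * (tot n (cnd (wgt F) I v) * Vx k n (cnd (wgt F) I v) j + Lam (tot n (cnd (wgt F) I v))))"
  proof (rule avg_cong)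
   fix F assume F: "F \<in> lsts i ?A"
   have "avg (lsts j ?D) (%G. ?f (F @ G)) = (\<Sum>v\<in>bl (length I). avg (lsts j ?D) (%G. Lam (tot (Suc n) (cnd (wgt (F @ G)) I v))))"
    by (rule avg_sum)
   also have "... = (\<Sum>v\<in>bl (length I). 2 * qq k ^ j * (tot n (cnd (wgt F) I v) * Vx k n (cnd (wgt F) I v) j + Lam (tot n (cnd (wgt F) I v))))"
   proof (rule sum.cong[OF refl])
    fix v
    have "avg (lsts j ?D) (%G. Lam (tot (Suc n) (cnd (wgt (F @ G)) I v)))
     = avg (lsts j ?D) (%G. Lam (tot n (%sg. cnd (wgt F) I v sg * Yt (map (truth sg) (map (rest n) G)))))"
    proof (rule avg_cong)
     fix G assume G: "G \<in> lsts j ?D"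
     have "tot (Suc n) (cnd (wgt (F @ G)) I v) = tot n (%sg. cnd (wgt F) I v sg * Yt (map (truth sg) (map (rest n) G)))"
      by (rule tot_new[OF _ _ I]) (use F G in \<open>auto simp: lsts_def\<close>)
     then show "Lam (tot (Suc n) (cnd (wgt (F @ G)) I v)) = Lam (tot n (%sg. cnd (wgt F) I v sg * Yt (map (truth sg) (map (rest n) G))))" by (simp only:)
    qed
    then show "avg (lsts j ?D) (%G. Lam (tot (Suc n) (cnd (wgt (F @ G)) I v)))
     = 2 * qq k ^ j * (tot n (cnd (wgt F) I v) * Vx k n (cnd (wgt F) I v) j + Lam (tot n (cnd (wgt F) I v)))"
     using avg_Lam_Yt[OF k, of "cnd (wgt F) I v" j] cnd_nonneg[OF wgt_01(1)] q by (simp add: divide_simps mult.commute)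
   qed
   finally show "avg (lsts j ?D) (%G. ?f (F @ G)) = (\<Sum>v\<in>bl (length I). 2 * qq k ^ j * (tot n (cnd (wgt F) I v) * Vx k n (cnd (wgt F) I v) j + Lam (tot n (cnd (wgt F) I v))))" .
  qed
  then show ?thesis unfolding sum_distrib_left[symmetric] avg_cmult Av_def using q by (simp add: power_add)
 qed
 have u: "avg (lsts m (?A \<union> ?D)) ?f = (\<Sum>i\<le>m. real (m choose i) * p ^ i * (1 - p) ^ (m - i)
   * avg (lsts i ?A) (%F. avg (lsts (m - i) ?D) (%G. ?f (F @ G))))"
 proof -
  have pp: "real (card ?A) / real (card (?A \<union> ?D)) = p" unfolding clauses_Suc p_def by (rule clauses_ratio) (use k in auto)
  have "finite ?A" "finite ?D" "?A \<inter> ?D = {}" "?A ~= {}" "?D ~= {}"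
   using clauses_nonempty[OF k(2)] new_clauses_nonempty[of k n] k by auto
  moreover have "mset F = mset G ==> ?f F = ?f G" for F G by (drule wgt_mset) simp
  ultimately show ?thesis using avg_lsts_union[of ?A ?D ?f m, unfolded pp] by blast
 qed
 have "Phi k (Suc n) I m = avg (lsts m (?A \<union> ?D)) ?f / (2 ^ Suc n * qq k ^ m)"
  unfolding Phi_def Av_def clauses_Suc ..
 also have "... = (\<Sum>i\<le>m. real (m choose i) * p ^ i * (1 - p) ^ (m - i)
   * (avg (lsts i ?A) (%F. avg (lsts (m - i) ?D) (%G. ?f (F @ G))) / (2 ^ Suc n * qq k ^ (i + (m - i)))))"
  unfolding u sum_divide_distrib by (intro sum.cong) auto
 finally show ?thesis unfolding inner .
qed

lemma tot_Vx_bound: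
 assumes k: "k >= 3" "k <= n" and w: "!!sg. 0 <= w sg"
 shows "\<bar>tot n w * Vx k n w j\<bar> <= tot n w * (1 / qq k) ^ j"
proof (cases "tot n w = 0")
 case False
 then have t: "0 < tot n w" using tot_nonneg[of n w] w by (simp add: order.order_iff_strict)
 have "tot n w * \<bar>Vx k n w j\<bar> <= tot n w * (1 / qq k) ^ j" using Vx_bound[OF k w t] t by (intro mult_left_mono) auto
 then show ?thesis using t by (simp add: abs_mult)
qed simp

definition VE :: "nat => nat => nat list => real => nat => real" where
 "VE k n I d i = Av k n I i (%w. tot n w * EP d (Vx k n w))"

lemma EP_Av_Vx:
 assumes k: "k >= 3" "k <= n" and d: "0 <= d"
 shows "(%j. po d j * Av k n I i (%w. tot n w * Vx k n w j)) summable_on UNIV"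
  and "EP d (%j. Av k n I i (%w. tot n w * Vx k n w j)) = VE k n I d i"
proof -
 have q: "0 < qq k" using qq_bounds[OF k(1)] by simp
 define c where "c = 1 / (real (card (Fm k n i)) * (2 ^ n * qq k ^ i))"
 have Av: "Av k n I i h = c * (\<Sum>F\<in>Fm k n i. \<Sum>v\<in>bl (length I). h (cnd (wgt F) I v))" for h
  unfolding Av_def avg_def c_def by simp
 have s: "(%j. po d j * (tot n (cnd (wgt F) I v) * Vx k n (cnd (wgt F) I v) j)) summable_on UNIV" for F v
  by (rule po_summable[OF d, of "1 / qq k" _ "tot n (cnd (wgt F) I v)"]) (use q tot_Vx_bound[OF k cnd_nonneg[OF wgt_01(1)]] in auto)
 have s1: "(%j. po d j * (\<Sum>v\<in>bl (length I). tot n (cnd (wgt F) I v) * Vx k n (cnd (wgt F) I v) j)) summable_on UNIV" for F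
  by (rule EP_sum(1)) (use s in auto)
 have s2: "(%j. po d j * (\<Sum>F\<in>Fm k n i. \<Sum>v\<in>bl (length I). tot n (cnd (wgt F) I v) * Vx k n (cnd (wgt F) I v) j)) summable_on UNIV"
  by (rule EP_sum(1)) (use s1 in auto)
 show "(%j. po d j * Av k n I i (%w. tot n w * Vx k n w j)) summable_on UNIV"
  unfolding Av using summable_on_cmult_right[OF s2, of c] by (simp add: mult.left_commute)
 have "EP d (%j. \<Sum>F\<in>Fm k n i. \<Sum>v\<in>bl (length I). tot n (cnd (wgt F) I v) * Vx k n (cnd (wgt F) I v) j)
  = (\<Sum>F\<in>Fm k n i. EP d (%j. \<Sum>v\<in>bl (length I). tot n (cnd (wgt F) I v) * Vx k n (cnd (wgt F) I v) j))"
  by (rule EP_sum(2)) (use s1 in auto)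
 also have "... = (\<Sum>F\<in>Fm k n i. \<Sum>v\<in>bl (length I). EP d (%j. tot n (cnd (wgt F) I v) * Vx k n (cnd (wgt F) I v) j))"
  by (intro sum.cong refl EP_sum(2)) (use s in auto)
 finally show "EP d (%j. Av k n I i (%w. tot n w * Vx k n w j)) = VE k n I d i"
  unfolding VE_def Av EP_cmult by simp
qed

lemma Av_Vx_bound:
 assumes k: "k >= 3" "k <= n"
 shows "\<bar>Av k n I i (%w. tot n w * Vx k n w j)\<bar> <= (1 / qq k) ^ j"
proof -
 have "\<bar>Av k n I i (%w. tot n w * Vx k n w j)\<bar> <= Av k n I i (%w. (1 / qq k) ^ j * tot n w)"
  by (rule Av_abs[OF k(1)], subst mult.commute[of "(1 / qq k) ^ j"]) (rule tot_Vx_bound[OF k])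
 then show ?thesis unfolding Av_cmult Av_tot[OF k] by simp
qed

lemma VE_bound:
 assumes k: "k >= 3" "k <= n" and d: "0 <= d"
 shows "\<bar>VE k n I d i\<bar> <= exp (d * (1 / qq k) - d)"
proof -
 have q: "0 < qq k" using qq_bounds[OF k(1)] by simp
 have "\<bar>EP d (%j. Av k n I i (%w. tot n w * Vx k n w j))\<bar> <= 1 * exp (d * (1 / qq k) - d)"
  by (rule EP_abs_le[OF d]) (use q Av_Vx_bound[OF k] in auto)
 then show ?thesis unfolding EP_Av_Vx(2)[OF k d] by simp
qed

lemma Phi_new_EP:
 assumes k: "k >= 3" "k <= n" and I: "set I \<subseteq> {..<n}" and d: "0 < d"
 shows "EP (d * real (Suc n) / real k) (Phi k (Suc n) I)
  = EP (d * (real (Suc n) - real k) / real k) (%i. VE k n I d i + Phi k n I i)"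
proof -
 define r where "r = 1 / qq k"
 have r: "1 <= r" using qq_bounds[OF k(1)] by (simp add: r_def)
 obtain C where C: "C >= 0" "!!m. \<bar>Phi k n I m\<bar> <= C * r ^ m" using Phi_bound[OF k, of I] by (auto simp: r_def)
 define p where "p = (real (Suc n) - real k) / real (Suc n)"
 have p: "0 <= p" "p <= 1" using k by (auto simp: p_def)
 have lp: "d * real (Suc n) / real k * p = d * (real (Suc n) - real k) / real k" by (simp add: p_def del: of_nat_Suc)
 have "1 - p = real k / real (Suc n)" by (simp add: p_def diff_divide_distrib del: of_nat_Suc)
 then have lp': "d * real (Suc n) / real k * (1 - p) = d" using k by (simp del: of_nat_Suc)
 define g where "g i j = Av k n I i (%w. tot n w * Vx k n w j + Lam (tot n w))" for i j
 have g: "g i j = Av k n I i (%w. tot n w * Vx k n w j) + Phi k n I i" for i j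
  unfolding g_def Av_add Phi_def ..
 have gb: "\<bar>g i j\<bar> <= (1 + C) * r ^ (i + j)" for i j
 proof -
  have "\<bar>g i j\<bar> <= r ^ j + C * r ^ i" unfolding g using Av_Vx_bound[OF k, of I i j] C(2)[of i] by (simp add: r_def)
  also have "... <= r ^ (i + j) + C * r ^ (i + j)" using r C by (intro add_mono mult_left_mono power_increasing) auto
  finally show ?thesis by (simp add: algebra_simps)
 qed
 have "EP (d * real (Suc n) / real k) (Phi k (Suc n) I)
  = EP (d * real (Suc n) / real k) (%m. \<Sum>i\<le>m. real (m choose i) * p ^ i * (1 - p) ^ (m - i) * g i (m - i))"
  unfolding Phi_new[OF k I] p_def g_def ..
 also have "... = EP (d * real (Suc n) / real k * p) (%i. EP (d * real (Suc n) / real k * (1 - p)) (g i))"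
  by (rule EP_thin[OF _ p _ gb]) (use r d in auto)
 also have "... = EP (d * (real (Suc n) - real k) / real k) (%i. EP d (g i))" unfolding lp lp' ..
 finally have fin: "EP (d * real (Suc n) / real k) (Phi k (Suc n) I) = EP (d * (real (Suc n) - real k) / real k) (%i. EP d (g i))" .
 have "EP d (g i) = VE k n I d i + Phi k n I i" for i
 proof -
  have "EP d (%j. Av k n I i (%w. tot n w * Vx k n w j) + Phi k n I i) = EP d (%j. Av k n I i (%w. tot n w * Vx k n w j)) + EP d (%_. Phi k n I i)"
   using d by (intro EP_add EP_Av_Vx(1)[OF k] po_summable[of d 1 _ "\<bar>Phi k n I i\<bar>"]) auto
  then show ?thesis unfolding EP_Av_Vx(2)[OF k less_imp_le[OF d]] EP_const[OF less_imp_le[OF d]] g .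
 qed
 then show ?thesis unfolding fin by (simp only:)
qed

lemma Dl_bounds:
 assumes w: "!!sg. 0 <= w sg" and n: "n > 0"
 shows "0 <= Dl R n w" "Dl R n w <= tot n w"
proof -
 show "0 <= Dl R n w" unfolding Dl_def del_def by (intro avg_nonneg sum_nonneg) auto
 have d: "del n w i J <= tot n w" for i J
 proof -
  have "del n w i J <= (\<Sum>y\<in>bl (length J). tot n (cnd w J y))" unfolding del_def
  proof (rule sum_mono)
   fix y
   have a: "0 <= tt n (cnd w J y) i" "tt n (cnd w J y) i <= tot n (cnd w J y)"
    using tt_bounds[of "cnd w J y" n i] cnd_nonneg w by auto
   have b: "0 <= tt n w i / tot n w" "tt n w i / tot n w <= 1"
    using tt_bounds[of w n i] w by (auto simp: divide_le_eq_1)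
   have t0: "0 <= tot n (cnd w J y)" using a by linarith
   show "\<bar>tt n (cnd w J y) i - tot n (cnd w J y) * tt n w i / tot n w\<bar> <= tot n (cnd w J y)"
    unfolding times_divide_eq_right[symmetric]
    using a mult_nonneg_nonneg[OF t0 b(1)] mult_right_le_one_le[OF t0 b] by linarith
  qed
  then show ?thesis using sum_tot_cnd[of J "length J" n w] by simp
 qed
 have "{..<n} ~= {}" using n by (simp add: lessThan_empty_iff)
 then show "Dl R n w <= tot n w" unfolding Dl_def
  by (intro avg_le d finite_lsts lsts_nonempty finite_lessThan)
qed

lemma free_energy_step:
 fixes d \<phi> C :: real
 assumes k: "k >= 3" "k <= n" and I: "set I \<subseteq> {..<n}" and d: "0 < d" and C: "0 <= C"
  and step: "!!w. (!!sg. 0 <= w sg) ==> 0 < tot n w ==>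
   EP d (Vx k n w) - d * (real k - 1) / real k * Ec k n w <= \<phi> + C * (Dl R n w / tot n w)"
 shows "EP (d * real (Suc n) / real k) (Phi k (Suc n) I) <= EP (d * real n / real k) (Phi k n I)
  + (\<phi> + C * EP (d * (real (Suc n) - real k) / real k) (%i. Av k n I i (Dl R n)))"
proof -
 define \<mu> where "\<mu> = d * (real k - 1) / real k"
 define l where "l = d * (real (Suc n) - real k) / real k"
 have \<mu>: "0 < \<mu>" using k d by (simp add: \<mu>_def)
 have l: "0 <= l" using k d by (simp add: l_def)
 have e: "l + \<mu> = d * real n / real k" by (simp add: l_def \<mu>_def add_divide_distrib[symmetric] distrib_left[symmetric])
 define r where "r = 1 / qq k"
 have r: "1 <= r" using qq_bounds[OF k(1)] by (simp add: r_def)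
 have q: "0 < qq k" using qq_bounds[OF k(1)] by simp
 obtain C' where C': "C' >= 0" "!!m. \<bar>Phi k n I m\<bar> <= C' * r ^ m" using Phi_bound[OF k, of I] by (auto simp: r_def)
 define c2 where "c2 = exp (d * r - d)"
 have r1: "x <= x * r ^ m" if "0 <= x" for x m
  using mult_left_mono[OF one_le_power[OF r, of m] that] by simp
 have bPhi: "(%i. po l i * Phi k n I i) summable_on UNIV" by (rule po_summable[OF l, of r _ C']) (use r C' in auto)
 have bVE: "(%i. po l i * VE k n I d i) summable_on UNIV"
  by (rule po_summable[OF l, of 1 _ c2]) (use VE_bound[OF k less_imp_le[OF d]] in \<open>auto simp: c2_def r_def\<close>)
 have bQ: "(%i. po l i * (\<mu> * Qe k n I i)) summable_on UNIV"
 proof (rule po_summable[OF l, of 1 _ "\<mu> * (2 / qq k)"])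
  show "\<bar>\<mu> * Qe k n I m\<bar> <= \<mu> * (2 / qq k) * 1 ^ m" for m
   using mult_left_mono[OF Qe_bound[OF k, of I m], of \<mu>] \<mu> by (simp add: abs_mult)
 qed auto
 have n: "n > 0" using k by simp
 have bD: "(%i. po l i * Av k n I i (Dl R n)) summable_on UNIV"
 proof (rule po_summable[OF l, of 1 _ 1])
  show "\<bar>Av k n I m (Dl R n)\<bar> <= 1 * 1 ^ m" for m
  proof -
   have "\<bar>Av k n I m (Dl R n)\<bar> <= Av k n I m (tot n)" by (rule Av_abs[OF k(1)]) (use Dl_bounds[OF _ n] in auto)
   then show ?thesis by (simp add: Av_tot[OF k])
  qed
 qed auto
 have pt: "VE k n I d i <= \<mu> * Qe k n I i + (\<phi> + C * Av k n I i (Dl R n))" for i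
 proof -
  have "VE k n I d i <= Av k n I i (%w. \<mu> * (tot n w * Ec k n w) + (\<phi> * tot n w + C * Dl R n w))"
   unfolding VE_def
  proof (rule Av_mono[OF k(1)])
   fix w :: "(nat => bool) => real" assume w: "!!sg. 0 <= w sg"
   show "tot n w * EP d (Vx k n w) <= \<mu> * (tot n w * Ec k n w) + (\<phi> * tot n w + C * Dl R n w)"
   proof (cases "tot n w = 0")
    case True
    then show ?thesis using Dl_bounds(1)[OF w n] C by simp
   next
    case False
    then have t: "0 < tot n w" using tot_nonneg[of n w] w by (simp add: order.order_iff_strict)
    have "tot n w * (EP d (Vx k n w) - \<mu> * Ec k n w) <= tot n w * (\<phi> + C * (Dl R n w / tot n w))"
     using step[OF w t] t by (intro mult_left_mono) (auto simp: \<mu>_def)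
    also have "... = \<phi> * tot n w + C * Dl R n w" using t by (simp add: distrib_left)
    finally show ?thesis by (simp add: algebra_simps)
   qed
  qed
  then show ?thesis unfolding Av_add Av_cmult Av_tot[OF k] Qe_def by simp
 qed
 have sc: "(%i. po l i * \<phi>) summable_on UNIV" by (rule po_summable[OF l, of 1 _ "\<bar>\<phi>\<bar>"]) auto
 have bCD: "(%i. po l i * (C * Av k n I i (Dl R n))) summable_on UNIV"
  using summable_on_cmult_right[OF bD, of C] by (simp add: mult.left_commute)
 have s4: "(%i. po l i * (\<phi> + C * Av k n I i (Dl R n))) summable_on UNIV"
  using summable_on_add[OF sc bCD] by (simp add: distrib_left)
 have s5: "(%i. po l i * (Phi k n I i + \<mu> * Qe k n I i)) summable_on UNIV"
  using summable_on_add[OF bPhi bQ] by (simp add: distrib_left)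
 have s6: "(%i. po l i * (VE k n I d i + Phi k n I i)) summable_on UNIV"
  using summable_on_add[OF bVE bPhi] by (simp add: distrib_left)
 have s7: "(%i. po l i * ((Phi k n I i + \<mu> * Qe k n I i) + (\<phi> + C * Av k n I i (Dl R n)))) summable_on UNIV"
  using summable_on_add[OF s5 s4] by (simp add: distrib_left)
 have "EP (d * real (Suc n) / real k) (Phi k (Suc n) I) = EP l (%i. VE k n I d i + Phi k n I i)"
  unfolding l_def by (rule Phi_new_EP[OF k I d])
 also have "... <= EP l (%i. (Phi k n I i + \<mu> * Qe k n I i) + (\<phi> + C * Av k n I i (Dl R n)))"
  by (rule EP_mono[OF l s6 s7]) (use pt in \<open>auto simp: algebra_simps\<close>)
 also have "... = EP l (%i. Phi k n I i + \<mu> * Qe k n I i) + (\<phi> + C * EP l (%i. Av k n I i (Dl R n)))"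
  unfolding EP_add[OF s5 s4] EP_add[OF sc bCD] EP_const[OF l] EP_cmult ..
 also have "EP l (%i. Phi k n I i + \<mu> * Qe k n I i) <= EP (d * real n / real k) (Phi k n I)"
  using Phi_old_lower[OF k l \<mu>, of I] by (simp add: e)
 finally show ?thesis by (simp add: l_def)
qed

lemma Lam_sum_bounds:
 assumes S: "finite S" "S ~= {}" and x: "!!v. v \<in> S ==> 0 <= x v"
 shows "(\<Sum>v\<in>S. Lam (x v)) <= Lam (sum x S)"
  and "Lam (sum x S) - sum x S * ln (real (card S)) <= (\<Sum>v\<in>S. Lam (x v))"
proof -
 let ?W = "sum x S"
 have c: "0 < real (card S)" using S by (simp add: card_gt_0_iff)
 have le: "Lam (x v) <= x v * ln ?W" if "v \<in> S" for v
 proof (cases "x v = 0")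
  case False
  have "x v <= ?W" using S x that by (intro member_le_sum) auto
  then show ?thesis using False x[OF that] unfolding Lam_def by (simp add: mult_left_mono)
 qed simp
 have "(\<Sum>v\<in>S. Lam (x v)) <= (\<Sum>v\<in>S. x v * ln ?W)" by (intro sum_mono le)
 also have "... = Lam ?W" by (simp add: sum_distrib_right[symmetric] Lam_def)
 finally show "(\<Sum>v\<in>S. Lam (x v)) <= Lam ?W" .
 have "avg S (%_. 1) * Lam (avg S x / avg S (%_. 1)) <= avg S (%b. 1 * Lam (x b / 1))"
  by (rule log_sum[OF S]) (use x in auto)
 then have "Lam (?W / real (card S)) <= (\<Sum>v\<in>S. Lam (x v)) / real (card S)"
  using S by (simp add: avg_const) (simp add: avg_def)
 then have "real (card S) * Lam (?W / real (card S)) <= (\<Sum>v\<in>S. Lam (x v))"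
  using c by (simp add: field_simps)
 moreover have "real (card S) * Lam (?W / real (card S)) = Lam ?W - ?W * ln (real (card S))"
 proof (cases "?W = 0")
  case False
  then have "0 < ?W" using sum_nonneg[of S x] x by (simp add: order.order_iff_strict)
  then show ?thesis using c by (simp add: Lam_def ln_divide_pos algebra_simps)
 qed simp
 ultimately show "Lam ?W - ?W * ln (real (card S)) <= (\<Sum>v\<in>S. Lam (x v))" by simp
qed

lemma Av_Nil: "Av k n [] m h = avg (Fm k n m) (%F. h (wgt F)) / (2 ^ n * qq k ^ m)"
 unfolding Av_def by (simp add: lsts_0)

lemma Phi_range:
 assumes k: "k >= 3" "k <= n"
 shows "Phi k n I m <= Phi k n [] m" "Phi k n [] m <= Phi k n I m + real (length I) * ln 2"
proof -
 have q: "0 < 2 ^ n * qq k ^ m" using qq_bounds[OF k(1)] by simp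
 have c: "ln (real (card (bl (length I)))) = real (length I) * ln 2" by (simp add: card_lsts ln_realpow)
 have s: "(\<Sum>v\<in>bl (length I). Lam (tot n (cnd (wgt F) I v))) <= Lam (tot n (wgt F))"
  "Lam (tot n (wgt F)) - tot n (wgt F) * (real (length I) * ln 2) <= (\<Sum>v\<in>bl (length I). Lam (tot n (cnd (wgt F) I v)))" for F
  using Lam_sum_bounds[of "bl (length I)" "%v. tot n (cnd (wgt F) I v)"] tot_nonneg[of n] cnd_nonneg[OF wgt_01(1)]
  unfolding sum_tot_cnd[OF refl] c by auto
 show "Phi k n I m <= Phi k n [] m"
  unfolding Phi_def Av_Nil unfolding Av_def using q s by (intro divide_right_mono avg_mono) auto
 have "avg (Fm k n m) (%F. Lam (tot n (wgt F)) - tot n (wgt F) * (real (length I) * ln 2)) / (2 ^ n * qq k ^ m) <= Phi k n I m"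
  unfolding Phi_def Av_def using q s by (intro divide_right_mono avg_mono) auto
 moreover have "avg (Fm k n m) (%F. tot n (wgt F)) / (2 ^ n * qq k ^ m) = 1"
  using Av_tot[OF k, of "[]" m] unfolding Av_Nil .
 moreover have "a / c <= P + s" if "(a - t * s) / c <= P" "t / c = 1" for a t c s P :: real
 proof -
  have "(a - t * s) / c = a / c - (t / c) * s" by (simp add: diff_divide_distrib)
  then show ?thesis using that by simp
 qed
 ultimately show "Phi k n [] m <= Phi k n I m + real (length I) * ln 2"
  unfolding avg_diff avg_cmult_right Phi_def[of k n "[]"] Av_Nil by blast
qed

lemma Phi_Nil:
 assumes k: "k >= 3" "k <= n"
 shows "Phi k n [] m = KK k n m + (real n * ln 2 + real m * ln (qq k))"
proof -
 have q: "0 < qq k" using qq_bounds[OF k(1)] by simp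
 define c where "c = 2 ^ n * qq k ^ m"
 have c: "0 < c" using q by (simp add: c_def)
 have lc: "ln c = real n * ln 2 + real m * ln (qq k)" unfolding c_def using q by (simp add: ln_mult_pos ln_realpow)
 have "avg (Fm k n m) (%F. Lam (tot n (wgt F))) = avg (Fm k n m) (%F. c * (Lam (MM k n F) + MM k n F * ln c))"
 proof (rule avg_cong)
  fix F assume "F \<in> Fm k n m"
  then have "tot n (wgt F) = c * MM k n F" using c q by (simp add: MM_def lsts_def c_def)
  then show "Lam (tot n (wgt F)) = c * (Lam (MM k n F) + MM k n F * ln c)"
   using Lam_mult[of c "MM k n F"] c MM_nonneg[OF k(1)] by (simp add: Lam_def[of c] algebra_simps)
 qed
 also have "... = c * (KK k n m + ln c)" unfolding avg_cmult avg_add avg_cmult_right avg_MM[OF k] KK_def by simp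
 finally show ?thesis unfolding Phi_def Av_Nil lc[symmetric] c_def[symmetric] using c by simp
qed

definition ff :: "nat => real => nat => nat list => real" where
 "ff k d n I = EP (d * real n / real k) (Phi k n I)"

lemma Phi_summable:
 assumes k: "k >= 3" "k <= n" and l: "0 <= l"
 shows "(%m. po l m * Phi k n I m) summable_on UNIV"
proof -
 obtain C where "\<forall>m. \<bar>Phi k n I m\<bar> <= C * (1 / qq k) ^ m" using Phi_bound[OF k, of I] by blast
 then show ?thesis using qq_bounds[OF k(1)] by (intro po_summable[OF l, of "1 / qq k" _ C]) auto
qed

lemma const_summable: "0 <= l ==> (%m. po l m * c) summable_on UNIV"
 by (rule po_summable[of l 1 _ "\<bar>c\<bar>"]) auto

lemma ff_range:
 assumes k: "k >= 3" "k <= n" and d: "0 < d"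
 shows "ff k d n I <= ff k d n []" "ff k d n [] <= ff k d n I + real (length I) * ln 2"
proof -
 define l where "l = d * real n / real k"
 have l: "0 <= l" using d by (simp add: l_def)
 show "ff k d n I <= ff k d n []" unfolding ff_def l_def[symmetric]
  by (intro EP_mono l Phi_summable k Phi_range)
 have "EP l (Phi k n []) <= EP l (%m. Phi k n I m + real (length I) * ln 2)"
 proof (intro EP_mono l Phi_summable k Phi_range)
  show "(%m. po l m * (Phi k n I m + real (length I) * ln 2)) summable_on UNIV"
   unfolding distrib_left by (intro summable_on_add Phi_summable const_summable k l)
 qed
 also have "... = EP l (Phi k n I) + real (length I) * ln 2"
  using EP_add[OF Phi_summable[OF k l] const_summable[OF l]] EP_const[OF l] by simp
 finally show "ff k d n [] <= ff k d n I + real (length I) * ln 2" unfolding ff_def l_def .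
qed

lemma KK_summable:
 assumes k: "k >= 3" "k <= n" and l: "0 <= l"
 shows "(%m. po l m * KK k n m) summable_on UNIV" "(%m. po l m * (real n * ln 2 + real m * ln (qq k))) summable_on UNIV"
proof -
 define c where "c = real n * ln 2"
 have c0: "0 <= c" by (simp add: c_def)
 show s: "(%m. po l m * (real n * ln 2 + real m * ln (qq k))) summable_on UNIV"
 proof (rule po_summable[OF l, of 2 _ "c + \<bar>ln (qq k)\<bar>"])
  show "\<bar>real n * ln 2 + real m * ln (qq k)\<bar> <= (c + \<bar>ln (qq k)\<bar>) * 2 ^ m" for m
  proof -
   have "real m <= 2 ^ m" using of_nat_less_two_power[of m] by (rule less_imp_le)
   then have "real m * \<bar>ln (qq k)\<bar> <= 2 ^ m * \<bar>ln (qq k)\<bar>" by (rule mult_right_mono) simp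
   moreover have "1 * c <= 2 ^ m * c" using c0 by (intro mult_right_mono) auto
   moreover have "\<bar>real m * ln (qq k)\<bar> = real m * \<bar>ln (qq k)\<bar>" by (simp add: abs_mult)
   ultimately show ?thesis using c0 abs_triangle_ineq[of c "real m * ln (qq k)"] unfolding c_def[symmetric] by (simp add: algebra_simps)
  qed
 qed auto
 have "(%m. po l m * Phi k n [] m + (- 1) * (po l m * (real n * ln 2 + real m * ln (qq k)))) summable_on UNIV"
  by (intro summable_on_add summable_on_cmult_right Phi_summable k l s)
 then show "(%m. po l m * KK k n m) summable_on UNIV"
  unfolding Phi_Nil[OF k] by (simp add: algebra_simps)
qed

lemma ff_Nil:
 assumes k: "k >= 3" "k <= n" and d: "0 < d"
 shows "ff k d n [] = EP (d * real n / real k) (KK k n) + real n * (ln 2 + d / real k * ln (qq k))"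
proof -
 define l where "l = d * real n / real k"
 have l: "0 <= l" using d by (simp add: l_def)
 have "ff k d n [] = EP l (%m. KK k n m + (real n * ln 2 + real m * ln (qq k)))"
  unfolding ff_def l_def[symmetric] Phi_Nil[OF k] ..
 also have "... = EP l (KK k n) + (real n * ln 2 + l * ln (qq k))"
  unfolding EP_add[OF KK_summable[OF k l]] EP_linear[OF l] ..
 finally show ?thesis by (simp add: l_def algebra_simps)
qed

lemma EP_avg:
 assumes S: "finite S" and s: "!!x. x \<in> S ==> (%m. po l m * f x m) summable_on UNIV"
 shows "(%m. po l m * avg S (%x. f x m)) summable_on UNIV" "EP l (%m. avg S (%x. f x m)) = avg S (%x. EP l (f x))"
proof -
 have e: "avg S h = (1 / real (card S)) * sum h S" for h by (simp add: avg_def)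
 show "(%m. po l m * avg S (%x. f x m)) summable_on UNIV"
  unfolding e using summable_on_cmult_right[OF EP_sum(1)[where f = f, OF S s], of "1 / real (card S)"] by (simp add: mult.left_commute)
 show "EP l (%m. avg S (%x. f x m)) = avg S (%x. EP l (f x))"
  unfolding e EP_cmult by (subst EP_sum(2)[OF S s]) auto
qed

lemma pinned_correlation:
 assumes k: "k >= 3" "k <= n" and l: "0 <= l" and \<eta>: "0 < \<eta>"
 shows "(\<Sum>\<theta><\<Theta>. avg (lsts (R * \<theta>) {..<n}) (%I. EP l (%i. Av k n I i (Dl R n)))) <= real \<Theta> * \<eta> + 1 / \<eta>"
proof -
 have n: "n > 0" using k by simp
 have q: "0 < qq k" using qq_bounds[OF k(1)] by simp
 have b: "\<bar>Av k n I m (Dl R n)\<bar> <= 1 * 1 ^ m" for I m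
 proof -
  have "\<bar>Av k n I m (Dl R n)\<bar> <= Av k n I m (tot n)" by (rule Av_abs[OF k(1)]) (use Dl_bounds[OF _ n] in auto)
  then show ?thesis by (simp add: Av_tot[OF k])
 qed
 have s: "(%i. po l i * Av k n I i (Dl R n)) summable_on UNIV" for I
  by (rule po_summable[OF l, of 1 _ 1]) (use b in auto)
 have s1: "(%i. po l i * avg (lsts (R * \<theta>) {..<n}) (%I. Av k n I i (Dl R n))) summable_on UNIV" for \<theta>
  by (rule EP_avg(1)) (use s in auto)
 have "(\<Sum>\<theta><\<Theta>. avg (lsts (R * \<theta>) {..<n}) (%I. EP l (%i. Av k n I i (Dl R n))))
  = (\<Sum>\<theta><\<Theta>. EP l (%i. avg (lsts (R * \<theta>) {..<n}) (%I. Av k n I i (Dl R n))))"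
  by (intro sum.cong refl EP_avg(2)[symmetric]) (use s in auto)
 also have "... = EP l (%i. \<Sum>\<theta><\<Theta>. avg (lsts (R * \<theta>) {..<n}) (%I. Av k n I i (Dl R n)))"
  by (rule EP_sum(2)[symmetric]) (use s1 in auto)
 also have "... <= EP l (%_. real \<Theta> * \<eta> + 1 / \<eta>)"
 proof (rule EP_mono[OF l _ const_summable[OF l]])
  show "(%i. po l i * (\<Sum>\<theta><\<Theta>. avg (lsts (R * \<theta>) {..<n}) (%I. Av k n I i (Dl R n)))) summable_on UNIV"
   by (rule EP_sum(1)) (use s1 in auto)
  fix i
  let ?c = "2 ^ n * qq k ^ i"
  have "avg (lsts (R * \<theta>) {..<n}) (%I. Av k n I i (Dl R n))
   = avg (Fm k n i) (%F. avg (lsts (R * \<theta>) {..<n}) (%I. \<Sum>v\<in>bl (R * \<theta>). Dl R n (cnd (wgt F) I v))) / ?c" for \<theta>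
  proof -
   have "avg (lsts (R * \<theta>) {..<n}) (%I. Av k n I i (Dl R n))
    = avg (lsts (R * \<theta>) {..<n}) (%I. avg (Fm k n i) (%F. \<Sum>v\<in>bl (R * \<theta>). Dl R n (cnd (wgt F) I v)) / ?c)"
    unfolding Av_def by (rule avg_cong) (simp add: lsts_def)
   then show ?thesis unfolding avg_divide by (subst avg_swap)
  qed
  then have "(\<Sum>\<theta><\<Theta>. avg (lsts (R * \<theta>) {..<n}) (%I. Av k n I i (Dl R n)))
   = avg (Fm k n i) (%F. \<Sum>\<theta><\<Theta>. avg (lsts (R * \<theta>) {..<n}) (%I. \<Sum>v\<in>bl (R * \<theta>). Dl R n (cnd (wgt F) I v))) / ?c"
   by (simp add: avg_sum sum_divide_distrib)
  also have "... <= avg (Fm k n i) (%F. (real \<Theta> * \<eta> + 1 / \<eta>) * tot n (wgt F)) / ?c"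
   using q by (intro divide_right_mono avg_mono pinning wgt_01 \<eta> n) auto
  also have "... = (real \<Theta> * \<eta> + 1 / \<eta>) * Av k n [] i (tot n)"
   unfolding avg_cmult Av_Nil by simp
  finally show "(\<Sum>\<theta><\<Theta>. avg (lsts (R * \<theta>) {..<n}) (%I. Av k n I i (Dl R n))) <= real \<Theta> * \<eta> + 1 / \<eta>"
   unfolding Av_tot[OF k] by simp
 qed
 finally show ?thesis unfolding EP_const[OF l] .
qed

lemma pin_shift:
 assumes k: "k >= 3" "k <= n" and d: "0 < d" and s: "s <= T"
 shows "avg (lsts s {..<Suc n}) (ff k d (Suc n)) <= avg (lsts s {..<n}) (ff k d (Suc n)) + 2 * real T ^ 2 / real (Suc n)"
proof -
 have n: "{..<n} ~= {}" "{..<Suc n} ~= {}" using k by (auto simp: lessThan_empty_iff)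
 define h where "h I = ff k d (Suc n) I - ff k d (Suc n) []" for I
 have "\<bar>avg (lsts s {..<n}) h - avg (lsts s {..<Suc n}) h\<bar> <= 2 * real T * (real s * (1 / real (Suc n)))"
 proof (rule avg_lsts_subset)
  show "\<bar>h xs\<bar> <= real T" if "xs \<in> lsts s {..<Suc n}" for xs
  proof -
   have "length xs = s" using that by (simp add: lsts_def)
   then have "real (length xs) * ln 2 <= real T * 1" using s ln_2_less_1 by (intro mult_mono) auto
   then show ?thesis using ff_range[of k "Suc n" d xs] k d unfolding h_def by (simp add: abs_le_iff)
  qed
  show "1 - 1 / real (Suc n) <= real (card {..<n}) / real (card {..<Suc n})" by (simp add: field_simps)
 qed (use n in auto)
 also have "... <= 2 * real T * (real T * (1 / real (Suc n)))" using s by (intro mult_left_mono mult_right_mono) auto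
 also have "... = 2 * real T ^ 2 / real (Suc n)" by (simp add: power2_eq_square)
 finally have "\<bar>avg (lsts s {..<n}) h - avg (lsts s {..<Suc n}) h\<bar> <= 2 * real T ^ 2 / real (Suc n)" .
 moreover have "avg (lsts s {..<m}) h = avg (lsts s {..<m}) (ff k d (Suc n)) - ff k d (Suc n) []" if "{..<m} ~= {}" for m
  unfolding h_def avg_diff using that by (simp add: avg_const)
 ultimately show ?thesis using n by (simp add: abs_le_iff)
qed

lemma free_energy_upper:
 fixes d \<epsilon> :: real
 assumes k: "k >= 3" and d: "0 < d" and \<epsilon>: "0 < \<epsilon>"
  and cond: "!!\<pi>. \<pi> \<in> P_star ==> B k d \<pi> <= ln 2 + d / real k * ln (qq k)"
 shows "\<forall>\<^sub>F n in sequentially. EP (d * real n / real k) (KK k n) <= \<epsilon> * real n"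
proof -
 define \<phi> where "\<phi> = ln 2 + d / real k * ln (qq k)"
 define e where "e = \<epsilon> / 6"
 have e: "0 < e" using \<epsilon> by (simp add: e_def)
 obtain R C where C: "0 < C" and CS: "!!n w. k <= n ==> (!!sg. 0 <= w sg) ==> 0 < tot n w ==>
   EP d (Vx k n w) - d * (real k - 1) / real k * Ec k n w <= \<phi> + e + C * (Dl R n w / tot n w + 1 / real n)"
  using cavity_step[OF k d e, of \<phi>] cond unfolding \<phi>_def by blast
 define \<eta> where "\<eta> = e / C"
 have \<eta>: "0 < \<eta>" using e C by (simp add: \<eta>_def)
 obtain \<Theta> :: nat where \<Theta>: "1 / (\<eta> * \<eta>) < real \<Theta>" using reals_Archimedean2 by blast
 have \<Theta>0: "0 < real \<Theta>" using \<Theta> \<eta> by (meson divide_pos_pos less_trans mult_pos_pos zero_less_one)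
 have \<Theta>': "1 / \<eta> <= real \<Theta> * \<eta>" using \<Theta> \<eta> by (simp add: field_simps)
 define T where "T = R * \<Theta>"
 define G where "G n = (\<Sum>\<theta><\<Theta>. avg (lsts (R * \<theta>) {..<n}) (ff k d n)) / real \<Theta>" for n
 have step: "G (Suc n) <= G n + (\<phi> + 5 * e)" if n: "k <= n" "C <= e * real n" "2 * real T ^ 2 <= e * real n" for n
 proof -
  have n0: "0 < n" using n k by simp
  have ne: "{..<n} ~= {}" using n0 by (simp add: lessThan_empty_iff)
  have C1: "C / real n <= e" using n n0 by (simp add: field_simps)
  have C2: "2 * real T ^ 2 / real (Suc n) <= e"
   using n(3) e by (simp add: divide_le_eq algebra_simps)
  define l where "l = d * (real (Suc n) - real k) / real k"
  have l: "0 <= l" using n d by (simp add: l_def)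
  have one: "avg (lsts (R * \<theta>) {..<Suc n}) (ff k d (Suc n)) <= avg (lsts (R * \<theta>) {..<n}) (ff k d n) + (\<phi> + 3 * e)
    + C * avg (lsts (R * \<theta>) {..<n}) (%I. EP l (%i. Av k n I i (Dl R n)))" if "\<theta> < \<Theta>" for \<theta>
  proof -
   have "R * \<theta> <= T" unfolding T_def using that by simp
   from pin_shift[OF k n(1) d this]
   have "avg (lsts (R * \<theta>) {..<Suc n}) (ff k d (Suc n)) <= avg (lsts (R * \<theta>) {..<n}) (ff k d (Suc n)) + e" using C2 by linarith
   also have "avg (lsts (R * \<theta>) {..<n}) (ff k d (Suc n)) <= avg (lsts (R * \<theta>) {..<n}) (%I. ff k d n I + ((\<phi> + e + C / real n) + C * EP l (%i. Av k n I i (Dl R n))))"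
   proof (rule avg_mono)
    fix I assume "I \<in> lsts (R * \<theta>) {..<n}"
    then have I: "set I \<subseteq> {..<n}" by (simp add: lsts_def)
    show "ff k d (Suc n) I <= ff k d n I + ((\<phi> + e + C / real n) + C * EP l (%i. Av k n I i (Dl R n)))"
     unfolding ff_def l_def
    proof (rule free_energy_step[OF k n(1) I d less_imp_le[OF C]])
     fix w :: "(nat => bool) => real" assume w: "!!sg. 0 <= w sg" "0 < tot n w"
     show "EP d (Vx k n w) - d * (real k - 1) / real k * Ec k n w <= \<phi> + e + C / real n + C * (Dl R n w / tot n w)"
      using CS[OF n(1) w] by (simp add: distrib_left)
    qed
   qed
   also have "... = avg (lsts (R * \<theta>) {..<n}) (ff k d n) + ((\<phi> + e + C / real n) + C * avg (lsts (R * \<theta>) {..<n}) (%I. EP l (%i. Av k n I i (Dl R n))))"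
    unfolding avg_add avg_cmult using ne by (simp add: avg_const)
   finally show ?thesis using C1 by linarith
  qed
  have "(\<Sum>\<theta><\<Theta>. avg (lsts (R * \<theta>) {..<Suc n}) (ff k d (Suc n)))
   <= (\<Sum>\<theta><\<Theta>. avg (lsts (R * \<theta>) {..<n}) (ff k d n) + (\<phi> + 3 * e) + C * avg (lsts (R * \<theta>) {..<n}) (%I. EP l (%i. Av k n I i (Dl R n))))"
   by (rule sum_mono) (use one in auto)
  also have "... = real \<Theta> * G n + real \<Theta> * (\<phi> + 3 * e) + C * (\<Sum>\<theta><\<Theta>. avg (lsts (R * \<theta>) {..<n}) (%I. EP l (%i. Av k n I i (Dl R n))))"
   unfolding sum.distrib sum_distrib_left[symmetric] G_def using \<Theta>0 by (simp add: algebra_simps)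
  also have "... <= real \<Theta> * G n + real \<Theta> * (\<phi> + 3 * e) + C * (real \<Theta> * \<eta> + 1 / \<eta>)"
   using C by (intro add_left_mono mult_left_mono pinned_correlation[OF k n(1) l \<eta>]) auto
  also have "C * (real \<Theta> * \<eta> + 1 / \<eta>) <= C * (real \<Theta> * \<eta> + real \<Theta> * \<eta>)"
   using C \<Theta>' by (intro mult_left_mono add_left_mono) (auto simp: mult.commute)
  also have "C * (real \<Theta> * \<eta> + real \<Theta> * \<eta>) = real \<Theta> * (2 * e)" using C by (simp add: \<eta>_def)
  finally have "real \<Theta> * G (Suc n) <= real \<Theta> * (G n + (\<phi> + 5 * e))"
   unfolding G_def using \<Theta>0 by (simp add: algebra_simps)
  then show ?thesis using \<Theta>0 by simp
 qed
 have "\<forall>\<^sub>F n in sequentially. C / e <= real n & 2 * real T ^ 2 / e <= real n & k <= n"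
  by (intro eventually_conj eventually_real_ge eventually_ge_at_top)
 then obtain n0 where n0: "!!n. n >= n0 ==> C / e <= real n & 2 * real T ^ 2 / e <= real n & k <= n"
  by (auto simp: eventually_sequentially)
 have grow: "G (n0 + j) <= G n0 + real j * (\<phi> + 5 * e)" for j
 proof (induction j)
  case (Suc j)
  have "G (Suc (n0 + j)) <= G (n0 + j) + (\<phi> + 5 * e)"
   by (rule step) (use n0[of "n0 + j"] e in \<open>auto simp: divide_le_eq mult.commute\<close>)
  then show ?case using Suc by (simp add: algebra_simps)
 qed simp
 define K where "K = G n0 - real n0 * (\<phi> + 5 * e) + real T"
 have bound: "EP (d * real n / real k) (KK k n) <= K + 5 * e * real n" if n: "n >= n0" for n
 proof -
  have kn: "k <= n" using n0[OF n] by simp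
  have ne: "{..<n} ~= {}" using kn k by (simp add: lessThan_empty_iff)
  have "ff k d n [] - real T <= avg (lsts (R * \<theta>) {..<n}) (ff k d n)" if "\<theta> < \<Theta>" for \<theta>
  proof (rule avg_ge)
   fix I assume "I \<in> lsts (R * \<theta>) {..<n}"
   then have "length I = R * \<theta>" by (simp add: lsts_def)
   then have "length I <= T" using that by (simp add: T_def)
   then have "real (length I) * ln 2 <= real T * 1" using ln_2_less_1 by (intro mult_mono) auto
   then show "ff k d n [] - real T <= ff k d n I" using ff_range(2)[OF k kn d, of I] by simp
  qed (use ne in auto)
  then have "(\<Sum>\<theta><\<Theta>. ff k d n [] - real T) <= (\<Sum>\<theta><\<Theta>. avg (lsts (R * \<theta>) {..<n}) (ff k d n))" by (intro sum_mono) auto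
  then have "ff k d n [] - real T <= G n" unfolding G_def using \<Theta>0 by (simp add: field_simps)
  also have "G n <= G n0 + real (n - n0) * (\<phi> + 5 * e)" using grow[of "n - n0"] n by simp
  finally have "ff k d n [] - real T <= G n0 + (real n - real n0) * (\<phi> + 5 * e)" using n by (simp add: of_nat_diff)
  moreover have "ff k d n [] = EP (d * real n / real k) (KK k n) + real n * \<phi>" unfolding \<phi>_def by (rule ff_Nil[OF k kn d])
  ultimately show ?thesis unfolding K_def by (simp add: algebra_simps)
 qed
 have "\<forall>\<^sub>F n in sequentially. K / e <= real n" by (rule eventually_real_ge)
 moreover have "\<forall>\<^sub>F n in sequentially. n0 <= n" by (rule eventually_ge_at_top)
 ultimately show ?thesis
 proof eventually_elim
  case (elim n)
  have "K <= e * real n" using elim(1) e by (simp add: divide_le_eq mult.commute)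
  then show ?case using bound[OF elim(2)] by (simp add: e_def)
 qed
qed

lemma KL_small:
 fixes d D \<delta> :: real
 assumes k: "k >= 3" and d: "0 < d" and D: "D < d / real k" and \<delta>: "0 < \<delta>"
  and cond: "!!\<pi>. \<pi> \<in> P_star ==> B k d \<pi> <= ln 2 + d / real k * ln (qq k)"
 shows "\<forall>\<^sub>F n in sequentially. \<forall>m. real m <= D * real n --> KK k n m <= \<delta> * real n"
proof -
 have "\<forall>\<^sub>F n in sequentially. EP (d * real n / real k) (KK k n) <= \<delta> / 2 * real n"
  by (rule free_energy_upper[OF k d _ cond]) (use \<delta> in auto)
 moreover have "\<forall>\<^sub>F n in sequentially. EP (d / real k * real n) (%m. of_bool (real m <= D * real n)) <= 1 / 2"
  by (rule po_lower_tail) (use k d D in auto)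
 moreover have "\<forall>\<^sub>F n in sequentially. k <= n" by (rule eventually_ge_at_top)
 ultimately show ?thesis
 proof eventually_elim
  case (elim n)
  define l where "l = d * real n / real k"
  have l: "0 <= l" using d by (simp add: l_def)
  have ob: "(%m. po l m * of_bool (P m)) summable_on UNIV" for P
   by (rule po_summable[OF l, of 1 _ 1]) auto
  have p: "EP l (%m. of_bool (~ real m <= D * real n)) >= 1 / 2"
  proof -
   have "EP l (%m. of_bool (~ real m <= D * real n) + of_bool (real m <= D * real n)) = EP l (%_. 1)"
    by (rule arg_cong[where f = "EP l"]) auto
   moreover have "EP l (%m. of_bool (real m <= D * real n)) <= 1 / 2" using elim(2) by (simp add: l_def)
   ultimately show ?thesis unfolding EP_add[OF ob ob] EP_const[OF l] by linarith
  qed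
  show ?case
  proof (intro allI impI)
   fix m assume m: "real m <= D * real n"
   have "KK k n m * (1 / 2) <= KK k n m * EP l (%m'. of_bool (~ real m' <= D * real n))"
    using p KK_nonneg[OF k elim(3)] by (rule mult_left_mono)
   also have "... = EP l (%m'. KK k n m * of_bool (~ real m' <= D * real n))" by (rule EP_cmult[symmetric])
   also have "... <= EP l (KK k n)"
   proof (rule EP_mono[OF l _ KK_summable(1)[OF k elim(3) l]])
    show "(%m'. po l m' * (KK k n m * of_bool (~ real m' <= D * real n))) summable_on UNIV"
     using summable_on_cmult_right[OF ob, of "KK k n m"] by (simp add: mult.left_commute)
    show "KK k n m * of_bool (~ real m' <= D * real n) <= KK k n m'" for m'
    proof (cases "real m' <= D * real n")
     case False
     then have "m <= m'" using m by simp
     then show ?thesis using KK_mono[OF k elim(3)] False by simp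
    qed (use KK_nonneg[OF k elim(3)] in simp)
   qed
   also have "... <= \<delta> / 2 * real n" using elim(1) by (simp add: l_def)
   finally show "KK k n m <= \<delta> * real n" by simp
  qed
 qed
qed

section \<open>Below the condensation threshold the Kesten--Stigum bound holds\<close>

lemma nonneg_from_deriv:
 fixes f :: "real => real"
 assumes f0: "f 0 = 0" and D: "!!z. z > -1 ==> (f has_real_derivative f' z) (at z)"
  and pos: "!!z. z >= 0 ==> 0 <= f' z" and neg: "!!z. -1 < z ==> z <= 0 ==> f' z <= 0" and y: "y > -1"
 shows "0 <= f y"
proof (cases "0 <= y")
 case True
 have "f 0 <= f y"
 proof (rule DERIV_nonneg_imp_nondecreasing[OF True])
  fix x :: real assume "0 <= x" "x <= y"
  then show "\<exists>D. (f has_real_derivative D) (at x) & 0 <= D" using D[of x] pos[of x] by (intro exI[of _ "f' x"]) auto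
 qed
 then show ?thesis using f0 by simp
next
 case False
 then have "y <= 0" by simp
 have "f 0 <= f y"
 proof (rule DERIV_nonpos_imp_nonincreasing[OF \<open>y <= 0\<close>])
  fix x :: real assume "y <= x" "x <= 0"
  then show "\<exists>D. (f has_real_derivative D) (at x) & D <= 0" using D[of x] neg[of x] y by (intro exI[of _ "f' x"]) auto
 qed
 then show ?thesis using f0 by simp
qed

lemma ln_upper3: "ln (1 + y) <= y - y\<^sup>2 / 2 + y ^ 3 / 3" if y: "y > -1" for y :: real
proof -
 have "0 <= y - y\<^sup>2 / 2 + y ^ 3 / 3 - ln (1 + y)"
 proof (rule nonneg_from_deriv[where f = "%y. y - y\<^sup>2 / 2 + y ^ 3 / 3 - ln (1 + y)" and f' = "%z. z ^ 3 / (1 + z)", OF _ _ _ _ y])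
  fix z :: real assume z: "z > -1"
  have "((%y. y - y\<^sup>2 / 2 + y ^ 3 / 3 - ln (1 + y)) has_real_derivative 1 - z + z\<^sup>2 - 1 / (1 + z)) (at z)"
   using z by (auto intro!: derivative_eq_intros simp: power2_eq_square)
  moreover have "1 - z + z\<^sup>2 - 1 / (1 + z) = z ^ 3 / (1 + z)"
   using z by (simp add: field_simps power2_eq_square power3_eq_cube)
  ultimately show "((%y. y - y\<^sup>2 / 2 + y ^ 3 / 3 - ln (1 + y)) has_real_derivative z ^ 3 / (1 + z)) (at z)" by simp
 next
  fix z :: real assume "-1 < z" "z <= 0"
  then have "z ^ 3 <= 0" by (simp add: power3_eq_cube mult_nonneg_nonpos)
  then show "z ^ 3 / (1 + z) <= 0" using \<open>-1 < z\<close> by (simp add: divide_nonpos_pos)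
 qed auto
 then show ?thesis by simp
qed

lemma ln_sign2: "y >= 0 ==> y - y\<^sup>2 / 2 <= ln (1 + y)" "-1 < y ==> y <= 0 ==> ln (1 + y) <= y - y\<^sup>2 / 2" for y :: real
proof -
 let ?g = "%y::real. ln (1 + y) - y + y\<^sup>2 / 2"
 have D: "\<exists>D. (?g has_real_derivative D) (at z) & 0 <= D" if z: "z > -1" for z
 proof -
  have "(?g has_real_derivative 1 / (1 + z) - 1 + z) (at z)"
   using z by (auto intro!: derivative_eq_intros)
  moreover have "1 / (1 + z) - 1 + z = z\<^sup>2 / (1 + z)" using z by (simp add: field_simps power2_eq_square)
  moreover have "0 <= z\<^sup>2 / (1 + z)" using z by simp
  ultimately show ?thesis by (intro exI[of _ "z\<^sup>2 / (1 + z)"]) simp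
 qed
 show "y - y\<^sup>2 / 2 <= ln (1 + y)" if "y >= 0"
 proof -
  have "?g 0 <= ?g y" by (rule DERIV_nonneg_imp_nondecreasing[OF that]) (rule D, simp)
  then show ?thesis by simp
 qed
 show "ln (1 + y) <= y - y\<^sup>2 / 2" if "-1 < y" "y <= 0"
 proof -
  have "?g y <= ?g 0" by (rule DERIV_nonneg_imp_nondecreasing[OF that(2)]) (rule D, use that in simp)
  then show ?thesis by simp
 qed
qed

lemma Lam_lower3: "y + y\<^sup>2 / 2 - \<bar>y\<bar> ^ 3 <= Lam (1 + y)" if y: "y >= -1"
proof (cases "y = -1")
 case False
 then have y: "y > -1" using y by simp
 let ?f = "%y::real. (1 + y) * ln (1 + y) - y - y\<^sup>2 / 2 + y ^ 3 / 6"
 have "0 <= ?f y"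
 proof (rule nonneg_from_deriv[where f = ?f and f' = "%z. ln (1 + z) - z + z\<^sup>2 / 2", OF _ _ _ _ y])
  fix z :: real assume z: "z > -1"
  show "(?f has_real_derivative ln (1 + z) - z + z\<^sup>2 / 2) (at z)"
   using z by (auto intro!: derivative_eq_intros simp: add_divide_distrib diff_divide_distrib power2_eq_square)
 qed (use ln_sign2 in \<open>auto simp: algebra_simps\<close>)
 moreover have "y ^ 3 / 6 <= \<bar>y\<bar> ^ 3"
 proof -
  have "y ^ 3 <= \<bar>y\<bar> ^ 3" by (metis abs_ge_self power_abs)
  moreover have "0 <= \<bar>y\<bar> ^ 3" by simp
  ultimately show ?thesis by linarith
 qed
 ultimately show ?thesis using y by (simp add: Lam_def)
qed simp

lemma Lam_upper3: "Lam (1 + y) <= y + y\<^sup>2 / 2 + \<bar>y\<bar> ^ 3" if y: "\<bar>y\<bar> <= 1 / 2"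
proof -
 have y1: "y > -1" using y by linarith
 have "(1 + y) * ln (1 + y) <= (1 + y) * (y - y\<^sup>2 / 2 + y ^ 3 / 3)"
  using y1 by (intro mult_left_mono ln_upper3) auto
 also have "... = y + y\<^sup>2 / 2 - y ^ 3 / 6 + y ^ 4 / 3"
  by (simp add: algebra_simps add_divide_distrib diff_divide_distrib power2_eq_square power3_eq_cube power4_eq_xxxx)
 also have "... <= y + y\<^sup>2 / 2 + \<bar>y\<bar> ^ 3"
 proof -
  have "- (y ^ 3) <= \<bar>y\<bar> ^ 3" by (metis abs_ge_minus_self power_abs)
  moreover have "y ^ 4 = \<bar>y\<bar> * \<bar>y\<bar> ^ 3" by (simp add: power4_eq_xxxx power3_eq_cube)
  moreover have "\<bar>y\<bar> * \<bar>y\<bar> ^ 3 <= 1 * \<bar>y\<bar> ^ 3" using y by (intro mult_right_mono) auto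
  moreover have "0 <= \<bar>y\<bar> ^ 3" by simp
  ultimately show ?thesis by linarith
 qed
 finally show ?thesis using y1 by (simp add: Lam_def)
qed

lemma avg_lsts_prod: "avg (lsts r S) (%xs. prod_list (map f xs)) = avg S f ^ r"
 by (induction r) (simp_all add: avg_lsts_Suc avg_cmult avg_cmult_right)

text \<open>The cancellation of first order terms in \<open>\<Prod>(1 + \<alpha>) + \<Prod>(1 + \<beta>)\<close>.\<close>

lemma prod_pair_bound:
 fixes \<alpha> \<beta> :: "'a => real" and t \<kappa> :: real
 assumes t: "0 <= t" "t <= 1" and \<kappa>: "0 <= \<kappa>"
  and "\<forall>z\<in>set zs. \<bar>\<alpha> z\<bar> <= \<kappa> * t & \<bar>\<beta> z\<bar> <= \<kappa> * t & \<bar>\<alpha> z + \<beta> z\<bar> <= \<kappa> * t\<^sup>2"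
 shows "\<bar>prod_list (map (%z. 1 + \<alpha> z) zs) - 1\<bar> <= t * (1 + 3 * \<kappa>) ^ length zs
  & \<bar>prod_list (map (%z. 1 + \<beta> z) zs) - 1\<bar> <= t * (1 + 3 * \<kappa>) ^ length zs
  & \<bar>prod_list (map (%z. 1 + \<alpha> z) zs) + prod_list (map (%z. 1 + \<beta> z) zs) - 2\<bar> <= t\<^sup>2 * (1 + 3 * \<kappa>) ^ length zs"
 using assms(4)
proof (induction zs)
 case (Cons z zs)
 define P Q K where "P = prod_list (map (%z. 1 + \<alpha> z) zs)" and "Q = prod_list (map (%z. 1 + \<beta> z) zs)" and "K = (1 + 3 * \<kappa>) ^ length zs"
 have IH: "\<bar>P - 1\<bar> <= t * K" "\<bar>Q - 1\<bar> <= t * K" "\<bar>P + Q - 2\<bar> <= t\<^sup>2 * K" using Cons by (auto simp: P_def Q_def K_def)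
 have z: "\<bar>\<alpha> z\<bar> <= \<kappa> * t" "\<bar>\<beta> z\<bar> <= \<kappa> * t" "\<bar>\<alpha> z + \<beta> z\<bar> <= \<kappa> * t\<^sup>2" using Cons.prems by auto
 have K: "1 <= K" unfolding K_def using \<kappa> by (intro one_le_power) simp
 have \<kappa>K: "\<kappa> * t <= \<kappa> * t * K" "\<kappa> * t\<^sup>2 <= \<kappa> * t\<^sup>2 * K"
  using K \<kappa> t by (auto intro!: mult_left_le mult_left_mono[of 1 K, simplified])
 have pr: "\<bar>a * b\<bar> <= \<kappa> * t\<^sup>2 * K" if "\<bar>a\<bar> <= \<kappa> * t" "\<bar>b\<bar> <= t * K" for a b
 proof -
  have "\<bar>a * b\<bar> <= (\<kappa> * t) * (t * K)" unfolding abs_mult using that \<kappa> t by (intro mult_mono) auto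
  then show ?thesis by (simp add: power2_eq_square mult_ac)
 qed
 have tt: "\<kappa> * t\<^sup>2 * K <= \<kappa> * t * K"
  using t \<kappa> K by (intro mult_right_mono mult_left_mono) (auto simp: power2_eq_square mult_left_le)
 have one: "\<bar>(1 + a) * R - 1\<bar> <= t * ((1 + 3 * \<kappa>) * K)" if a: "\<bar>a\<bar> <= \<kappa> * t" and R: "\<bar>R - 1\<bar> <= t * K" for a R
 proof -
  have "(1 + a) * R - 1 = (R - 1) + a + a * (R - 1)" by (simp add: algebra_simps)
  moreover have "t * ((1 + 3 * \<kappa>) * K) = t * K + 3 * (\<kappa> * t * K)" by (simp add: algebra_simps)
  moreover have "0 <= \<kappa> * t * K" using \<kappa> t K by simp
  ultimately show ?thesis using a R pr[OF a R] \<kappa>K(1) tt by linarith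
 qed
 have "(1 + \<alpha> z) * P + (1 + \<beta> z) * Q - 2 = (P + Q - 2) + (\<alpha> z + \<beta> z) + \<alpha> z * (P - 1) + \<beta> z * (Q - 1)" by (simp add: algebra_simps)
 moreover have "t\<^sup>2 * ((1 + 3 * \<kappa>) * K) = t\<^sup>2 * K + 3 * (\<kappa> * t\<^sup>2 * K)" by (simp add: algebra_simps)
 ultimately have "\<bar>(1 + \<alpha> z) * P + (1 + \<beta> z) * Q - 2\<bar> <= t\<^sup>2 * ((1 + 3 * \<kappa>) * K)"
  using IH(3) z(3) pr[OF z(1) IH(1)] pr[OF z(2) IH(2)] \<kappa>K(2) by linarith
 then show ?case using one[OF z(1) IH(1)] one[OF z(2) IH(2)] by (simp add: P_def Q_def K_def)
qed (use t in auto)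

definition cq :: "nat => real" where "cq k = 2 / 2 ^ k / qq k"

locale two_point =
 fixes k :: nat and t :: real
 assumes k: "k >= 3" and t: "0 < t" "t <= 1"
begin

definition y :: "bool => real" where "y b = (if b then t else - t)"
definition p :: "bool => real" where "p b = (1 + y b) / 2"
definition u :: "bool list => real" where "u xs = prod_list (map (%b. 1 + y b) xs) - 1"
definition v :: "bool list => real" where "v xs = prod_list (map (%b. 1 + - y b) xs) - 1"

lemma q: "0 < qq k" "qq k < 1" using qq_bounds[OF k] by auto
lemma c: "0 < cq k" unfolding cq_def using q by simp

lemma avg_bool: "avg (UNIV :: bool set) f = (f True + f False) / 2"
 by (simp add: avg_def UNIV_bool)

lemma p01: "0 <= p b & p b <= 1" using t by (simp add: p_def y_def)

lemma avg_p: "avg UNIV p = 1 / 2" by (simp add: avg_bool p_def y_def add_divide_distrib[symmetric])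

lemma uv_bound: "\<bar>u xs\<bar> <= t * 4 ^ length xs" "\<bar>v xs\<bar> <= t * 4 ^ length xs" "\<bar>u xs + v xs\<bar> <= t\<^sup>2 * 4 ^ length xs"
 using prod_pair_bound[of t 1 xs y "%b. - y b"] t by (auto simp: u_def v_def y_def)

lemma avg_u: "avg (lsts r UNIV) u = 0" "avg (lsts r UNIV) v = 0"
 and avg_uu: "avg (lsts r UNIV) (%xs. (u xs)\<^sup>2) = (1 + t\<^sup>2) ^ r - 1" "avg (lsts r UNIV) (%xs. (v xs)\<^sup>2) = (1 + t\<^sup>2) ^ r - 1"
 and avg_uv: "avg (lsts r UNIV) (%xs. u xs * v xs) = (1 - t\<^sup>2) ^ r - 1"
proof -
 let ?f = "%b. 1 + y b" and ?g = "%b. 1 + - y b"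
 have pm: "prod_list (map f xs) * prod_list (map g xs) = prod_list (map (%b. f b * g b) xs)" for f g :: "bool => real" and xs
  by (induction xs) (simp_all add: mult_ac)
 have ne: "finite (lsts r (UNIV :: bool set))" "lsts r (UNIV :: bool set) ~= {}" by auto
 have F: "avg (lsts r UNIV) (%xs. prod_list (map ?f xs)) = 1" "avg (lsts r UNIV) (%xs. prod_list (map ?g xs)) = 1"
  unfolding avg_lsts_prod by (simp_all add: avg_bool y_def add_divide_distrib diff_divide_distrib)
 show "avg (lsts r UNIV) u = 0" "avg (lsts r UNIV) v = 0"
  unfolding u_def v_def avg_diff F using ne by (simp_all add: avg_const)
 have G: "avg (lsts r UNIV) (%xs. (prod_list (map f xs) - 1) * (prod_list (map g xs) - 1)) = avg UNIV (%b. f b * g b) ^ r - 1"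
  if "f = ?f \<or> f = ?g" "g = ?f \<or> g = ?g" for f g
 proof -
  have "avg (lsts r UNIV) (%xs. (prod_list (map f xs) - 1) * (prod_list (map g xs) - 1))
   = avg (lsts r UNIV) (%xs. prod_list (map (%b. f b * g b) xs) - prod_list (map f xs) - prod_list (map g xs) + 1)"
   by (intro avg_cong) (simp add: pm[symmetric] algebra_simps)
  also have "... = avg UNIV (%b. f b * g b) ^ r - avg (lsts r UNIV) (%xs. prod_list (map f xs)) - avg (lsts r UNIV) (%xs. prod_list (map g xs)) + 1"
   unfolding avg_add avg_diff avg_lsts_prod using ne by (simp add: avg_const)
  also have "avg (lsts r UNIV) (%xs. prod_list (map f xs)) = 1" using that(1) F by auto
  also have "avg (lsts r UNIV) (%xs. prod_list (map g xs)) = 1" using that(2) F by auto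
  finally show ?thesis by simp
 qed
 have 1: "avg UNIV (%b. ?f b * ?f b) = 1 + t\<^sup>2" "avg UNIV (%b. ?g b * ?g b) = 1 + t\<^sup>2" "avg UNIV (%b. ?f b * ?g b) = 1 - t\<^sup>2"
  by (simp_all add: avg_bool y_def power2_eq_square algebra_simps add_divide_distrib diff_divide_distrib)
 show "avg (lsts r UNIV) (%xs. (u xs)\<^sup>2) = (1 + t\<^sup>2) ^ r - 1" "avg (lsts r UNIV) (%xs. (v xs)\<^sup>2) = (1 + t\<^sup>2) ^ r - 1"
  unfolding u_def v_def power2_eq_square[of "_ - _"] using G[of ?f ?f] G[of ?g ?g] 1 by auto
 show "avg (lsts r UNIV) (%xs. u xs * v xs) = (1 - t\<^sup>2) ^ r - 1"
  unfolding u_def v_def using G[of ?f ?g] 1 by auto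
qed

definition PQ :: "(bool list => real) => bool list list => real" where
 "PQ f xss = prod_list (map (%xs. 1 + - cq k * f xs) xss)"

definition X :: "bool list list => real" where "X xss = (PQ u xss + PQ v xss) / 2"

lemma prod_p: "prod_list (map p xs) = (1 + u xs) / 2 ^ length xs" "prod_list (map (%b. 1 - p b) xs) = (1 + v xs) / 2 ^ length xs"
 unfolding u_def v_def by (induction xs) (auto simp: p_def field_simps)

lemma one_minus: "1 - (1 + z) / 2 ^ (k - 1) = qq k * (1 + - cq k * z)"
proof -
 have "(2::real) ^ k = 2 * 2 ^ (k - 1)" using k by (metis Suc_diff_1 less_le_trans power_Suc zero_less_numeral)
 then have h: "2 / 2 ^ k = 1 / (2::real) ^ (k - 1)" by simp
 have e1: "qq k = 1 - 1 / 2 ^ (k - 1)" unfolding h[symmetric] by (rule qq_eq) (use k in simp)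
 have e2: "qq k * cq k = 1 / 2 ^ (k - 1)" unfolding h[symmetric] cq_def using q by simp
 have "qq k * (1 + - cq k * z) = qq k - (qq k * cq k) * z" by (simp add: algebra_simps)
 then show ?thesis unfolding e2 unfolding e1 by (simp add: add_divide_distrib)
qed

lemma Wl_X: assumes "xss \<in> lsts \<gamma> (lsts (k - 1) UNIV)"
 shows "Wl (map (map p) xss) = 2 * qq k ^ \<gamma> * X xss"
proof -
 have a: "prod_list (map (%xs. 1 - prod_list (map f xs)) xss) = qq k ^ length xss * PQ g xss"
  if "\<forall>xs\<in>set xss. length xs = k - 1" "!!xs. prod_list (map f xs) = (1 + g xs) / 2 ^ length xs" for f :: "bool => real" and g xss
  using that(1)
 proof (induction xss)
  case (Cons xs xss)
  then show ?case using that(2)[of xs] one_minus[of "g xs"] by (simp add: PQ_def)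
 qed (simp add: PQ_def)
 have l: "\<forall>xs\<in>set xss. length xs = k - 1" "length xss = \<gamma>" using assms by (auto simp: lsts_def)
 show ?thesis using a[OF l(1) prod_p(1)] a[OF l(1) prod_p(2)] l(2) by (simp add: Wl_def o_def X_def algebra_simps)
qed

definition a :: real where "a = (1 + t\<^sup>2) ^ (k - 1) - 1"
definition b :: real where "b = (1 - t\<^sup>2) ^ (k - 1) - 1"

lemma avg_PQ: "avg (lsts \<gamma> (lsts (k - 1) UNIV)) (PQ u) = 1" "avg (lsts \<gamma> (lsts (k - 1) UNIV)) (PQ v) = 1"
 unfolding PQ_def avg_lsts_prod avg_add avg_cmult avg_u by (simp_all add: avg_const)

lemma avg_X2: "avg (lsts \<gamma> (lsts (k - 1) UNIV)) (%xss. (X xss)\<^sup>2) = ((1 + (cq k)\<^sup>2 * a) ^ \<gamma> + (1 + (cq k)\<^sup>2 * b) ^ \<gamma>) / 2"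
proof -
 have pm: "PQ f xss * PQ g xss = prod_list (map (%xs. (1 + - cq k * f xs) * (1 + - cq k * g xs)) xss)" for f g xss
  unfolding PQ_def by (induction xss) (simp_all add: mult_ac)
 have G: "avg (lsts \<gamma> (lsts (k - 1) UNIV)) (%xss. PQ f xss * PQ g xss) = (1 + (cq k)\<^sup>2 * avg (lsts (k - 1) UNIV) (%xs. f xs * g xs)) ^ \<gamma>"
  if "avg (lsts (k - 1) UNIV) f = 0" "avg (lsts (k - 1) UNIV) g = 0" for f g
 proof -
  have "avg (lsts (k - 1) UNIV) (%xs. (1 + - cq k * f xs) * (1 + - cq k * g xs))
   = avg (lsts (k - 1) UNIV) (%xs. 1 + (- cq k * f xs + (- cq k * g xs + (cq k)\<^sup>2 * (f xs * g xs))))"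
   by (intro avg_cong) (simp add: algebra_simps power2_eq_square)
  also have "... = 1 + (cq k)\<^sup>2 * avg (lsts (k - 1) UNIV) (%xs. f xs * g xs)"
   unfolding avg_add avg_cmult that by (simp add: avg_const)
  finally show ?thesis unfolding pm avg_lsts_prod by simp
 qed
 have "avg (lsts \<gamma> (lsts (k - 1) UNIV)) (%xss. (X xss)\<^sup>2)
  = avg (lsts \<gamma> (lsts (k - 1) UNIV)) (%xss. (1/4) * (PQ u xss * PQ u xss) + ((1/4) * (PQ v xss * PQ v xss) + (1/2) * (PQ u xss * PQ v xss)))"
  by (intro avg_cong) (simp add: X_def power2_eq_square algebra_simps)
 also have "... = ((1 + (cq k)\<^sup>2 * a) ^ \<gamma> + (1 + (cq k)\<^sup>2 * b) ^ \<gamma>) / 2"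
  unfolding avg_add avg_cmult G[OF avg_u(1) avg_u(1)] G[OF avg_u(2) avg_u(2)] G[OF avg_u] power2_eq_square[symmetric, of "u _"] power2_eq_square[symmetric, of "v _"] avg_uu avg_uv a_def b_def
  by simp
 finally show ?thesis .
qed

definition K :: real where "K = 1 + 3 * (cq k * 4 ^ k)"

lemma X_bound: assumes "xss \<in> lsts \<gamma> (lsts (k - 1) UNIV)" shows "\<bar>X xss - 1\<bar> <= t\<^sup>2 * K ^ \<gamma>"
proof -
 have l: "\<forall>xs\<in>set xss. length xs = k - 1" "length xss = \<gamma>" using assms by (auto simp: lsts_def)
 have k4: "(4::real) ^ (k - 1) <= 4 ^ k" by (rule power_increasing) auto
 have m: "\<bar>- cq k * z\<bar> <= cq k * 4 ^ k * s" if "\<bar>z\<bar> <= s * 4 ^ (k - 1)" "0 <= s" for z s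
 proof -
  have "\<bar>z\<bar> <= s * 4 ^ k" using that mult_left_mono[OF k4 that(2)] by linarith
  then have "cq k * \<bar>z\<bar> <= cq k * (s * 4 ^ k)" using c by (intro mult_left_mono) auto
  then show ?thesis using c by (simp add: abs_mult mult_ac)
 qed
 have "\<bar>prod_list (map (%z. 1 + - cq k * u z) xss) + prod_list (map (%z. 1 + - cq k * v z) xss) - 2\<bar> <= t\<^sup>2 * K ^ length xss"
  unfolding K_def
 proof (rule conjunct2[OF conjunct2[OF prod_pair_bound]])
  show "\<forall>z\<in>set xss. \<bar>- cq k * u z\<bar> <= cq k * 4 ^ k * t & \<bar>- cq k * v z\<bar> <= cq k * 4 ^ k * t & \<bar>- cq k * u z + - cq k * v z\<bar> <= cq k * 4 ^ k * t\<^sup>2"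
  proof
   fix z assume "z \<in> set xss"
   then have lz: "length z = k - 1" using l by simp
   have "- cq k * u z + - cq k * v z = - cq k * (u z + v z)" by (simp add: algebra_simps)
   then show "\<bar>- cq k * u z\<bar> <= cq k * 4 ^ k * t & \<bar>- cq k * v z\<bar> <= cq k * 4 ^ k * t & \<bar>- cq k * u z + - cq k * v z\<bar> <= cq k * 4 ^ k * t\<^sup>2"
    using m[of "u z" t] m[of "v z" t] m[of "u z + v z" "t\<^sup>2"] uv_bound[of z, unfolded lz] t by simp
  qed
 qed (use t c in auto)
 then have "\<bar>PQ u xss + PQ v xss - 2\<bar> <= t\<^sup>2 * K ^ \<gamma>" by (simp add: PQ_def l)
 moreover have "X xss - 1 = (PQ u xss + PQ v xss - 2) / 2" by (simp add: X_def)
 ultimately show ?thesis by simp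
qed

lemma Vt_lower: "ln 2 + real \<gamma> * ln (qq k) + ((1 + (cq k)\<^sup>2 * a) ^ \<gamma> + (1 + (cq k)\<^sup>2 * b) ^ \<gamma>) / 4 - 1 / 2 - t ^ 6 * (K ^ 3) ^ \<gamma> <= Vt k UNIV p \<gamma>"
proof -
 let ?L = "lsts \<gamma> (lsts (k - 1) (UNIV :: bool set))"
 have ne: "finite ?L" "?L ~= {}" by auto
 define s where "s = 2 * qq k ^ \<gamma>"
 have s: "0 < s" using q by (simp add: s_def)
 have ls: "ln s = ln 2 + real \<gamma> * ln (qq k)" unfolding s_def using q by (simp add: ln_mult_pos ln_realpow)
 have X0: "0 <= X xss" if "xss \<in> ?L" for xss
 proof -
  have "0 <= Wl (map (map p) xss)" by (rule Wl_bounds) (use p01 in auto)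
  then show ?thesis using Wl_X[OF that] s by (simp add: s_def zero_le_mult_iff)
 qed
 have pt: "s * (ln s * X xss + ((X xss)\<^sup>2 / 2 - 1 / 2 - t ^ 6 * (K ^ 3) ^ \<gamma>)) <= Lam (Wl (map (map p) xss))" if x: "xss \<in> ?L" for xss
 proof -
  have "Lam (Wl (map (map p) xss)) = s * Lam (X xss) + X xss * Lam s"
   unfolding Wl_X[OF x] s_def[symmetric] by (rule Lam_mult) (use s X0[OF x] in auto)
  also have "Lam s = s * ln s" using s by (simp add: Lam_def)
  finally have e: "Lam (Wl (map (map p) xss)) = s * (ln s * X xss + Lam (X xss))" by (simp add: algebra_simps)
  have "\<bar>X xss - 1\<bar> ^ 3 <= (t\<^sup>2 * K ^ \<gamma>) ^ 3" by (intro power_mono X_bound[OF x]) auto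
  also have "... = t ^ 6 * (K ^ 3) ^ \<gamma>" by (simp add: power_mult_distrib power_mult[symmetric] mult.commute)
  finally have "(X xss - 1) + (X xss - 1)\<^sup>2 / 2 - t ^ 6 * (K ^ 3) ^ \<gamma> <= Lam (X xss)"
   using Lam_lower3[of "X xss - 1"] X0[OF x] by simp
  moreover have "(X xss - 1) + (X xss - 1)\<^sup>2 / 2 = (X xss)\<^sup>2 / 2 - 1 / 2" by (simp add: power2_eq_square algebra_simps add_divide_distrib diff_divide_distrib)
  ultimately show ?thesis unfolding e using s by (intro mult_left_mono) auto
 qed
 have avX: "avg ?L X = 1" unfolding X_def avg_divide avg_add avg_PQ by simp
 have "s * (ln s * 1 + (((1 + (cq k)\<^sup>2 * a) ^ \<gamma> + (1 + (cq k)\<^sup>2 * b) ^ \<gamma>) / 2 / 2 - 1 / 2 - t ^ 6 * (K ^ 3) ^ \<gamma>))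
  = avg ?L (%xss. s * (ln s * X xss + ((X xss)\<^sup>2 / 2 - 1 / 2 - t ^ 6 * (K ^ 3) ^ \<gamma>)))"
  unfolding avg_cmult avg_add avg_diff avX avg_divide[of _ "%x. (X x)\<^sup>2"] avg_X2 using ne by (simp add: avg_const)
 also have "... <= avg ?L (%xss. Lam (Wl (map (map p) xss)))" by (rule avg_mono) (rule pt)
 also have "... = s * Vt k UNIV p \<gamma>" unfolding Vt_def s_def using q by simp
 finally show ?thesis using s ls by simp
qed

lemma Ed_upper:
 assumes small: "cq k * 4 ^ k * t\<^sup>2 <= 1 / 2"
 shows "Ed k UNIV p <= ln (qq k) + (cq k)\<^sup>2 * hh k (t\<^sup>2) / 4 + t ^ 6 * (cq k * 4 ^ k) ^ 3"
proof -
 let ?L = "lsts k (UNIV :: bool set)"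
 have ne: "finite ?L" "?L ~= {}" by auto
 define w where "w xs = - (cq k / 2) * (u xs + v xs)" for xs
 have wb: "\<bar>w xs\<bar> <= cq k * 4 ^ k * t\<^sup>2" if "xs \<in> ?L" for xs
 proof -
  have "\<bar>u xs + v xs\<bar> <= t\<^sup>2 * 4 ^ k" using uv_bound(3)[of xs] that by (simp add: lsts_def)
  then have "cq k / 2 * \<bar>u xs + v xs\<bar> <= cq k / 2 * (t\<^sup>2 * 4 ^ k)" using c by (intro mult_left_mono) auto
  also have "... <= cq k * (t\<^sup>2 * 4 ^ k)" using c by (intro mult_right_mono) auto
  finally show ?thesis using c by (simp add: w_def abs_mult mult_ac)
 qed
 have El: "El (map p xs) = qq k * (1 + w xs)" if "xs \<in> ?L" for xs
 proof -
  have l: "length xs = k" using that by (simp add: lsts_def)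
  have e1: "qq k = 1 - 2 / 2 ^ k" by (rule qq_eq) (use k in simp)
  have e2: "qq k * cq k = 2 / 2 ^ k" unfolding cq_def using q by simp
  have "qq k * (1 + w xs) = qq k - (qq k * cq k) * ((u xs + v xs) / 2)" by (simp add: w_def algebra_simps)
  also have "... = 1 - (1 + u xs) / 2 ^ k - (1 + v xs) / 2 ^ k"
   unfolding e2 unfolding e1 by (simp add: add_divide_distrib)
  finally show ?thesis using prod_p[of xs] l by (simp add: El_def o_def)
 qed
 have pt: "Lam (El (map p xs)) <= qq k * (ln (qq k) * (1 + w xs) + (w xs + (w xs)\<^sup>2 / 2 + t ^ 6 * (cq k * 4 ^ k) ^ 3))" if x: "xs \<in> ?L" for xs
 proof -
  have w1: "\<bar>w xs\<bar> <= 1 / 2" using wb[OF x] small by linarith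
  have "Lam (El (map p xs)) = qq k * Lam (1 + w xs) + (1 + w xs) * Lam (qq k)"
   unfolding El[OF x] by (rule Lam_mult) (use q w1 in auto)
  also have "... = qq k * (ln (qq k) * (1 + w xs) + Lam (1 + w xs))" using q by (simp add: Lam_def[of "qq k"] algebra_simps)
  also have "... <= qq k * (ln (qq k) * (1 + w xs) + (w xs + (w xs)\<^sup>2 / 2 + t ^ 6 * (cq k * 4 ^ k) ^ 3))"
  proof (intro mult_left_mono add_left_mono)
   have "\<bar>w xs\<bar> ^ 3 <= (cq k * 4 ^ k * t\<^sup>2) ^ 3" by (intro power_mono wb[OF x]) auto
   also have "... = t ^ 6 * (cq k * 4 ^ k) ^ 3" by (simp add: power_mult_distrib power_mult[symmetric] mult_ac)
   finally show "Lam (1 + w xs) <= w xs + (w xs)\<^sup>2 / 2 + t ^ 6 * (cq k * 4 ^ k) ^ 3" using Lam_upper3[OF w1] by linarith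
  qed (use q in auto)
  finally show ?thesis .
 qed
 have aw: "avg ?L w = 0" unfolding w_def avg_cmult avg_add avg_u by simp
 have aw2: "avg ?L (%xs. (w xs)\<^sup>2) = (cq k)\<^sup>2 * hh k (t\<^sup>2) / 2"
 proof -
  have "avg ?L (%xs. (w xs)\<^sup>2) = avg ?L (%xs. ((cq k)\<^sup>2 / 4) * ((u xs)\<^sup>2 + ((v xs)\<^sup>2 + 2 * (u xs * v xs))))"
   by (intro avg_cong) (simp add: w_def power2_eq_square algebra_simps)
  also have "... = (cq k)\<^sup>2 / 4 * (2 * ((1 + t\<^sup>2) ^ k - 1) + 2 * ((1 - t\<^sup>2) ^ k - 1))"
   unfolding avg_cmult avg_add avg_uu avg_uv by simp
  finally show ?thesis by (simp add: hh_def algebra_simps)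
 qed
 have "avg ?L (%xs. Lam (El (map p xs))) <= avg ?L (%xs. qq k * (ln (qq k) * (1 + w xs) + (w xs + (w xs)\<^sup>2 / 2 + t ^ 6 * (cq k * 4 ^ k) ^ 3)))"
  by (rule avg_mono) (rule pt)
 also have "... = qq k * (ln (qq k) * (1 + 0) + (0 + (cq k)\<^sup>2 * hh k (t\<^sup>2) / 2 / 2 + t ^ 6 * (cq k * 4 ^ k) ^ 3))"
  unfolding avg_cmult avg_add aw avg_divide aw2 using ne by (simp add: avg_const)
 finally show ?thesis unfolding Ed_def using q by (simp add: divide_le_eq mult.commute add.assoc)
qed

lemma c_le: "(cq k)\<^sup>2 <= 1"
proof -
 have "(2::real) ^ 3 <= 2 ^ k" using k by (intro power_increasing) auto
 then have "2 / 2 ^ k <= (2::real) / 8" by (intro divide_left_mono) auto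
 also have "... <= qq k" using qq_bounds(1)[OF k] by simp
 finally have "cq k <= 1" unfolding cq_def using q by (simp add: divide_le_eq mult.commute)
 then show ?thesis using c by (simp add: power_le_one)
qed

lemma AB_nonneg: "0 <= 1 + (cq k)\<^sup>2 * a" "0 <= 1 + (cq k)\<^sup>2 * b"
proof -
 have "0 <= a" unfolding a_def by (simp add: one_le_power)
 then show "0 <= 1 + (cq k)\<^sup>2 * a" by simp
 have "t\<^sup>2 <= 1" using t by (simp add: power_le_one)
 then have "-1 <= b" unfolding b_def by simp
 then have "(cq k)\<^sup>2 * (-1) <= (cq k)\<^sup>2 * b" by (intro mult_left_mono) auto
 then show "0 <= 1 + (cq k)\<^sup>2 * b" using c_le by simp
qed

lemma B_lower:
 assumes d: "0 < d" and small: "cq k * 4 ^ k * t\<^sup>2 <= 1 / 2"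
 shows "ln 2 + d / real k * ln (qq k) + (exp (d * ((cq k)\<^sup>2 * a)) + exp (d * ((cq k)\<^sup>2 * b))) / 4 - 1 / 2 - t ^ 6 * exp (d * K ^ 3 - d)
   - d * (real k - 1) / real k * ((cq k)\<^sup>2 * hh k (t\<^sup>2) / 4 + t ^ 6 * (cq k * 4 ^ k) ^ 3) <= B k d (fpi UNIV p)"
proof -
 have d0: "0 <= d" using d by simp
 define A1 B1 K3 where "A1 = 1 + (cq k)\<^sup>2 * a" and "B1 = 1 + (cq k)\<^sup>2 * b" and "K3 = K ^ 3"
 have pos: "0 <= A1" "0 <= B1" "0 <= K3" using AB_nonneg c by (auto simp: A1_def B1_def K3_def K_def)
 define f where "f \<gamma> = (ln 2 + real \<gamma> * ln (qq k)) + ((1/4) * A1 ^ \<gamma> + ((1/4) * B1 ^ \<gamma> + (- 1 / 2 + (- (t ^ 6)) * K3 ^ \<gamma>)))" for \<gamma> :: nat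
 have sp: "(%m. po d m * (e * r ^ m)) summable_on UNIV" if "0 <= r" for e r
  by (rule po_summable[OF d0 that, of _ "\<bar>e\<bar>"]) (use that in \<open>auto simp: abs_mult\<close>)
 have sl: "(%m. po d m * (ln 2 + real m * ln (qq k))) summable_on UNIV"
 proof (rule po_summable[OF d0, of 2 _ "1 + \<bar>ln (qq k)\<bar>"])
  show "\<bar>ln 2 + real m * ln (qq k)\<bar> <= (1 + \<bar>ln (qq k)\<bar>) * 2 ^ m" for m
  proof -
   have "real m <= 2 ^ m" using of_nat_less_two_power[of m] by (rule less_imp_le)
   then have "real m * \<bar>ln (qq k)\<bar> <= 2 ^ m * \<bar>ln (qq k)\<bar>" by (rule mult_right_mono) simp
   moreover have "ln 2 <= (2::real) ^ m" using ln_2_less_1 one_le_power[of "2::real" m] by linarith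
   moreover have "\<bar>real m * ln (qq k)\<bar> = real m * \<bar>ln (qq k)\<bar>" by (simp add: abs_mult)
   ultimately show ?thesis using abs_triangle_ineq[of "ln 2" "real m * ln (qq k)"] by (simp add: algebra_simps)
  qed
 qed auto
 note s1 = sp[OF pos(3), of "- (t ^ 6)"]
 have s2: "(%m. po d m * (- 1 / 2 + (- (t ^ 6)) * K3 ^ m)) summable_on UNIV"
  unfolding distrib_left[of "po d _"] by (intro summable_on_add s1 const_summable d0)
 have s3: "(%m. po d m * ((1/4) * B1 ^ m + (- 1 / 2 + (- (t ^ 6)) * K3 ^ m))) summable_on UNIV"
  unfolding distrib_left[of "po d _" "(1/4) * B1 ^ _"] by (intro summable_on_add s2 sp pos)
 have s4: "(%m. po d m * ((1/4) * A1 ^ m + ((1/4) * B1 ^ m + (- 1 / 2 + (- (t ^ 6)) * K3 ^ m)))) summable_on UNIV"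
  unfolding distrib_left[of "po d _" "(1/4) * A1 ^ _"] by (intro summable_on_add s3 sp pos)
 have s5: "(%m. po d m * f m) summable_on UNIV"
  unfolding f_def distrib_left[of "po d _" "ln 2 + _"] by (intro summable_on_add s4 sl)
 have "EP d f = (ln 2 + d * ln (qq k)) + ((1/4) * exp (d * A1 - d) + ((1/4) * exp (d * B1 - d) + (- 1 / 2 + (- (t ^ 6)) * exp (d * K3 - d))))"
  unfolding f_def EP_add[OF sl s4] EP_add[OF sp[OF pos(1)] s3] EP_add[OF sp[OF pos(2)] s2] EP_add[OF const_summable[OF d0] s1]
  unfolding EP_cmult EP_power[OF d0 pos(1)] EP_power[OF d0 pos(2)] EP_power[OF d0 pos(3)] EP_linear[OF d0] EP_const[OF d0] ..
 also have "d * A1 - d = d * ((cq k)\<^sup>2 * a)" by (simp add: A1_def algebra_simps)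
 also have "d * B1 - d = d * ((cq k)\<^sup>2 * b)" by (simp add: B1_def algebra_simps)
 finally have Ef: "EP d f = (ln 2 + d * ln (qq k)) + ((1/4) * exp (d * ((cq k)\<^sup>2 * a)) + ((1/4) * exp (d * ((cq k)\<^sup>2 * b)) + (- 1 / 2 + (- (t ^ 6)) * exp (d * K3 - d))))" .
 have S: "finite (UNIV :: bool set)" "(UNIV :: bool set) ~= {}" by auto
 have "EP d f <= EP d (Vt k UNIV p)"
 proof (rule EP_mono[OF d0 s5])
  show "(%m. po d m * Vt k UNIV p m) summable_on UNIV"
   by (rule po_summable[OF d0, of "1 / qq k" _ 1]) (use q Vt_bound[OF k S p01] in auto)
  show "f m <= Vt k UNIV p m" for m using Vt_lower[of m] by (simp add: f_def A1_def B1_def K3_def add_divide_distrib)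
 qed
 moreover have "d * (real k - 1) / real k * Ed k UNIV p <= d * (real k - 1) / real k * (ln (qq k) + ((cq k)\<^sup>2 * hh k (t\<^sup>2) / 4 + t ^ 6 * (cq k * 4 ^ k) ^ 3))"
  using Ed_upper[OF small] d k by (intro mult_left_mono) auto
 moreover have "d * ln (qq k) - d * (real k - 1) / real k * ln (qq k) = d / real k * ln (qq k)"
  using k by (simp add: field_simps)
 ultimately show ?thesis unfolding B_fpi[OF k d S p01] Ef K3_def by (simp add: distrib_left add_divide_distrib)
qed

lemma fpi_p: "fpi UNIV p \<in> P_star"
 by (rule fpi_P_star) (use p01 avg_p in auto)

end

lemma exp_lower3: "1 + z + z\<^sup>2 / 2 + z ^ 3 / 6 <= exp (z::real)"
proof -
 obtain s where "exp z = (\<Sum>m<4. z ^ m / fact m) + exp s / fact 4 * z ^ 4" using Maclaurin_exp_le[of z 4] by blast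
 moreover have "(\<Sum>m<4. z ^ m / fact m) = 1 + z + z\<^sup>2 / 2 + z ^ 3 / 6" by (simp add: eval_nat_numeral)
 moreover have "0 <= exp s / fact 4 * z ^ 4" by simp
 ultimately show ?thesis by linarith
qed

lemma one_minus_power_le:
 assumes "0 <= x" "x <= 1" shows "(1 - x) ^ m <= 1 - real m * x + (real m * x)\<^sup>2"
proof -
 define w where "w = real m * x"
 have w: "0 <= w" using assms by (simp add: w_def)
 have "(1 - x) ^ m <= exp (- x) ^ m" using assms exp_ge_add_one_self[of "- x"] by (intro power_mono) auto
 also have "... = exp (- w)" by (simp add: w_def flip: exp_of_nat_mult)
 also have "... = 1 / exp w" by (simp add: exp_minus field_simps)
 also have "... <= 1 / (1 + w)" using w exp_ge_add_one_self[of w] by (intro divide_left_mono) auto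
 also have "... <= 1 - w + w\<^sup>2"
 proof -
  have "(1 - w + w\<^sup>2) * (1 + w) = 1 + w * w\<^sup>2" by (simp add: power2_eq_square algebra_simps)
  moreover have "0 <= w * w\<^sup>2" using w by simp
  ultimately show ?thesis using w by (subst pos_divide_le_eq) auto
 qed
 finally show ?thesis by (simp add: w_def)
qed

lemma Kesten_Stigum:
 fixes d :: real
 assumes k: "k >= 3" and d: "0 < d"
  and cond: "!!\<pi>. \<pi> \<in> P_star ==> B k d \<pi> <= ln 2 + d / real k * ln (qq k)"
 shows "d * (cq k)\<^sup>2 * (real k - 1) <= 1"
proof (rule ccontr)
 assume "~ d * (cq k)\<^sup>2 * (real k - 1) <= 1"
 define g m s where "g = d * (cq k)\<^sup>2" and "m = real k - 1" and "s = g * m"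
 have s: "1 < s" using \<open>~ _\<close> by (simp add: s_def g_def m_def)
 have q: "0 < qq k" using qq_bounds[OF k] by simp
 have c: "0 < cq k" unfolding cq_def using q by simp
 have g: "0 < g" using d c by (simp add: g_def)
 have m: "2 <= m" "real (k - 1) = m" using k by (auto simp: m_def of_nat_diff)
 define K0 where "K0 = 1 + 3 * (cq k * 4 ^ k)"
 define \<mu> where "\<mu> = d * m / real k"
 have \<mu>: "0 <= \<mu>" using d m by (simp add: \<mu>_def)
 define A where "A = s * (s - 1) / 4"
 have A: "0 < A" using s by (simp add: A_def)
 define C where "C = g\<^sup>2 * m ^ 3 / 4 + s ^ 3 / 24 + exp (d * K0 ^ 3 - d) + \<mu> * ((cq k)\<^sup>2 * (2 * 2 ^ k) / 4 + (cq k * 4 ^ k) ^ 3)"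
 have C: "0 < C"
 proof -
  have "0 <= g\<^sup>2 * m ^ 3 / 4" "0 <= s ^ 3 / 24" "0 < exp (d * K0 ^ 3 - d)" "0 <= \<mu> * ((cq k)\<^sup>2 * (2 * 2 ^ k) / 4 + (cq k * 4 ^ k) ^ 3)"
   using m s \<mu> c by auto
  then show ?thesis unfolding C_def by linarith
 qed
 define x where "x = min (min 1 (1 / m)) (min (1 / (2 * (cq k * 4 ^ k))) (A / (2 * C)))"
 have x0: "0 < x" using m c A C by (simp add: x_def)
 have x1: "x <= 1" and xm: "x <= 1 / m" and xs: "x <= 1 / (2 * (cq k * 4 ^ k))" and xC: "x <= A / (2 * C)"
  by (auto simp: x_def)
 have small: "cq k * 4 ^ k * x <= 1 / 2" using xs c by (simp add: field_simps)
 have mx: "m * x <= 1" using xm m by (simp add: field_simps)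
 have CA: "C * x < A"
 proof -
  have "C * x <= C * (A / (2 * C))" using xC C by (intro mult_left_mono) auto
  also have "... < A" using A C by simp
  finally show ?thesis .
 qed
 define t where "t = sqrt x"
 have t: "0 < t" "t <= 1" using x0 x1 by (auto simp: t_def)
 have t2: "t\<^sup>2 = x" using x0 by (simp add: t_def)
 have t6: "t ^ 6 = x ^ 3" unfolding t2[symmetric] by (simp add: power_mult[symmetric])
 interpret two_point k t by unfold_locales (use k t in auto)
 have KK: "K0 = K" by (simp only: K0_def K_def)
 define z1 z2 where "z1 = d * ((cq k)\<^sup>2 * a)" and "z2 = d * ((cq k)\<^sup>2 * b)"
 have z1': "z1 = g * a" and z2': "z2 = g * b" by (simp_all add: z1_def z2_def g_def)
 have a: "m * x <= a" unfolding a_def t2 using Bernoulli_inequality[of x "k - 1"] x0 m(2) by simp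
 have b1: "- (m * x) <= b" unfolding b_def t2 using Bernoulli_inequality[of "- x" "k - 1"] x1 m(2) by simp
 have b2: "b <= - (m * x) + (m * x)\<^sup>2" unfolding b_def t2 using one_minus_power_le[of x "k - 1"] x0 x1 m(2) by simp
 have ab: "m * (m - 1) * x\<^sup>2 <= a + b" 
 proof -
  have "2 <= k - 1" using k by simp
  from hh_ge[OF this, of x] show ?thesis unfolding m(2) a_def b_def t2 hh_def by simp
 qed
 have z1p: "s * x <= z1" unfolding z1' s_def using mult_left_mono[OF a, of g] g by (simp add: mult.assoc)
 have sx: "0 <= s * x" using s x0 by simp
 have z1sq: "(s * x)\<^sup>2 <= z1\<^sup>2" using z1p sx by (rule power_mono)
 have z2sq: "(s * x)\<^sup>2 - 2 * (g\<^sup>2 * m ^ 3) * x ^ 3 <= z2\<^sup>2"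
 proof -
  define r where "r = m * x - (m * x)\<^sup>2"
  have "0 <= m * x" using m x0 by simp
  then have r0: "0 <= r" using mx by (simp add: r_def power2_eq_square mult_left_le)
  have "r <= - b" using b2 by (simp add: r_def)
  then have "r\<^sup>2 <= (- b)\<^sup>2" using r0 by (rule power_mono)
  moreover have "(m * x)\<^sup>2 - 2 * (m * x) ^ 3 <= r\<^sup>2"
  proof -
   have "r\<^sup>2 = (m * x)\<^sup>2 - 2 * (m * x) ^ 3 + (m * x) ^ 4" unfolding r_def by (simp add: power2_eq_square power3_eq_cube power4_eq_xxxx algebra_simps)
   then show ?thesis by simp
  qed
  ultimately have "(m * x)\<^sup>2 - 2 * (m * x) ^ 3 <= b\<^sup>2" by simp
  then have "g\<^sup>2 * ((m * x)\<^sup>2 - 2 * (m * x) ^ 3) <= g\<^sup>2 * b\<^sup>2" by (rule mult_left_mono) simp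
  then show ?thesis by (simp add: z2' s_def power_mult_distrib algebra_simps)
 qed
 have z2cb: "- (s ^ 3 * x ^ 3) <= z2 ^ 3"
 proof (cases "z2 <= 0")
  case True
  have "g * (- (m * x)) <= g * b" using b1 g by (intro mult_left_mono) auto
  then have "- z2 <= s * x" by (simp add: z2' s_def mult.assoc)
  then have "(- z2) ^ 3 <= (s * x) ^ 3" using True by (intro power_mono) auto
  then show ?thesis by (simp add: power_mult_distrib)
 next
  case False
  have "0 <= s ^ 3 * x ^ 3" using s x0 by simp
  moreover have "0 <= z2 ^ 3" using False by simp
  ultimately show ?thesis by linarith
 qed
 have z1cb: "0 <= z1 ^ 3" using z1p sx by simp
 have zz: "s * (m - 1) * x\<^sup>2 <= z1 + z2"
 proof -
  have "g * (m * (m - 1) * x\<^sup>2) <= g * (a + b)" using ab g by (intro mult_left_mono) auto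
  then show ?thesis by (simp add: z1' z2' s_def algebra_simps)
 qed
 have hh: "\<mu> * ((cq k)\<^sup>2 * hh k x / 4 + x ^ 3 * (cq k * 4 ^ k) ^ 3) <= s * m * x\<^sup>2 / 4 + \<mu> * ((cq k)\<^sup>2 * (2 * 2 ^ k) / 4 + (cq k * 4 ^ k) ^ 3) * x ^ 3"
 proof -
  have x4: "x ^ 4 <= x ^ 3" using x0 x1 by (intro power_decreasing) auto
  have "hh k x <= real k * m * x\<^sup>2 + 2 * 2 ^ k * x ^ 4" using hh_le[of k x] k x0 x1 by (simp add: m_def)
  also have "... <= real k * m * x\<^sup>2 + 2 * 2 ^ k * x ^ 3" using x4 by simp
  finally have "(cq k)\<^sup>2 * hh k x <= (cq k)\<^sup>2 * (real k * m * x\<^sup>2 + 2 * 2 ^ k * x ^ 3)" by (intro mult_left_mono) auto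
  then have "(cq k)\<^sup>2 * hh k x / 4 + x ^ 3 * (cq k * 4 ^ k) ^ 3 <= (cq k)\<^sup>2 * (real k * m * x\<^sup>2 + 2 * 2 ^ k * x ^ 3) / 4 + x ^ 3 * (cq k * 4 ^ k) ^ 3" by simp
  then have "\<mu> * ((cq k)\<^sup>2 * hh k x / 4 + x ^ 3 * (cq k * 4 ^ k) ^ 3) <= \<mu> * ((cq k)\<^sup>2 * (real k * m * x\<^sup>2 + 2 * 2 ^ k * x ^ 3) / 4 + x ^ 3 * (cq k * 4 ^ k) ^ 3)"
   using \<mu> by (rule mult_left_mono)
  also have "... = (\<mu> * real k) * (cq k)\<^sup>2 * m * x\<^sup>2 / 4 + \<mu> * ((cq k)\<^sup>2 * (2 * 2 ^ k) / 4 + (cq k * 4 ^ k) ^ 3) * x ^ 3"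
   by (simp add: algebra_simps add_divide_distrib)
  also have "\<mu> * real k = d * m" using k by (simp add: \<mu>_def)
  finally show ?thesis by (simp add: s_def g_def mult_ac)
 qed
 have "ln 2 + d / real k * ln (qq k) + (exp z1 + exp z2) / 4 - 1 / 2 - x ^ 3 * exp (d * K0 ^ 3 - d)
   - \<mu> * ((cq k)\<^sup>2 * hh k x / 4 + x ^ 3 * (cq k * 4 ^ k) ^ 3) <= B k d (fpi UNIV p)"
  using B_lower[OF d] small unfolding t2 t6 z1_def z2_def \<mu>_def m_def KK by blast
 also have "... <= ln 2 + d / real k * ln (qq k)" by (rule cond[OF fpi_p])
 finally have "(exp z1 + exp z2) / 4 - 1 / 2 <= x ^ 3 * exp (d * K0 ^ 3 - d) + \<mu> * ((cq k)\<^sup>2 * hh k x / 4 + x ^ 3 * (cq k * 4 ^ k) ^ 3)" by simp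
 moreover have "(z1 + z2) / 4 + (z1\<^sup>2 + z2\<^sup>2) / 8 + (z1 ^ 3 + z2 ^ 3) / 24 <= (exp z1 + exp z2) / 4 - 1 / 2"
  using exp_lower3[of z1] exp_lower3[of z2] by (simp add: field_simps)
 moreover have comb: "P1 / 4 + (2 * P2 - P3) / 8 - P4 / 24 <= R1 + R2"
  if "P1 <= Z1" "P2 <= S1" "P2 - P3 <= S2" "- P4 <= C2" "0 <= C1" "H <= R2" "E <= R1 + H" "Z1 / 4 + (S1 + S2) / 8 + (C1 + C2) / 24 <= E"
  for P1 P2 P3 P4 R1 R2 Z1 S1 S2 C1 C2 H E :: real using that by argo
 ultimately have "s * (m - 1) * x\<^sup>2 / 4 + (2 * (s * x)\<^sup>2 - 2 * (g\<^sup>2 * m ^ 3) * x ^ 3) / 8 - s ^ 3 * x ^ 3 / 24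
   <= x ^ 3 * exp (d * K0 ^ 3 - d) + (s * m * x\<^sup>2 / 4 + \<mu> * ((cq k)\<^sup>2 * (2 * 2 ^ k) / 4 + (cq k * 4 ^ k) ^ 3) * x ^ 3)"
  by (intro comb[OF zz z1sq z2sq z2cb z1cb hh])
 then have "A * x\<^sup>2 <= C * x ^ 3"
  unfolding A_def C_def by (simp add: algebra_simps power2_eq_square add_divide_distrib diff_divide_distrib)
 then have "A * x\<^sup>2 <= (C * x) * x\<^sup>2" by (simp add: power2_eq_square power3_eq_cube mult.assoc)
 then have "A <= C * x" using x0 by simp
 then show False using CA by simp
qed

section \<open>The conditional overlap\<close>

lemma sum_nae_solutions: "(\<Sum>sg\<in>nae_solutions n F. g sg) = (\<Sum>sg\<in>assignments n. wgt F sg * g sg)" for g :: "_ => real"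
proof -
 have "(\<Sum>sg\<in>assignments n. wgt F sg * g sg) = (\<Sum>sg\<in>assignments n. if nae_sat sg F then g sg else 0)"
  by (intro sum.cong) (auto simp: wgt_def)
 then show ?thesis unfolding nae_solutions_def by (simp add: sum.inter_filter)
qed

lemma avg_abs_overlap_mean2: "avg_abs_overlap n F / real n = mean2 n (wgt F) (%sg ta. \<bar>ov n sg ta\<bar>)"
 unfolding avg_abs_overlap_def sum_nae_solutions mean2_def tot2_def tot_wgt_Z[symmetric] ov_def
 by (simp add: sum_divide_distrib sum_distrib_left abs_divide mult_ac)

lemma overlap_le:
 assumes \<epsilon>: "0 < \<epsilon>"
 shows "0 <= avg_abs_overlap n F / real n" "avg_abs_overlap n F / real n <= 1"
  and "r2 n F <= \<epsilon>\<^sup>2 ==> avg_abs_overlap n F / real n <= 2 * \<epsilon>"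
proof -
 show "0 <= avg_abs_overlap n F / real n" unfolding avg_abs_overlap_mean2 by (intro mean2_nonneg wgt_01) auto
 have c: "mean2 n (wgt F) (%_ _. e) <= e" if "0 <= e" for e
 proof (cases "tot n (wgt F) = 0")
  case True
  then show ?thesis using that by (simp add: mean2_def)
 qed (simp add: mean2_const)
 have "mean2 n (wgt F) (%sg ta. \<bar>ov n sg ta\<bar>) <= mean2 n (wgt F) (%_ _. 1)" by (intro mean2_mono wgt_01 abs_ov)
 then show "avg_abs_overlap n F / real n <= 1" unfolding avg_abs_overlap_mean2 using c[of 1] by simp
 assume r: "r2 n F <= \<epsilon>\<^sup>2"
 have "mean2 n (wgt F) (%sg ta. \<bar>ov n sg ta\<bar>) <= mean2 n (wgt F) (%sg ta. \<epsilon> + (1 / \<epsilon>) * (ov n sg ta)\<^sup>2)"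
 proof (intro mean2_mono wgt_01)
  fix sg ta
  define z where "z = \<bar>ov n sg ta\<bar>"
  have "z <= \<epsilon> + (1 / \<epsilon>) * z\<^sup>2"
  proof (cases "z <= \<epsilon>")
   case True
   moreover have "0 <= (1 / \<epsilon>) * z\<^sup>2" using \<epsilon> by simp
   ultimately show ?thesis by linarith
  next
   case False
   then have "\<epsilon> * z <= z * z" using \<epsilon> by (intro mult_right_mono) auto
   then have "z <= (1 / \<epsilon>) * z\<^sup>2" using \<epsilon> by (simp add: power2_eq_square field_simps)
   then show ?thesis using \<epsilon> by linarith
  qed
  then show "\<bar>ov n sg ta\<bar> <= \<epsilon> + (1 / \<epsilon>) * (ov n sg ta)\<^sup>2" by (simp add: z_def)
 qed
 also have "... = mean2 n (wgt F) (%_ _. \<epsilon>) + (1 / \<epsilon>) * r2 n F" unfolding mean2_add mean2_cmult r2_def ..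
 also have "... <= \<epsilon> + (1 / \<epsilon>) * \<epsilon>\<^sup>2" using r \<epsilon> c[of \<epsilon>] by (intro add_mono mult_left_mono) auto
 also have "... = 2 * \<epsilon>" using \<epsilon> by (simp add: power2_eq_square)
 finally show "avg_abs_overlap n F / real n <= 2 * \<epsilon>" unfolding avg_abs_overlap_mean2 .
qed

lemma nn_integral_formula:
 assumes k: "k >= 1" "k <= n" and d: "0 < d" and h: "!!F. 0 <= h F" "!!F. h F <= 1"
 shows "(\<integral>\<^sup>+F. ennreal (h F) \<partial>measure_pmf (poisson_random_formula k n d))
  = ennreal (EP (d * real n / real k) (%m. avg (Fm k n m) h))"
proof -
 have l: "0 < d * real n / real k" using d k by simp
 have ne: "finite (Fm k n m)" "Fm k n m ~= {}" for m using clauses_nonempty[OF k(2)] by auto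
 have rf: "random_formula k n m = pmf_of_set (Fm k n m)" for m by (simp add: random_formula_def lsts_def)
 have b: "0 <= avg (Fm k n m) h" "avg (Fm k n m) h <= 1" for m
  using h ne by (auto intro!: avg_nonneg avg_le)
 have inner: "(\<integral>\<^sup>+F. ennreal (h F) \<partial>measure_pmf (random_formula k n m)) = ennreal (avg (Fm k n m) h)" for m
 proof -
  have "(\<integral>\<^sup>+F. ennreal (h F) \<partial>measure_pmf (random_formula k n m)) = ennreal (\<integral>F. h F \<partial>measure_pmf (random_formula k n m))"
   unfolding rf using ne h(1) by (intro nn_integral_eq_integral integrable_measure_pmf_finite) (auto simp: set_pmf_of_set)
  then show ?thesis unfolding rf integral_pmf_of_set[OF ne(2,1)] avg_def .
 qed
 have i: "\<bar>avg (Fm k n m) h\<bar> <= 1 * 1 ^ m" for m using b[of m] by simp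
 have "(\<integral>\<^sup>+F. ennreal (h F) \<partial>measure_pmf (poisson_random_formula k n d))
  = (\<integral>\<^sup>+m. ennreal (avg (Fm k n m) h) \<partial>measure_pmf (poisson_pmf (d * real n / real k)))"
  unfolding poisson_random_formula_def nn_integral_bind_pmf inner ..
 also have "... = ennreal (\<integral>m. avg (Fm k n m) h \<partial>measure_pmf (poisson_pmf (d * real n / real k)))"
  using integral_poisson(1)[OF l _ i] b(1) by (intro nn_integral_eq_integral) auto
 also have "(\<integral>m. avg (Fm k n m) h \<partial>measure_pmf (poisson_pmf (d * real n / real k))) = EP (d * real n / real k) (%m. avg (Fm k n m) h)"
  by (rule integral_poisson(2)[OF l _ i]) simp
 finally show ?thesis .
qed

lemma cond_exp_overlap_eq:
 fixes d :: real
 assumes k: "k >= 1" "k <= n" and d: "0 < d"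
 defines "E \<equiv> %h. EP (d * real n / real k) (%m. avg (Fm k n m) h)"
 assumes pos: "0 < E (%F. of_bool (Z n F > 0))" and E0: "0 <= E (%F. avg_abs_overlap n F / real n * of_bool (Z n F > 0))"
 shows "cond_exp_overlap k n d / real n = E (%F. avg_abs_overlap n F / real n * of_bool (Z n F > 0)) / E (%F. of_bool (Z n F > 0))"
proof -
 let ?P = "poisson_random_formula k n d" and ?A = "{F. Z n F > 0}"
 let ?h = "%F. avg_abs_overlap n F / real n"
 have h: "0 <= ?h F" "?h F <= 1" for F using overlap_le[of 1] by auto
 have em: "emeasure (measure_pmf ?P) ?A = ennreal (E (%F. of_bool (Z n F > 0)))"
 proof -
  have "emeasure (measure_pmf ?P) ?A = (\<integral>\<^sup>+F. indicator ?A F \<partial>measure_pmf ?P)" by simp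
  also have "... = (\<integral>\<^sup>+F. ennreal (of_bool (Z n F > 0)) \<partial>measure_pmf ?P)"
   by (intro nn_integral_cong) (auto simp: indicator_def)
  finally show ?thesis unfolding E_def using nn_integral_formula[OF k d, of "%F. of_bool (Z n F > 0)"] by simp
 qed
 then have "measure (measure_pmf ?P) ?A = E (%F. of_bool (Z n F > 0))" using pos by (simp add: measure_def)
 then have ne: "set_pmf ?P \<inter> ?A ~= {}" using pos measure_pmf_zero_iff[of ?P ?A] by simp
 have "(\<integral>\<^sup>+F. ennreal (?h F) \<partial>measure_pmf (cond_pmf ?P ?A)) = (\<integral>\<^sup>+F. ennreal (?h F) * indicator ?A F \<partial>measure_pmf ?P) / emeasure (measure_pmf ?P) ?A"
  unfolding cond_pmf.rep_eq[OF ne] by (subst nn_integral_uniform_measure) auto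
 also have "(\<integral>\<^sup>+F. ennreal (?h F) * indicator ?A F \<partial>measure_pmf ?P) = (\<integral>\<^sup>+F. ennreal (?h F * of_bool (Z n F > 0)) \<partial>measure_pmf ?P)"
  by (intro nn_integral_cong) (auto simp: indicator_def)
 also have "... = ennreal (E (%F. ?h F * of_bool (Z n F > 0)))"
  unfolding E_def using h by (intro nn_integral_formula[OF k d]) auto
 finally have nn: "(\<integral>\<^sup>+F. ennreal (?h F) \<partial>measure_pmf (cond_pmf ?P ?A)) = ennreal (E (%F. ?h F * of_bool (Z n F > 0)) / E (%F. of_bool (Z n F > 0)))"
  unfolding em using pos E0 by (simp add: divide_ennreal)
 have "cond_exp_overlap k n d / real n = (\<integral>F. ?h F \<partial>measure_pmf (cond_pmf ?P ?A))"
  unfolding cond_exp_overlap_def by (rule integral_divide_zero[symmetric])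
 also have "... = enn2real (\<integral>\<^sup>+F. ennreal (?h F) \<partial>measure_pmf (cond_pmf ?P ?A))"
  by (rule integral_eq_nn_integral) (use h in auto)
 also have "... = E (%F. ?h F * of_bool (Z n F > 0)) / E (%F. of_bool (Z n F > 0))"
  unfolding nn using pos E0 by (intro enn2real_ennreal divide_nonneg_pos) auto
 finally show ?thesis .
qed

lemma below_condensation:
 assumes "0 < d" "ereal d < d_cond k" "\<pi> \<in> P_star"
 shows "B k d \<pi> <= ln 2 + d / real k * ln (qq k)"
proof -
 have "~ (SUP \<pi>\<in>P_star. ereal (B k d \<pi>)) > ereal (ln 2 + d / real k * ln (1 - 2 powr (1 - real k)))"
 proof
  assume "(SUP \<pi>\<in>P_star. ereal (B k d \<pi>)) > ereal (ln 2 + d / real k * ln (1 - 2 powr (1 - real k)))"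
  then have "d_cond k <= ereal d" unfolding d_cond_def using assms(1) by (intro Inf_lower) auto
  then show False using assms(2) by simp
 qed
 moreover have "ereal (B k d \<pi>) <= (SUP \<pi>\<in>P_star. ereal (B k d \<pi>))" using assms(3) by (rule SUP_upper)
 ultimately have "ereal (B k d \<pi>) <= ereal (ln 2 + d / real k * ln (1 - 2 powr (1 - real k)))"
  by (meson not_less order.trans)
 then show ?thesis by (simp add: qq_def)
qed

lemma overlap_vanishes:
 fixes d d' \<delta> :: real
 assumes k: "k >= 3" and d: "0 < d" "d < d'" "ereal d' < d_cond k" and \<delta>: "0 < \<delta>"
 shows "\<exists>D > d / real k. \<forall>\<^sub>F n in sequentially. \<forall>m. real m <= D * real n -->
   avg (Fm k n m) (%F. of_bool (MM k n F = 0 \<or> \<delta> < r2 n F)) <= \<delta>"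
proof -
 have d': "0 < d'" using d by simp
 note cond = below_condensation[OF d' d(3)]
 have k0: "0 < real k" using k by simp
 have "d / real k < d' / real k" using d k0 by (simp add: divide_strict_right_mono)
 then obtain D where D: "d / real k < D" "D < d' / real k" using dense by blast
 obtain D1 where D1: "D < D1" "D1 < d' / real k" using D(2) dense by blast
 obtain D2 where D2: "D1 < D2" "D2 < d' / real k" using D1(2) dense by blast
 have D0: "0 < D" using D(1) d k0 by (meson divide_pos_pos less_trans)
 have KS: "D * ck k < 1 / 2"
 proof -
  have ckp: "0 < ck k" by (rule ck_pos[OF k])
  have "(4 :: real) ^ k = (2 ^ k)\<^sup>2" by (simp add: power2_eq_square power_mult_distrib[symmetric])
  then have "(cq k)\<^sup>2 = 4 / 4 ^ k / (qq k)\<^sup>2" by (simp add: cq_def power_divide power_mult_distrib)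
  moreover have "2 / x * (y * z) / u = y * (4 / x / u * z) / 2" for x y z u :: real by simp
  ultimately have ckq: "ck k = real k * ((cq k)\<^sup>2 * (real k - 1)) / 2" unfolding ck_def by (simp only:)
  have gen: "x / u * (u * (y * z) / 2) = x * y * z / 2" if "u ~= 0" for x y z u :: real using that by simp
  have "real k ~= 0" using k0 by simp
  from gen[OF this] have "d' / real k * ck k = d' * (cq k)\<^sup>2 * (real k - 1) / 2" unfolding ckq .
  also have "... <= 1 / 2" using Kesten_Stigum[OF k d' cond] by simp
  finally have "d' / real k * ck k <= 1 / 2" .
  moreover have "D * ck k < d' / real k * ck k" using D(2) ckp by (rule mult_strict_right_mono)
  ultimately show ?thesis by linarith
 qed
 have KH: "\<forall>\<^sub>F n in sequentially. \<forall>m. real m <= D2 * real n --> KK k n m <= \<delta> * real n" if "0 < \<delta>" for \<delta>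
  by (rule KL_small[OF k d' D2(2) that cond])
 have D10: "0 < D1" using D0 D1 by simp
 have OC: "\<exists>c>0. \<forall>\<^sub>F n in sequentially. \<forall>m. real m <= D1 * real n --> pl k n m (%F. of_bool (\<epsilon> <= r2 n F)) <= exp (- c * real n)" if "0 < \<epsilon>" for \<epsilon>
  by (rule overlap_conc[OF k D10 D2(1) that KH])
 have TC: "\<exists>c>0. \<forall>\<^sub>F n in sequentially. \<forall>m. real m <= D * real n --> pl k n m (%F. of_bool (exp (- c * real n) <= TT n \<epsilon> F)) <= exp (- c * real n)" if "0 < \<epsilon>" for \<epsilon>
  by (rule TT_conc[OF k D0 D1(1) that OC])
 obtain a c A where "a > 0" "c > 0" "\<forall>\<^sub>F n in sequentially. \<forall>m L \<xi>. real m <= D * real n --> 0 <= L --> 0 < \<xi> --> exp (- c * real n) <= \<xi> -->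
   avg (Fm k n m) (%F. of_bool (exp (- L) <= MM k n F & 3 * \<xi> < r2 n F))
    <= A * (real n + 1) / \<xi> * exp (2 * L - a * real n * \<xi>) + exp (L - c * real n)"
  using null_overlap[OF k D0 KS TC] by blast
 from null_main[OF k D0 this(1,2) \<delta> this(3)] show ?thesis using D(1) by blast
qed

theorem theorem1p2:
  fixes k :: nat and d :: real
  assumes "k \<ge> 3" and "0 < d" and "ereal d < d_cond k"
  shows "(\<lambda>n. cond_exp_overlap k n d / real n) \<longlonglongrightarrow> 0"
proof (rule LIMSEQ_I)
 note k = assms(1) and d = assms(2)
 obtain d' where d': "d < d'" "ereal d' < d_cond k" using ereal_dense2[OF assms(3)] by auto
 fix e :: real assume e: "0 < e"
 define \<epsilon> where "\<epsilon> = min (1 / 4) (e / 16)"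
 have \<epsilon>: "0 < \<epsilon>" "\<epsilon> <= 1 / 4" "\<epsilon> <= e / 16" using e by (auto simp: \<epsilon>_def)
 define \<delta> where "\<delta> = \<epsilon>\<^sup>2"
 have \<delta>: "0 < \<delta>" "\<delta> <= \<epsilon>" using \<epsilon> by (auto simp: \<delta>_def power2_eq_square mult_left_le)
 obtain D where D: "d / real k < D" and main: "\<forall>\<^sub>F n in sequentially. \<forall>m. real m <= D * real n -->
   avg (Fm k n m) (%F. of_bool (MM k n F = 0 \<or> \<delta> < r2 n F)) <= \<delta>"
  using overlap_vanishes[OF k d d' \<delta>(1)] by blast
 have "\<forall>\<^sub>F n in sequentially. EP (d / real k * real n) (%m. of_bool (~ real m <= D * real n)) <= \<epsilon>"
  using k d D \<epsilon> by (intro po_upper_tail) auto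
 moreover have "\<forall>\<^sub>F n in sequentially. k <= n" by (rule eventually_ge_at_top)
 ultimately have "\<forall>\<^sub>F n in sequentially. norm (cond_exp_overlap k n d / real n - 0) < e"
  using main
 proof eventually_elim
  case (elim n)
  have kn: "k >= 1" "k <= n" using elim k by auto
  define l where "l = d * real n / real k"
  have l: "0 <= l" using d by (simp add: l_def)
  define E where "E h = EP l (%m. avg (Fm k n m) h)" for h
  have ne: "finite (Fm k n m)" "Fm k n m ~= {}" for m using clauses_nonempty[OF kn(2)] by auto
  have av1: "\<bar>avg (Fm k n m) h\<bar> <= 1 * 1 ^ m" if h: "!!F. 0 <= h F" "!!F. h F <= 1" for h m
  proof -
   have "0 <= avg (Fm k n m) h" "avg (Fm k n m) h <= 1" using h ne by (auto intro!: avg_nonneg avg_le)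
   then show ?thesis by simp
  qed
  have s: "(%m. po l m * avg (Fm k n m) h) summable_on UNIV" if "!!F. 0 <= h F" "!!F. h F <= 1" for h
   by (rule po_summable[OF l _ av1[OF that]]) auto
  let ?bad = "%F. of_bool (MM k n F = 0 \<or> \<delta> < r2 n F) :: real"
  have tail: "EP l (%m. of_bool (~ real m <= D * real n)) <= \<epsilon>" using elim(1) by (simp add: l_def)
  have st: "(%m. po l m * of_bool (~ real m <= D * real n)) summable_on UNIV" by (rule po_summable[OF l, of 1 _ 1]) auto
  have bad: "E ?bad <= 2 * \<epsilon>"
  proof -
   have "E ?bad <= EP l (%m. \<delta> + of_bool (~ real m <= D * real n))"
    unfolding E_def
   proof (rule EP_mono[OF l s])
    show "(%m. po l m * (\<delta> + of_bool (~ real m <= D * real n))) summable_on UNIV"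
     unfolding distrib_left by (intro summable_on_add const_summable[OF l] st)
    show "avg (Fm k n m) ?bad <= \<delta> + of_bool (~ real m <= D * real n)" for m
    proof (cases "real m <= D * real n")
     case False
     have "avg (Fm k n m) ?bad <= 1" using ne by (intro avg_le) auto
     then show ?thesis using False \<delta> by simp
    qed (use elim(3) in simp)
   qed auto
   also have "... = \<delta> + EP l (%m. of_bool (~ real m <= D * real n))"
    using EP_add[OF const_summable[OF l] st] EP_const[OF l] by simp
   finally show ?thesis using tail \<delta> by linarith
  qed
  have E_mono: "E h <= E h'" if "!!F. 0 <= h F" "!!F. h F <= 1" "!!F. 0 <= h' F" "!!F. h' F <= 1" "!!F. h F <= h' F" for h h'
   unfolding E_def using that by (intro EP_mono[OF l] s avg_mono)
  have E_add: "E (%F. h F + h' F) = E h + E h'" if "!!F. 0 <= h F" "!!F. h F <= 1" "!!F. 0 <= h' F" "!!F. h' F <= 1" for h h'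
   unfolding E_def avg_add using that by (intro EP_add s)
  have E_const: "E (%_. c) = c" for c unfolding E_def using ne by (simp add: avg_const EP_const[OF l])
  let ?z = "%F. of_bool (Z n F > 0) :: real"
  let ?h = "%F. avg_abs_overlap n F / real n * of_bool (Z n F > 0)"
  have q: "0 < qq k" using qq_bounds[OF k] by simp
  have ZM: "Z n F > 0 \<longleftrightarrow> MM k n F ~= 0" for F
   using q tot_wgt_Z[of n F] by (simp add: MM_def)
  have h: "0 <= avg_abs_overlap n F / real n" "avg_abs_overlap n F / real n <= 1" for F using overlap_le[OF \<epsilon>(1)] by auto
  have "1 = E (%F. ?z F + of_bool (~ Z n F > 0))"
  proof -
   have "(%F. ?z F + of_bool (~ Z n F > 0)) = (%_. 1)" by auto
   then show ?thesis by (simp only: E_const)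
  qed
  also have "... = E ?z + E (%F. of_bool (~ Z n F > 0))" by (rule E_add) auto
  also have "E (%F. of_bool (~ Z n F > 0)) <= E ?bad" by (rule E_mono) (auto simp: ZM)
  finally have z: "1 / 2 <= E ?z" using bad \<epsilon> by linarith
  have hb: "0 <= ?h F" "?h F <= 1" for F using h[of F] by auto
  have E0: "0 <= E ?h" using E_mono[of "%_. 0" ?h] hb E_const[of 0] by simp
  have "E ?h <= EP l (%m. 2 * \<epsilon> + avg (Fm k n m) ?bad)"
   unfolding E_def
  proof (rule EP_mono[OF l s])
   show "(%m. po l m * (2 * \<epsilon> + avg (Fm k n m) ?bad)) summable_on UNIV"
    unfolding distrib_left by (intro summable_on_add const_summable[OF l] s) auto
   fix m
   have "avg (Fm k n m) ?h <= avg (Fm k n m) (%F. 2 * \<epsilon> + ?bad F)"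
   proof (rule avg_mono)
    fix F
    show "?h F <= 2 * \<epsilon> + ?bad F"
    proof (cases "MM k n F = 0 \<or> \<delta> < r2 n F")
     case True
     then show ?thesis using hb(2)[of F] \<epsilon> by simp
    next
     case False
     then have "avg_abs_overlap n F / real n <= 2 * \<epsilon>" by (intro overlap_le(3)[OF \<epsilon>(1)]) (simp add: \<delta>_def)
     then show ?thesis using False \<epsilon> by (simp add: ZM)
    qed
   qed
   then show "avg (Fm k n m) ?h <= 2 * \<epsilon> + avg (Fm k n m) ?bad" unfolding avg_add using ne by (simp add: avg_const)
  qed (use hb in auto)
  also have "... = 2 * \<epsilon> + E ?bad"
   unfolding E_def using EP_add[OF const_summable[OF l] s] EP_const[OF l] by simp
  finally have hE: "E ?h <= 4 * \<epsilon>" using bad by linarith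
  have eq: "cond_exp_overlap k n d / real n = E ?h / E ?z"
   unfolding E_def l_def by (rule cond_exp_overlap_eq[OF kn d]) (use z E0 in \<open>auto simp: E_def l_def\<close>)
  have "E ?h / E ?z <= (4 * \<epsilon>) / (1 / 2)" using hE z \<epsilon> by (intro frac_le) auto
  also have "... < e" using \<epsilon> e by simp
  finally show ?case unfolding eq using E0 z by simp
 qed
 then show "\<exists>n0. \<forall>n\<ge>n0. norm (cond_exp_overlap k n d / real n - 0) < e"
  by (simp add: eventually_sequentially)
qed

end
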